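(* Let $(\mathcal M,\mathfrak g)$ be a Riemannian or Lorentzian manifold; for each $j\in\mathbb{N}\cup\{\infty\}$ let $\mathcal P_j$ be a $k$-dimensional smooth submanifold of $\mathcal M$ and let $\gamma_j:[a,b]\to\mathcal M$ be a non constant geodesic with $\gamma_j(a)\in\mathcal P_j$ and $\gamma_j'(a)\in T_{\gamma_j(a)}\mathcal P_j^\perp$. If $(\mathcal M,\mathfrak g)$ is Lorentzian, assume also that $\gamma_j$ is non spacelike and that $\gamma_j'(a)\notin T_{\gamma_j(a)}\mathcal P_j$ for all $j=1,\ldots,\infty$. Let $\mathcal S_j$ denote the second fundamental form of $\mathcal P_j$ at $\gamma_j(a)$ in the normal direction $\gamma_j'(a)$. Suppose that - $\lim_{j\to\infty}\gamma_j'(a)=\gamma_\infty'(a)$ in $T\mathcal M$; - $\lim_{j\to\infty}(\gamma_j(a),T_{\gamma_j(a)}\mathcal P_j,\mathcal S_j)=(\gamma_\infty(a),T_{\gamma_\infty(a)}\mathcal P_\infty,\mathcal S_\infty)$ in $\mathrm{GB}_k(\mathcal M)$. Then, if $\gamma_\infty(b)$ is not $\mathcal P_\infty$-focal, it follows that for $j\in\mathbb{N}$ sufficiently large $\gamma_j(b)$ is not $\mathcal P_j$-focal, and the geometric index of $\gamma_j$ relative to $\mathcal P_j$ equals the geometric index of $\gamma_\infty$ relative to $\mathcal P_\infty$: $\mathrm{i}_{\rm geom}(\gamma_j)=\mathrm{i}_{\rm geom}(\gamma_\infty)$ for all $j$ sufficiently large.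
   Context: A Lorentzian manifold is a semi-Riemannian manifold whose metric has index $1$ at each point. A nonzero vector $v$ is spacelike if $\mathfrak g(v,v)>0$; a geodesic is non spacelike if $\mathfrak g(\gamma',\gamma')\le0$. $\nabla$ is the Levi-Civita connection and $\mathcal R(X,Y)=\nabla_X\nabla_Y-\nabla_Y\nabla_X-\nabla_{[X,Y]}$. The second fundamental form of $\mathcal P$ at $p$ in the normal direction $n\in T_p\mathcal P^\perp$ is $\mathcal S_n(v_1,v_2)=\mathfrak g(\nabla_{v_1}V_2,n)$, with $V_2$ any extension of $v_2$ to a vector field on $\mathcal P$; when $T_p\mathcal P$ is nondegenerate it is also viewed as the operator with $\mathcal S_n(v_1,v_2)=\mathfrak g(\mathcal S_n(v_1),v_2)$. (Under the hypotheses, $\mathfrak g$ is nondegenerate on each $T_{\gamma_j(a)}\mathcal P_j$.) For a geodesic $\gamma:[a,b]\to\mathcal M$ starting orthogonally to $\mathcal P$ (with $T_{\gamma(a)}\mathcal P$ nondegenerate), a $\mathcal P$-Jacobi field is a field $\mathcal J$ along $\gamma$ with $\mathcal J''=\mathcal R(\gamma',\mathcal J)\gamma'$, $\mathcal J(a)\in T_{\gamma(a)}\mathcal P$ and $\mathcal J'(a)+\mathcal S_{\gamma'(a)}[\mathcal J(a)]\in T_{\gamma(a)}\mathcal P^\perp$. The point $\gamma(t_0)$, $t_0\in\,]a,b]$, is $\mathcal P$-focal if some nonzero $\mathcal P$-Jacobi field vanishes at $t_0$; its multiplicity is the dimension of the space of $\mathcal P$-Jacobi fields vanishing at $t_0$.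 The geometric index $\mathrm{i}_{\rm geom}(\gamma)$ of $\gamma$ relative to $\mathcal P$ is the sum over $t\in\,]a,b]$ of the multiplicities of the $\mathcal P$-focal points $\gamma(t)$ (there are finitely many in the cases considered). $\mathrm{GB}_k(\mathcal M)$ is the set of triples $(p,P,S)$ with $p\in\mathcal M$, $P$ a $k$-dimensional subspace of $T_p\mathcal M$ and $S$ a symmetric bilinear form on $P$, with its natural fiber bundle topology over $\mathcal M$. Explicitly, $(p_j,P_j,S_j)\to(p,P,S)$ iff $p_j\to p$ and, in a local trivialization of $T\mathcal M$ near $p$, for each (large) $j$ there is a basis $e^j_1,\dots,e^j_k$ of $P_j$ with $e^j_i\to e_i$ for all $i$, where $e_1,\dots,e_k$ is a basis of $P$, and $S_j(e^j_\alpha,e^j_\beta)\to S(e_\alpha,e_\beta)$ for all $\alpha,\beta$. *)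

theory Defs
  imports
    "HOL-Analysis.Analysis"
    "HOL-Library.Function_Algebras"
    "HOL-Library.Extended_Nat"
begin

section \<open>Smooth maps between Euclidean spaces\<close>

primrec Ck_on :: "nat \<Rightarrow> 'a::euclidean_space set \<Rightarrow> ('a \<Rightarrow> 'b::real_normed_vector) \<Rightarrow> bool" where
  "Ck_on 0 U f \<longleftrightarrow> continuous_on U f"
| "Ck_on (Suc k) U f \<longleftrightarrow>
     (\<forall>x\<in>U. f differentiable (at x)) \<and> (\<forall>v. Ck_on k U (\<lambda>x. frechet_derivative f (at x) v))"

text \<open>Only meant for open \<open>U\<close>.\<close>
definition smooth_on :: "'a::euclidean_space set \<Rightarrow> ('a \<Rightarrow> 'b::real_normed_vector) \<Rightarrow> bool" where
  "smooth_on U f \<longleftrightarrow> (\<forall>k. Ck_on k U f)"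


section \<open>Functions into a vector space form a vector space\<close>

text \<open>This makes the library's \<open>subspace\<close>, \<open>independent\<close>, \<open>span\<close>, \<open>dim\<close> available for
  tangent vectors and for fields along a curve, which are encoded as functions below.\<close>

instantiation "fun" :: (type, real_vector) real_vector
begin

definition scaleR_fun :: "real \<Rightarrow> ('a \<Rightarrow> 'b) \<Rightarrow> 'a \<Rightarrow> 'b" where
  "scaleR_fun r f = (\<lambda>x. r *\<^sub>R f x)"

instance
  by standard (simp_all add: scaleR_fun_def fun_eq_iff scaleR_add_right scaleR_add_left)

end


section \<open>Smooth manifolds\<close>

text \<open>A chart is a pair of its domain and its coordinate map; the values of the
  coordinate map outside the domain are irrelevant. The manifold is the whole type \<open>'m\<close>, which is
  modelled on the Euclidean space \<open>'e\<close>.\<close>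

type_synonym ('m, 'e) chart = "'m set \<times> ('m \<Rightarrow> 'e)"

definition chart_image :: "('m, 'e) chart \<Rightarrow> 'e set" where
  "chart_image c = snd c ` fst c"

definition chart_inv :: "('m, 'e) chart \<Rightarrow> 'e \<Rightarrow> 'm" where
  "chart_inv c = inv_into (fst c) (snd c)"

definition is_chart :: "('m::topological_space, 'e::euclidean_space) chart \<Rightarrow> bool" where
  "is_chart c \<longleftrightarrow> open (fst c) \<and> open (chart_image c) \<and>
     homeomorphism (fst c) (chart_image c) (snd c) (chart_inv c)"

definition transition :: "('m, 'e) chart \<Rightarrow> ('m, 'e) chart \<Rightarrow> 'e \<Rightarrow> 'e" where
  "transition c d = snd d \<circ> chart_inv c"

definition smooth_compatible ::
    "('m, 'e::euclidean_space) chart \<Rightarrow> ('m, 'e) chart \<Rightarrow> bool" where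
  "smooth_compatible c d \<longleftrightarrow>
     smooth_on (snd c ` (fst c \<inter> fst d)) (transition c d) \<and>
     smooth_on (snd d ` (fst c \<inter> fst d)) (transition d c)"

text \<open>A smooth structure is a maximal smooth atlas.\<close>
definition smooth_structure ::
    "('m::topological_space, 'e::euclidean_space) chart set \<Rightarrow> bool" where
  "smooth_structure A \<longleftrightarrow>
     (\<forall>c\<in>A. is_chart c) \<and> (\<Union>c\<in>A. fst c) = UNIV \<and>
     (\<forall>c\<in>A. \<forall>d\<in>A. smooth_compatible c d) \<and>
     (\<forall>c. is_chart c \<and> (\<forall>d\<in>A. smooth_compatible c d) \<longrightarrow> c \<in> A)"

definition charts_at :: "('m, 'e) chart set \<Rightarrow> 'm \<Rightarrow> ('m, 'e) chart set" where
  "charts_at A p = {c \<in> A. p \<in> fst c}"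

text \<open>A tangent vector at \<open>p\<close> is the family of its components in all charts around \<open>p\<close>, which
  transform by the differentials of the transition maps. The components in the charts not
  around \<open>p\<close> are set to \<open>0\<close>, so that equality is equality of functions.\<close>

type_synonym ('m, 'e) tvec = "('m, 'e) chart \<Rightarrow> 'e"

definition tangent_space ::
    "('m, 'e::euclidean_space) chart set \<Rightarrow> 'm \<Rightarrow> ('m, 'e) tvec set" where
  "tangent_space A p = {v.
     (\<forall>c\<in>charts_at A p. \<forall>d\<in>charts_at A p.
        v d = frechet_derivative (transition c d) (at (snd c p)) (v c)) \<and>
     (\<forall>c. c \<notin> charts_at A p \<longrightarrow> v c = 0)}"

text \<open>The tangent vector at \<open>p\<close> whose components in the chart \<open>c\<close> are \<open>u\<close>; for fixed \<open>u\<close> and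
  varying \<open>p\<close>, the coordinate field of \<open>c\<close> with constant components \<open>u\<close>.\<close>
definition coord_vector ::
    "('m, 'e::euclidean_space) chart set \<Rightarrow> ('m, 'e) chart \<Rightarrow> 'e \<Rightarrow> 'm \<Rightarrow> ('m, 'e) tvec" where
  "coord_vector A c u p = (\<lambda>d. if d \<in> charts_at A p
     then frechet_derivative (transition c d) (at (snd c p)) u else 0)"

definition smooth_vector_field_on ::
    "('m::topological_space, 'e::euclidean_space) chart set \<Rightarrow> 'm set \<Rightarrow>
     ('m \<Rightarrow> ('m, 'e) tvec) \<Rightarrow> bool" where
  "smooth_vector_field_on A U X \<longleftrightarrow>
     (\<forall>p\<in>U. X p \<in> tangent_space A p) \<and>
     (\<forall>c\<in>A. smooth_on (snd c ` (fst c \<inter> U)) (\<lambda>x. X (chart_inv c x) c))"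


section \<open>Semi-Riemannian metrics\<close>

type_synonym ('m, 'e) metric = "'m \<Rightarrow> ('m, 'e) tvec \<Rightarrow> ('m, 'e) tvec \<Rightarrow> real"

text \<open>The components of \<open>g\<close> in the chart \<open>c\<close>, at the point with coordinates \<open>x\<close>.\<close>
definition metric_coeff ::
    "('m, 'e::euclidean_space) chart set \<Rightarrow> ('m, 'e) metric \<Rightarrow> ('m, 'e) chart \<Rightarrow>
     'e \<Rightarrow> 'e \<Rightarrow> 'e \<Rightarrow> real" where
  "metric_coeff A g c u v x =
     g (chart_inv c x) (coord_vector A c u (chart_inv c x)) (coord_vector A c v (chart_inv c x))"

definition semi_riemannian_metric ::
    "('m::topological_space, 'e::euclidean_space) chart set \<Rightarrow> ('m, 'e) metric \<Rightarrow> bool" where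
  "semi_riemannian_metric A g \<longleftrightarrow>
     (\<forall>p. \<forall>u\<in>tangent_space A p. \<forall>v\<in>tangent_space A p. \<forall>w\<in>tangent_space A p. \<forall>r.
        g p (u + v) w = g p u w + g p v w \<and> g p (r *\<^sub>R u) v = r * g p u v \<and> g p u v = g p v u) \<and>
     (\<forall>p. \<forall>u\<in>tangent_space A p. (\<forall>v\<in>tangent_space A p. g p u v = 0) \<longrightarrow> u = 0) \<and>
     (\<forall>c\<in>A. \<forall>u v. smooth_on (chart_image c) (metric_coeff A g c u v))"

definition metric_index ::
    "('m, 'e::euclidean_space) chart set \<Rightarrow> ('m, 'e) metric \<Rightarrow> 'm \<Rightarrow> nat" where
  "metric_index A g p = Max {dim W | W. subspace W \<and> W \<subseteq> tangent_space A p \<and>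
     (\<forall>v\<in>W. v \<noteq> 0 \<longrightarrow> g p v v < 0)}"

definition riemannian ::
    "('m::topological_space, 'e::euclidean_space) chart set \<Rightarrow> ('m, 'e) metric \<Rightarrow> bool" where
  "riemannian A g \<longleftrightarrow> semi_riemannian_metric A g \<and>
     (\<forall>p. \<forall>v\<in>tangent_space A p. v \<noteq> 0 \<longrightarrow> g p v v > 0)"

definition lorentzian ::
    "('m::topological_space, 'e::euclidean_space) chart set \<Rightarrow> ('m, 'e) metric \<Rightarrow> bool" where
  "lorentzian A g \<longleftrightarrow> semi_riemannian_metric A g \<and> (\<forall>p. metric_index A g p = 1)"


section \<open>Levi-Civita connection and curvature\<close>

text \<open>The Christoffel map of \<open>c\<close> at \<open>p\<close>, i.e. the components in \<open>c\<close> of \<open>\<nabla>\<^bsub>U\<^esub> V\<close> for the coordinate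
  fields \<open>U\<close>, \<open>V\<close> with constant components \<open>u\<close>, \<open>v\<close>. It is given by the Koszul formula,
  in which the brackets of coordinate fields vanish.\<close>
definition christoffel ::
    "('m, 'e::euclidean_space) chart set \<Rightarrow> ('m, 'e) metric \<Rightarrow> ('m, 'e) chart \<Rightarrow>
     'm \<Rightarrow> 'e \<Rightarrow> 'e \<Rightarrow> 'e" where
  "christoffel A g c p u v = (THE w. \<forall>z.
     2 * metric_coeff A g c w z (snd c p) =
       frechet_derivative (metric_coeff A g c v z) (at (snd c p)) u
     + frechet_derivative (metric_coeff A g c u z) (at (snd c p)) v
     - frechet_derivative (metric_coeff A g c u v) (at (snd c p)) z)"

text \<open>\<open>\<nabla>\<^sub>v Y\<close> for a tangent vector \<open>v\<close> at \<open>p\<close> and a vector field \<open>Y\<close> defined near \<open>p\<close>.\<close>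
definition nabla ::
    "('m, 'e::euclidean_space) chart set \<Rightarrow> ('m, 'e) metric \<Rightarrow> 'm \<Rightarrow> ('m, 'e) tvec \<Rightarrow>
     ('m \<Rightarrow> ('m, 'e) tvec) \<Rightarrow> ('m, 'e) tvec" where
  "nabla A g p v Y = (\<lambda>c. if c \<in> charts_at A p
     then frechet_derivative (\<lambda>x. Y (chart_inv c x) c) (at (snd c p)) (v c)
          + christoffel A g c p (v c) (Y p c)
     else 0)"

definition nabla_field ::
    "('m, 'e::euclidean_space) chart set \<Rightarrow> ('m, 'e) metric \<Rightarrow> ('m \<Rightarrow> ('m, 'e) tvec) \<Rightarrow>
     ('m \<Rightarrow> ('m, 'e) tvec) \<Rightarrow> 'm \<Rightarrow> ('m, 'e) tvec" where
  "nabla_field A g X Y p = nabla A g p (X p) Y"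

definition lie_bracket ::
    "('m, 'e::euclidean_space) chart set \<Rightarrow> ('m \<Rightarrow> ('m, 'e) tvec) \<Rightarrow>
     ('m \<Rightarrow> ('m, 'e) tvec) \<Rightarrow> 'm \<Rightarrow> ('m, 'e) tvec" where
  "lie_bracket A X Y p = (\<lambda>c. if c \<in> charts_at A p
     then frechet_derivative (\<lambda>x. Y (chart_inv c x) c) (at (snd c p)) (X p c)
          - frechet_derivative (\<lambda>x. X (chart_inv c x) c) (at (snd c p)) (Y p c)
     else 0)"

definition curvature_field ::
    "('m, 'e::euclidean_space) chart set \<Rightarrow> ('m, 'e) metric \<Rightarrow> ('m \<Rightarrow> ('m, 'e) tvec) \<Rightarrow>
     ('m \<Rightarrow> ('m, 'e) tvec) \<Rightarrow> ('m \<Rightarrow> ('m, 'e) tvec) \<Rightarrow> 'm \<Rightarrow> ('m, 'e) tvec" where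
  "curvature_field A g X Y Z =
     nabla_field A g X (nabla_field A g Y Z)
   - nabla_field A g Y (nabla_field A g X Z)
   - nabla_field A g (lie_bracket A X Y) Z"

text \<open>The curvature tensor at \<open>p\<close>. By tensoriality any local extensions of the three vectors may be
  used; the component in the chart \<open>c\<close> is computed with their extensions to coordinate
  fields of \<open>c\<close>.\<close>
definition curvature ::
    "('m, 'e::euclidean_space) chart set \<Rightarrow> ('m, 'e) metric \<Rightarrow> 'm \<Rightarrow> ('m, 'e) tvec \<Rightarrow>
     ('m, 'e) tvec \<Rightarrow> ('m, 'e) tvec \<Rightarrow> ('m, 'e) tvec" where
  "curvature A g p u v w = (\<lambda>c. if c \<in> charts_at A p
     then curvature_field A g (coord_vector A c (u c)) (coord_vector A c (v c))
            (coord_vector A c (w c)) p c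
     else 0)"


section \<open>Curves and geodesics\<close>

definition velocity ::
    "('m, 'e::euclidean_space) chart set \<Rightarrow> real \<Rightarrow> real \<Rightarrow> (real \<Rightarrow> 'm) \<Rightarrow>
     real \<Rightarrow> ('m, 'e) tvec" where
  "velocity A a b \<gamma> t = (\<lambda>c. if c \<in> charts_at A (\<gamma> t)
     then vector_derivative (snd c \<circ> \<gamma>) (at t within {a..b}) else 0)"

definition field_along ::
    "('m, 'e::euclidean_space) chart set \<Rightarrow> real \<Rightarrow> real \<Rightarrow> (real \<Rightarrow> 'm) \<Rightarrow>
     (real \<Rightarrow> ('m, 'e) tvec) \<Rightarrow> bool" where
  "field_along A a b \<gamma> X \<longleftrightarrow> (\<forall>t\<in>{a..b}. X t \<in> tangent_space A (\<gamma> t) \<and>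
     (\<forall>c\<in>charts_at A (\<gamma> t). (\<lambda>s. X s c) differentiable (at t within {a..b})))"

text \<open>The covariant derivative of a field along the curve \<open>\<gamma>\<close>.\<close>
definition covariant_deriv ::
    "('m, 'e::euclidean_space) chart set \<Rightarrow> ('m, 'e) metric \<Rightarrow> real \<Rightarrow> real \<Rightarrow>
     (real \<Rightarrow> 'm) \<Rightarrow> (real \<Rightarrow> ('m, 'e) tvec) \<Rightarrow> real \<Rightarrow> ('m, 'e) tvec" where
  "covariant_deriv A g a b \<gamma> X t = (\<lambda>c. if c \<in> charts_at A (\<gamma> t)
     then vector_derivative (\<lambda>s. X s c) (at t within {a..b})
          + christoffel A g c (\<gamma> t) (velocity A a b \<gamma> t c) (X t c)
     else 0)"

definition geodesic ::
    "('m::topological_space, 'e::euclidean_space) chart set \<Rightarrow> ('m, 'e) metric \<Rightarrow>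
     real \<Rightarrow> real \<Rightarrow> (real \<Rightarrow> 'm) \<Rightarrow> bool" where
  "geodesic A g a b \<gamma> \<longleftrightarrow>
     continuous_on {a..b} \<gamma> \<and>
     (\<forall>t\<in>{a..b}. \<forall>c\<in>charts_at A (\<gamma> t). (snd c \<circ> \<gamma>) differentiable (at t within {a..b})) \<and>
     field_along A a b \<gamma> (velocity A a b \<gamma>) \<and>
     (\<forall>t\<in>{a..b}. covariant_deriv A g a b \<gamma> (velocity A a b \<gamma>) t = 0)"


section \<open>Submanifolds and their second fundamental form\<close>

definition slice_chart ::
    "('m, 'e::euclidean_space) chart set \<Rightarrow> 'm set \<Rightarrow> ('m, 'e) chart \<Rightarrow> 'e set \<Rightarrow> bool" where
  "slice_chart A P c W \<longleftrightarrow> c \<in> A \<and> subspace W \<and> snd c ` (fst c \<inter> P) = chart_image c \<inter> W"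

definition submanifold ::
    "('m, 'e::euclidean_space) chart set \<Rightarrow> nat \<Rightarrow> 'm set \<Rightarrow> bool" where
  "submanifold A k P \<longleftrightarrow>
     (\<forall>p\<in>P. \<exists>c W. p \<in> fst c \<and> slice_chart A P c W \<and> dim W = k)"

text \<open>The tangent space of the submanifold \<open>P\<close> at \<open>p \<in> P\<close>, as a subspace of that of the
  ambient manifold.\<close>
definition sub_tangent ::
    "('m, 'e::euclidean_space) chart set \<Rightarrow> 'm set \<Rightarrow> 'm \<Rightarrow> ('m, 'e) tvec set" where
  "sub_tangent A P p = {v \<in> tangent_space A p.
     \<exists>c W. p \<in> fst c \<and> slice_chart A P c W \<and> v c \<in> W}"

definition orth_complement ::
    "('m, 'e::euclidean_space) chart set \<Rightarrow> ('m, 'e) metric \<Rightarrow> 'm \<Rightarrow> ('m, 'e) tvec set \<Rightarrow>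
     ('m, 'e) tvec set" where
  "orth_complement A g p V = {n \<in> tangent_space A p. \<forall>v\<in>V. g p n v = 0}"

text \<open>A vector field on \<open>P\<close> near \<open>p\<close> is given by a local vector field of the ambient manifold that is
  tangent to \<open>P\<close> along \<open>P\<close>. The value below does not depend on the extension of \<open>v\<^sub>2\<close>.\<close>
definition second_fundamental_form ::
    "('m::topological_space, 'e::euclidean_space) chart set \<Rightarrow> ('m, 'e) metric \<Rightarrow> 'm set \<Rightarrow>
     'm \<Rightarrow> ('m, 'e) tvec \<Rightarrow> ('m, 'e) tvec \<Rightarrow> ('m, 'e) tvec \<Rightarrow> real" where
  "second_fundamental_form A g P p n v\<^sub>1 v\<^sub>2 = (THE s. \<forall>U V\<^sub>2.
     open U \<and> p \<in> U \<and> smooth_vector_field_on A U V\<^sub>2 \<and>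
     (\<forall>q\<in>U \<inter> P. V\<^sub>2 q \<in> sub_tangent A P q) \<and> V\<^sub>2 p = v\<^sub>2
     \<longrightarrow> s = g p (nabla A g p v\<^sub>1 V\<^sub>2) n)"

definition shape_operator ::
    "('m::topological_space, 'e::euclidean_space) chart set \<Rightarrow> ('m, 'e) metric \<Rightarrow> 'm set \<Rightarrow>
     'm \<Rightarrow> ('m, 'e) tvec \<Rightarrow> ('m, 'e) tvec \<Rightarrow> ('m, 'e) tvec" where
  "shape_operator A g P p n v = (THE s. s \<in> sub_tangent A P p \<and>
     (\<forall>w\<in>sub_tangent A P p. second_fundamental_form A g P p n v w = g p s w))"


section \<open>Focal points and the geometric index\<close>

text \<open>Fields along \<open>\<gamma>\<close> are set to \<open>0\<close> outside \<open>[a, b]\<close>, so that distinct functions are distinct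
  fields and \<open>dim\<close> counts correctly.\<close>
definition jacobi_fields ::
    "('m::topological_space, 'e::euclidean_space) chart set \<Rightarrow> ('m, 'e) metric \<Rightarrow> 'm set \<Rightarrow>
     real \<Rightarrow> real \<Rightarrow> (real \<Rightarrow> 'm) \<Rightarrow> (real \<Rightarrow> ('m, 'e) tvec) set" where
  "jacobi_fields A g P a b \<gamma> = {J.
     (\<forall>t. t \<notin> {a..b} \<longrightarrow> J t = 0) \<and>
     field_along A a b \<gamma> J \<and>
     field_along A a b \<gamma> (covariant_deriv A g a b \<gamma> J) \<and>
     (\<forall>t\<in>{a..b}. covariant_deriv A g a b \<gamma> (covariant_deriv A g a b \<gamma> J) t
        = curvature A g (\<gamma> t) (velocity A a b \<gamma> t) (J t) (velocity A a b \<gamma> t)) \<and>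
     J a \<in> sub_tangent A P (\<gamma> a) \<and>
     covariant_deriv A g a b \<gamma> J a + shape_operator A g P (\<gamma> a) (velocity A a b \<gamma> a) (J a)
       \<in> orth_complement A g (\<gamma> a) (sub_tangent A P (\<gamma> a))}"

definition focal ::
    "('m::topological_space, 'e::euclidean_space) chart set \<Rightarrow> ('m, 'e) metric \<Rightarrow> 'm set \<Rightarrow>
     real \<Rightarrow> real \<Rightarrow> (real \<Rightarrow> 'm) \<Rightarrow> real \<Rightarrow> bool" where
  "focal A g P a b \<gamma> t\<^sub>0 \<longleftrightarrow>
     t\<^sub>0 \<in> {a<..b} \<and> (\<exists>J\<in>jacobi_fields A g P a b \<gamma>. J \<noteq> 0 \<and> J t\<^sub>0 = 0)"

definition focal_multiplicity ::
    "('m::topological_space, 'e::euclidean_space) chart set \<Rightarrow> ('m, 'e) metric \<Rightarrow> 'm set \<Rightarrow>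
     real \<Rightarrow> real \<Rightarrow> (real \<Rightarrow> 'm) \<Rightarrow> real \<Rightarrow> nat" where
  "focal_multiplicity A g P a b \<gamma> t\<^sub>0 = dim {J \<in> jacobi_fields A g P a b \<gamma>. J t\<^sub>0 = 0}"

text \<open>If there are infinitely many focal points, then the sum of their multiplicities is \<open>\<infinity>\<close>.\<close>
definition geometric_index ::
    "('m::topological_space, 'e::euclidean_space) chart set \<Rightarrow> ('m, 'e) metric \<Rightarrow> 'm set \<Rightarrow>
     real \<Rightarrow> real \<Rightarrow> (real \<Rightarrow> 'm) \<Rightarrow> enat" where
  "geometric_index A g P a b \<gamma> =
     (if finite {t. focal A g P a b \<gamma> t}
      then enat (\<Sum>t | focal A g P a b \<gamma> t. focal_multiplicity A g P a b \<gamma> t)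
      else \<infinity>)"


section \<open>Convergence in the tangent bundle and in the bundle of subspaces with forms\<close>

text \<open>In both definitions the local trivialization of the tangent bundle is the one
  given by a chart around the limit point.\<close>

definition tangent_bundle_tendsto ::
    "('m::topological_space, 'e::euclidean_space) chart set \<Rightarrow> (nat \<Rightarrow> 'm) \<Rightarrow>
     (nat \<Rightarrow> ('m, 'e) tvec) \<Rightarrow> 'm \<Rightarrow> ('m, 'e) tvec \<Rightarrow> bool" where
  "tangent_bundle_tendsto A p v p\<^sub>0 v\<^sub>0 \<longleftrightarrow>
     p \<longlonglongrightarrow> p\<^sub>0 \<and> (\<exists>c\<in>charts_at A p\<^sub>0. (\<lambda>j. v j c) \<longlonglongrightarrow> v\<^sub>0 c)"

definition is_basis :: "nat \<Rightarrow> (nat \<Rightarrow> 'v::real_vector) \<Rightarrow> 'v set \<Rightarrow> bool" where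
  "is_basis k e V \<longleftrightarrow>
     inj_on e {..<k} \<and> independent (e ` {..<k}) \<and> span (e ` {..<k}) = V"

definition GB_tendsto ::
    "('m::topological_space, 'e::euclidean_space) chart set \<Rightarrow> nat \<Rightarrow> (nat \<Rightarrow> 'm) \<Rightarrow>
     (nat \<Rightarrow> ('m, 'e) tvec set) \<Rightarrow> (nat \<Rightarrow> ('m, 'e) tvec \<Rightarrow> ('m, 'e) tvec \<Rightarrow> real) \<Rightarrow>
     'm \<Rightarrow> ('m, 'e) tvec set \<Rightarrow> (('m, 'e) tvec \<Rightarrow> ('m, 'e) tvec \<Rightarrow> real) \<Rightarrow> bool" where
  "GB_tendsto A k p P S p\<^sub>0 P\<^sub>0 S\<^sub>0 \<longleftrightarrow>
     p \<longlonglongrightarrow> p\<^sub>0 \<and>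
     (\<exists>c\<in>charts_at A p\<^sub>0. \<exists>e e\<^sub>0.
        is_basis k e\<^sub>0 P\<^sub>0 \<and> (\<forall>\<^sub>F j in sequentially. is_basis k (e j) (P j)) \<and>
        (\<forall>i<k. (\<lambda>j. e j i c) \<longlonglongrightarrow> e\<^sub>0 i c) \<and>
        (\<forall>\<alpha><k. \<forall>\<beta><k. (\<lambda>j. S j (e j \<alpha>) (e j \<beta>)) \<longlonglongrightarrow> S\<^sub>0 (e\<^sub>0 \<alpha>) (e\<^sub>0 \<beta>)))"


section \<open>The connection is torsion-free and metric\<close>

text \<open>These two properties characterise the Levi-Civita connection; they also show that the definite
  description in \<open>christoffel\<close> is well-defined. The metric property is stated for
  coordinate fields, which suffices by the product rule.\<close>

context
  fixes A :: "('m::topological_space, 'e::euclidean_space) chart set"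
  assumes A: "smooth_structure A"
begin

lemma chart_facts:
  assumes "c \<in> A"
  shows "open (fst c)" "open (chart_image c)" "p \<in> fst c \<Longrightarrow> chart_inv c (snd c p) = p"
    "x \<in> chart_image c \<Longrightarrow> snd c (chart_inv c x) = x" "x \<in> chart_image c \<Longrightarrow> chart_inv c x \<in> fst c"
    "continuous_on (fst c) (snd c)" "continuous_on (chart_image c) (chart_inv c)"
  using A assms unfolding smooth_structure_def is_chart_def homeomorphism_def by auto

lemma open_overlap:
  assumes "c \<in> A" "open U" shows "open (snd c ` (fst c \<inter> U))"
proof -
  have "snd c ` (fst c \<inter> U) = chart_image c \<inter> chart_inv c -` U"
    using chart_facts[OF assms(1)] unfolding chart_image_def by force
  then show ?thesis
    using continuous_on_open_vimage[OF chart_facts(2)[OF assms(1)]] chart_facts(7)[OF assms(1)] assms(2)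
    by (metis Int_commute)
qed

lemma transition_differentiable:
  assumes "c \<in> charts_at A p" "d \<in> charts_at A p"
  shows "transition c d differentiable (at (snd c p))"
proof -
  have "Ck_on 1 (snd c ` (fst c \<inter> fst d)) (transition c d)"
    using A assms unfolding smooth_structure_def charts_at_def smooth_compatible_def smooth_on_def by blast
  then show ?thesis using assms by (auto simp: charts_at_def)
qed

lemma transition_cocycle:
  assumes "c \<in> charts_at A p" "d \<in> charts_at A p" "e \<in> charts_at A p"
  shows "frechet_derivative (transition c e) (at (snd c p)) =
    frechet_derivative (transition d e) (at (snd d p)) \<circ> frechet_derivative (transition c d) (at (snd c p))"
proof -
  have cA: "c \<in> A" "d \<in> A" "e \<in> A" "p \<in> fst c" "p \<in> fst d" using assms by (auto simp: charts_at_def)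
  have eq: "transition c d (snd c p) = snd d p" using cA chart_facts(3) by (simp add: transition_def)
  have d1: "(transition c d has_derivative frechet_derivative (transition c d) (at (snd c p))) (at (snd c p))"
    using transition_differentiable[OF assms(1,2)] frechet_derivative_works by blast
  have d2: "(transition d e has_derivative frechet_derivative (transition d e) (at (snd d p))) (at (snd d p))"
    using transition_differentiable[OF assms(2,3)] frechet_derivative_works by blast
  have "((transition d e \<circ> transition c d) has_derivative
     (frechet_derivative (transition d e) (at (snd d p)) \<circ> frechet_derivative (transition c d) (at (snd c p)))) (at (snd c p))"
    by (rule diff_chain_at[OF d1]) (simp add: eq d2)
  then have "(transition c e has_derivative
     (frechet_derivative (transition d e) (at (snd d p)) \<circ> frechet_derivative (transition c d) (at (snd c p)))) (at (snd c p))"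
  proof (rule has_derivative_transform_within_open)
    show "open (snd c ` (fst c \<inter> fst d))" using open_overlap cA chart_facts(1) by blast
    show "snd c p \<in> snd c ` (fst c \<inter> fst d)" using cA by blast
    show "(transition d e \<circ> transition c d) x = transition c e x" if "x \<in> snd c ` (fst c \<inter> fst d)" for x
    proof -
      from that obtain q where q: "x = snd c q" "q \<in> fst c" "q \<in> fst d" by blast
      show ?thesis using chart_facts(3)[OF cA(1) q(2)] chart_facts(3)[OF cA(2) q(3)] q(1) by (simp add: transition_def)
    qed
  qed
  then show ?thesis using frechet_derivative_at by metis
qed

lemma transition_self:
  assumes "c \<in> charts_at A p"
  shows "frechet_derivative (transition c c) (at (snd c p)) = id"
proof -
  have cA: "c \<in> A" "p \<in> fst c" using assms by (auto simp: charts_at_def)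
  have "((\<lambda>x. x) has_derivative id) (at (snd c p))" by (simp add: id_def)
  then have "(transition c c has_derivative id) (at (snd c p))"
    by (rule has_derivative_transform_within_open[OF _ chart_facts(2)[OF cA(1)]])
      (use cA chart_facts in \<open>auto simp: transition_def chart_image_def\<close>)
  then show ?thesis using frechet_derivative_at by metis
qed

lemma coord_vector_self: "c \<in> charts_at A p \<Longrightarrow> coord_vector A c u p c = u"
  by (simp add: coord_vector_def transition_self)

lemma coord_vector_tangent:
  assumes "c \<in> charts_at A p" shows "coord_vector A c u p \<in> tangent_space A p"
proof -
  have "coord_vector A c u p e = frechet_derivative (transition d e) (at (snd d p)) (coord_vector A c u p d)"
    if "d \<in> charts_at A p" "e \<in> charts_at A p" for d e
    using fun_cong[OF transition_cocycle[OF assms that], of u] that by (simp add: coord_vector_def)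
  moreover have "coord_vector A c u p e = 0" if "e \<notin> charts_at A p" for e
    using that by (simp add: coord_vector_def)
  ultimately show ?thesis unfolding tangent_space_def by blast
qed

lemma coord_vector_of_tangent:
  assumes "c \<in> charts_at A p" "v \<in> tangent_space A p" shows "coord_vector A c (v c) p = v"
proof
  fix d
  have "d \<in> charts_at A p \<Longrightarrow> v d = frechet_derivative (transition c d) (at (snd c p)) (v c)"
    "d \<notin> charts_at A p \<Longrightarrow> v d = 0"
    using assms unfolding tangent_space_def by blast+
  then show "coord_vector A c (v c) p d = v d" unfolding coord_vector_def by presburger
qed

lemma coord_vector_lin:
  assumes "c \<in> charts_at A p"
  shows "coord_vector A c (u + v) p = coord_vector A c u p + coord_vector A c v p"
    "coord_vector A c (r *\<^sub>R u) p = r *\<^sub>R coord_vector A c u p"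
proof -
  have "linear (frechet_derivative (transition c d) (at (snd c p)))" if "d \<in> charts_at A p" for d
    using transition_differentiable[OF assms that] linear_frechet_derivative by blast
  then show "coord_vector A c (u + v) p = coord_vector A c u p + coord_vector A c v p"
    "coord_vector A c (r *\<^sub>R u) p = r *\<^sub>R coord_vector A c u p"
    by (auto simp: coord_vector_def fun_eq_iff scaleR_fun_def linear_add linear_scale)
qed

context
  fixes g assumes g: "semi_riemannian_metric A g"
begin

lemma metric_coeff_lin:
  assumes "c \<in> A" "x \<in> chart_image c"
  shows "metric_coeff A g c (u+v) w x = metric_coeff A g c u w x + metric_coeff A g c v w x"
   "metric_coeff A g c (r *\<^sub>R u) w x = r * metric_coeff A g c u w x"
   "metric_coeff A g c u w x = metric_coeff A g c w u x"
proof -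
  have c: "c \<in> charts_at A (chart_inv c x)" using assms chart_facts by (auto simp: charts_at_def)
  note H = conjunct1[OF g[unfolded semi_riemannian_metric_def], rule_format]
  note t = coord_vector_tangent[OF c, of u] coord_vector_tangent[OF c, of v] coord_vector_tangent[OF c, of w]
  show "metric_coeff A g c (u+v) w x = metric_coeff A g c u w x + metric_coeff A g c v w x"
   "metric_coeff A g c (r *\<^sub>R u) w x = r * metric_coeff A g c u w x"
   "metric_coeff A g c u w x = metric_coeff A g c w u x"
    unfolding metric_coeff_def coord_vector_lin[OF c]
    using H[OF t, THEN conjunct1] H[OF t(1,3,3), THEN conjunct2, THEN conjunct1] H[OF t(1,3,3), THEN conjunct2, THEN conjunct2]
    by (assumption | simp only:)+
qed

lemma metric_coeff_nondegenerate:
  assumes c: "c \<in> charts_at A p" and "\<And>z. metric_coeff A g c w z (snd c p) = 0"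
  shows "w = 0"
proof -
  have p: "chart_inv c (snd c p) = p" using c chart_facts by (auto simp: charts_at_def)
  have "g p (coord_vector A c w p) v = 0" if "v \<in> tangent_space A p" for v
    using assms(2)[of "v c"] coord_vector_of_tangent[OF c that] p by (simp add: metric_coeff_def)
  then have "coord_vector A c w p = 0"
    using g coord_vector_tangent[OF c] unfolding semi_riemannian_metric_def by blast
  then show ?thesis using coord_vector_self[OF c, of w] by simp
qed

lemma metric_coeff_differentiable:
  assumes "c \<in> A" "x \<in> chart_image c"
  shows "metric_coeff A g c u v differentiable (at x)"
proof -
  have "Ck_on (Suc 0) (chart_image c) (metric_coeff A g c u v)"
    using conjunct2[OF conjunct2[OF g[unfolded semi_riemannian_metric_def]], rule_format, OF assms(1), of u v]
    unfolding smooth_on_def by (rule spec)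
  then show ?thesis using assms(2) by (simp only: Ck_on.simps)
qed

definition "metric_deriv c x w u v = frechet_derivative (metric_coeff A g c u v) (at x) w"

lemma metric_deriv_lin:
  assumes "c \<in> A" "x \<in> chart_image c"
  shows "metric_deriv c x w (u+u') v = metric_deriv c x w u v + metric_deriv c x w u' v"
   "metric_deriv c x w (r *\<^sub>R u) v = r * metric_deriv c x w u v"
   "metric_deriv c x w u v = metric_deriv c x w v u"
   "metric_deriv c x (w+w') u v = metric_deriv c x w u v + metric_deriv c x w' u v"
   "metric_deriv c x (r *\<^sub>R w) u v = r * metric_deriv c x w u v"
proof -
  have lin: "linear (frechet_derivative (metric_coeff A g c u v) (at x))" for u v
    using metric_coeff_differentiable[OF assms] linear_frechet_derivative by blast
  show "metric_deriv c x (w+w') u v = metric_deriv c x w u v + metric_deriv c x w' u v"  "metric_deriv c x (r *\<^sub>R w) u v = r * metric_deriv c x w u v"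
    using lin by (auto simp: metric_deriv_def linear_add linear_scale)
  have op: "open (chart_image c)" using chart_facts assms by blast
  have D: "(metric_coeff A g c u v has_derivative frechet_derivative (metric_coeff A g c u v) (at x)) (at x)" for u v
    using metric_coeff_differentiable[OF assms] frechet_derivative_works by blast
  have 1: "(metric_coeff A g c (u+u') v has_derivative 
     (\<lambda>w. frechet_derivative (metric_coeff A g c u v) (at x) w + frechet_derivative (metric_coeff A g c u' v) (at x) w)) (at x)"
    by (rule has_derivative_transform_within_open[OF has_derivative_add[OF D D] op assms(2)])
      (simp add: metric_coeff_lin(1,2) assms)
  show "metric_deriv c x w (u+u') v = metric_deriv c x w u v + metric_deriv c x w u' v"
    unfolding metric_deriv_def using frechet_derivative_at[OF 1] by metis
  have 2: "(metric_coeff A g c (r *\<^sub>R u) v has_derivative 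
     (\<lambda>w. r * frechet_derivative (metric_coeff A g c u v) (at x) w)) (at x)"
    by (rule has_derivative_transform_within_open[OF has_derivative_mult_right[OF D] op assms(2)])
      (simp add: metric_coeff_lin(1,2) assms)
  show "metric_deriv c x w (r *\<^sub>R u) v = r * metric_deriv c x w u v"
    unfolding metric_deriv_def using frechet_derivative_at[OF 2] by metis
  have 3: "(metric_coeff A g c u v has_derivative 
     (frechet_derivative (metric_coeff A g c v u) (at x))) (at x)"
    by (rule has_derivative_transform_within_open[OF D op assms(2)])
      (metis metric_coeff_lin(3) assms(1))
  show "metric_deriv c x w u v = metric_deriv c x w v u"
    unfolding metric_deriv_def using frechet_derivative_at[OF 3] by metis
qed

lemma christoffel_koszul:
  assumes c: "c \<in> charts_at A p"
  shows "2 * metric_coeff A g c (christoffel A g c p u v) z (snd c p) =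
     metric_deriv c (snd c p) u v z + metric_deriv c (snd c p) v u z - metric_deriv c (snd c p) z u v"
proof -
  let ?x = "snd c p"
  have cA: "c \<in> A" "?x \<in> chart_image c" using c by (auto simp: charts_at_def chart_image_def)
  define B where "B w = (\<Sum>b\<in>Basis. metric_coeff A g c w b ?x *\<^sub>R b)" for w
  have Bi: "B w \<bullet> z = metric_coeff A g c w z ?x" for w z
  proof -
    have lin: "linear (\<lambda>z. metric_coeff A g c w z ?x)"
      using metric_coeff_lin[OF cA] by (intro linearI) (metis, metis real_scaleR_def)
    have "metric_coeff A g c w z ?x = metric_coeff A g c w (\<Sum>b\<in>Basis. (z \<bullet> b) *\<^sub>R b) ?x"
      by (simp add: euclidean_representation)
    also have "\<dots> = (\<Sum>b\<in>Basis. (z \<bullet> b) * metric_coeff A g c w b ?x)"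
      using linear_sum[OF lin, of "\<lambda>b. (z \<bullet> b) *\<^sub>R b" Basis] linear_scale[OF lin] by simp
    also have "\<dots> = B w \<bullet> z" unfolding B_def inner_sum_left by (intro sum.cong) (simp_all add: inner_commute)
    finally show ?thesis by simp
  qed
  have linB: "linear B"
    by (intro linearI) (auto simp: B_def metric_coeff_lin(1,2)[OF cA] scaleR_add_left sum.distrib scaleR_sum_right)
  have "inj B"
    unfolding linear_injective_0[OF linB]
    using metric_coeff_nondegenerate[OF c] Bi by (metis inner_zero_left)
  then have "surj B" using linB linear_injective_imp_surjective by blast
  let ?f = "\<lambda>z. (metric_deriv c ?x u v z + metric_deriv c ?x v u z - metric_deriv c ?x z u v) / 2"
  have linf: "linear ?f"
  proof (rule linearI)
    have q: "metric_deriv c ?x w u (a + b) = metric_deriv c ?x w u a + metric_deriv c ?x w u b" for w u a b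
      using metric_deriv_lin(1,3)[OF cA] by metis
    show "?f (a + b) = ?f a + ?f b" for a b
      by (simp only: q metric_deriv_lin(4)[OF cA]) (simp add: field_simps)
    have r: "metric_deriv c ?x w u (r *\<^sub>R a) = r * metric_deriv c ?x w u a" for w u r a
      using metric_deriv_lin(2,3)[OF cA] by metis
    show "?f (r *\<^sub>R a) = r *\<^sub>R ?f a" for r a
      by (simp only: r metric_deriv_lin(5)[OF cA] real_scaleR_def) (simp add: field_simps)
  qed
  define f where "f = ?f"
  have lf: "linear f" using linf unfolding f_def .
  obtain w where w: "B w = (\<Sum>b\<in>Basis. f b *\<^sub>R b)" using \<open>surj B\<close> by (metis surjD)
  have wz: "metric_coeff A g c w z ?x = ?f z" for z
  proof -
    have "f z = f (\<Sum>b\<in>Basis. (z \<bullet> b) *\<^sub>R b)" by (simp add: euclidean_representation)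
    also have "\<dots> = (\<Sum>b\<in>Basis. f ((z \<bullet> b) *\<^sub>R b))" by (rule linear_sum[OF lf])
    also have "\<dots> = B w \<bullet> z" unfolding w inner_sum_left
      by (intro sum.cong refl) (simp add: linear_scale[OF lf] inner_commute[of z])
    finally show ?thesis using Bi unfolding f_def by simp
  qed
  have "\<exists>!w. \<forall>z. 2 * metric_coeff A g c w z ?x = metric_deriv c ?x u v z + metric_deriv c ?x v u z - metric_deriv c ?x z u v"
  proof (rule ex1I[of _ w])
    show "\<forall>z. 2 * metric_coeff A g c w z ?x = metric_deriv c ?x u v z + metric_deriv c ?x v u z - metric_deriv c ?x z u v"
      by (simp add: wz)
    fix w' assume "\<forall>z. 2 * metric_coeff A g c w' z ?x = metric_deriv c ?x u v z + metric_deriv c ?x v u z - metric_deriv c ?x z u v"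
    then have "B w' = B w" using Bi wz
      by (metis (no_types, lifting) euclidean_eqI nonzero_mult_div_cancel_left zero_neq_numeral)
    then show "w' = w" using \<open>inj B\<close> by (simp add: inj_eq)
  qed
  from theI'[OF this] show ?thesis unfolding christoffel_def metric_deriv_def by (rule spec)
qed

lemma christoffel_sym:
  assumes c: "c \<in> charts_at A p"
  shows "christoffel A g c p u v = christoffel A g c p v u"
proof -
  have cA: "c \<in> A" "snd c p \<in> chart_image c" using c by (auto simp: charts_at_def chart_image_def)
  have 1: "(2 * m = metric_deriv c (snd c p) u v z + metric_deriv c (snd c p) v u z - metric_deriv c (snd c p) z u v)
    = (2 * m = metric_deriv c (snd c p) v u z + metric_deriv c (snd c p) u v z - metric_deriv c (snd c p) z v u)" for m z
    using metric_deriv_lin(3)[OF cA, of z u v] by linarith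
  show ?thesis unfolding christoffel_def metric_deriv_def[symmetric] by (simp only: 1)
qed

lemma nabla_torsion_free:
  "nabla_field A g X Y p - nabla_field A g Y X p = lie_bracket A X Y p"
proof
  fix c
  show "(nabla_field A g X Y p - nabla_field A g Y X p) c = lie_bracket A X Y p c"
  proof (cases "c \<in> charts_at A p")
    case True
    show ?thesis using christoffel_sym[OF True, of "X p c" "Y p c"] True
      unfolding nabla_field_def nabla_def lie_bracket_def fun_diff_def by simp
  next
    case False
    then show ?thesis unfolding nabla_field_def nabla_def lie_bracket_def fun_diff_def by simp
  qed
qed

lemma christoffel_metric:
  assumes c: "c \<in> charts_at A p"
  shows "frechet_derivative (metric_coeff A g c u v) (at (snd c p)) w =
    metric_coeff A g c (christoffel A g c p w u) v (snd c p) + metric_coeff A g c u (christoffel A g c p w v) (snd c p)"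
proof -
  have cA: "c \<in> A" "snd c p \<in> chart_image c" using c by (auto simp: charts_at_def chart_image_def)
  have 1: "2 * metric_coeff A g c (christoffel A g c p w u) v (snd c p) =
     metric_deriv c (snd c p) w u v + metric_deriv c (snd c p) u w v - metric_deriv c (snd c p) v w u" by (rule christoffel_koszul[OF c])
  have 2: "2 * metric_coeff A g c (christoffel A g c p w v) u (snd c p) =
     metric_deriv c (snd c p) w v u + metric_deriv c (snd c p) v w u - metric_deriv c (snd c p) u w v" by (rule christoffel_koszul[OF c])
  have 3: "metric_deriv c (snd c p) w v u = metric_deriv c (snd c p) w u v" by (rule metric_deriv_lin(3)[OF cA])
  have 4: "metric_coeff A g c u (christoffel A g c p w v) (snd c p) = metric_coeff A g c (christoffel A g c p w v) u (snd c p)"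
    by (rule metric_coeff_lin(3)[OF cA])
  show ?thesis using 1 2 3 4 unfolding metric_deriv_def[symmetric] by linarith
qed

end
end

end

theory Submission
  imports Defs
begin

text \<open>Focal points are crossings of a path of symmetric bilinear forms, all crossings are positive, and the
  number of positive crossings between two nondegenerate forms depends only on the two forms.

  The initial data of the \<open>P i\<close>-Jacobi fields along \<open>\<gamma> i\<close> are parametrised linearly by the vectors \<open>x\<close> of the
  model space. Let \<open>J x\<close> be the field with data \<open>x\<close>, and \<open>Z x\<close> its covariant derivative. The conservation of
  the symplectic form (\<open>lagrange_identity\<close>) and the symmetry of the second fundamental form make the pairing
  \<open>g (J x) (Z y)\<close> symmetric, and for a constant \<open>r\<close> so is \<open>B x y = g (J x) (Z y + r J y)\<close>. Near a given time
  \<open>t > a\<close> and for a suitable \<open>r\<close>, the radical of \<open>B\<close> consists of the \<open>x\<close> with \<open>J x t = 0\<close>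
  (\<open>shift_exists\<close>), so its dimension is the multiplicity of \<open>t\<close> as a focal time. On the radical the
  derivative of \<open>B\<close> is \<open>g (Z x) (Z x)\<close>. This is positive (\<open>crossing_positive\<close>): in the Lorentzian case
  because \<open>Z x\<close> is orthogonal to the velocity, which is causal, and transversality excludes that it is
  proportional to it.

  At a positive crossing the largest dimension of a subspace on which the form is nonpositive drops by the
  dimension of the radical (\<open>form_crossing\<close>). So on a short interval the focal points, counted with
  multiplicity, are counted by the difference of these dimensions at the ends (\<open>crossing_count\<close>), and at ends
  where the limit form is nondegenerate these dimensions are stable (\<open>nondegenerate_form_stable\<close>).

  Gronwall's estimate shows that the geodesics and their Jacobi fields converge to those of the limit, jointly in
  the index and the time (\<open>geodesic_local\<close>, \<open>jacobi_local\<close>). Hence near a time that is not focal for the limit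
  there is no focal point for large indices. The forms degenerate at time \<open>a\<close>, where a different argument is
  needed: for small \<open>s - a\<close> the map from the suitably rescaled data to \<open>J x s\<close> is close to one that is injective
  because \<open>g\<close> is nondegenerate on the tangent space of the submanifold (\<open>kernel_initial\<close>). Compactness of
  the interval puts these local statements together (\<open>stable_count\<close>, \<open>geometric_index_stable\<close>).\<close>


section \<open>Linear maps and bilinear forms depending on a parameter\<close>

lemma linear_basis_sum:
  fixes f :: "'e::euclidean_space \<Rightarrow> 'f::real_vector"
  assumes "linear f" shows "f x = (\<Sum>b\<in>Basis. (x \<bullet> b) *\<^sub>R f b)"
proof -
  have "f x = f (\<Sum>b\<in>Basis. (x \<bullet> b) *\<^sub>R b)" by (simp add: euclidean_representation)
  also have "\<dots> = (\<Sum>b\<in>Basis. (x \<bullet> b) *\<^sub>R f b)"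
    by (simp add: linear_sum[OF assms] linear_scale[OF assms])
  finally show ?thesis .
qed

lemma linear_fromI:
  fixes h :: "'x::real_vector \<Rightarrow> 'y::real_vector"
  assumes "\<And>x y r. h (x + r *\<^sub>R y) = h x + r *\<^sub>R h y" shows "linear h"
proof -
  have "h 0 = 0" using assms[of 0 1 0] by simp
  then show ?thesis using assms[of _ 1] assms[of 0] by (intro linearI) simp_all
qed

lemma linear_apply_tendsto:
  fixes G :: "'i \<Rightarrow> 'e::euclidean_space \<Rightarrow> 'f::real_normed_vector"
  assumes lin: "\<forall>\<^sub>F i in F. linear (G i)" "linear G0"
    and conv: "\<And>b. ((\<lambda>i. G i b) \<longlongrightarrow> G0 b) F" and x: "(x \<longlongrightarrow> x0) F"
  shows "((\<lambda>i. G i (x i)) \<longlongrightarrow> G0 x0) F"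
proof -
  have "((\<lambda>i. \<Sum>b\<in>Basis. (x i \<bullet> b) *\<^sub>R G i b) \<longlongrightarrow> (\<Sum>b\<in>Basis. (x0 \<bullet> b) *\<^sub>R G0 b)) F"
    by (intro tendsto_intros conv x)
  then have "((\<lambda>i. \<Sum>b\<in>Basis. (x i \<bullet> b) *\<^sub>R G i b) \<longlongrightarrow> G0 x0) F"
    by (simp only: linear_basis_sum[OF lin(2), symmetric])
  then show ?thesis
    by (rule Lim_transform_eventually) (use lin(1) in \<open>eventually_elim, simp only: linear_basis_sum[symmetric]\<close>)
qed

lemma bilinear_apply_tendsto:
  fixes B :: "'i \<Rightarrow> 'e::euclidean_space \<Rightarrow> 'e \<Rightarrow> 'f::real_normed_vector"
  assumes lin: "\<forall>\<^sub>F i in F. bilinear (B i)" "bilinear B0"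
    and conv: "\<And>b b'. ((\<lambda>i. B i b b') \<longlongrightarrow> B0 b b') F"
    and x: "(x \<longlongrightarrow> x0) F" and y: "(y \<longlongrightarrow> y0) F"
  shows "((\<lambda>i. B i (x i) (y i)) \<longlongrightarrow> B0 x0 y0) F"
proof (rule linear_apply_tendsto[OF _ _ _ y])
  show "\<forall>\<^sub>F i in F. linear (B i (x i))" "linear (B0 x0)"
    using lin by (auto simp: bilinear_def elim: eventually_mono)
  show "((\<lambda>i. B i (x i) b) \<longlongrightarrow> B0 x0 b) F" for b
    by (rule linear_apply_tendsto[where G = "\<lambda>i x. B i x b", OF _ _ conv x])
      (use lin in \<open>auto simp: bilinear_def elim: eventually_mono\<close>)
qed

lemma linear_tendsto_uniform:
  fixes G :: "'i \<Rightarrow> 'e::euclidean_space \<Rightarrow> 'f::real_normed_vector"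
  assumes lin: "\<forall>\<^sub>F i in F. linear (G i)" "linear G0"
    and conv: "\<And>b. ((\<lambda>i. G i b) \<longlongrightarrow> G0 b) F" and "e > 0"
  shows "\<forall>\<^sub>F i in F. \<forall>x. norm (G i x - G0 x) \<le> e * norm x"
proof -
  have "((\<lambda>i. \<Sum>b\<in>Basis. norm (G i b - G0 b)) \<longlongrightarrow> (\<Sum>b\<in>(Basis::'e set). norm (G0 b - G0 b))) F"
    by (intro tendsto_intros conv)
  then have "\<forall>\<^sub>F i in F. (\<Sum>b\<in>Basis. norm (G i b - G0 b)) < e"
    using \<open>e > 0\<close> by (auto dest: order_tendstoD(2))
  with lin(1) show ?thesis
  proof eventually_elim
    case (elim i)
    show ?case
    proof
      fix x
      have "G i x - G0 x = (\<Sum>b\<in>Basis. (x \<bullet> b) *\<^sub>R (G i b - G0 b))"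
        using linear_basis_sum[OF linear_compose_sub[OF elim(1) lin(2)], of x] .
      also have "norm \<dots> \<le> (\<Sum>b\<in>Basis. norm x * norm (G i b - G0 b))"
        by (rule sum_norm_le) (simp add: Basis_le_norm mult_right_mono)
      also have "\<dots> = norm x * (\<Sum>b\<in>Basis. norm (G i b - G0 b))" by (simp add: sum_distrib_left)
      also have "\<dots> \<le> norm x * e" using elim(2) by (intro mult_left_mono) auto
      finally show "norm (G i x - G0 x) \<le> e * norm x" by (simp add: mult.commute)
    qed
  qed
qed

lemma linear_injective_eventually:
  fixes G :: "'i \<Rightarrow> 'e::euclidean_space \<Rightarrow> 'f::euclidean_space"
  assumes lin: "\<forall>\<^sub>F i in F. linear (G i)" "linear G0"
    and conv: "\<And>b. ((\<lambda>i. G i b) \<longlongrightarrow> G0 b) F" and inj: "\<And>x. G0 x = 0 \<Longrightarrow> x = 0"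
  shows "\<exists>m>0. \<forall>\<^sub>F i in F. \<forall>x. m * norm x \<le> norm (G i x)"
proof -
  have "inj G0" using inj linear_injective_0[OF lin(2)] by blast
  then obtain m where m: "m > 0" "\<And>x. m * norm x \<le> norm (G0 x)"
    using linear_inj_bounded_below_pos[OF lin(2)] by blast
  have "\<forall>\<^sub>F i in F. \<forall>x. norm (G i x - G0 x) \<le> m / 2 * norm x"
    using linear_tendsto_uniform[OF lin conv, of "m/2"] m(1) by simp
  then have "\<forall>\<^sub>F i in F. \<forall>x. (m / 2) * norm x \<le> norm (G i x)"
  proof eventually_elim
    case (elim i)
    show ?case
    proof
      fix x
      have "norm (G0 x) \<le> norm (G i x) + norm (G i x - G0 x)" by norm
      then show "m / 2 * norm x \<le> norm (G i x)" using m(2)[of x] elim[rule_format, of x] by linarith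
    qed
  qed
  then show ?thesis using m(1) by (intro exI[of _ "m/2"]) auto
qed

text \<open>The solution of a linear system depends continuously on the coefficients and the right-hand side.
  The lower bound for the coefficients controls the error, so no formula for the inverse is needed.\<close>
lemma linear_solution_tendsto:
  fixes G :: "'i \<Rightarrow> 'e::euclidean_space \<Rightarrow> 'f::euclidean_space"
  assumes lin: "\<forall>\<^sub>F i in F. linear (G i)" "linear G0"
    and conv: "\<And>b. ((\<lambda>i. G i b) \<longlongrightarrow> G0 b) F" and inj: "\<And>x. G0 x = 0 \<Longrightarrow> x = 0"
    and rhs: "((\<lambda>i. G i (w i)) \<longlongrightarrow> G0 w0) F"
  shows "(w \<longlongrightarrow> w0) F"
proof -
  obtain m where m: "m > 0" "\<forall>\<^sub>F i in F. \<forall>x. m * norm x \<le> norm (G i x)"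
    using linear_injective_eventually[OF lin conv inj] by blast
  have "((\<lambda>i. norm (G i (w i) - G i w0) / m) \<longlongrightarrow> norm (G0 w0 - G0 w0) / m) F"
    using m(1) by (intro tendsto_intros rhs conv) auto
  then have *: "((\<lambda>i. norm (G i (w i) - G i w0) / m) \<longlongrightarrow> 0) F" by simp
  have "\<forall>\<^sub>F i in F. norm (w i - w0) \<le> norm (G i (w i) - G i w0) / m"
    using m(2) lin(1)
  proof eventually_elim
    case (elim i)
    show ?case using elim(1)[rule_format, of "w i - w0"] m(1) linear_diff[OF elim(2), of "w i" w0]
      by (simp add: field_simps)
  qed
  then have "((\<lambda>i. w i - w0) \<longlongrightarrow> 0) F" by (rule Lim_null_comparison[OF _ *])
  then show ?thesis by (simp add: LIM_zero_iff)
qed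


section \<open>Symmetric bilinear forms\<close>

definition sym_form :: "('e::real_vector \<Rightarrow> 'e \<Rightarrow> real) \<Rightarrow> bool" where
  "sym_form B \<longleftrightarrow> bilinear B \<and> (\<forall>x y. B x y = B y x)"

lemma sym_formD:
  assumes "sym_form B"
  shows "bilinear B" "B x y = B y x" "B (x + y) z = B x z + B y z" "B z (x + y) = B z x + B z y"
    "B (r *\<^sub>R x) z = r * B x z" "B z (r *\<^sub>R x) = r * B z x" "B 0 z = 0" "B z 0 = 0"
    "B (x - y) z = B x z - B y z" "B z (x - y) = B z x - B z y"
  using assms by (auto simp: sym_form_def bilinear_ladd bilinear_radd bilinear_lmul bilinear_rmul
      bilinear_lzero bilinear_rzero bilinear_lsub bilinear_rsub)

lemma sym_form_square:
  assumes "sym_form B"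
  shows "B (x + y) (x + y) = B x x + 2 * B x y + B y y" "B (r *\<^sub>R x) (r *\<^sub>R x) = r\<^sup>2 * B x x"
  using sym_formD[OF assms] by (simp_all add: power2_eq_square)

lemma sym_form_combine:
  assumes "sym_form B" "sym_form C" shows "sym_form (\<lambda>x y. r * B x y + s * C x y)"
  using sym_formD(2)[OF assms(1)] sym_formD(2)[OF assms(2)]
  unfolding sym_form_def bilinear_def
  by (auto intro!: linearI simp: sym_formD(3-6)[OF assms(1)] sym_formD(3-6)[OF assms(2)] algebra_simps)

lemma sym_form_minus: "sym_form B \<Longrightarrow> sym_form (\<lambda>x y. - B x y)"
  using sym_form_combine[of B B "-1" 0] by simp

lemma sym_form_tendsto_uniform:
  fixes B :: "'i \<Rightarrow> 'e::euclidean_space \<Rightarrow> 'e \<Rightarrow> real"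
  assumes B: "\<forall>\<^sub>F i in F. sym_form (B i)" "sym_form B0"
    and conv: "\<And>x y. ((\<lambda>i. B i x y) \<longlongrightarrow> B0 x y) F" and "e > 0"
  shows "\<forall>\<^sub>F i in F. \<forall>x. \<bar>B i x x - B0 x x\<bar> \<le> e * (norm x)\<^sup>2"
proof -
  define G where "G i x = (\<Sum>b\<in>Basis. B i x b *\<^sub>R b)" for i x
  define G0 where "G0 x = (\<Sum>b\<in>Basis. B0 x b *\<^sub>R b)" for x
  have lin: "linear (\<lambda>x. \<Sum>b\<in>Basis. C x b *\<^sub>R (b::'e))" if "sym_form C" for C :: "'e \<Rightarrow> 'e \<Rightarrow> real"
    by (intro linearI) (simp_all add: sym_formD[OF that] scaleR_add_left sum.distrib scaleR_sum_right)
  have inner: "(\<Sum>b\<in>Basis. C x b *\<^sub>R b) \<bullet> y = C x y" if "sym_form C" for C :: "'e \<Rightarrow> 'e \<Rightarrow> real" and x y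
  proof -
    have "linear (C x)" using that by (simp add: sym_form_def bilinear_def)
    from linear_basis_sum[OF this, of y] show ?thesis
      by (simp add: inner_sum_left inner_commute[of y] mult.commute)
  qed
  have "\<forall>\<^sub>F i in F. linear (G i)"
    using B(1) by eventually_elim (unfold G_def, rule lin)
  then have "\<forall>\<^sub>F i in F. \<forall>x. norm (G i x - G0 x) \<le> e * norm x"
    by (rule linear_tendsto_uniform) (unfold G0_def G_def, auto intro!: lin B(2) tendsto_intros conv \<open>e > 0\<close>)
  with B(1) show ?thesis
  proof eventually_elim
    case (elim i)
    show ?case
    proof
      fix x
      have "B i x x - B0 x x = (G i x - G0 x) \<bullet> x"
        unfolding inner_diff_left G_def G0_def using inner[OF elim(1)] inner[OF B(2)] by simp
      also have "\<bar>\<dots>\<bar> \<le> norm (G i x - G0 x) * norm x" by (rule Cauchy_Schwarz_ineq2)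
      also have "\<dots> \<le> e * norm x * norm x" using elim(2) by (intro mult_right_mono) auto
      finally show "\<bar>B i x x - B0 x x\<bar> \<le> e * (norm x)\<^sup>2" by (simp add: power2_eq_square mult.assoc)
    qed
  qed
qed

lemma sym_form_continuous: 
  fixes B :: "'e::euclidean_space \<Rightarrow> 'e \<Rightarrow> real"
  assumes "sym_form B" shows "continuous_on S (\<lambda>x. B x x)"
proof -
  have "((\<lambda>x. B x x) \<longlongrightarrow> B x x) (at x within S)" for x
    by (rule bilinear_apply_tendsto) (use assms in \<open>auto simp: sym_form_def\<close>)
  then show ?thesis by (simp add: continuous_on_def)
qed

lemma positive_definite_lower_bound:
  fixes B :: "'e::euclidean_space \<Rightarrow> 'e \<Rightarrow> real"
  assumes B: "sym_form B" and W: "subspace W" and pos: "\<And>x. x \<in> W \<Longrightarrow> x \<noteq> 0 \<Longrightarrow> B x x > 0"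
  shows "\<exists>m>0. \<forall>x\<in>W. m * (norm x)\<^sup>2 \<le> B x x"
proof (cases "W \<inter> sphere 0 1 = {}")
  case True
  have "x = 0" if "x \<in> W" for x
  proof (rule ccontr)
    assume "x \<noteq> 0"
    then have "(1 / norm x) *\<^sub>R x \<in> W \<inter> sphere 0 1"
      using that W by (auto simp: subspace_scale)
    then show False using True by blast
  qed
  then have "1 * (norm x)\<^sup>2 \<le> B x x" if "x \<in> W" for x using that sym_formD(7)[OF B, of 0] by fastforce
  then show ?thesis using zero_less_one by blast
next
  case False
  have "compact (W \<inter> sphere 0 1)" using closed_subspace[OF W] by (simp add: closed_Int_compact)
  then obtain z where z: "z \<in> W \<inter> sphere 0 1" "\<And>y. y \<in> W \<inter> sphere 0 1 \<Longrightarrow> B z z \<le> B y y"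
    using continuous_attains_inf[OF _ False sym_form_continuous[OF B]] by blast
  have "B z z * (norm x)\<^sup>2 \<le> B x x" if "x \<in> W" for x
  proof (cases "x = 0")
    case False
    define y where "y = (1 / norm x) *\<^sub>R x"
    have "y \<in> W \<inter> sphere 0 1" using that W False by (auto simp: subspace_scale y_def)
    then have "B z z \<le> B y y" by (rule z(2))
    also have "\<dots> = B x x / (norm x)\<^sup>2"
      unfolding y_def sym_form_square(2)[OF B] by (simp add: power_divide)
    finally show ?thesis using False by (simp add: field_simps)
  qed (simp add: sym_formD(7)[OF B])
  moreover have "z \<noteq> 0" using z(1) by auto
  then have "B z z > 0" using z(1) pos by blast
  ultimately show ?thesis by blast
qed

text \<open>Debreu's lemma: on the compact set of unit vectors where \<open>B1\<close> is not positive, \<open>B0\<close> is bounded away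
  from zero, so a large multiple of \<open>B0\<close> compensates for \<open>B1\<close>.\<close>
lemma debreu:
  fixes B0 B1 :: "'e::euclidean_space \<Rightarrow> 'e \<Rightarrow> real"
  assumes B: "sym_form B0" "sym_form B1" and W: "subspace W"
    and nonneg: "\<And>x. x \<in> W \<Longrightarrow> B0 x x \<ge> 0"
    and pos: "\<And>x. x \<in> W \<Longrightarrow> x \<noteq> 0 \<Longrightarrow> B0 x x = 0 \<Longrightarrow> B1 x x > 0"
  shows "\<exists>M>0. \<exists>m>0. \<forall>x\<in>W. m * (norm x)\<^sup>2 \<le> M * B0 x x + B1 x x"
proof -
  define S where "S = W \<inter> sphere 0 1"
  define K where "K = S \<inter> {x. B1 x x \<le> 0}"
  have S: "compact S" unfolding S_def using closed_subspace[OF W] by (simp add: closed_Int_compact)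
  have "closed {x. B1 x x \<le> 0}"
    by (rule closed_Collect_le) (rule sym_form_continuous[OF B(2)] continuous_on_const)+
  then have K: "compact K" unfolding K_def using S by (simp add: compact_Int_closed)
  obtain \<mu> where \<mu>: "\<mu> > 0" "\<And>x. x \<in> K \<Longrightarrow> \<mu> \<le> B0 x x"
  proof (cases "K = {}")
    case False
    obtain z where z: "z \<in> K" "\<And>y. y \<in> K \<Longrightarrow> B0 z z \<le> B0 y y"
      using continuous_attains_inf[OF K False sym_form_continuous[OF B(1)]] by blast
    have "B0 z z > 0" using z(1) pos[of z] nonneg[of z] unfolding K_def S_def by force
    then show ?thesis using that z by blast
  qed (use that[of 1] in auto)
  have "compact ((\<lambda>x. B1 x x) ` S)" using S compact_continuous_image sym_form_continuous[OF B(2)] by blast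
  then have "bounded ((\<lambda>x. B1 x x) ` S)" by (rule compact_imp_bounded)
  then obtain c where "c > 0" "\<forall>y\<in>(\<lambda>x. B1 x x) ` S. norm y \<le> c" unfolding bounded_pos by blast
  then have c: "c > 0" "\<And>x. x \<in> S \<Longrightarrow> \<bar>B1 x x\<bar> \<le> c" by auto
  define M where "M = (c + 1) / \<mu>"
  have M: "M > 0" using c \<mu> by (simp add: M_def)
  let ?C = "\<lambda>x y. M * B0 x y + 1 * B1 x y"
  have C: "sym_form ?C" by (rule sym_form_combine[OF B])
  have unit: "?C x x > 0" if "x \<in> S" for x
  proof (cases "x \<in> K")
    case True
    have "c + 1 = M * \<mu>" using \<mu>(1) by (simp add: M_def)
    also have "\<dots> \<le> M * B0 x x" using M \<mu>(2)[OF True] by (intro mult_left_mono) auto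
    finally show ?thesis using c(2)[OF that] by linarith
  next
    case False
    then have "B1 x x > 0" using that by (auto simp: K_def)
    moreover have "M * B0 x x \<ge> 0" using nonneg that M by (auto simp: S_def)
    ultimately show ?thesis by linarith
  qed
  have "?C x x > 0" if "x \<in> W" "x \<noteq> 0" for x
  proof -
    have "(1 / norm x) *\<^sub>R x \<in> S" using that W by (auto simp: subspace_scale S_def)
    from unit[OF this] have "0 < (1 / norm x)\<^sup>2 * ?C x x" using sym_form_square(2)[OF C, where r = "1 / norm x" and x = x] by linarith
    then show ?thesis using that(2) by (simp add: zero_less_mult_iff)
  qed
  from positive_definite_lower_bound[OF C W this] M show ?thesis by auto
qed

definition form_radical :: "('e \<Rightarrow> 'e \<Rightarrow> real) \<Rightarrow> 'e set" where
  "form_radical B = {x. \<forall>y. B x y = 0}"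

text \<open>The number of nonpositive eigenvalues. On a path that crosses the degenerate forms in the positive direction it
  is continuous from the left at a crossing, so that crossings add up over half-open intervals.\<close>
definition nsd_dim :: "('e::euclidean_space \<Rightarrow> 'e \<Rightarrow> real) \<Rightarrow> nat" where
  "nsd_dim B = Max {dim W | W. subspace W \<and> (\<forall>x\<in>W. B x x \<le> 0)}"

lemma subspace_form_radical: "sym_form B \<Longrightarrow> subspace (form_radical B)"
  by (auto simp: subspace_def form_radical_def sym_formD)

lemma dim_sum_le:
  fixes S T :: "'e::euclidean_space set"
  assumes "subspace S" "subspace T" "S \<inter> T = {0}"
  shows "dim {x + y |x y. x \<in> S \<and> y \<in> T} = dim S + dim T" "dim S + dim T \<le> DIM('e)"
proof -
  show "dim {x + y |x y. x \<in> S \<and> y \<in> T} = dim S + dim T"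
    using dim_sums_Int[OF assms(1,2)] assms(3) by simp
  then show "dim S + dim T \<le> DIM('e)" using dim_subset_UNIV[of "{x + y |x y. x \<in> S \<and> y \<in> T}"] by linarith
qed

text \<open>A subspace where the form is nonpositive meets one where it is positive definite only in \<open>0\<close>.\<close>
lemma nsd_dim_eqI:
  fixes B :: "'e::euclidean_space \<Rightarrow> 'e \<Rightarrow> real"
  assumes N: "subspace N" "\<And>x. x \<in> N \<Longrightarrow> B x x \<le> 0"
    and P: "subspace P" "\<And>x. x \<in> P \<Longrightarrow> x \<noteq> 0 \<Longrightarrow> B x x > 0"
    and dim: "dim N + dim P = DIM('e)"
  shows "nsd_dim B = dim N"
  unfolding nsd_dim_def
proof (rule Max_eqI)
  show le: "y \<le> dim N" if "y \<in> {dim W |W. subspace W \<and> (\<forall>x\<in>W. B x x \<le> 0)}" for y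
  proof -
    from that obtain W where W: "y = dim W" "subspace W" "\<And>x. x \<in> W \<Longrightarrow> B x x \<le> 0" by blast
    have "W \<inter> P = {0}" using W P subspace_0[OF W(2)] subspace_0[OF P(1)] by force
    then show ?thesis using dim_sum_le(2)[OF W(2) P(1)] dim W(1) by simp
  qed
  show "finite {dim W |W. subspace W \<and> (\<forall>x\<in>W. B x x \<le> 0)}"
    using le by (meson finite_nat_set_iff_bounded_le)
qed (use N in blast)

lemma form_radical_trivialI:
  fixes B :: "'e::euclidean_space \<Rightarrow> 'e \<Rightarrow> real"
  assumes B: "sym_form B"
    and N: "subspace N" "\<And>x. x \<in> N \<Longrightarrow> x \<noteq> 0 \<Longrightarrow> B x x < 0"
    and P: "subspace P" "\<And>x. x \<in> P \<Longrightarrow> x \<noteq> 0 \<Longrightarrow> B x x > 0"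
    and dim: "dim N + dim P = DIM('e)"
  shows "form_radical B = {0}"
proof -
  let ?R = "form_radical B" let ?W = "{x + y |x y. x \<in> N \<and> y \<in> ?R}"
  note R = subspace_form_radical[OF B]
  have nonpos: "B x x \<le> 0" if x: "x \<in> ?W" for x
  proof -
    obtain u v where u: "x = u + v" "u \<in> N" "v \<in> ?R" using x by blast
    have "B v u = 0" "B v v = 0" using u(3) by (auto simp: form_radical_def)
    then have "B x x = B u u" using sym_form_square(1)[OF B, of u v] sym_formD(2)[OF B, of u v] u(1) by simp
    then show ?thesis using N(2)[OF u(2)] sym_formD(7)[OF B, of 0] by (cases "u = 0") auto
  qed
  have W: "subspace ?W" using N(1) R by (rule subspace_sums)
  have "N \<inter> ?R = {0}" using N(2) subspace_0[OF N(1)] subspace_0[OF R] by (force simp: form_radical_def)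
  then have "dim ?W = dim N + dim ?R" by (rule dim_sum_le(1)[OF N(1) R])
  moreover have "?W \<inter> P = {0}" using nonpos P subspace_0[OF W] subspace_0[OF P(1)] by force
  then have "dim ?W + dim P \<le> DIM('e)" using dim_sum_le(2)[OF W P(1)] by blast
  ultimately have "dim ?R = 0" using dim by linarith
  then show ?thesis using subspace_0[OF R] by (auto simp: dim_eq_0)
qed

text \<open>Sylvester's law of inertia, by maximality: orthogonally to a negative definite subspace of maximal
  dimension the form is nonnegative, and there its isotropic vectors form the radical.\<close>
lemma signature_decomposition:
  fixes B :: "'e::euclidean_space \<Rightarrow> 'e \<Rightarrow> real"
  assumes B: "sym_form B"
  obtains N P where "subspace N" "\<And>x. x \<in> N \<Longrightarrow> x \<noteq> 0 \<Longrightarrow> B x x < 0"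
    "subspace P" "\<And>x. x \<in> P \<Longrightarrow> x \<noteq> 0 \<Longrightarrow> B x x > 0"
    "dim N + dim (form_radical B) + dim P = DIM('e)"
proof -
  define neg where "neg W \<longleftrightarrow> subspace W \<and> (\<forall>x\<in>W. x \<noteq> 0 \<longrightarrow> B x x < 0)" for W
  have "neg {0}" by (auto simp: neg_def)
  moreover have "\<forall>W. neg W \<longrightarrow> dim W < Suc DIM('e)" by (simp add: dim_subset_UNIV less_Suc_eq_le)
  ultimately obtain N where N: "neg N" "\<And>W. neg W \<Longrightarrow> dim W \<le> dim N"
    using ex_has_greatest_nat[of neg "{0}" dim] by metis
  then have sN: "subspace N" by (simp add: neg_def)
  define h where "h x = (\<Sum>b\<in>Basis. B x b *\<^sub>R b)" for x
  have h: "linear h"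
    unfolding h_def by (intro linearI) (simp_all add: sym_formD[OF B] scaleR_add_left sum.distrib scaleR_sum_right)
  have hB: "h x \<bullet> y = B x y" for x y
  proof -
    have "linear (B x)" using B by (simp add: sym_form_def bilinear_def)
    from linear_basis_sum[OF this, of y] show ?thesis
      by (simp add: h_def inner_sum_left inner_commute[of y] mult.commute)
  qed
  define Q where "Q = {y \<in> UNIV. \<forall>x \<in> h ` N. orthogonal x y}"
  have Q: "y \<in> Q \<longleftrightarrow> (\<forall>x\<in>N. B x y = 0)" for y by (auto simp: Q_def orthogonal_def hB)
  have sQ: "subspace Q" by (auto simp: subspace_def Q sym_formD[OF B])
  have "dim Q + dim (h ` N) = DIM('e)"
    unfolding Q_def using dim_subspace_orthogonal_to_vectors[of "h ` N" UNIV] linear_subspace_image[OF h sN] by simp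
  moreover have "dim (h ` N) \<le> dim N" by (rule dim_image_le[OF h])
  moreover have NQ: "N \<inter> Q = {0}"
    using N(1) subspace_0[OF sN] subspace_0[OF sQ] by (force simp: neg_def Q)
  ultimately have dimQ: "dim N + dim Q = DIM('e)" using dim_sum_le(2)[OF sN sQ NQ] by linarith
  have full: "\<exists>x\<in>N. \<exists>y\<in>Q. z = x + y" for z
  proof -
    have "dim {x + y |x y. x \<in> N \<and> y \<in> Q} = DIM('e)" using dim_sum_le(1)[OF sN sQ NQ] dimQ by simp
    then have "span {x + y |x y. x \<in> N \<and> y \<in> Q} = UNIV" using dim_eq_full by blast
    then show ?thesis using span_eq_iff[THEN iffD2, OF subspace_sums[OF sN sQ]] by blast
  qed
  have nonneg: "B q q \<ge> 0" if q: "q \<in> Q" for q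
  proof (rule ccontr)
    assume neg_q: "\<not> B q q \<ge> 0"
    then have q0: "q \<noteq> 0" using sym_formD(7)[OF B] by auto
    have sq: "span {q} \<subseteq> Q" using q sQ by (simp add: span_minimal)
    have "N \<inter> span {q} = {0}" using NQ sq span_zero subspace_0[OF sN] by blast
    then have "dim {x + y |x y. x \<in> N \<and> y \<in> span {q}} = dim N + dim (span {q})"
      by (rule dim_sum_le(1)[OF sN subspace_span])
    moreover have "dim (span {q}) = 1" using q0 by simp
    moreover have "neg {x + y |x y. x \<in> N \<and> y \<in> span {q}}"
      unfolding neg_def
    proof (intro conjI ballI impI)
      show "subspace {x + y |x y. x \<in> N \<and> y \<in> span {q}}" by (rule subspace_sums[OF sN subspace_span])
      fix z assume *: "z \<in> {x + y |x y. x \<in> N \<and> y \<in> span {q}}" "z \<noteq> 0"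
      then obtain x r where "z = x + r *\<^sub>R q" "x \<in> N" by (auto simp: span_singleton)
      then have z: "z = x + r *\<^sub>R q" "x \<in> N" "x \<noteq> 0 \<or> r \<noteq> 0" using *(2) by auto
      have "B z z = B x x + 2 * (r * B x q) + r\<^sup>2 * B q q"
        unfolding z(1) sym_form_square[OF B] by (simp add: sym_formD[OF B])
      also have "\<dots> = B x x + r\<^sup>2 * B q q" using q z(2) by (simp add: Q)
      also have "\<dots> < 0"
        using z N(1) neg_q sym_formD(7)[OF B] unfolding neg_def
        by (cases "x = 0") (auto simp: mult_less_0_iff add_neg_nonpos mult_nonneg_nonpos)
      finally show "B z z < 0" .
    qed
    ultimately show False using N(2) by fastforce
  qed
  have rad: "q \<in> form_radical B" if q: "q \<in> Q" "B q q = 0" for q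
  proof -
    have "B q y = 0" if y: "y \<in> Q" for y
    proof (rule ccontr)
      assume ne: "B q y \<noteq> 0"
      \<comment> \<open>this multiple of the isotropic vector \<open>q\<close> makes the value at \<open>s q + y\<close> equal to \<open>-1\<close>\<close>
      define s where "s = - (B y y + 1) / (2 * B q y)"
      have "B (s *\<^sub>R q + y) (s *\<^sub>R q + y) = 2 * (s * B q y) + B y y"
        unfolding sym_form_square[OF B] by (simp add: sym_formD[OF B] q)
      also have "2 * (s * B q y) = - (B y y + 1)" unfolding s_def using ne by (simp add: field_simps)
      finally have "B (s *\<^sub>R q + y) (s *\<^sub>R q + y) = -1" by simp
      moreover have "s *\<^sub>R q + y \<in> Q" using sQ q y by (simp add: subspace_add subspace_scale)
      ultimately show False using nonneg by force
    qed
    moreover have "B q x = 0" if "x \<in> N" for x using q(1) that sym_formD(2)[OF B] by (metis Q)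
    ultimately have "B q z = 0" for z using full[of z] sym_formD(4)[OF B] by force
    then show ?thesis by (simp add: form_radical_def)
  qed
  have radQ: "form_radical B \<subseteq> Q" using sym_formD(2)[OF B] by (auto simp: form_radical_def Q)
  define P where "P = {y \<in> Q. \<forall>x \<in> form_radical B. orthogonal x y}"
  have sP: "subspace P" using sQ by (auto simp: P_def subspace_def orthogonal_clauses)
  have "dim P + dim (form_radical B) = dim Q"
    unfolding P_def using dim_subspace_orthogonal_to_vectors[OF subspace_form_radical[OF B] sQ radQ] .
  moreover have "B x x > 0" if "x \<in> P" "x \<noteq> 0" for x
    using that nonneg[of x] rad[of x] by (force simp: P_def orthogonal_self)
  ultimately show thesis using that[of N P] sN sP N(1) dimQ by (auto simp: neg_def)
qed

text \<open>The two subspaces on which the limit is negative and positive definite serve for the nearby forms as well.\<close>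
lemma nondegenerate_form_stable:
  fixes B :: "'i \<Rightarrow> 'e::euclidean_space \<Rightarrow> 'e \<Rightarrow> real"
  assumes B: "\<forall>\<^sub>F i in F. sym_form (B i)" "sym_form B0"
    and conv: "\<And>x y. ((\<lambda>i. B i x y) \<longlongrightarrow> B0 x y) F" and rad: "form_radical B0 = {0}"
  shows "\<forall>\<^sub>F i in F. form_radical (B i) = {0} \<and> nsd_dim (B i) = nsd_dim B0"
proof -
  obtain N P where N: "subspace N" "\<And>x. x \<in> N \<Longrightarrow> x \<noteq> 0 \<Longrightarrow> B0 x x < 0"
    and P: "subspace P" "\<And>x. x \<in> P \<Longrightarrow> x \<noteq> 0 \<Longrightarrow> B0 x x > 0" and d: "dim N + dim P = DIM('e)"
    using signature_decomposition[OF B(2)] rad by (auto simp: dim_eq_0)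
  obtain m where m: "m > 0" "\<And>x. x \<in> P \<Longrightarrow> m * (norm x)\<^sup>2 \<le> B0 x x"
    using positive_definite_lower_bound[OF B(2) P] by blast
  obtain n where n: "n > 0" "\<And>x. x \<in> N \<Longrightarrow> n * (norm x)\<^sup>2 \<le> - B0 x x"
    using positive_definite_lower_bound[OF sym_form_minus[OF B(2)] N(1)] N(2) by force
  have N0: "B0 x x \<le> 0" if "x \<in> N" for x using that N(2)[of x] sym_formD(7)[OF B(2)] by force
  define e where "e = min m n / 2"
  have e: "e > 0" "e < m" "e < n" using m n by (auto simp: e_def)
  from sym_form_tendsto_uniform[OF B conv e(1)] B(1) show ?thesis
  proof eventually_elim
    case (elim i)
    have N': "B i x x < 0" if "x \<in> N" "x \<noteq> 0" for x
    proof -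
      have "e * (norm x)\<^sup>2 < n * (norm x)\<^sup>2" using e that by (intro mult_strict_right_mono) auto
      then show ?thesis using elim(1)[rule_format, of x] n(2)[OF that(1)] by linarith
    qed
    have P': "B i x x > 0" if "x \<in> P" "x \<noteq> 0" for x
    proof -
      have "e * (norm x)\<^sup>2 < m * (norm x)\<^sup>2" using e that by (intro mult_strict_right_mono) auto
      then show ?thesis using elim(1)[rule_format, of x] m(2)[OF that(1)] by linarith
    qed
    have N'': "B i x x \<le> 0" if "x \<in> N" for x using N'[OF that] sym_formD(7)[OF elim(2)] by (cases "x = 0") force+
    have "form_radical (B i) = {0}" by (rule form_radical_trivialI[OF elim(2) N(1) N' P(1) P' d])
    moreover have "nsd_dim (B i) = dim N" by (rule nsd_dim_eqI[OF N(1) N'' P(1) P' d])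
    moreover have "nsd_dim B0 = dim N" by (rule nsd_dim_eqI[OF N(1) N0 P d])
    ultimately show ?case by simp
  qed
qed

section \<open>Counting the crossings of a path of symmetric forms\<close>

lemma sym_form_limit:
  fixes B :: "'i \<Rightarrow> 'e::real_vector \<Rightarrow> 'e \<Rightarrow> real"
  assumes F: "F \<noteq> bot" and B: "\<forall>\<^sub>F i in F. sym_form (B i)" and lim: "\<And>x y. ((\<lambda>i. B i x y) \<longlongrightarrow> B0 x y) F"
  shows "sym_form B0"
proof -
  have unique: "B0 x y = r" if "((\<lambda>i. h (B i)) \<longlongrightarrow> r) F" "\<And>C. sym_form C \<Longrightarrow> h C = C x y" for x y r h
  proof -
    have "\<forall>\<^sub>F i in F. h (B i) = B i x y" using B by eventually_elim (rule that(2))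
    then have "((\<lambda>i. B i x y) \<longlongrightarrow> r) F" by (rule Lim_transform_eventually[OF that(1)])
    then show ?thesis using tendsto_unique[OF F lim] by blast
  qed
  have sym: "B0 x y = B0 y x" for x y
    by (rule unique[where h = "\<lambda>C. C y x"]) (rule lim, rule sym_formD(2))
  have add: "B0 (x + y) z = B0 x z + B0 y z" for x y z
    by (rule unique[where h = "\<lambda>C. C x z + C y z"]) (intro tendsto_intros lim, simp add: sym_formD(3))
  have scale: "B0 (r *\<^sub>R x) z = r * B0 x z" for r x z
    by (rule unique[where h = "\<lambda>C. r * C x z"]) (intro tendsto_intros lim, simp add: sym_formD(5))
  show ?thesis
    unfolding sym_form_def bilinear_def
    using add scale sym by (auto intro!: linearI)
qed

text \<open>On the radical the form changes to first order, so it is positive there just after \<open>t0\<close> and negative just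
  before. By Debreu's lemma this persists on the sum of the radical with a subspace where the old form is positive,
  respectively negative, definite.\<close>
lemma form_crossing:
  fixes B :: "real \<Rightarrow> 'e::euclidean_space \<Rightarrow> 'e \<Rightarrow> real"
  assumes B: "\<And>t. t \<in> I \<Longrightarrow> sym_form (B t)" and t0: "t0 \<in> I"
    and deriv: "\<And>x y. ((\<lambda>t. B t x y) has_real_derivative B' x y) (at t0 within I)"
    and pos: "\<And>x. x \<in> form_radical (B t0) \<Longrightarrow> x \<noteq> 0 \<Longrightarrow> B' x x > 0"
  shows "\<forall>\<^sub>F t in at t0 within I. form_radical (B t) = {0} \<and>
    nsd_dim (B t) + (if t0 < t then dim (form_radical (B t0)) else 0) = nsd_dim (B t0)"
proof (cases "at t0 within I = bot")
  case False
  note B0 = B[OF t0]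
  define D where "D t x y = (B t x y - B t0 x y) / (t - t0)" for t x y
  have symD: "sym_form (D t)" if "t \<in> I" for t
    using sym_form_combine[OF B[OF that] B0, of "1 / (t - t0)" "- (1 / (t - t0))"]
    by (simp add: D_def[abs_def] diff_divide_distrib)
  have limD: "((\<lambda>t. D t x y) \<longlongrightarrow> B' x y) (at t0 within I)" for x y
    using deriv[of x y] unfolding D_def has_field_derivative_iff .
  have evD: "\<forall>\<^sub>F t in at t0 within I. sym_form (D t)"
    unfolding eventually_at_filter using symD by (auto intro: always_eventually)
  have B': "sym_form B'" by (rule sym_form_limit[OF False evD limD])
  let ?R = "form_radical (B t0)"
  obtain N P where N: "subspace N" "\<And>x. x \<in> N \<Longrightarrow> x \<noteq> 0 \<Longrightarrow> B t0 x x < 0"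
    and P: "subspace P" "\<And>x. x \<in> P \<Longrightarrow> x \<noteq> 0 \<Longrightarrow> B t0 x x > 0" and d: "dim N + dim ?R + dim P = DIM('e)"
    using signature_decomposition[OF B0] by blast
  note R = subspace_form_radical[OF B0]
  let ?N = "{x + y |x y. x \<in> N \<and> y \<in> ?R}" and ?P = "{x + y |x y. x \<in> P \<and> y \<in> ?R}"
  have sum_value: "B t0 (x + y) (x + y) = B t0 x x" if "y \<in> ?R" for x y
    using that sym_form_square(1)[OF B0] sym_formD(2)[OF B0] by (auto simp: form_radical_def)
  have sN: "subspace ?N" and sP: "subspace ?P" using N(1) P(1) R by (auto intro: subspace_sums)
  have "N \<inter> ?R = {0}" "P \<inter> ?R = {0}"
    using N P subspace_0[OF N(1)] subspace_0[OF P(1)] subspace_0[OF R] by (force simp: form_radical_def)+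
  then have dN: "dim ?N = dim N + dim ?R" and dP: "dim ?P = dim P + dim ?R"
    using dim_sum_le(1) N(1) P(1) R by blast+
  have N0: "B t0 x x \<le> 0" if "x \<in> N" for x using that N(2)[of x] sym_formD(7)[OF B0] by force
  have P0: "B t0 x x \<ge> 0" if "x \<in> P" for x using that P(2)[of x] sym_formD(7)[OF B0] by force
  have nonpos: "B t0 x x \<le> 0" if "x \<in> ?N" for x using that sum_value N0 by auto
  have nonneg: "B t0 x x \<ge> 0" if "x \<in> ?P" for x using that sum_value P0 by auto
  have isoN: "x \<in> ?R" if x: "x \<in> ?N" "B t0 x x = 0" for x
  proof -
    obtain u y where u: "x = u + y" "u \<in> N" "y \<in> ?R" using x(1) by blast
    then have "u = 0" using sum_value[OF u(3), of u] x(2) N(2)[of u] by force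
    then show ?thesis using u by simp
  qed
  have isoP: "x \<in> ?R" if x: "x \<in> ?P" "B t0 x x = 0" for x
  proof -
    obtain u y where u: "x = u + y" "u \<in> P" "y \<in> ?R" using x(1) by blast
    then have "u = 0" using sum_value[OF u(3), of u] x(2) P(2)[of u] by force
    then show ?thesis using u by simp
  qed
  have nn: "- B t0 x x \<ge> 0" if "x \<in> ?N" for x using nonpos[OF that] by simp
  have pp: "B' x x > 0" if "x \<in> ?N" "x \<noteq> 0" "- B t0 x x = 0" for x using pos[OF isoN] that by simp
  have ppP: "B' x x > 0" if "x \<in> ?P" "x \<noteq> 0" "B t0 x x = 0" for x using pos[OF isoP] that by simp
  have "\<exists>M>0. \<exists>m>0. \<forall>x\<in>?P. m * (norm x)\<^sup>2 \<le> M * B t0 x x + B' x x"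
    by (rule debreu[OF B0 B' sP nonneg ppP])
  then obtain MP mP where MP: "MP > 0" "mP > 0"
    and MP': "\<forall>x\<in>?P. mP * (norm x)\<^sup>2 \<le> MP * B t0 x x + B' x x"
    by (elim exE conjE) (rule that)
  have "\<exists>M>0. \<exists>m>0. \<forall>x\<in>?N. m * (norm x)\<^sup>2 \<le> M * (- B t0 x x) + B' x x"
    by (rule debreu[where ?B0.0 = "\<lambda>x y. - B t0 x y", OF sym_form_minus[OF B0] B' sN nn pp])
  then obtain MN mN where MN: "MN > 0" "mN > 0"
    and MN': "\<forall>x\<in>?N. mN * (norm x)\<^sup>2 \<le> MN * (- B t0 x x) + B' x x"
    by (elim exE conjE) (rule that)
  define e where "e = min mP mN / 2"
  have e: "e > 0" "e < mP" "e < mN" using MP MN by (auto simp: e_def)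
  have "\<forall>\<^sub>F t in at t0 within I. \<forall>x. \<bar>D t x x - B' x x\<bar> \<le> e * (norm x)\<^sup>2"
    by (rule sym_form_tendsto_uniform[OF evD B' limD e(1)])
  moreover have "\<forall>\<^sub>F t in at t0 within I. t \<in> I \<and> t \<noteq> t0" by (simp add: eventually_at_filter)
  \<comment> \<open>for such \<open>t\<close> the coefficient of \<open>B t0\<close> in Debreu's lemma, multiplied by \<open>\<bar>t - t0\<bar>\<close>, is less than \<open>1\<close>\<close>
  moreover have "\<forall>\<^sub>F t in at t0 within I. \<bar>t - t0\<bar> < min (1 / MP) (1 / MN)"
    unfolding eventually_at using MP(1) MN(1) by (intro exI[of _ "min (1 / MP) (1 / MN)"]) (auto simp: dist_real_def)
  moreover have N': "\<forall>\<^sub>F t in at t0 within I. \<forall>x\<in>N. x \<noteq> 0 \<longrightarrow> B t x x < 0"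
    and P': "\<forall>\<^sub>F t in at t0 within I. \<forall>x\<in>P. x \<noteq> 0 \<longrightarrow> B t x x > 0"
  proof -
    obtain p where p: "p > 0" "\<And>x. x \<in> P \<Longrightarrow> p * (norm x)\<^sup>2 \<le> B t0 x x"
      using positive_definite_lower_bound[OF B0 P] by blast
    obtain n where n: "n > 0" "\<And>x. x \<in> N \<Longrightarrow> n * (norm x)\<^sup>2 \<le> - B t0 x x"
      using positive_definite_lower_bound[OF sym_form_minus[OF B0] N(1)] N(2) by force
    have ev: "\<forall>\<^sub>F t in at t0 within I. sym_form (B t)"
      unfolding eventually_at_filter using B by (auto intro: always_eventually)
    have conv: "((\<lambda>t. B t x y) \<longlongrightarrow> B t0 x y) (at t0 within I)" for x y
      using has_field_derivative_imp_has_derivative[OF deriv, THEN has_derivative_continuous] continuous_within by blast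
    define q where "q = min p n / 2"
    have q: "q > 0" "q < p" "q < n" using p n by (auto simp: q_def)
    have *: "\<forall>\<^sub>F t in at t0 within I. \<forall>x. \<bar>B t x x - B t0 x x\<bar> \<le> q * (norm x)\<^sup>2"
      by (rule sym_form_tendsto_uniform[OF ev B0 conv q(1)])
    show "\<forall>\<^sub>F t in at t0 within I. \<forall>x\<in>N. x \<noteq> 0 \<longrightarrow> B t x x < 0"
      using *
    proof eventually_elim
      case (elim t)
      have "B t x x < 0" if "x \<in> N" "x \<noteq> 0" for x
      proof -
        have "q * (norm x)\<^sup>2 < n * (norm x)\<^sup>2" using q that by (intro mult_strict_right_mono) auto
        then show ?thesis using elim[rule_format, of x] n(2)[OF that(1)] by linarith
      qed
      then show ?case by blast
    qed
    show "\<forall>\<^sub>F t in at t0 within I. \<forall>x\<in>P. x \<noteq> 0 \<longrightarrow> B t x x > 0"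
      using *
    proof eventually_elim
      case (elim t)
      have "B t x x > 0" if "x \<in> P" "x \<noteq> 0" for x
      proof -
        have "q * (norm x)\<^sup>2 < p * (norm x)\<^sup>2" using q that by (intro mult_strict_right_mono) auto
        then show ?thesis using elim[rule_format, of x] p(2)[OF that(1)] by linarith
      qed
      then show ?case by blast
    qed
  qed
  ultimately show ?thesis
  proof eventually_elim
    case (elim t)
    have tI: "t \<in> I" "t \<noteq> t0" using elim by auto
    note Bt = B[OF tI(1)]
    have n0: "nsd_dim (B t0) = dim N + dim ?R"
      using nsd_dim_eqI[where B = "B t0", OF sN nonpos P] dN d by simp
    have expand: "B t x x = B t0 x x + (t - t0) * D t x x" for x using tI by (simp add: D_def)
    show ?case
    proof (cases "t0 < t")
      case True
      have posP: "B t x x > 0" if x: "x \<in> ?P" "x \<noteq> 0" for x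
      proof -
        have "e * (norm x)\<^sup>2 < mP * (norm x)\<^sup>2" using e x by (intro mult_strict_right_mono) auto
        then have "0 < MP * B t0 x x + D t x x"
          using MP'[rule_format, OF x(1)] elim(1)[rule_format, of x] by linarith
        then have "0 < (t - t0) * (MP * B t0 x x + D t x x)" using True by simp
        also have "\<dots> = ((t - t0) * MP) * B t0 x x + (t - t0) * D t x x" by (simp add: algebra_simps)
        also have "\<dots> \<le> 1 * B t0 x x + (t - t0) * D t x x"
          using elim(3) MP(1) nonneg[OF x(1)] True
          by (intro add_right_mono mult_right_mono) (auto simp: field_simps)
        finally show ?thesis using expand by simp
      qed
      have negN: "B t x x < 0" if "x \<in> N" "x \<noteq> 0" for x using elim that by blast
      then have negN': "B t x x \<le> 0" if "x \<in> N" for x using that sym_formD(7)[OF Bt] by (cases "x = 0") force+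
      have dd: "dim N + dim ?P = DIM('e)" using dP d by simp
      show ?thesis
        using form_radical_trivialI[OF Bt N(1) negN sP posP dd] nsd_dim_eqI[where B = "B t", OF N(1) negN' sP posP dd] n0 True by simp
    next
      case False
      then have less: "t < t0" using tI by simp
      have negN: "B t x x < 0" if x: "x \<in> ?N" "x \<noteq> 0" for x
      proof -
        have "e * (norm x)\<^sup>2 < mN * (norm x)\<^sup>2" using e x by (intro mult_strict_right_mono) auto
        then have "0 < MN * (- B t0 x x) + D t x x"
          using MN'[rule_format, OF x(1)] elim(1)[rule_format, of x] by linarith
        then have "0 < (t0 - t) * (MN * (- B t0 x x) + D t x x)" using less by simp
        also have "\<dots> = ((t0 - t) * MN) * (- B t0 x x) + (t0 - t) * D t x x" by (simp add: algebra_simps)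
        also have "\<dots> \<le> 1 * (- B t0 x x) + (t0 - t) * D t x x"
          using elim(3) MN(1) nonpos[OF x(1)] less
          by (intro add_right_mono mult_right_mono) (auto simp: field_simps)
        finally show ?thesis using expand[of x] by (simp add: algebra_simps)
      qed
      then have negN': "B t x x \<le> 0" if "x \<in> ?N" for x using that sym_formD(7)[OF Bt] by (cases "x = 0") force+
      have posP: "B t x x > 0" if "x \<in> P" "x \<noteq> 0" for x using elim that by blast
      have dd: "dim ?N + dim P = DIM('e)" using dN d by simp
      show ?thesis
        using form_radical_trivialI[OF Bt sN negN P(1) posP dd] nsd_dim_eqI[where B = "B t", OF sN negN' P(1) posP dd] n0 dN False by simp
    qed
  qed
qed simp

lemma eventually_at_within_ballE:
  fixes t0 :: real
  assumes "\<forall>\<^sub>F t in at t0 within I. Q t"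
  obtains d where "d > 0" "\<And>t. t \<in> I \<Longrightarrow> t \<noteq> t0 \<Longrightarrow> \<bar>t - t0\<bar> < d \<Longrightarrow> Q t"
  using assms unfolding eventually_at dist_real_def by blast

text \<open>The formula is additive over adjacent intervals and holds on short ones by \<open>form_crossing\<close>, so it holds by
  bisection.\<close>
lemma crossing_count:
  fixes B :: "real \<Rightarrow> 'e::euclidean_space \<Rightarrow> 'e \<Rightarrow> real"
  assumes cd: "c \<le> d" and B: "\<And>t. t \<in> {c..d} \<Longrightarrow> sym_form (B t)"
    and deriv: "\<And>t x y. t \<in> {c..d} \<Longrightarrow> ((\<lambda>t. B t x y) has_real_derivative B' t x y) (at t within {c..d})"
    and pos: "\<And>t x. t \<in> {c..d} \<Longrightarrow> x \<in> form_radical (B t) \<Longrightarrow> x \<noteq> 0 \<Longrightarrow> B' t x x > 0"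
  shows "finite {t \<in> {c..<d}. form_radical (B t) \<noteq> {0}}"
    "(\<Sum>t | t \<in> {c..<d} \<and> form_radical (B t) \<noteq> {0}. dim (form_radical (B t))) + nsd_dim (B d) = nsd_dim (B c)"
proof -
  define Z where "Z p q = {t \<in> {p..<q}. form_radical (B t) \<noteq> {0}}" for p q
  define \<Phi> where "\<Phi> p q \<longleftrightarrow> (c \<le> p \<longrightarrow> p \<le> q \<longrightarrow> q \<le> d \<longrightarrow> finite (Z p q) \<and>
    (\<Sum>t\<in>Z p q. dim (form_radical (B t))) + nsd_dim (B q) = nsd_dim (B p))" for p q
  have "\<Phi> c d"
  proof (rule Bolzano[OF cd])
    fix p q r assume *: "\<Phi> p q" "\<Phi> q r" "p \<le> q" "q \<le> r"
    have Z: "Z p r = Z p q \<union> Z q r" "Z p q \<inter> Z q r = {}" using *(3,4) by (auto simp: Z_def)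
    show "\<Phi> p r"
      unfolding \<Phi>_def
    proof (intro impI)
      assume "c \<le> p" "p \<le> r" "r \<le> d"
      then have 1: "finite (Z p q)" "(\<Sum>t\<in>Z p q. dim (form_radical (B t))) + nsd_dim (B q) = nsd_dim (B p)"
        and 2: "finite (Z q r)" "(\<Sum>t\<in>Z q r. dim (form_radical (B t))) + nsd_dim (B r) = nsd_dim (B q)"
        using * by (auto simp: \<Phi>_def)
      show "finite (Z p r) \<and> (\<Sum>t\<in>Z p r. dim (form_radical (B t))) + nsd_dim (B r) = nsd_dim (B p)"
        unfolding Z(1) sum.union_disjoint[OF 1(1) 2(1) Z(2)] using 1 2 by simp
    qed
  next
    fix x assume x: "c \<le> x" "x \<le> d"
    then have xI: "x \<in> {c..d}" by simp
    have cr: "\<forall>\<^sub>F t in at x within {c..d}. form_radical (B t) = {0} \<and>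
      nsd_dim (B t) + (if x < t then dim (form_radical (B x)) else 0) = nsd_dim (B x)"
      by (rule form_crossing[where B' = "B' x"]) (use B xI deriv[OF xI] pos[OF xI] in auto)
    obtain \<delta> where \<delta>: "\<delta> > 0" "\<And>t. t \<in> {c..d} \<Longrightarrow> t \<noteq> x \<Longrightarrow> \<bar>t - x\<bar> < \<delta> \<Longrightarrow> form_radical (B t) = {0} \<and>
      nsd_dim (B t) + (if x < t then dim (form_radical (B x)) else 0) = nsd_dim (B x)"
      by (rule eventually_at_within_ballE[OF cr]) (rule that, assumption, blast)
    have "\<Phi> p q" if pq: "p \<le> x" "x \<le> q" "q - p < \<delta>" for p q
      unfolding \<Phi>_def
    proof (intro impI)
      assume c: "c \<le> p" "p \<le> q" "q \<le> d"
      have p: "nsd_dim (B p) = nsd_dim (B x)" using \<delta>(2)[of p] pq c by (cases "p = x") auto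
      have off: "form_radical (B t) = {0}" if "t \<in> {p..q}" "t \<noteq> x" for t using \<delta>(2)[of t] that pq c by auto
      show "finite (Z p q) \<and> (\<Sum>t\<in>Z p q. dim (form_radical (B t))) + nsd_dim (B q) = nsd_dim (B p)"
      proof (cases "x < q")
        case True
        then have q: "nsd_dim (B q) + dim (form_radical (B x)) = nsd_dim (B x)" using \<delta>(2)[of q] pq c by auto
        have "Z p q = (if form_radical (B x) = {0} then {} else {x})" using off True pq by (force simp: Z_def)
        then show ?thesis using p q by auto
      next
        case False
        then have q: "q = x" using pq by simp
        have "Z p q = {}" using off q by (force simp: Z_def)
        then show ?thesis using p q by simp
      qed
    qed
    then show "\<exists>\<delta>>0. \<forall>p q. p \<le> x \<and> x \<le> q \<and> q - p < \<delta> \<longrightarrow> \<Phi> p q" using \<delta>(1) by blast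
  qed
  then show "finite {t \<in> {c..<d}. form_radical (B t) \<noteq> {0}}"
    "(\<Sum>t | t \<in> {c..<d} \<and> form_radical (B t) \<noteq> {0}. dim (form_radical (B t))) + nsd_dim (B d) = nsd_dim (B c)"
    using cd by (simp_all add: \<Phi>_def Z_def)
qed

text \<open>This makes the form \<open>g (U x) (W y + r U y)\<close> detect the kernel of \<open>U\<close>. If \<open>W x + n U x = 0\<close> for unit vectors
  \<open>x\<close> and arbitrarily large \<open>n\<close>, then in the limit \<open>x\<close> is in the kernel of \<open>U\<close> and \<open>W x\<close> is isotropic.\<close>
lemma exists_shift_injective:
  fixes U W :: "'e::euclidean_space \<Rightarrow> 'f::euclidean_space"
  assumes U: "linear U" and W: "linear W" and g: "sym_form g"
    and sym: "\<And>x y. g (U x) (W y) = g (U y) (W x)"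
    and pos: "\<And>x. U x = 0 \<Longrightarrow> x \<noteq> 0 \<Longrightarrow> g (W x) (W x) > 0"
  shows "\<exists>r. \<forall>x. W x + r *\<^sub>R U x = 0 \<longrightarrow> x = 0"
proof (rule ccontr)
  assume "\<not> ?thesis"
  then have "\<forall>n. \<exists>x. W x + real (Suc n) *\<^sub>R U x = 0 \<and> x \<noteq> 0" by blast
  then obtain y where y: "\<And>n. W (y n) + real (Suc n) *\<^sub>R U (y n) = 0" "\<And>n. y n \<noteq> 0" by metis
  define x where "x n = (1 / norm (y n)) *\<^sub>R y n" for n
  have x: "W (x n) + real (Suc n) *\<^sub>R U (x n) = 0" "norm (x n) = 1" for n
  proof -
    have "W (x n) + real (Suc n) *\<^sub>R U (x n) = (1 / norm (y n)) *\<^sub>R (W (y n) + real (Suc n) *\<^sub>R U (y n))"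
      unfolding x_def linear_scale[OF U] linear_scale[OF W] by (simp add: scaleR_add_right)
    then show "W (x n) + real (Suc n) *\<^sub>R U (x n) = 0" using y by simp
    show "norm (x n) = 1" using y(2) by (simp add: x_def)
  qed
  have "\<forall>n. x n \<in> sphere 0 1" using x by simp
  then obtain l s where l: "l \<in> sphere 0 1" "strict_mono (s :: nat \<Rightarrow> nat)" "(x \<circ> s) \<longlonglongrightarrow> l"
    using compact_sphere[of 0 1, unfolded compact_def] by blast
  have xs: "(\<lambda>n. x (s n)) \<longlonglongrightarrow> l" using l(3) by (simp add: comp_def)
  have lU: "(\<lambda>n. U (x (s n))) \<longlonglongrightarrow> U l" and lW: "(\<lambda>n. W (x (s n))) \<longlonglongrightarrow> W l"
    by (rule linear_apply_tendsto[OF _ _ _ xs]; use U W in auto)+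
  have "(\<lambda>n. - (inverse (real (Suc (s n))) *\<^sub>R W (x (s n)))) \<longlonglongrightarrow> - (0 *\<^sub>R W l)"
    using LIMSEQ_subseq_LIMSEQ[OF LIMSEQ_inverse_real_of_nat l(2)] lW
    by (intro tendsto_intros) (auto simp: comp_def)
  moreover have "- (inverse (real (Suc (s n))) *\<^sub>R W (x (s n))) = U (x (s n))" for n
  proof -
    have "W (x (s n)) = - (real (Suc (s n)) *\<^sub>R U (x (s n)))" using x(1)[of "s n"] by (simp add: eq_neg_iff_add_eq_0)
    then show ?thesis by simp
  qed
  ultimately have Ul: "U l = 0" using LIMSEQ_unique[OF lU] by simp
  have neg: "g (- (r *\<^sub>R u)) w = - (r * g u w)" for r u w using sym_formD(5)[OF g, of "- r" u w] by simp
  have "g (W (x n)) (W l) = 0" for n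
  proof -
    have "W (x n) = - (real (Suc n) *\<^sub>R U (x n))" using x(1)[of n] by (simp add: eq_neg_iff_add_eq_0)
    then have "g (W (x n)) (W l) = - (real (Suc n) * g (U (x n)) (W l))"
      using neg[of "real (Suc n)"] by simp
    then show ?thesis using sym[of "x n" l] Ul sym_formD(7)[OF g] by simp
  qed
  moreover have "(\<lambda>n. g (W (x (s n))) (W l)) \<longlonglongrightarrow> g (W l) (W l)"
    by (rule bilinear_apply_tendsto[OF _ _ _ lW]) (use g in \<open>auto simp: sym_form_def\<close>)
  ultimately have "g (W l) (W l) = 0" by (simp add: LIMSEQ_const_iff)
  then show False using pos[OF Ul] l(1) by force
qed

section \<open>Differential inequalities and linear differential equations\<close>

text \<open>The norm need not be differentiable where it vanishes, hence the squares. The inhomogeneous term enters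
  through \<open>2 * norm (u s) * e \<le> (norm (u s))\<^sup>2 + e\<^sup>2\<close>, which accounts for the \<open>1\<close> in the exponent.\<close>
lemma gronwall:
  fixes u :: "real \<Rightarrow> 'a::real_inner"
  assumes u: "\<And>s. s \<in> {c..d} \<Longrightarrow> (u has_vector_derivative u' s) (at s within {c..d})"
    and bound: "\<And>s. s \<in> {c..d} \<Longrightarrow> norm (u' s) \<le> L * norm (u s) + e"
    and L: "L \<ge> 0" and t: "t \<in> {c..d}"
  shows "(norm (u t))\<^sup>2 + e\<^sup>2 \<le> exp ((2 * L + 1) * (t - c)) * ((norm (u c))\<^sup>2 + e\<^sup>2)"
proof -
  define M where "M = 2 * L + 1"
  define h where "h s = exp (- (M * (s - c))) * (u s \<bullet> u s + e\<^sup>2)" for s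
  define h' where "h' s = exp (- (M * (s - c))) * (2 * (u s \<bullet> u' s)) + (- M * exp (- (M * (s - c)))) * (u s \<bullet> u s + e\<^sup>2)" for s
  have dh: "(h has_real_derivative h' s) (at s within {c..d})" if "s \<in> {c..d}" for s
  proof -
    have "((\<lambda>s. u s \<bullet> u s) has_vector_derivative (u s \<bullet> u' s + u' s \<bullet> u s)) (at s within {c..d})"
      using bounded_bilinear.has_vector_derivative[OF bounded_bilinear_inner u[OF that] u[OF that]] .
    then have "((\<lambda>s. u s \<bullet> u s) has_real_derivative 2 * (u s \<bullet> u' s)) (at s within {c..d})"
      by (simp add: has_real_derivative_iff_has_vector_derivative inner_commute)
    note this [derivative_intros]
    show ?thesis unfolding h_def h'_def
      by (auto intro!: derivative_eq_intros simp: algebra_simps)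
  qed
  have neg: "h' s \<le> 0" if "s \<in> {c..d}" for s
  proof -
    have "u s \<bullet> u' s \<le> norm (u s) * norm (u' s)" by (rule norm_cauchy_schwarz)
    also have "\<dots> \<le> norm (u s) * (L * norm (u s) + e)" using bound[OF that] by (intro mult_left_mono) auto
    finally have "2 * (u s \<bullet> u' s) \<le> 2 * L * (norm (u s))\<^sup>2 + 2 * norm (u s) * e"
      by (simp add: algebra_simps power2_eq_square)
    also have "\<dots> \<le> 2 * L * (norm (u s))\<^sup>2 + ((norm (u s))\<^sup>2 + e\<^sup>2)"
      using sum_squares_bound[of "norm (u s)" e] by simp
    also have "\<dots> \<le> M * ((norm (u s))\<^sup>2 + e\<^sup>2)" using L by (simp add: M_def algebra_simps)
    finally have le: "2 * (u s \<bullet> u' s) - M * (u s \<bullet> u s + e\<^sup>2) \<le> 0" by (simp add: power2_norm_eq_inner)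
    have "h' s = exp (- (M * (s - c))) * (2 * (u s \<bullet> u' s) - M * (u s \<bullet> u s + e\<^sup>2))"
      by (simp add: h'_def algebra_simps)
    then show ?thesis using le by (simp add: mult_nonneg_nonpos)
  qed
  have "h t \<le> h c"
  proof (rule DERIV_nonpos_imp_decreasing_open[where f = h and a = c and b = t])
    show "c \<le> t" using t by simp
    show "\<exists>y. (h has_real_derivative y) (at x) \<and> y \<le> 0" if "c < x" "x < t" for x
      using dh[of x] neg[of x] that t at_within_Icc_at[of c x d] by auto
    have "continuous_on {c..d} h" using dh by (meson DERIV_continuous continuous_on_eq_continuous_within)
    then show "continuous_on {c..t} h" using t by (auto elim: continuous_on_subset)
  qed
  then have "exp (M * (t - c)) * h t \<le> exp (M * (t - c)) * h c" by (intro mult_left_mono) auto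
  moreover have "exp (M * (t - c)) * h t = u t \<bullet> u t + e\<^sup>2"
  proof -
    have "exp (M * (t - c)) * exp (- (M * (t - c))) = 1" by (rule exp_minus_inverse)
    then show ?thesis unfolding h_def mult.assoc[symmetric] by simp
  qed
  moreover have "h c = u c \<bullet> u c + e\<^sup>2" by (simp add: h_def)
  ultimately show ?thesis unfolding M_def[symmetric] power2_norm_eq_inner by (simp only:)
qed

lemma linear_growth_zero:
  fixes u :: "real \<Rightarrow> 'a::real_inner"
  assumes u: "\<And>s. s \<in> {c..d} \<Longrightarrow> (u has_vector_derivative u' s) (at s within {c..d})"
    and bound: "\<And>s. s \<in> {c..d} \<Longrightarrow> norm (u' s) \<le> L * norm (u s)" and L: "L \<ge> 0"
    and s: "s \<in> {c..d}" "u s = 0" and t: "t \<in> {c..d}"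
  shows "u t = 0"
proof (cases "s \<le> t")
  case True
  have "(norm (u t))\<^sup>2 + 0\<^sup>2 \<le> exp ((2 * L + 1) * (t - s)) * ((norm (u s))\<^sup>2 + 0\<^sup>2)"
  proof (rule gronwall[where d = t and u' = u'])
    show "(u has_vector_derivative u' x) (at x within {s..t})" if "x \<in> {s..t}" for x
      by (rule has_vector_derivative_within_subset[OF u]) (use that s t in auto)
  qed (use bound s t L True in auto)
  then show ?thesis using s by simp
next
  case False
  define w where "w x = u (- x)" for x
  have "(norm (w (- t)))\<^sup>2 + 0\<^sup>2 \<le> exp ((2 * L + 1) * (- t - (- s))) * ((norm (w (- s)))\<^sup>2 + 0\<^sup>2)"
  proof (rule gronwall[where d = "- t" and u' = "\<lambda>x. - u' (- x)"])
    show "(w has_vector_derivative - u' (- x)) (at x within {- s..- t})" if "x \<in> {- s..- t}" for x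
    proof -
      have 1: "(uminus has_vector_derivative (-1)) (at x within {- s..- t})" by (auto intro!: derivative_eq_intros)
      have sub: "uminus ` {- s..- t} \<subseteq> {c..d}" using s t by auto
      have 2: "(u has_vector_derivative u' (- x)) (at (- x) within uminus ` {- s..- t})"
        by (rule has_vector_derivative_within_subset[OF u sub]) (use that s t in auto)
      show ?thesis using vector_diff_chain_within[OF 1 2] by (simp add: w_def[abs_def] comp_def)
    qed
    show "norm (- u' (- x)) \<le> L * norm (w x) + 0" if "x \<in> {- s..- t}" for x
      using bound[of "- x"] that s t by (auto simp: w_def)
  qed (use s t L False in auto)
  then show ?thesis using s by (simp add: w_def)
qed

lemma continuous_on_linear_apply:
  fixes A :: "'x::topological_space \<Rightarrow> 'a::euclidean_space \<Rightarrow> 'b::real_normed_vector"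
  assumes lin: "\<And>t. t \<in> S \<Longrightarrow> linear (A t)" and cont: "\<And>x. continuous_on S (\<lambda>t. A t x)" and f: "continuous_on S f"
  shows "continuous_on S (\<lambda>t. A t (f t))"
  unfolding continuous_on_def
proof
  fix t assume t: "t \<in> S"
  show "((\<lambda>t. A t (f t)) \<longlongrightarrow> A t (f t)) (at t within S)"
  proof (rule linear_apply_tendsto)
    show "\<forall>\<^sub>F s in at t within S. linear (A s)"
      unfolding eventually_at_filter using lin by (auto intro: always_eventually)
  qed (use lin t cont f in \<open>auto simp: continuous_on_def\<close>)
qed

lemma linear_family_bounded:
  fixes A :: "'x::topological_space \<Rightarrow> 'a::euclidean_space \<Rightarrow> 'b::real_normed_vector"
  assumes S: "compact S" and lin: "\<And>t. t \<in> S \<Longrightarrow> linear (A t)" and cont: "\<And>x. continuous_on S (\<lambda>t. A t x)"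
  obtains K where "K > 0" "\<And>t x. t \<in> S \<Longrightarrow> norm (A t x) \<le> K * norm x"
proof -
  have "continuous_on S (\<lambda>t. \<Sum>b\<in>Basis. norm (A t b))" by (intro continuous_intros cont)
  then have "bounded ((\<lambda>t. \<Sum>b\<in>Basis. norm (A t b)) ` S)"
    using S compact_continuous_image compact_imp_bounded by blast
  then obtain K where K: "K > 0" "\<And>t. t \<in> S \<Longrightarrow> \<bar>\<Sum>b\<in>Basis. norm (A t b)\<bar> \<le> K"
    unfolding bounded_pos by (force simp del: abs_sum_abs)
  have "norm (A t x) \<le> K * norm x" if t: "t \<in> S" for t x
  proof -
    have "norm (A t x) = norm (\<Sum>b\<in>Basis. (x \<bullet> b) *\<^sub>R A t b)" using linear_basis_sum[OF lin[OF t], of x] by simp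
    also have "\<dots> \<le> (\<Sum>b\<in>Basis. norm x * norm (A t b))"
      by (rule sum_norm_le) (simp add: Basis_le_norm mult_right_mono)
    also have "\<dots> = norm x * (\<Sum>b\<in>Basis. norm (A t b))" by (simp add: sum_distrib_left)
    also have "\<dots> \<le> norm x * K" using K(2)[OF t] by (intro mult_left_mono) auto
    finally show ?thesis by (simp add: mult.commute)
  qed
  then show thesis using that K(1) by blast
qed

text \<open>On a short interval the Picard operator is a contraction.\<close>
lemma linear_ode_exists:
  fixes A :: "real \<Rightarrow> 'a::euclidean_space \<Rightarrow> 'a"
  assumes cd: "c \<le> d" and lin: "\<And>t. t \<in> {c..d} \<Longrightarrow> linear (A t)"
    and cont: "\<And>x. continuous_on {c..d} (\<lambda>t. A t x)"
    and K: "\<And>t x. t \<in> {c..d} \<Longrightarrow> norm (A t x) \<le> K * norm x" "K * (d - c) \<le> 1 / 2" "K \<ge> 0"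
  obtains y where "y c = y0" "\<And>t. t \<in> {c..d} \<Longrightarrow> (y has_vector_derivative A t (y t)) (at t within {c..d})"
proof -
  \<comment> \<open>functions on the interval are extended by constants, to lie in the Banach space of bounded continuous functions\<close>
  define cl where "cl t = max c (min d t)" for t
  have cl: "cl t \<in> {c..d}" for t using cd by (simp add: cl_def)
  have cl_id: "cl t = t" if "t \<in> {c..d}" for t using that by (simp add: cl_def)
  have ccl: "continuous_on UNIV cl" unfolding cl_def[abs_def] by (intro continuous_intros)
  define h where "h f t = y0 + integral {c..t} (\<lambda>s. A s (f s))" for f t
  have cA: "continuous_on {c..d} (\<lambda>s. A s (f s))" if "continuous_on UNIV f" for f
    by (rule continuous_on_linear_apply[OF lin cont]) (use that continuous_on_subset in auto)
  have ch: "continuous_on {c..d} (h f)" if "continuous_on UNIV f" for f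
    unfolding h_def[abs_def]
    by (intro continuous_intros indefinite_integral_continuous_1 integrable_continuous_real cA that)
  have hb: "(\<lambda>t. h f (cl t)) \<in> bcontfun" if "continuous_on UNIV f" for f
  proof -
    have "continuous_on UNIV (\<lambda>t. h f (cl t))"
      by (rule continuous_on_compose2[OF ch[OF that] ccl]) (use cl in blast)
    moreover have "bounded (h f ` {c..d})" using ch[OF that] compact_continuous_image compact_imp_bounded by blast
    then have "bounded (range (\<lambda>t. h f (cl t)))" by (rule bounded_subset) (use cl in auto)
    ultimately show ?thesis by (simp add: bcontfun_def)
  qed
  define T where "T f = Bcontfun (\<lambda>t. h (apply_bcontfun f) (cl t))" for f
  have T: "apply_bcontfun (T f) t = h (apply_bcontfun f) (cl t)" for f t
    unfolding T_def using Bcontfun_inverse[OF hb] continuous_on_apply_bcontfun by metis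
  have "dist (T f) (T g) \<le> 1 / 2 * dist f g" for f g
  proof (rule dist_bound)
    fix t
    let ?f = "apply_bcontfun f" and ?g = "apply_bcontfun g"
    have sub: "{c..cl t} \<subseteq> {c..d}" using cl[of t] by auto
    have int: "(\<lambda>s. A s (k s)) integrable_on {c..cl t}" if "continuous_on UNIV k" for k
      using integrable_continuous_real continuous_on_subset[OF cA[OF that] sub] by blast
    have cf: "continuous_on UNIV ?f" "continuous_on UNIV ?g" by (rule continuous_on_apply_bcontfun)+
    have "dist (apply_bcontfun (T f) t) (apply_bcontfun (T g) t)
        = norm (integral {c..cl t} (\<lambda>s. A s (?f s)) - integral {c..cl t} (\<lambda>s. A s (?g s)))"
      by (simp add: T h_def dist_norm)
    also have "\<dots> = norm (integral {c..cl t} (\<lambda>s. A s (?f s) - A s (?g s)))"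
      using integral_diff[OF int[OF cf(1)] int[OF cf(2)]] by simp
    also have "\<dots> \<le> (K * dist f g) * (cl t - c)"
    proof (rule integral_bound)
      show "c \<le> cl t" using cl[of t] by simp
      show "continuous_on {c..cl t} (\<lambda>s. A s (?f s) - A s (?g s))"
        by (intro continuous_intros continuous_on_subset[OF cA[OF cf(1)] sub] continuous_on_subset[OF cA[OF cf(2)] sub])
      fix s assume "s \<in> {c..cl t}"
      then have s: "s \<in> {c..d}" using sub by blast
      have "norm (A s (?f s) - A s (?g s)) = norm (A s (?f s - ?g s))" using linear_diff[OF lin[OF s]] by simp
      also have "\<dots> \<le> K * norm (?f s - ?g s)" by (rule K(1)[OF s])
      also have "\<dots> \<le> K * dist f g" using dist_bounded[of f s g] K(3) by (intro mult_left_mono) (auto simp: dist_norm)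
      finally show "norm (A s (?f s) - A s (?g s)) \<le> K * dist f g" .
    qed
    also have "\<dots> \<le> (K * dist f g) * (d - c)" using cl[of t] K(3) by (intro mult_left_mono) auto
    also have "\<dots> = (K * (d - c)) * dist f g" by simp
    also have "\<dots> \<le> 1 / 2 * dist f g" using K(2) by (intro mult_right_mono) auto
    finally show "dist (apply_bcontfun (T f) t) (apply_bcontfun (T g) t) \<le> 1 / 2 * dist f g" .
  qed
  then have "\<exists>!f. T f = f" by (intro banach_fix_type[of "1/2"]) auto
  then obtain f where f: "T f = f" by blast
  define y where "y = apply_bcontfun f"
  have y: "y t = h y (cl t)" for t using T[of f t] f by (simp add: y_def)
  have "y c = y0" using y[of c] cl_id[of c] cd by (simp add: h_def)
  moreover have "(y has_vector_derivative A t (y t)) (at t within {c..d})" if t: "t \<in> {c..d}" for t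
  proof -
    have "continuous_on UNIV y" unfolding y_def by (rule continuous_on_apply_bcontfun)
    from integral_has_vector_derivative[OF cA[OF this] t]
    have "((\<lambda>u. integral {c..u} (\<lambda>s. A s (y s))) has_vector_derivative A t (y t)) (at t within {c..d})" .
    then have "(h y has_vector_derivative A t (y t)) (at t within {c..d})"
      unfolding h_def[abs_def] using has_vector_derivative_add[OF has_vector_derivative_const[of y0]] by fastforce
    then show ?thesis
      by (rule has_vector_derivative_transform[OF t, rotated]) (use y cl_id in metis)
  qed
  ultimately show thesis using that by blast
qed


section \<open>Derivatives of linear maps depending on a parameter\<close>

lemma has_derivative_linear_apply:
  fixes f :: "'a::real_normed_vector \<Rightarrow> 'e::euclidean_space \<Rightarrow> 'f::real_normed_vector"
  assumes lin: "\<And>y. y \<in> S \<Longrightarrow> linear (f y)" and x: "x \<in> S" and linD: "\<And>h. linear (D h)"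
    and D: "\<And>u. ((\<lambda>y. f y u) has_derivative (\<lambda>h. D h u)) (at x within S)"
    and c: "(c has_derivative c') (at x within S)"
  shows "((\<lambda>y. f y (c y)) has_derivative (\<lambda>h. D h (c x) + f x (c' h))) (at x within S)"
proof -
  have "((\<lambda>y. \<Sum>b\<in>Basis. (c y \<bullet> b) *\<^sub>R f y b) has_derivative
      (\<lambda>h. \<Sum>b\<in>Basis. ((c x \<bullet> b) *\<^sub>R D h b + (c' h \<bullet> b) *\<^sub>R f x b))) (at x within S)"
    by (intro has_derivative_sum has_derivative_scaleR D has_derivative_inner_left c)
  moreover have "(\<Sum>b\<in>Basis. ((c x \<bullet> b) *\<^sub>R D h b + (c' h \<bullet> b) *\<^sub>R f x b)) = D h (c x) + f x (c' h)" for h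
    unfolding sum.distrib using linear_basis_sum[OF linD, of h "c x"] linear_basis_sum[OF lin[OF x], of "c' h"] by simp
  ultimately have "((\<lambda>y. \<Sum>b\<in>Basis. (c y \<bullet> b) *\<^sub>R f y b) has_derivative (\<lambda>h. D h (c x) + f x (c' h))) (at x within S)"
    by simp
  then show ?thesis
    by (rule has_derivative_transform[OF x, rotated]) (rule linear_basis_sum[OF lin])
qed

text \<open>Implicit differentiation of the system \<open>G y (w y) = k y\<close>. The map \<open>G y\<close> sends the error quotient of the
  candidate \<open>w'\<close> to a combination of error quotients that tend to zero, and \<open>linear_solution_tendsto\<close> applies.\<close>
lemma linear_solution_has_derivative:
  fixes G :: "'a::real_normed_vector \<Rightarrow> 'e::euclidean_space \<Rightarrow> 'f::euclidean_space"
  assumes lin: "\<And>y. y \<in> S \<Longrightarrow> linear (G y)" and x: "x \<in> S" and inj: "\<And>u. G x u = 0 \<Longrightarrow> u = 0"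
    and D: "\<And>u. ((\<lambda>y. G y u) has_derivative (\<lambda>h. D h u)) (at x within S)"
    and k: "((\<lambda>y. G y (w y)) has_derivative k') (at x within S)"
    and w': "linear w'" "bounded_linear w'" "\<And>h. G x (w' h) = k' h - D h (w x)"
  shows "(w has_derivative w') (at x within S)"
proof -
  define r where "r y = (1 / norm (y - x)) *\<^sub>R (w y - w x - w' (y - x))" for y
  have ev: "\<forall>\<^sub>F y in at x within S. linear (G y)"
    unfolding eventually_at_filter using lin by (auto intro: always_eventually)
  have conv: "((\<lambda>y. G y u) \<longlongrightarrow> G x u) (at x within S)" for u
    using has_derivative_continuous[OF D] by (simp add: continuous_within)
  obtain C where C: "C > 0" "\<And>h. norm (w' h) \<le> norm h * C"
    using bounded_linear.pos_bounded[OF w'(2)] by blast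
  define R1 where "R1 y = (1 / norm (y - x)) *\<^sub>R (G y (w y) - G x (w x) - k' (y - x))" for y
  define R2 where "R2 y = (1 / norm (y - x)) *\<^sub>R (G y (w x) - G x (w x) - D (y - x) (w x))" for y
  define R3 where "R3 y = (1 / norm (y - x)) *\<^sub>R (G y (w' (y - x)) - G x (w' (y - x)))" for y
  have 1: "(R1 \<longlongrightarrow> 0) (at x within S)"
    using k unfolding has_derivative_within R1_def by (simp add: diff_diff_eq)
  have 2: "(R2 \<longlongrightarrow> 0) (at x within S)"
    using D[of "w x"] unfolding has_derivative_within R2_def by (simp add: diff_diff_eq)
  have 3: "(R3 \<longlongrightarrow> 0) (at x within S)"
  proof (rule tendstoI)
    fix e :: real assume "e > 0"
    then have "\<forall>\<^sub>F y in at x within S. \<forall>u. norm (G y u - G x u) \<le> e / (2 * C) * norm u"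
      using C(1) by (intro linear_tendsto_uniform[OF ev lin[OF x] conv]) auto
    then show "\<forall>\<^sub>F y in at x within S. dist (R3 y) 0 < e"
    proof eventually_elim
      case (elim y)
      show ?case
      proof (cases "y = x")
        case False
        have "norm (G y (w' (y - x)) - G x (w' (y - x))) \<le> e / (2 * C) * norm (w' (y - x))" using elim by blast
        also have "\<dots> \<le> e / (2 * C) * (norm (y - x) * C)" using C \<open>e > 0\<close> by (intro mult_left_mono) auto
        also have "\<dots> = e / 2 * norm (y - x)" using C(1) by simp
        finally have "norm (G y (w' (y - x)) - G x (w' (y - x))) / norm (y - x) \<le> e / 2"
          using False by (simp add: pos_divide_le_eq)
        moreover have "norm (R3 y) = norm (G y (w' (y - x)) - G x (w' (y - x))) / norm (y - x)"
          unfolding R3_def norm_scaleR by simp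
        ultimately have "norm (R3 y) \<le> e / 2" by (simp only:)
        then have "norm (R3 y) < e" using \<open>e > 0\<close> by linarith
        then show ?thesis by (simp add: dist_norm)
      qed (simp add: R3_def \<open>e > 0\<close>)
    qed
  qed
  have eq: "G y (r y) = R1 y - R2 y - R3 y" if "y \<in> S" for y
  proof -
    note l = linear_diff[OF lin[OF that]] linear_scale[OF lin[OF that]]
    have "G y (w y - w x - w' (y - x)) = G y (w y) - G y (w x) - G y (w' (y - x))" by (simp add: l)
    also have "\<dots> = (G y (w y) - G x (w x) - k' (y - x)) - (G y (w x) - G x (w x) - D (y - x) (w x))
       - (G y (w' (y - x)) - G x (w' (y - x)))"
      using w'(3)[of "y - x"] by (simp add: algebra_simps)
    finally have E: "G y (w y - w x - w' (y - x)) = (G y (w y) - G x (w x) - k' (y - x))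
       - (G y (w x) - G x (w x) - D (y - x) (w x)) - (G y (w' (y - x)) - G x (w' (y - x)))" .
    show ?thesis unfolding r_def l(2) E R1_def R2_def R3_def by (simp only: scaleR_diff_right)
  qed
  have "((\<lambda>y. R1 y - R2 y - R3 y) \<longlongrightarrow> 0 - 0 - 0) (at x within S)" by (intro tendsto_intros 1 2 3)
  moreover have "\<forall>\<^sub>F y in at x within S. R1 y - R2 y - R3 y = G y (r y)"
    unfolding eventually_at_filter using eq by (auto intro: always_eventually)
  ultimately have "((\<lambda>y. G y (r y)) \<longlongrightarrow> 0) (at x within S)" using Lim_transform_eventually by fastforce
  moreover have "G x 0 = 0" by (rule linear_0[OF lin[OF x]])
  ultimately have "((\<lambda>y. G y (r y)) \<longlongrightarrow> G x 0) (at x within S)" by simp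
  from linear_solution_tendsto[OF ev lin[OF x] conv inj this] have "(r \<longlongrightarrow> 0) (at x within S)" by simp
  then show ?thesis unfolding has_derivative_within r_def using w'(2) by (simp add: diff_diff_eq)
qed

text \<open>Both mixed derivatives are limits of the same second difference.\<close>
lemma second_derivative_symmetric_real:
  fixes f :: "'a::real_normed_vector \<Rightarrow> real"
  assumes U: "open U" "x \<in> U"
    and f: "\<And>y. y \<in> U \<Longrightarrow> (f has_derivative f' y) (at y)"
    and fv: "\<And>y. y \<in> U \<Longrightarrow> ((\<lambda>y. f' y v) has_derivative fv y) (at y)"
    and fw: "\<And>y. y \<in> U \<Longrightarrow> ((\<lambda>y. f' y w) has_derivative fw y) (at y)"
    and cont: "continuous_on U (\<lambda>y. fv y w)" "continuous_on U (\<lambda>y. fw y v)"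
  shows "fv x w = fw x v"
proof -
  have key: "\<exists>y\<in>ball x (s * (norm v + norm w) + e). f (x + s *\<^sub>R v + s *\<^sub>R w) - f (x + s *\<^sub>R v) - f (x + s *\<^sub>R w) + f x = s * (s * fv y w)"
    if s: "s > 0" and e: "e > 0" "ball x (s * (norm v + norm w) + e) \<subseteq> U"
      and fv: "\<And>y. y \<in> U \<Longrightarrow> ((\<lambda>y. f' y v) has_derivative fv y) (at y)" for s e v w fv
  proof -
    have in_ball: "x + p *\<^sub>R v + q *\<^sub>R w \<in> ball x (s * (norm v + norm w) + e)" if "0 \<le> p" "p \<le> s" "0 \<le> q" "q \<le> s" for p q
    proof -
      have "norm (p *\<^sub>R v + q *\<^sub>R w) \<le> p * norm v + q * norm w" using that norm_triangle_ineq[of "p *\<^sub>R v" "q *\<^sub>R w"] by simp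
      also have "\<dots> \<le> s * norm v + s * norm w" using that by (intro add_mono mult_right_mono) auto
      finally have "norm (p *\<^sub>R v + q *\<^sub>R w) < s * (norm v + norm w) + e" using e by (simp add: algebra_simps)
      moreover have "x - (x + p *\<^sub>R v + q *\<^sub>R w) = - (p *\<^sub>R v + q *\<^sub>R w)" by simp
      ultimately show ?thesis by (simp only: mem_ball dist_norm norm_minus_cancel)
    qed
    have line: "((\<lambda>p. k (z + p *\<^sub>R u)) has_real_derivative k' u) (at p)"
      if "(k has_derivative k') (at (z + p *\<^sub>R u))" for k :: "'a \<Rightarrow> real" and k' z u p
    proof -
      have "((\<lambda>p. z + p *\<^sub>R u) has_derivative (\<lambda>h. h *\<^sub>R u)) (at p)" by (auto intro!: derivative_eq_intros)
      from has_derivative_compose[OF this that] have "((\<lambda>p. k (z + p *\<^sub>R u)) has_derivative (\<lambda>h. k' (h *\<^sub>R u))) (at p)" .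
      moreover have "k' (h *\<^sub>R u) = h * k' u" for h using that linear_scale[OF has_derivative_linear, of k k'] by simp
      moreover have "(\<lambda>h. h * k' u) = (*) (k' u)" by (auto simp: mult.commute)
      ultimately show ?thesis by (simp add: has_field_derivative_def)
    qed
    define \<phi> where "\<phi> p = f ((x + s *\<^sub>R w) + p *\<^sub>R v) - f (x + p *\<^sub>R v)" for p
    have "\<exists>p. 0 < p \<and> p < s \<and> \<phi> s - \<phi> 0 = (s - 0) * (f' ((x + s *\<^sub>R w) + p *\<^sub>R v) v - f' (x + p *\<^sub>R v) v)"
    proof (rule MVT2[OF s])
      fix p assume p: "0 \<le> p" "p \<le> s"
      have "(x + s *\<^sub>R w) + p *\<^sub>R v \<in> U" "x + p *\<^sub>R v \<in> U"
        using in_ball[of p s] in_ball[of p 0] p s e(2) by (auto simp: algebra_simps)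
      then show "(\<phi> has_real_derivative f' ((x + s *\<^sub>R w) + p *\<^sub>R v) v - f' (x + p *\<^sub>R v) v) (at p)"
        unfolding \<phi>_def[abs_def] by (intro DERIV_diff line f)
    qed
    then obtain p where p: "0 < p" "p < s" "\<phi> s - \<phi> 0 = s * (f' ((x + s *\<^sub>R w) + p *\<^sub>R v) v - f' (x + p *\<^sub>R v) v)" by auto
    have "\<exists>q. 0 < q \<and> q < s \<and> f' ((x + p *\<^sub>R v) + s *\<^sub>R w) v - f' ((x + p *\<^sub>R v) + 0 *\<^sub>R w) v = (s - 0) * fv ((x + p *\<^sub>R v) + q *\<^sub>R w) w"
    proof (rule MVT2[OF s])
      fix q assume "0 \<le> q" "q \<le> s"
      then have "(x + p *\<^sub>R v) + q *\<^sub>R w \<in> U" using in_ball[of p q] p e(2) by auto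
      then show "((\<lambda>q. f' ((x + p *\<^sub>R v) + q *\<^sub>R w) v) has_real_derivative fv ((x + p *\<^sub>R v) + q *\<^sub>R w) w) (at q)"
        using line[OF fv] by blast
    qed
    then obtain q where q: "0 < q" "q < s" "f' ((x + p *\<^sub>R v) + s *\<^sub>R w) v - f' (x + p *\<^sub>R v) v = s * fv ((x + p *\<^sub>R v) + q *\<^sub>R w) w" by auto
    have "\<phi> s - \<phi> 0 = s * (s * fv ((x + p *\<^sub>R v) + q *\<^sub>R w) w)" using p(3) q(3) by (simp add: algebra_simps)
    moreover have "\<phi> s - \<phi> 0 = f (x + s *\<^sub>R v + s *\<^sub>R w) - f (x + s *\<^sub>R v) - f (x + s *\<^sub>R w) + f x"
      by (simp add: \<phi>_def algebra_simps)
    ultimately show ?thesis using in_ball[of p q] p q by (intro bexI[of _ "(x + p *\<^sub>R v) + q *\<^sub>R w"]) auto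
  qed
  show ?thesis
  proof (rule ccontr)
    assume ne: "fv x w \<noteq> fw x v"
    define e where "e = \<bar>fv x w - fw x v\<bar> / 2"
    have e: "e > 0" using ne by (simp add: e_def)
    obtain d1 where d1: "d1 > 0" "\<And>y. y \<in> U \<Longrightarrow> dist y x < d1 \<Longrightarrow> dist (fv y w) (fv x w) < e"
      using cont(1) U(2) e unfolding continuous_on_iff by blast
    obtain d2 where d2: "d2 > 0" "\<And>y. y \<in> U \<Longrightarrow> dist y x < d2 \<Longrightarrow> dist (fw y v) (fw x v) < e"
      using cont(2) U(2) e unfolding continuous_on_iff by blast
    obtain d3 where d3: "d3 > 0" "ball x d3 \<subseteq> U" using U openE by blast
    define d where "d = min d1 (min d2 d3)"
    have d0: "d > 0" using d1 d2 d3 by (simp add: d_def)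
    define N where "N = norm v + norm w + 1"
    define s where "s = d / (2 * N)"
    have N: "N > 0" by (simp add: N_def add_nonneg_pos)
    have s: "s > 0" using d0 N by (simp add: s_def)
    have "s * (norm v + norm w) \<le> s * N" using s by (simp add: N_def)
    also have "\<dots> = d / 2" using N by (simp add: s_def)
    finally have le: "s * (norm v + norm w) + d / 2 \<le> d" by simp
    have sub: "ball x (s * (norm v + norm w) + d / 2) \<subseteq> U" "ball x (s * (norm w + norm v) + d / 2) \<subseteq> U"
      using le d3(2) by (auto simp: d_def add.commute)
    obtain y where y: "y \<in> ball x d" "f (x + s *\<^sub>R v + s *\<^sub>R w) - f (x + s *\<^sub>R v) - f (x + s *\<^sub>R w) + f x = s * (s * fv y w)"
      using key[OF s _ sub(1) fv] d0 le by force
    obtain z where z: "z \<in> ball x d" "f (x + s *\<^sub>R w + s *\<^sub>R v) - f (x + s *\<^sub>R w) - f (x + s *\<^sub>R v) + f x = s * (s * fw z v)"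
      using key[OF s _ sub(2) fw] d0 le by (force simp: add.commute)
    have "s * (s * fv y w) = s * (s * fw z v)" using y(2) z(2) by (simp add: algebra_simps)
    then have "fv y w = fw z v" using s by simp
    moreover have "\<bar>fv y w - fv x w\<bar> < e" "\<bar>fw z v - fw x v\<bar> < e"
      using d1(2)[of y] d2(2)[of z] y(1) z(1) d3(2) by (auto simp: dist_real_def dist_commute d_def)
    ultimately show False by (simp add: e_def abs_if split: if_splits)
  qed
qed

lemma smooth_on_has_derivative:
  assumes "smooth_on U f" "x \<in> U" shows "(f has_derivative frechet_derivative f (at x)) (at x)"
proof -
  have "Ck_on (Suc 0) U f" using assms(1) unfolding smooth_on_def by blast
  then show ?thesis using assms(2) frechet_derivative_works by auto
qed

lemma smooth_on_frechet: "smooth_on U f \<Longrightarrow> smooth_on U (\<lambda>x. frechet_derivative f (at x) v)"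
  unfolding smooth_on_def by (metis Ck_on.simps(2))

lemma smooth_on_continuous: "smooth_on U f \<Longrightarrow> continuous_on U f"
  unfolding smooth_on_def by (metis Ck_on.simps(1))

lemma second_derivative_symmetric:
  fixes f :: "'a::euclidean_space \<Rightarrow> 'b::euclidean_space"
  assumes f: "smooth_on U f" and U: "open U" "x \<in> U"
  shows "frechet_derivative (\<lambda>y. frechet_derivative f (at y) v) (at x) w =
    frechet_derivative (\<lambda>y. frechet_derivative f (at y) w) (at x) v"
proof (rule euclidean_eqI)
  fix b :: 'b assume "b \<in> Basis"
  let ?D = "\<lambda>v y. frechet_derivative (\<lambda>y. frechet_derivative f (at y) v) (at y)"
  show "?D v x w \<bullet> b = ?D w x v \<bullet> b"
  proof (rule second_derivative_symmetric_real[OF U])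
    show "((\<lambda>y. f y \<bullet> b) has_derivative (\<lambda>h. frechet_derivative f (at y) h \<bullet> b)) (at y)" if "y \<in> U" for y
      by (intro has_derivative_inner_left smooth_on_has_derivative[OF f that])
    show "((\<lambda>y. frechet_derivative f (at y) v \<bullet> b) has_derivative (\<lambda>h. ?D v y h \<bullet> b)) (at y)"
      "((\<lambda>y. frechet_derivative f (at y) w \<bullet> b) has_derivative (\<lambda>h. ?D w y h \<bullet> b)) (at y)" if "y \<in> U" for y
      by (intro has_derivative_inner_left smooth_on_has_derivative[OF smooth_on_frechet[OF f] that])+
    show "continuous_on U (\<lambda>y. ?D v y w \<bullet> b)" "continuous_on U (\<lambda>y. ?D w y v \<bullet> b)"
      by (intro continuous_intros smooth_on_continuous smooth_on_frechet f)+
  qed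
qed

lemma has_derivative_linear_apply_at:
  fixes f :: "'a::real_normed_vector \<Rightarrow> 'e::euclidean_space \<Rightarrow> 'f::real_normed_vector"
  assumes S: "open S" "x \<in> S" and "\<And>y. y \<in> S \<Longrightarrow> linear (f y)" and "\<And>h. linear (D h)"
    and "\<And>u. ((\<lambda>y. f y u) has_derivative (\<lambda>h. D h u)) (at x)" and "(c has_derivative c') (at x)"
  shows "((\<lambda>y. f y (c y)) has_derivative (\<lambda>h. D h (c x) + f x (c' h))) (at x)"
  using has_derivative_linear_apply[of S f x D c c'] assms at_within_open[OF S(2,1)] by simp

lemma has_derivative_bilinear_apply_at:
  fixes f :: "'a::real_normed_vector \<Rightarrow> 'e::euclidean_space \<Rightarrow> 'e \<Rightarrow> 'f::real_normed_vector"
  assumes S: "open S" "x \<in> S" and f: "\<And>y. y \<in> S \<Longrightarrow> bilinear (f y)" and D: "\<And>h. bilinear (D h)"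
    and fD: "\<And>u v. ((\<lambda>y. f y u v) has_derivative (\<lambda>h. D h u v)) (at x)"
    and b: "(b has_derivative b') (at x)" and c: "(c has_derivative c') (at x)"
  shows "((\<lambda>y. f y (b y) (c y)) has_derivative (\<lambda>h. D h (b x) (c x) + f x (b' h) (c x) + f x (b x) (c' h))) (at x)"
proof (rule has_derivative_linear_apply_at[OF S, where D = "\<lambda>h v. D h (b x) v + f x (b' h) v"])
  have 1: "linear (\<lambda>u. f y u v)" "linear (f y u)" if "y \<in> S" for y u v using f[OF that] by (simp_all add: bilinear_def)
  have 2: "linear (\<lambda>u. D h u v)" "linear (D h u)" for h u v using D by (simp_all add: bilinear_def)
  show "linear (f y (b y))" if "y \<in> S" for y using 1 that by blast
  show "linear (\<lambda>v. D h (b x) v + f x (b' h) v)" for h by (intro linear_compose_add 2 1 S)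
  show "((\<lambda>y. f y (b y) v) has_derivative (\<lambda>h. D h (b x) v + f x (b' h) v)) (at x)" for v
    by (rule has_derivative_linear_apply_at[OF S, where f = "\<lambda>y u. f y u v" and D = "\<lambda>h u. D h u v"]) (use 1 2 fD b in auto)
qed (rule c)


section \<open>The Levi-Civita connection in charts\<close>

locale manifold =
  fixes A :: "('m::t2_space, 'e::euclidean_space) chart set"
  assumes A: "smooth_structure A"
begin

lemmas chart = chart_facts[OF A]

definition overlap :: "('m, 'e) chart \<Rightarrow> ('m, 'e) chart \<Rightarrow> 'e set" where
  "overlap c d = snd c ` (fst c \<inter> fst d)"

definition trans_deriv :: "('m, 'e) chart \<Rightarrow> ('m, 'e) chart \<Rightarrow> 'e \<Rightarrow> 'e \<Rightarrow> 'e" where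
  "trans_deriv c d x = frechet_derivative (transition c d) (at x)"

definition trans_deriv2 :: "('m, 'e) chart \<Rightarrow> ('m, 'e) chart \<Rightarrow> 'e \<Rightarrow> 'e \<Rightarrow> 'e \<Rightarrow> 'e" where
  "trans_deriv2 c d x u v = frechet_derivative (\<lambda>y. trans_deriv c d y u) (at x) v"

definition trans_deriv3 :: "('m, 'e) chart \<Rightarrow> ('m, 'e) chart \<Rightarrow> 'e \<Rightarrow> 'e \<Rightarrow> 'e \<Rightarrow> 'e \<Rightarrow> 'e" where
  "trans_deriv3 c d x u v w = frechet_derivative (\<lambda>y. trans_deriv2 c d y u v) (at x) w"

lemma charts_atD: "c \<in> charts_at A p \<Longrightarrow> c \<in> A" "c \<in> charts_at A p \<Longrightarrow> p \<in> fst c"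
  "c \<in> charts_at A p \<Longrightarrow> snd c p \<in> chart_image c" "c \<in> charts_at A p \<Longrightarrow> chart_inv c (snd c p) = p"
  using chart by (auto simp: charts_at_def chart_image_def)

lemma charts_at_inv: "c \<in> A \<Longrightarrow> x \<in> chart_image c \<Longrightarrow> c \<in> charts_at A (chart_inv c x)"
  using chart by (auto simp: charts_at_def)

context
  fixes c d :: "('m, 'e) chart"
  assumes cd: "c \<in> A" "d \<in> A"
begin

lemma open_overlap': "open (overlap c d)"
  unfolding overlap_def by (rule open_overlap[OF A cd(1) chart(1)[OF cd(2)]])

lemma overlapD:
  assumes "x \<in> overlap c d"
  shows "x \<in> chart_image c" "transition c d x \<in> chart_image d" "chart_inv d (transition c d x) = chart_inv c x"
    "c \<in> charts_at A (chart_inv c x)" "d \<in> charts_at A (chart_inv c x)"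
proof -
  obtain p where p: "x = snd c p" "p \<in> fst c" "p \<in> fst d" using assms unfolding overlap_def by blast
  have inv: "chart_inv c x = p" "chart_inv d (snd d p) = p" using p chart(3) cd by auto
  show "x \<in> chart_image c" using p by (simp add: chart_image_def)
  show "transition c d x \<in> chart_image d" using inv p by (simp add: transition_def chart_image_def)
  show "chart_inv d (transition c d x) = chart_inv c x" using inv by (simp add: transition_def)
  show "c \<in> charts_at A (chart_inv c x)" "d \<in> charts_at A (chart_inv c x)"
    using inv p cd by (simp_all add: charts_at_def)
qed

lemma overlapI: "c \<in> charts_at A p \<Longrightarrow> d \<in> charts_at A p \<Longrightarrow> snd c p \<in> overlap c d"
  by (auto simp: overlap_def charts_at_def)

lemma transition_smooth: "smooth_on (overlap c d) (transition c d)"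
  using A cd unfolding smooth_structure_def smooth_compatible_def overlap_def by blast

lemma trans_deriv_smooth: "smooth_on (overlap c d) (\<lambda>x. trans_deriv c d x u)"
  unfolding trans_deriv_def by (rule smooth_on_frechet[OF transition_smooth])

lemma trans_deriv2_smooth: "smooth_on (overlap c d) (\<lambda>x. trans_deriv2 c d x u v)"
  unfolding trans_deriv2_def by (rule smooth_on_frechet[OF trans_deriv_smooth])

context
  fixes x assumes x: "x \<in> overlap c d"
begin

lemma transition_has_derivative: "(transition c d has_derivative trans_deriv c d x) (at x)"
  unfolding trans_deriv_def by (rule smooth_on_has_derivative[OF transition_smooth x])

lemma trans_deriv_has_derivative: "((\<lambda>y. trans_deriv c d y u) has_derivative trans_deriv2 c d x u) (at x)"
  unfolding trans_deriv2_def[abs_def] by (rule smooth_on_has_derivative[OF trans_deriv_smooth x])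

lemma trans_deriv2_has_derivative: "((\<lambda>y. trans_deriv2 c d y u v) has_derivative trans_deriv3 c d x u v) (at x)"
  unfolding trans_deriv3_def[abs_def] by (rule smooth_on_has_derivative[OF trans_deriv2_smooth x])

lemma trans_deriv_linear: "linear (trans_deriv c d x)"
  using transition_has_derivative has_derivative_linear by blast

lemma trans_deriv2_sym: "trans_deriv2 c d x u v = trans_deriv2 c d x v u"
  unfolding trans_deriv2_def trans_deriv_def
  by (rule second_derivative_symmetric[OF transition_smooth open_overlap' x])

lemma trans_deriv2_linear: "linear (trans_deriv2 c d x u)" "linear (\<lambda>u. trans_deriv2 c d x u v)"
proof -
  show 1: "linear (trans_deriv2 c d x u)" for u using trans_deriv_has_derivative has_derivative_linear by blast
  show "linear (\<lambda>u. trans_deriv2 c d x u v)" unfolding trans_deriv2_sym[of _ v] by (rule 1)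
qed

lemma trans_deriv3_sym: "trans_deriv3 c d x u v w = trans_deriv3 c d x u w v"
  unfolding trans_deriv3_def trans_deriv2_def
  by (rule second_derivative_symmetric[OF trans_deriv_smooth open_overlap' x])

end

lemma trans_deriv3_sym':
  assumes x: "x \<in> overlap c d" shows "trans_deriv3 c d x u v w = trans_deriv3 c d x v u w"
proof -
  have "((\<lambda>y. trans_deriv2 c d y v u) has_derivative trans_deriv3 c d x u v) (at x)"
    by (rule has_derivative_transform_within_open[OF trans_deriv2_has_derivative[OF x, of u v] open_overlap' x])
      (rule trans_deriv2_sym)
  then show ?thesis using has_derivative_unique[OF trans_deriv2_has_derivative[OF x, of v u]] by metis
qed

end

lemma tangent_transform:
  assumes "c \<in> charts_at A p" "d \<in> charts_at A p" "v \<in> tangent_space A p"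
  shows "v d = trans_deriv c d (snd c p) (v c)"
  using assms unfolding tangent_space_def trans_deriv_def by blast

lemma tangentI:
  assumes "c \<in> charts_at A p" "\<And>d. d \<in> charts_at A p \<Longrightarrow> v d = trans_deriv c d (snd c p) (v c)"
    "\<And>d. d \<notin> charts_at A p \<Longrightarrow> v d = 0"
  shows "v \<in> tangent_space A p"
proof -
  have "v d = coord_vector A c (v c) p d" for d
    using assms(2,3)[of d] unfolding coord_vector_def trans_deriv_def by presburger
  then have "v = coord_vector A c (v c) p" by (rule ext)
  then show ?thesis using coord_vector_tangent[OF A assms(1)] by metis
qed

lemma trans_deriv_inverse:
  assumes "c \<in> charts_at A p" "d \<in> charts_at A p"
  shows "trans_deriv d c (snd d p) (trans_deriv c d (snd c p) u) = u"
  using transition_cocycle[OF A assms assms(1)] transition_self[OF A assms(1)]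
  by (simp add: trans_deriv_def fun_eq_iff)

lemma ex_chart: "\<exists>c. c \<in> charts_at A p"
  using A unfolding smooth_structure_def charts_at_def by blast

lemma tangent_zero: "v \<in> tangent_space A p \<Longrightarrow> c \<notin> charts_at A p \<Longrightarrow> v c = 0"
  unfolding tangent_space_def by blast

lemma trans_deriv_linear_at:
  assumes "c \<in> charts_at A p" "d \<in> charts_at A p" shows "linear (trans_deriv c d (snd c p))"
  using trans_deriv_linear[OF charts_atD(1)[OF assms(1)] charts_atD(1)[OF assms(2)]] overlapI[OF _ _ assms] assms charts_atD
  by blast

lemma subspace_tangent: "subspace (tangent_space A p)"
proof (rule subspaceI)
  obtain c where c: "c \<in> charts_at A p" using ex_chart by blast
  note lin = trans_deriv_linear_at[OF c]
  show "0 \<in> tangent_space A p" by (rule tangentI[OF c]) (simp_all add: linear_0[OF lin])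
  show "u + v \<in> tangent_space A p" if uv: "u \<in> tangent_space A p" "v \<in> tangent_space A p" for u v
  proof (rule tangentI[OF c])
    show "(u + v) d = trans_deriv c d (snd c p) ((u + v) c)" if d: "d \<in> charts_at A p" for d
      using tangent_transform[OF c d uv(1)] tangent_transform[OF c d uv(2)] linear_add[OF lin[OF d], of "u c" "v c"]
      by (simp only: plus_fun_apply)
    show "(u + v) d = 0" if "d \<notin> charts_at A p" for d
      using tangent_zero[OF uv(1) that] tangent_zero[OF uv(2) that] by simp
  qed
  show "r *\<^sub>R u \<in> tangent_space A p" if u: "u \<in> tangent_space A p" for r u
  proof (rule tangentI[OF c])
    show "(r *\<^sub>R u) d = trans_deriv c d (snd c p) ((r *\<^sub>R u) c)" if d: "d \<in> charts_at A p" for d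
      using tangent_transform[OF c d u] linear_scale[OF lin[OF d], of r "u c"] by (simp only: scaleR_fun_def)
    show "(r *\<^sub>R u) d = 0" if "d \<notin> charts_at A p" for d
      using tangent_zero[OF u that] by (simp add: scaleR_fun_def)
  qed
qed

lemma tangent_eqI:
  assumes "c \<in> charts_at A p" "u \<in> tangent_space A p" "v \<in> tangent_space A p" "u c = v c"
  shows "u = v"
  using coord_vector_of_tangent[OF A assms(1,2)] coord_vector_of_tangent[OF A assms(1,3)] assms(4) by metis

end

locale semi_riemannian = manifold A for A :: "('m::t2_space, 'e::euclidean_space) chart set" +
  fixes g :: "('m, 'e) metric"
  assumes g: "semi_riemannian_metric A g"
begin

abbreviation "metr c x u v \<equiv> metric_coeff A g c u v x"

definition metr_deriv :: "('m, 'e) chart \<Rightarrow> 'e \<Rightarrow> 'e \<Rightarrow> 'e \<Rightarrow> 'e \<Rightarrow> real" where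
  "metr_deriv c x w u v = frechet_derivative (metric_coeff A g c u v) (at x) w"

definition Gam :: "('m, 'e) chart \<Rightarrow> 'e \<Rightarrow> 'e \<Rightarrow> 'e \<Rightarrow> 'e" where
  "Gam c x u v = christoffel A g c (chart_inv c x) u v"

definition dGam :: "('m, 'e) chart \<Rightarrow> 'e \<Rightarrow> 'e \<Rightarrow> 'e \<Rightarrow> 'e \<Rightarrow> 'e" where
  "dGam c x w u v = frechet_derivative (\<lambda>y. Gam c y u v) (at x) w"

text \<open>The coordinate expression of the curvature. The brackets of coordinate fields vanish.\<close>
definition Riem :: "('m, 'e) chart \<Rightarrow> 'e \<Rightarrow> 'e \<Rightarrow> 'e \<Rightarrow> 'e \<Rightarrow> 'e" where
  "Riem c x u v w = dGam c x u v w - dGam c x v u w + Gam c x u (Gam c x v w) - Gam c x v (Gam c x u w)"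

lemma metric_value:
  assumes "c \<in> charts_at A p" "u \<in> tangent_space A p" "v \<in> tangent_space A p"
  shows "g p u v = metr c (snd c p) (u c) (v c)"
  unfolding metric_coeff_def charts_atD(4)[OF assms(1)]
  using coord_vector_of_tangent[OF A assms(1,2)] coord_vector_of_tangent[OF A assms(1,3)] by simp

context
  fixes c assumes c: "c \<in> A"
begin

lemma open_image: "open (chart_image c)" using chart c by blast

lemma metr_smooth: "smooth_on (chart_image c) (metric_coeff A g c u v)"
  using g c unfolding semi_riemannian_metric_def by blast

lemma metr_has_derivative:
  "x \<in> chart_image c \<Longrightarrow> (metric_coeff A g c u v has_derivative (\<lambda>h. metr_deriv c x h u v)) (at x)"
  unfolding metr_deriv_def using smooth_on_has_derivative[OF metr_smooth] .

lemma metr_sym_form: "x \<in> chart_image c \<Longrightarrow> sym_form (metr c x)"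
  unfolding sym_form_def bilinear_def
proof (intro conjI allI linearI)
  assume x: "x \<in> chart_image c"
  note l = metric_coeff_lin[OF A g c x]
  show "metr c x u v = metr c x v u" for u v by (rule l(3))
  show "metr c x (u + v) w = metr c x u w + metr c x v w" for u v w by (rule l(1))
  then show "metr c x w (u + v) = metr c x w u + metr c x w v" for u v w using l(3) by metis
  show "metr c x (r *\<^sub>R u) w = r *\<^sub>R metr c x u w" for r u w using l(2) by simp
  then show "metr c x w (r *\<^sub>R u) = r *\<^sub>R metr c x w u" for r u w using l(3) by metis
qed

lemma metr_nondegenerate: "x \<in> chart_image c \<Longrightarrow> (\<And>z. metr c x w z = 0) \<Longrightarrow> w = 0"
  using metric_coeff_nondegenerate[OF A g charts_at_inv[OF c], of x w] chart(4)[OF c] by simp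

lemma metr_cancel:
  assumes "x \<in> chart_image c" "\<And>z. metr c x u z = metr c x v z" shows "u = v"
  using metr_nondegenerate[OF assms(1), of "u - v"] assms(2) sym_formD(9)[OF metr_sym_form[OF assms(1)]] by simp

lemma metr_deriv_bilinear: 
  assumes x: "x \<in> chart_image c" shows "sym_form (metr_deriv c x w)" "linear (\<lambda>w. metr_deriv c x w u v)"
proof -
  note l = metric_deriv_lin[OF A g c x, unfolded metric_deriv_def[OF A g], folded metr_deriv_def]
  show "sym_form (metr_deriv c x w)"
    unfolding sym_form_def bilinear_def
  proof (intro conjI allI linearI)
    show "metr_deriv c x w u v = metr_deriv c x w v u" for u v by (rule l(3))
    show "metr_deriv c x w (u + v) z = metr_deriv c x w u z + metr_deriv c x w v z" for u v z by (rule l(1))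
    then show "metr_deriv c x w z (u + v) = metr_deriv c x w z u + metr_deriv c x w z v" for u v z using l(3) by metis
    show "metr_deriv c x w (r *\<^sub>R u) z = r *\<^sub>R metr_deriv c x w u z" for r u z using l(2) by simp
    then show "metr_deriv c x w z (r *\<^sub>R u) = r *\<^sub>R metr_deriv c x w z u" for r u z using l(3) by metis
  qed
  show "linear (\<lambda>w. metr_deriv c x w u v)" using has_derivative_linear[OF metr_has_derivative[OF x]] .
qed

lemma koszul:
  assumes x: "x \<in> chart_image c"
  shows "2 * metr c x (Gam c x u v) z = metr_deriv c x u v z + metr_deriv c x v u z - metr_deriv c x z u v"
  using christoffel_koszul[OF A g charts_at_inv[OF c x], of u v z] chart(4)[OF c x]
  by (simp add: Gam_def metric_deriv_def[OF A g] metr_deriv_def)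

lemma metr_compatible:
  assumes x: "x \<in> chart_image c"
  shows "metr_deriv c x w u v = metr c x (Gam c x w u) v + metr c x u (Gam c x w v)"
  using christoffel_metric[OF A g charts_at_inv[OF c x], of u v w] chart(4)[OF c x]
  by (simp add: Gam_def metr_deriv_def)

lemma Gam_sym: "x \<in> chart_image c \<Longrightarrow> Gam c x u v = Gam c x v u"
  unfolding Gam_def by (rule christoffel_sym[OF A g charts_at_inv[OF c]])

lemma Gam_bilinear:
  assumes x: "x \<in> chart_image c" shows "bilinear (Gam c x)"
proof -
  note s = sym_formD[OF metr_sym_form[OF x]] and d = sym_formD[OF metr_deriv_bilinear(1)[OF x]]
    and w = linear_add[OF metr_deriv_bilinear(2)[OF x]] linear_scale[OF metr_deriv_bilinear(2)[OF x]]
  have 1: "Gam c x (u + u') v = Gam c x u v + Gam c x u' v" for u u' v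
  proof (rule metr_cancel[OF x])
    fix z
    have "2 * metr c x (Gam c x (u + u') v) z = 2 * metr c x (Gam c x u v) z + 2 * metr c x (Gam c x u' v) z"
      unfolding koszul[OF x] by (simp add: d(3,4) w)
    then show "metr c x (Gam c x (u + u') v) z = metr c x (Gam c x u v + Gam c x u' v) z" by (simp add: s(3))
  qed
  have 2: "Gam c x (r *\<^sub>R u) v = r *\<^sub>R Gam c x u v" for r u v
  proof (rule metr_cancel[OF x])
    fix z
    have "2 * metr c x (Gam c x (r *\<^sub>R u) v) z = r * (2 * metr c x (Gam c x u v) z)"
      unfolding koszul[OF x] by (simp add: d(5,6) w algebra_simps)
    then show "metr c x (Gam c x (r *\<^sub>R u) v) z = metr c x (r *\<^sub>R Gam c x u v) z" by (simp add: s(5))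
  qed
  show ?thesis unfolding bilinear_def
    using 1 2 Gam_sym[OF x] by (auto intro!: linearI)
qed

text \<open>By the Koszul formula the Christoffel map solves a linear system with smooth coefficients; the system is
  differentiated implicitly.\<close>
lemma Gam_C1:
  shows Gam_has_derivative: "\<And>x. x \<in> chart_image c \<Longrightarrow> ((\<lambda>y. Gam c y u v) has_derivative (\<lambda>h. dGam c x h u v)) (at x)"
    and dGam_continuous: "continuous_on (chart_image c) (\<lambda>x. dGam c x h u v)"
proof -
  let ?U = "chart_image c"
  define G where "G y a = (\<Sum>b\<in>Basis. metr c y a b *\<^sub>R (b::'e))" for y a
  define D where "D y h a = (\<Sum>b\<in>Basis. metr_deriv c y h a b *\<^sub>R (b::'e))" for y h a
  define k where "k y = (\<Sum>b\<in>Basis. ((metr_deriv c y u v b + metr_deriv c y v u b - metr_deriv c y b u v) / 2) *\<^sub>R (b::'e))" for y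
  define k' where "k' y h = (\<Sum>b\<in>Basis. ((frechet_derivative (\<lambda>y. metr_deriv c y u v b) (at y) h
    + frechet_derivative (\<lambda>y. metr_deriv c y v u b) (at y) h - frechet_derivative (\<lambda>y. metr_deriv c y b u v) (at y) h) / 2) *\<^sub>R (b::'e))" for y h
  have smooth_d: "smooth_on ?U (\<lambda>y. metr_deriv c y h a b)" for h a b
    unfolding metr_deriv_def by (rule smooth_on_frechet[OF metr_smooth])
  have G_lin: "linear (G y)" if "y \<in> ?U" for y
    using sym_formD[OF metr_sym_form[OF that]]
    by (intro linearI) (simp_all add: G_def scaleR_add_left sum.distrib scaleR_sum_right)
  have G_inner: "G y a \<bullet> b = metr c y a b" if "y \<in> ?U" for y a b
  proof -
    have "linear (metr c y a)" using metr_sym_form[OF that] by (simp add: sym_form_def bilinear_def)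
    from linear_basis_sum[OF this, of b] show ?thesis
      by (simp add: G_def inner_sum_left inner_commute[of b] mult.commute)
  qed
  have G_inj: "a = 0" if "y \<in> ?U" "G y a = 0" for y a
    using metr_nondegenerate[OF that(1), of a] G_inner[OF that(1), of a] that(2) by simp
  have G_deriv: "((\<lambda>y. G y a) has_derivative (\<lambda>h. D y h a)) (at y)" if "y \<in> ?U" for y a
    unfolding G_def D_def by (intro has_derivative_sum has_derivative_scaleR_left metr_has_derivative that)
  have k_deriv: "(k has_derivative k' y) (at y)" if "y \<in> ?U" for y
  proof -
    have "((\<lambda>y. (metr_deriv c y u v b + metr_deriv c y v u b - metr_deriv c y b u v) / 2) has_derivative
      (\<lambda>h. (frechet_derivative (\<lambda>y. metr_deriv c y u v b) (at y) h
    + frechet_derivative (\<lambda>y. metr_deriv c y v u b) (at y) h - frechet_derivative (\<lambda>y. metr_deriv c y b u v) (at y) h) / 2)) (at y)" for b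
      using smooth_on_has_derivative[OF smooth_d that] 
      by (intro bounded_linear.has_derivative[OF bounded_linear_divide] has_derivative_diff has_derivative_add)
    then show ?thesis unfolding k_def[abs_def] k'_def[abs_def] by (intro has_derivative_sum has_derivative_scaleR_left)
  qed
  have GGam: "G y (Gam c y u v) = k y" if "y \<in> ?U" for y
    unfolding G_def k_def using koszul[OF that] by (intro sum.cong refl) (simp add: field_simps)
  have ex: "\<exists>w'. (\<forall>h. G y (w' h) = k' y h - D y h (Gam c y u v)) \<and> ((\<lambda>y. Gam c y u v) has_derivative w') (at y)"
    if y: "y \<in> ?U" for y
  proof -
    have "inj (G y)" using G_inj[OF y] linear_injective_0[OF G_lin[OF y]] by blast
    then obtain f where f: "linear f" "\<And>x. G y (f x) = x"
      using linear_injective_isomorphism[OF G_lin[OF y]] by blast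
    define w' where "w' h = f (k' y h - D y h (Gam c y u v))" for h
    have "linear (k' y)" using k_deriv[OF y] has_derivative_linear by blast
    moreover have "linear (\<lambda>h. D y h a)" for a using G_deriv[OF y] has_derivative_linear by blast
    ultimately have "linear (\<lambda>h. k' y h - D y h (Gam c y u v))" by (intro linear_compose_sub)
    then have lin: "linear w'" unfolding w'_def[abs_def] using linear_compose[OF _ f(1)] by (simp add: comp_def)
    have at: "at y within ?U = at y" using at_within_open[OF y open_image] .
    have "((\<lambda>y. Gam c y u v) has_derivative w') (at y within ?U)"
    proof (rule linear_solution_has_derivative[where G = G and D = "D y" and k' = "k' y"])
      show "((\<lambda>y. G y (Gam c y u v)) has_derivative k' y) (at y within ?U)"
        by (rule has_derivative_transform[OF y _ has_derivative_at_withinI[OF k_deriv[OF y]]]) (rule GGam)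
      show "bounded_linear w'" using lin by (simp add: linear_conv_bounded_linear)
    qed (use G_lin y G_inj G_deriv[OF y] lin f(2) in \<open>auto simp: w'_def at\<close>)
    then show ?thesis using f(2) unfolding at by (intro exI[of _ w']) (auto simp: w'_def)
  qed
  have der: "((\<lambda>y. Gam c y u v) has_derivative (\<lambda>h. dGam c x h u v)) (at x)"
    and sol: "G x (dGam c x h u v) = k' x h - D x h (Gam c x u v)" if x: "x \<in> ?U" for x h
  proof -
    obtain w' where w': "\<And>h. G x (w' h) = k' x h - D x h (Gam c x u v)" "((\<lambda>y. Gam c y u v) has_derivative w') (at x)"
      using ex[OF x] by blast
    have eqw: "w' = (\<lambda>h. dGam c x h u v)" unfolding dGam_def using frechet_derivative_at[OF w'(2)] by simp
    show "((\<lambda>y. Gam c y u v) has_derivative (\<lambda>h. dGam c x h u v)) (at x)" using w'(2) unfolding eqw .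
    show "G x (dGam c x h u v) = k' x h - D x h (Gam c x u v)" using w'(1)[of h] unfolding eqw .
  qed
  show "((\<lambda>y. Gam c y u v) has_derivative (\<lambda>h. dGam c x h u v)) (at x)" if "x \<in> ?U" for x by (rule der[OF that])
  have cG: "continuous_on ?U (\<lambda>y. Gam c y u v)"
    by (intro continuous_at_imp_continuous_on ballI has_derivative_continuous[OF der])
  have ck: "continuous_on ?U (\<lambda>y. k' y h)"
    unfolding k'_def by (intro continuous_intros smooth_on_continuous smooth_on_frechet smooth_d) auto
  have cD: "continuous_on ?U (\<lambda>y. D y h (Gam c y u v))"
  proof (rule continuous_on_linear_apply[OF _ _ cG])
    show "linear (D y h)" if "y \<in> ?U" for y
      using sym_formD[OF metr_deriv_bilinear(1)[OF that]]
      by (intro linearI) (simp_all add: D_def scaleR_add_left sum.distrib scaleR_sum_right)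
    show "continuous_on ?U (\<lambda>y. D y h a)" for a
      unfolding D_def by (intro continuous_intros smooth_on_continuous smooth_d)
  qed
  show "continuous_on ?U (\<lambda>x. dGam c x h u v)"
    unfolding continuous_on_def
  proof
    fix x assume x: "x \<in> ?U"
    have ev: "\<forall>\<^sub>F y in at x within ?U. y \<in> ?U" by (simp add: eventually_at_filter)
    show "((\<lambda>x. dGam c x h u v) \<longlongrightarrow> dGam c x h u v) (at x within ?U)"
    proof (rule linear_solution_tendsto)
      show "\<forall>\<^sub>F y in at x within ?U. linear (G y)" using ev G_lin by (auto elim: eventually_mono)
      show "((\<lambda>y. G y b) \<longlongrightarrow> G x b) (at x within ?U)" for b
        using has_derivative_continuous[OF G_deriv[OF x], of b] unfolding continuous_at
        by (rule Lim_at_imp_Lim_at_within)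
      have "((\<lambda>y. k' y h - D y h (Gam c y u v)) \<longlongrightarrow> k' x h - D x h (Gam c x u v)) (at x within ?U)"
        using ck cD x by (intro tendsto_intros) (auto simp: continuous_on_def)
      then show "((\<lambda>y. G y (dGam c y h u v)) \<longlongrightarrow> G x (dGam c x h u v)) (at x within ?U)"
        unfolding sol[OF x] by (rule Lim_transform_eventually) (use ev sol in \<open>auto elim: eventually_mono\<close>)
    qed (use G_lin x G_inj in auto)
  qed
qed

lemma Gam_continuous: "continuous_on (chart_image c) (\<lambda>x. Gam c x u v)"
  by (intro continuous_at_imp_continuous_on ballI has_derivative_continuous[OF Gam_has_derivative])

lemma dGam_bilinear:
  assumes x: "x \<in> chart_image c"
  shows "bilinear (dGam c x h)" "linear (\<lambda>h. dGam c x h u v)" "dGam c x h u v = dGam c x h v u"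
proof -
  note D = Gam_has_derivative[OF x]
  have unique: "dGam c x h u v = f h" if "((\<lambda>y. Gam c y u v) has_derivative f) (at x)" for f u v h
    using has_derivative_unique[OF D that] by (simp add: fun_eq_iff)
  have bil: "bilinear (Gam c y)" if "y \<in> chart_image c" for y using Gam_bilinear[OF that] .
  show lin: "linear (\<lambda>h. dGam c x h u v)" for u v using has_derivative_linear[OF D] .
  show sym: "dGam c x h u v = dGam c x h v u" for u v
    by (rule unique[OF has_derivative_transform_within_open[OF D open_image x]]) (rule Gam_sym)
  have add: "dGam c x h (u + u') v = dGam c x h u v + dGam c x h u' v" for u u' v
    by (rule unique[OF has_derivative_transform_within_open[OF has_derivative_add[OF D D] open_image x]])
      (use bilinear_ladd[OF bil] in auto)
  have scale: "dGam c x h (r *\<^sub>R u) v = r *\<^sub>R dGam c x h u v" for r u v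
    by (rule unique[OF has_derivative_transform_within_open[OF has_derivative_scaleR_right[OF D] open_image x]])
      (use bilinear_lmul[OF bil] in auto)
  show "bilinear (dGam c x h)"
    unfolding bilinear_def
  proof (intro conjI allI linearI)
    show "dGam c x h w (u + v) = dGam c x h w u + dGam c x h w v" for u v w using add sym by metis
    show "dGam c x h w (r *\<^sub>R u) = r *\<^sub>R dGam c x h w u" for r u w using scale sym by metis
  qed (rule add scale)+
qed

text \<open>The second derivatives of the metric coefficients are symmetric. Expanding them by metric compatibility gives
  the antisymmetry.\<close>
lemma Riem_antisym:
  assumes x: "x \<in> chart_image c"
  shows "metr c x (Riem c x u v w) z = - metr c x w (Riem c x u v z)"
proof -
  note s = sym_formD[OF metr_sym_form[OF x]]
  define H where "H u v = frechet_derivative (\<lambda>y. metr_deriv c y v w z) (at x) u" for u v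
  have H: "H u v = metr_deriv c x u (Gam c x v w) z + metr c x (dGam c x u v w) z
      + metr_deriv c x u w (Gam c x v z) + metr c x w (dGam c x u v z)" for u v
  proof -
    have lin: "linear (metr c y a)" "linear (\<lambda>b. metr c y b a)" if "y \<in> chart_image c" for y a
      using metr_sym_form[OF that] by (simp_all add: sym_form_def bilinear_def)
    have dlin: "linear (metr_deriv c x h a)" "linear (\<lambda>b. metr_deriv c x h b a)" for h a
      using metr_deriv_bilinear(1)[OF x] by (simp_all add: sym_form_def bilinear_def)
    have 1: "((\<lambda>y. metr c y (Gam c y v w) z) has_derivative
      (\<lambda>h. metr_deriv c x h (Gam c x v w) z + metr c x (dGam c x h v w) z)) (at x)"
      by (rule has_derivative_linear_apply_at[where f = "\<lambda>y a. metr c y a z" and D = "\<lambda>h a. metr_deriv c x h a z", OF open_image x])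
        (use lin dlin metr_has_derivative[OF x] Gam_has_derivative[OF x] in auto)
    have 2: "((\<lambda>y. metr c y w (Gam c y v z)) has_derivative
      (\<lambda>h. metr_deriv c x h w (Gam c x v z) + metr c x w (dGam c x h v z))) (at x)"
      by (rule has_derivative_linear_apply_at[where f = "\<lambda>y a. metr c y w a" and D = "\<lambda>h a. metr_deriv c x h w a", OF open_image x])
        (use lin dlin metr_has_derivative[OF x] Gam_has_derivative[OF x] in auto)
    have "((\<lambda>y. metr_deriv c y v w z) has_derivative
      (\<lambda>h. (metr_deriv c x h (Gam c x v w) z + metr c x (dGam c x h v w) z)
        + (metr_deriv c x h w (Gam c x v z) + metr c x w (dGam c x h v z)))) (at x)"
      by (rule has_derivative_transform_within_open[OF has_derivative_add[OF 1 2] open_image x])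
        (simp add: metr_compatible)
    from fun_cong[OF frechet_derivative_at[OF this], of u] show ?thesis unfolding H_def by simp
  qed
  have "H u v = H v u"
    unfolding H_def metr_deriv_def by (rule second_derivative_symmetric[OF metr_smooth open_image x])
  then show ?thesis
    unfolding H metr_compatible[OF x] Riem_def by (simp add: s(3,4,9,10))
qed

lemma Riem_swap: "Riem c x u v w = - Riem c x v u w"
  by (simp add: Riem_def)

lemma Riem_bianchi:
  assumes x: "x \<in> chart_image c"
  shows "Riem c x u v w + Riem c x v w u + Riem c x w u v = 0"
  using Gam_sym[OF x] dGam_bilinear(3)[OF x] by (simp add: Riem_def)

text \<open>The first Bianchi identity is summed over the four cyclic triples of \<open>u\<close>, \<open>v\<close>, \<open>w\<close>, \<open>z\<close>.\<close>
lemma Riem_pair_sym: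
  assumes x: "x \<in> chart_image c"
  shows "metr c x (Riem c x u v w) z = metr c x (Riem c x w z u) v"
proof -
  note s = sym_formD[OF metr_sym_form[OF x]]
  define r where "r u v w z = metr c x (Riem c x u v w) z" for u v w z
  have neg: "metr c x (- a) b = - metr c x a b" for a b using s(5)[of "-1"] by simp
  have 1: "r u v w z = - r v u w z" for u v w z unfolding r_def using Riem_swap[of x u v w] neg by simp
  have 2: "r u v w z = - r u v z w" for u v w z unfolding r_def using Riem_antisym[OF x, of u v w z] s(2) by simp
  have 3: "r u v w z + r v w u z + r w u v z = 0" for u v w z
    unfolding r_def s(3)[symmetric] Riem_bianchi[OF x] by (rule s(7))
  show ?thesis
    using 3[of u v w z] 3[of v w z u] 3[of w z u v] 3[of z u v w] 1 2
    unfolding r_def[symmetric] by (smt (verit))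
qed

lemma Riem_linear: 
  assumes x: "x \<in> chart_image c" shows "linear (\<lambda>v. Riem c x u v w)"
proof -
  have 1: "linear (Gam c x a)" "linear (\<lambda>b. Gam c x b a)" for a using Gam_bilinear[OF x] by (simp_all add: bilinear_def)
  have 2: "linear (\<lambda>b. dGam c x a b w)" for a using dGam_bilinear(1)[OF x] by (simp add: bilinear_def)
  show ?thesis unfolding Riem_def
    using linear_compose[OF 1(2) 1(1)]
    by (intro linear_compose_sub linear_compose_add 2 dGam_bilinear(2)[OF x] 1) (simp_all add: comp_def)
qed

end

section \<open>Change of charts\<close>

context
  fixes c d :: "('m, 'e) chart" and x :: 'e
  assumes cd: "c \<in> A" "d \<in> A" and x: "x \<in> overlap c d"
begin

lemma metr_transform:
  "metr c x u v = metr d (transition c d x) (trans_deriv c d x u) (trans_deriv c d x v)"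
proof -
  note o = overlapD[OF cd x]
  let ?p = "chart_inv c x"
  have sx: "snd c ?p = x" using o chart(4) cd by blast
  have "coord_vector A c u ?p = coord_vector A d (trans_deriv c d x u) ?p" for u
    using coord_vector_of_tangent[OF A o(5) coord_vector_tangent[OF A o(4)], of u] o(5) sx
    by (simp add: coord_vector_def trans_deriv_def)
  then show ?thesis unfolding metric_coeff_def o(3) by simp
qed

lemma trans_deriv_surj: "\<exists>z. w = trans_deriv c d x z"
proof -
  note o = overlapD[OF cd x]
  have "snd c (chart_inv c x) = x" using o chart(4) cd by blast
  then show ?thesis using trans_deriv_inverse[OF o(5,4), of w] by (metis)
qed

end

lemma metr_deriv_transform:
  assumes cd: "c \<in> A" "d \<in> A" and x: "x \<in> overlap c d"
  defines "T \<equiv> trans_deriv c d x" and "y \<equiv> transition c d x"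
  shows "metr_deriv c x w u v = metr_deriv d y (T w) (T u) (T v)
    + metr d y (trans_deriv2 c d x u w) (T v) + metr d y (T u) (trans_deriv2 c d x v w)"
proof -
  note o = overlapD[OF cd x]
  have "((\<lambda>z. metr d (transition c d z) (trans_deriv c d z u) (trans_deriv c d z v)) has_derivative
    (\<lambda>h. metr_deriv d y (T h) (T u) (T v) + metr d y (trans_deriv2 c d x u h) (T v) + metr d y (T u) (trans_deriv2 c d x v h))) (at x)"
    unfolding T_def y_def
  proof (rule has_derivative_bilinear_apply_at[OF open_overlap'[OF cd] x])
    show "bilinear (metr d (transition c d z))" if "z \<in> overlap c d" for z
      using sym_formD(1)[OF metr_sym_form[OF cd(2) overlapD(2)[OF cd that]]] .
    show "bilinear (metr_deriv d (transition c d x) (trans_deriv c d x h))" for h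
      using sym_formD(1)[OF metr_deriv_bilinear(1)[OF cd(2) o(2)]] .
    show "((\<lambda>z. metr d (transition c d z) a b) has_derivative (\<lambda>h. metr_deriv d (transition c d x) (trans_deriv c d x h) a b)) (at x)" for a b
      by (rule has_derivative_compose[OF transition_has_derivative[OF cd x] metr_has_derivative[OF cd(2) o(2)]])
  qed (rule trans_deriv_has_derivative[OF cd x])+
  then have "(metric_coeff A g c u v has_derivative
    (\<lambda>h. metr_deriv d y (T h) (T u) (T v) + metr d y (trans_deriv2 c d x u h) (T v) + metr d y (T u) (trans_deriv2 c d x v h))) (at x)"
    by (rule has_derivative_transform_within_open[OF _ open_overlap'[OF cd] x]) (rule metr_transform[OF cd, symmetric])
  from has_derivative_unique[OF metr_has_derivative[OF cd(1) o(1)] this] show ?thesis by (simp add: fun_eq_iff)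
qed

text \<open>The Koszul formula determines both sides. The second derivatives of the transition map remain because the
  transformation law of the metric is differentiated.\<close>
lemma Gam_transform:
  assumes cd: "c \<in> A" "d \<in> A" and x: "x \<in> overlap c d"
  defines "T \<equiv> trans_deriv c d x" and "y \<equiv> transition c d x"
  shows "Gam d y (T u) (T v) = T (Gam c x u v) - trans_deriv2 c d x u v"
proof (rule metr_cancel[OF cd(2)])
  note o = overlapD[OF cd x]
  show yd: "y \<in> chart_image d" using o by (simp add: y_def)
  note s = sym_formD[OF metr_sym_form[OF cd(2) yd]]
  note sym2 = trans_deriv2_sym[OF cd x]
  fix w
  obtain z where w: "w = T z" using trans_deriv_surj[OF cd x] unfolding T_def by blast
  let ?H = "trans_deriv2 c d x"
  have "2 * metr d y (T (Gam c x u v)) (T z) = 2 * metr c x (Gam c x u v) z"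
    using metr_transform[OF cd x] by (simp add: T_def y_def)
  also have "\<dots> = metr_deriv c x u v z + metr_deriv c x v u z - metr_deriv c x z u v" by (rule koszul[OF cd(1) o(1)])
  also have "\<dots> = (metr_deriv d y (T u) (T v) (T z) + metr_deriv d y (T v) (T u) (T z) - metr_deriv d y (T z) (T u) (T v))
      + (metr d y (?H v u) (T z) + metr d y (T v) (?H z u) + metr d y (?H u v) (T z) + metr d y (T u) (?H z v)
      - metr d y (?H u z) (T v) - metr d y (T u) (?H v z))"
    using metr_deriv_transform[OF cd x] unfolding T_def y_def by simp
  also have "\<dots> = 2 * metr d y (Gam d y (T u) (T v)) (T z) + 2 * metr d y (?H u v) (T z)"
    unfolding koszul[OF cd(2) yd] using sym2[of v u] sym2[of z u] sym2[of z v] s(2)[of "T v" "?H u z"] by simp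
  finally show "metr d y (Gam d y (T u) (T v)) w = metr d y (T (Gam c x u v) - ?H u v) w"
    unfolding w s(9) by linarith
qed

text \<open>The transformation law of the Christoffel map is differentiated. After antisymmetrisation the third derivatives
  of the transition map cancel by symmetry, and the second derivatives by the law itself.\<close>
lemma Riem_transform:
  assumes cd: "c \<in> A" "d \<in> A" and x: "x \<in> overlap c d"
  defines "T \<equiv> trans_deriv c d x" and "y \<equiv> transition c d x"
  shows "Riem d y (T u) (T v) (T w) = T (Riem c x u v w)"
proof -
  note o = overlapD[OF cd x]
  have yd: "y \<in> chart_image d" using o by (simp add: y_def)
  let ?H = "trans_deriv2 c d x" and ?K = "trans_deriv3 c d x"
  have lT: "linear T" unfolding T_def by (rule trans_deriv_linear[OF cd x])
  note T = linear_add[OF lT] linear_diff[OF lT]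
  have eq: "dGam d y (T w) (T u) (T v) + Gam d y (?H u w) (T v) + Gam d y (T u) (?H v w)
    = ?H (Gam c x u v) w + T (dGam c x w u v) - ?K u v w" for u v w
  proof -
    have 1: "((\<lambda>z. Gam d (transition c d z) (trans_deriv c d z u) (trans_deriv c d z v)) has_derivative
      (\<lambda>h. dGam d y (T h) (T u) (T v) + Gam d y (?H u h) (T v) + Gam d y (T u) (?H v h))) (at x)"
      unfolding T_def y_def
    proof (rule has_derivative_bilinear_apply_at[OF open_overlap'[OF cd] x])
      show "bilinear (Gam d (transition c d z))" if "z \<in> overlap c d" for z
        by (rule Gam_bilinear[OF cd(2) overlapD(2)[OF cd that]])
      show "bilinear (dGam d (transition c d x) (trans_deriv c d x h))" for h by (rule dGam_bilinear(1)[OF cd(2) o(2)])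
      show "((\<lambda>z. Gam d (transition c d z) a b) has_derivative (\<lambda>h. dGam d (transition c d x) (trans_deriv c d x h) a b)) (at x)" for a b
        by (rule has_derivative_compose[OF transition_has_derivative[OF cd x] Gam_has_derivative[OF cd(2) o(2)]])
    qed (rule trans_deriv_has_derivative[OF cd x])+
    have "((\<lambda>z. trans_deriv c d z (Gam c z u v)) has_derivative (\<lambda>h. ?H (Gam c x u v) h + T (dGam c x h u v))) (at x)"
      unfolding T_def
    proof (rule has_derivative_linear_apply_at[OF open_overlap'[OF cd] x, where D = "\<lambda>h a. ?H a h"])
      show "linear (\<lambda>a. ?H a h)" for h by (rule trans_deriv2_linear(2)[OF cd x])
    qed (use trans_deriv_linear[OF cd] trans_deriv_has_derivative[OF cd x] Gam_has_derivative[OF cd(1) o(1)] in auto)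
    from has_derivative_diff[OF this trans_deriv2_has_derivative[OF cd x, of u v]]
    have 2: "((\<lambda>z. trans_deriv c d z (Gam c z u v) - trans_deriv2 c d z u v) has_derivative
      (\<lambda>h. ?H (Gam c x u v) h + T (dGam c x h u v) - ?K u v h)) (at x)" .
    have "((\<lambda>z. Gam d (transition c d z) (trans_deriv c d z u) (trans_deriv c d z v)) has_derivative
      (\<lambda>h. ?H (Gam c x u v) h + T (dGam c x h u v) - ?K u v h)) (at x)"
      by (rule has_derivative_transform_within_open[OF 2 open_overlap'[OF cd] x]) (rule Gam_transform[OF cd, symmetric])
    from has_derivative_unique[OF 1 this] show ?thesis by (simp add: fun_eq_iff)
  qed
  have eq': "dGam d y (T w) (T u) (T v)
    = ?H (Gam c x u v) w + T (dGam c x w u v) - ?K u v w - Gam d y (?H u w) (T v) - Gam d y (T u) (?H v w)" for u v w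
    using eq[of w u v, unfolded eq_diff_eq] unfolding eq_diff_eq by (simp add: ac_simps)
  have law: "?H u v = T (Gam c x u v) - Gam d y (T u) (T v)" for u v
    using Gam_transform[OF cd x, of u v] by (simp add: T_def y_def)
  note sym2 = trans_deriv2_sym[OF cd x]
  have K: "?K v w u = ?K u w v"
    using trans_deriv3_sym[OF cd x] trans_deriv3_sym'[OF cd x] by metis
  have Gd: "Gam d y a (b - b') = Gam d y a b - Gam d y a b'" for a b b'
    by (rule bilinear_rsub[OF Gam_bilinear[OF cd(2) yd]])
  note Gs = Gam_sym[OF cd(2) yd] Gam_sym[OF cd(1) o(1)]
  have a1: "Gam d y (T v) (?H w u) = Gam d y (T v) (T (Gam c x u w)) - Gam d y (T v) (Gam d y (T u) (T w))"
    by (simp only: law[of u w] sym2[of w u] Gd)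
  have a2: "Gam d y (T u) (?H w v) = Gam d y (T u) (T (Gam c x v w)) - Gam d y (T u) (Gam d y (T v) (T w))"
    by (simp only: law[of v w] sym2[of w v] Gd)
  have b1: "?H (Gam c x v w) u = T (Gam c x u (Gam c x v w)) - Gam d y (T u) (T (Gam c x v w))"
    by (simp only: law[of u "Gam c x v w"] sym2[of "Gam c x v w" u])
  have b2: "?H (Gam c x u w) v = T (Gam c x v (Gam c x u w)) - Gam d y (T v) (T (Gam c x u w))"
    by (simp only: law[of v "Gam c x u w"] sym2[of "Gam c x u w" v])
  have "dGam d y (T u) (T v) (T w) - dGam d y (T v) (T u) (T w)
     = (?H (Gam c x v w) u + T (dGam c x u v w) - ?K v w u - Gam d y (?H v u) (T w) - Gam d y (T v) (?H w u))
      - (?H (Gam c x u w) v + T (dGam c x v u w) - ?K u w v - Gam d y (?H u v) (T w) - Gam d y (T u) (?H w v))"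
    unfolding eq' ..
  also have "\<dots> = T (Gam c x u (Gam c x v w)) - T (Gam c x v (Gam c x u w)) + T (dGam c x u v w) - T (dGam c x v u w)
     + Gam d y (T v) (Gam d y (T u) (T w)) - Gam d y (T u) (Gam d y (T v) (T w))"
    unfolding a1 a2 b1 b2 K sym2[of v u] by simp
  finally show ?thesis unfolding Riem_def T by simp
qed

text \<open>The fields in the definition of the curvature have constant components and vanishing brackets.\<close>
lemma curvature_chart:
  assumes c: "c \<in> charts_at A p"
  shows "curvature A g p u v w c = Riem c (snd c p) (u c) (v c) (w c)"
proof -
  let ?x = "snd c p"
  note cA = charts_atD(1)[OF c] and x = charts_atD(3)[OF c] and p = charts_atD(4)[OF c]
  have op: "open (chart_image c)" by (rule open_image[OF cA])
  let ?X = "\<lambda>u. coord_vector A c u"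
  have X: "?X u (chart_inv c y) c = u" if "y \<in> chart_image c" for u y
    using coord_vector_self[OF A charts_at_inv[OF cA that]] .
  have const: "frechet_derivative (\<lambda>y. ?X u (chart_inv c y) c) (at y) = (\<lambda>_. 0)" if "y \<in> chart_image c" for u y
  proof -
    have "((\<lambda>y. ?X u (chart_inv c y) c) has_derivative (\<lambda>_. 0)) (at y)"
      by (rule has_derivative_transform_within_open[OF has_derivative_const[of u] op that]) (rule X[symmetric])
    then show ?thesis by (rule frechet_derivative_at[symmetric])
  qed
  have nab: "nabla_field A g (?X v) (?X w) (chart_inv c y) c = Gam c y v w" if "y \<in> chart_image c" for y v w
    using charts_at_inv[OF cA that] chart(4)[OF cA that] const[OF that] X[OF that]
    by (simp add: nabla_field_def nabla_def Gam_def)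
  have nab2: "nabla_field A g (?X u) (nabla_field A g (?X v) (?X w)) p c = dGam c ?x u v w + Gam c ?x u (Gam c ?x v w)" for u v w
  proof -
    have "((\<lambda>y. nabla_field A g (?X v) (?X w) (chart_inv c y) c) has_derivative (\<lambda>h. dGam c ?x h v w)) (at ?x)"
      by (rule has_derivative_transform_within_open[OF Gam_has_derivative[OF cA x] op x]) (rule nab[symmetric])
    then have "frechet_derivative (\<lambda>y. nabla_field A g (?X v) (?X w) (chart_inv c y) c) (at ?x) = (\<lambda>h. dGam c ?x h v w)"
      using frechet_derivative_at by metis
    then show ?thesis
      using c X[OF x] nab[OF x] p unfolding nabla_field_def[of A g "?X u"] nabla_def by (simp add: Gam_def)
  qed
  have br: "lie_bracket A (?X u) (?X v) p c = 0" for u v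
    using c const[OF x] by (simp add: lie_bracket_def)
  have nab0: "nabla_field A g (lie_bracket A (?X u) (?X v)) (?X w) p c = 0" for u v w
  proof -
    have "christoffel A g c p 0 (?X w p c) = 0"
      using bilinear_lzero[OF Gam_bilinear[OF cA x]] p by (simp add: Gam_def)
    then show ?thesis using c const[OF x] br unfolding nabla_field_def nabla_def by simp
  qed
  show ?thesis
    unfolding curvature_def curvature_field_def using c by (simp add: nab2 nab0 Riem_def)
qed

end

section \<open>Jacobi fields along a geodesic\<close>

lemma has_vector_derivative_Un:
  fixes f :: "real \<Rightarrow> 'a::real_normed_vector"
  assumes "(f has_vector_derivative D) (at x within S)" "(f has_vector_derivative D) (at x within T)"
  shows "(f has_vector_derivative D) (at x within (S \<union> T))"
  using assms unfolding has_vector_derivative_def has_derivative_within by (auto intro: Lim_Un)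

lemma has_vector_derivative_outside:
  fixes f :: "real \<Rightarrow> 'a::real_normed_vector"
  assumes "closed S" "x \<notin> S" shows "(f has_vector_derivative D) (at x within S)"
proof -
  have "at x within S = bot" using assms closed_limpt trivial_limit_within trivial_limit_def trivial_limit_eq by metis
  then show ?thesis unfolding has_vector_derivative_def has_derivative_within
    by (auto intro: bounded_linear_scaleR_left)
qed

lemma glue_has_vector_derivative:
  fixes f f' :: "real \<Rightarrow> 'a::real_normed_vector"
  assumes pqr: "p \<le> q" "q \<le> r" and t: "t \<in> {p..r}" and eq: "f q = f' q"
    and f: "t \<le> q \<Longrightarrow> (f has_vector_derivative D) (at t within {p..q})"
    and f': "q \<le> t \<Longrightarrow> (f' has_vector_derivative D) (at t within {q..r})"
  shows "((\<lambda>t. if t \<le> q then f t else f' t) has_vector_derivative D) (at t within {p..r})"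
proof -
  let ?h = "\<lambda>t. if t \<le> q then f t else f' t"
  have "(?h has_vector_derivative D) (at t within {p..q})"
  proof (cases "t \<le> q")
    case True
    show ?thesis by (rule has_vector_derivative_transform[OF _ _ f[OF True]]) (use t True in auto)
  qed (auto intro: has_vector_derivative_outside)
  moreover have "(?h has_vector_derivative D) (at t within {q..r})"
  proof (cases "q \<le> t")
    case True
    show ?thesis by (rule has_vector_derivative_transform[OF _ _ f'[OF True]]) (use t True eq in auto)
  qed (auto intro: has_vector_derivative_outside)
  moreover have "{p..r} = {p..q} \<union> {q..r}" using pqr by auto
  ultimately show ?thesis using has_vector_derivative_Un by metis
qed

context semi_riemannian
begin

lemma Gam_tendsto:
  assumes c: "c \<in> A" and x: "(x \<longlongrightarrow> x0) F" "x0 \<in> chart_image c" and u: "(u \<longlongrightarrow> u0) F" and v: "(v \<longlongrightarrow> v0) F"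
  shows "((\<lambda>i. Gam c (x i) (u i) (v i)) \<longlongrightarrow> Gam c x0 u0 v0) F"
proof (rule bilinear_apply_tendsto[OF _ _ _ u v])
  have ev: "\<forall>\<^sub>F i in F. x i \<in> chart_image c" by (rule topological_tendstoD[OF x(1) open_image[OF c] x(2)])
  then show "\<forall>\<^sub>F i in F. bilinear (Gam c (x i))" by eventually_elim (rule Gam_bilinear[OF c])
  show "bilinear (Gam c x0)" by (rule Gam_bilinear[OF c x(2)])
  show "((\<lambda>i. Gam c (x i) b b') \<longlongrightarrow> Gam c x0 b b') F" for b b'
    by (rule continuous_on_tendsto_compose[OF Gam_continuous[OF c] x ev])
qed

lemma metr_tendsto:
  assumes c: "c \<in> A" and x: "(x \<longlongrightarrow> x0) F" "x0 \<in> chart_image c" and u: "(u \<longlongrightarrow> u0) F" and v: "(v \<longlongrightarrow> v0) F"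
  shows "((\<lambda>i. metr c (x i) (u i) (v i)) \<longlongrightarrow> metr c x0 u0 v0) F"
proof (rule bilinear_apply_tendsto[OF _ _ _ u v])
  have ev: "\<forall>\<^sub>F i in F. x i \<in> chart_image c" by (rule topological_tendstoD[OF x(1) open_image[OF c] x(2)])
  then show "\<forall>\<^sub>F i in F. bilinear (metr c (x i))"
    by eventually_elim (rule sym_formD(1)[OF metr_sym_form[OF c]])
  show "bilinear (metr c x0)" by (rule sym_formD(1)[OF metr_sym_form[OF c x(2)]])
  show "((\<lambda>i. metr c (x i) b b') \<longlongrightarrow> metr c x0 b b') F" for b b'
    by (rule continuous_on_tendsto_compose[OF smooth_on_continuous[OF metr_smooth[OF c]] x ev])
qed

lemma dGam_tendsto:
  assumes c: "c \<in> A" and x: "(x \<longlongrightarrow> x0) F" "x0 \<in> chart_image c"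
    and u: "(u \<longlongrightarrow> u0) F" and v: "(v \<longlongrightarrow> v0) F" and w: "(w \<longlongrightarrow> w0) F"
  shows "((\<lambda>i. dGam c (x i) (u i) (v i) (w i)) \<longlongrightarrow> dGam c x0 u0 v0 w0) F"
proof (rule linear_apply_tendsto[where G = "\<lambda>i u. dGam c (x i) u (v i) (w i)", OF _ _ _ u])
  have ev: "\<forall>\<^sub>F i in F. x i \<in> chart_image c" by (rule topological_tendstoD[OF x(1) open_image[OF c] x(2)])
  then show "\<forall>\<^sub>F i in F. linear (\<lambda>u. dGam c (x i) u (v i) (w i))"
    by eventually_elim (rule dGam_bilinear(2)[OF c])
  show "linear (\<lambda>u. dGam c x0 u v0 w0)" by (rule dGam_bilinear(2)[OF c x(2)])
  show "((\<lambda>i. dGam c (x i) h (v i) (w i)) \<longlongrightarrow> dGam c x0 h v0 w0) F" for h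
  proof (rule bilinear_apply_tendsto[OF _ _ _ v w])
    from ev show "\<forall>\<^sub>F i in F. bilinear (dGam c (x i) h)" by eventually_elim (rule dGam_bilinear(1)[OF c])
    show "bilinear (dGam c x0 h)" by (rule dGam_bilinear(1)[OF c x(2)])
    show "((\<lambda>i. dGam c (x i) h b b') \<longlongrightarrow> dGam c x0 h b b') F" for b b'
      by (rule continuous_on_tendsto_compose[OF dGam_continuous[OF c] x ev])
  qed
qed

lemma Riem_tendsto:
  assumes c: "c \<in> A" and x: "(x \<longlongrightarrow> x0) F" "x0 \<in> chart_image c"
    and u: "(u \<longlongrightarrow> u0) F" and v: "(v \<longlongrightarrow> v0) F" and w: "(w \<longlongrightarrow> w0) F"
  shows "((\<lambda>i. Riem c (x i) (u i) (v i) (w i)) \<longlongrightarrow> Riem c x0 u0 v0 w0) F"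
  unfolding Riem_def by (intro tendsto_intros dGam_tendsto Gam_tendsto c x u v w)

text \<open>The coefficients of the first order system for a Jacobi field and its covariant derivative, at a point
  with coordinates \<open>x\<close> where the geodesic has velocity \<open>u\<close>.\<close>
definition jacobi_coeff :: "('m, 'e) chart \<Rightarrow> 'e \<Rightarrow> 'e \<Rightarrow> 'e \<times> 'e \<Rightarrow> 'e \<times> 'e" where
  "jacobi_coeff c x u y = (snd y - Gam c x u (fst y), Riem c x u (fst y) u - Gam c x u (snd y))"

lemma jacobi_coeff_linear:
  assumes "c \<in> A" "x \<in> chart_image c" shows "linear (jacobi_coeff c x u)"
proof -
  have G: "Gam c x u (a + b) = Gam c x u a + Gam c x u b" "Gam c x u (r *\<^sub>R a) = r *\<^sub>R Gam c x u a" for a b r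
    using bilinear_radd[OF Gam_bilinear[OF assms]] bilinear_rmul[OF Gam_bilinear[OF assms]] by auto
  show ?thesis
    by (intro linearI) (simp_all add: jacobi_coeff_def G linear_add[OF Riem_linear[OF assms]]
      linear_scale[OF Riem_linear[OF assms]] scaleR_diff_right)
qed

lemma jacobi_coeff_linear_at: "c \<in> charts_at A p \<Longrightarrow> linear (jacobi_coeff c (snd c p) u)"
  by (rule jacobi_coeff_linear[OF charts_atD(1) charts_atD(3)])

lemma jacobi_coeff_tendsto:
  assumes "c \<in> A" "(x \<longlongrightarrow> x0) F" "x0 \<in> chart_image c" "(u \<longlongrightarrow> u0) F" "(y \<longlongrightarrow> y0) F"
  shows "((\<lambda>i. jacobi_coeff c (x i) (u i) (y i)) \<longlongrightarrow> jacobi_coeff c x0 u0 y0) F"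
  unfolding jacobi_coeff_def using assms by (intro tendsto_intros Riem_tendsto Gam_tendsto) auto

end

locale geodesic_segment = semi_riemannian A g
  for A :: "('m::t2_space, 'e::euclidean_space) chart set" and g +
  fixes a b :: real and \<gamma> :: "real \<Rightarrow> 'm"
  assumes ab: "a < b" and geo: "geodesic A g a b \<gamma>"
begin

abbreviation "vel \<equiv> velocity A a b \<gamma>"
abbreviation "crd c t \<equiv> snd c (\<gamma> t)"

lemma vel_tangent: "t \<in> {a..b} \<Longrightarrow> vel t \<in> tangent_space A (\<gamma> t)"
  using geo unfolding geodesic_def field_along_def by blast

lemma curve_continuous: "continuous_on {a..b} \<gamma>"
  using geo unfolding geodesic_def by blast

lemma curve_deriv:
  assumes t: "t \<in> {a..b}" and c: "c \<in> charts_at A (\<gamma> t)"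
  shows "(crd c has_vector_derivative vel t c) (at t within {a..b})"
proof -
  have "(snd c \<circ> \<gamma>) differentiable (at t within {a..b})" using geo t c unfolding geodesic_def by blast
  then show ?thesis using c unfolding vector_derivative_works velocity_def by (simp add: comp_def)
qed

text \<open>The vector \<open>Y\<close> is the covariant derivative at time \<open>t\<close> of the field \<open>X\<close>, read in the chart \<open>c\<close>. As a relation it
  also makes sense on subintervals, where local solutions are constructed before they are glued.\<close>
definition cov_deriv_at :: "real set \<Rightarrow> (real \<Rightarrow> ('m, 'e) tvec) \<Rightarrow> ('m, 'e) tvec \<Rightarrow> ('m, 'e) chart \<Rightarrow> real \<Rightarrow> bool" where
  "cov_deriv_at I X Y c t \<longleftrightarrow>
    ((\<lambda>s. X s c) has_vector_derivative (Y c - Gam c (crd c t) (vel t c) (X t c))) (at t within I)"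

lemma Gam_crd: "c \<in> charts_at A (\<gamma> t) \<Longrightarrow> Gam c (crd c t) = christoffel A g c (\<gamma> t)"
  using charts_atD by (simp add: Gam_def fun_eq_iff)

lemma cov_deriv_at_iff:
  assumes t: "t \<in> {a..b}" and c: "c \<in> charts_at A (\<gamma> t)"
  shows "cov_deriv_at {a..b} X Y c t \<longleftrightarrow> (\<lambda>s. X s c) differentiable (at t within {a..b}) \<and> covariant_deriv A g a b \<gamma> X t c = Y c"
proof
  assume *: "cov_deriv_at {a..b} X Y c t"
  note D = *[unfolded cov_deriv_at_def]
  show "(\<lambda>s. X s c) differentiable (at t within {a..b}) \<and> covariant_deriv A g a b \<gamma> X t c = Y c"
    using differentiableI_vector[OF D] vector_derivative_within_closed_interval[OF ab t D] c
    by (simp add: covariant_deriv_def Gam_crd[OF c])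
next
  assume *: "(\<lambda>s. X s c) differentiable (at t within {a..b}) \<and> covariant_deriv A g a b \<gamma> X t c = Y c"
  then have "vector_derivative (\<lambda>s. X s c) (at t within {a..b}) = Y c - christoffel A g c (\<gamma> t) (vel t c) (X t c)"
    using c by (simp add: covariant_deriv_def eq_diff_eq)
  then show "cov_deriv_at {a..b} X Y c t"
    using * unfolding cov_deriv_at_def vector_derivative_works Gam_crd[OF c] by simp
qed

lemma vel_parallel: "t \<in> {a..b} \<Longrightarrow> c \<in> charts_at A (\<gamma> t) \<Longrightarrow> cov_deriv_at {a..b} vel 0 c t"
  using geo cov_deriv_at_iff[of t c vel 0] unfolding geodesic_def field_along_def by auto

lemma stays_in_open:
  assumes I: "I \<subseteq> {a..b}" "t \<in> I" and U: "open U" "\<gamma> t \<in> U"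
  obtains W where "open W" "t \<in> W" "I \<inter> W = {s \<in> I. \<gamma> s \<in> U}"
proof -
  obtain W where W: "open W" "W \<inter> I = \<gamma> -` U \<inter> I"
    using continuous_on_subset[OF curve_continuous I(1)] U(1) unfolding continuous_on_open_invariant by blast
  show thesis by (rule that[OF W(1)]) (use W I U in auto)
qed

text \<open>The second derivative of the transition map cancels against the one in \<open>Gam_transform\<close>.\<close>
lemma cov_deriv_at_transform:
  assumes I: "I \<subseteq> {a..b}" "t \<in> I" and X: "\<And>s. s \<in> I \<Longrightarrow> X s \<in> tangent_space A (\<gamma> s)"
    and c: "c \<in> charts_at A (\<gamma> t)" and d: "d \<in> charts_at A (\<gamma> t)" and D: "cov_deriv_at I X Y c t"
    and Y: "Y d = trans_deriv c d (crd c t) (Y c)"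
  shows "cov_deriv_at I X Y d t"
proof -
  have t: "t \<in> {a..b}" using I by blast
  note cA = charts_atD(1)[OF c] and dA = charts_atD(1)[OF d]
  have o: "crd c t \<in> overlap c d" by (rule overlapI[OF cA dA c d])
  have eqt: "transition c d (crd c t) = crd d t" using charts_atD(4)[OF c] by (simp add: transition_def)
  obtain W where W: "open W" "t \<in> W" "I \<inter> W = {s \<in> I. \<gamma> s \<in> fst c \<inter> fst d}"
    using stays_in_open[OF I, of "fst c \<inter> fst d"] chart(1) cA dA charts_atD(2)[OF c] charts_atD(2)[OF d] by blast
  let ?S = "I \<inter> W"
  have at: "at t within ?S = at t within I" by (rule at_within_nhd[OF W(2,1)]) auto
  have tS: "t \<in> ?S" using I W by blast
  have S: "c \<in> charts_at A (\<gamma> s)" "d \<in> charts_at A (\<gamma> s)" "crd c s \<in> overlap c d" if "s \<in> ?S" for s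
    using that W(3) cA dA by (auto simp: charts_at_def overlap_def)
  let ?v = "vel t c" and ?x = "crd c t"
  have crdD: "(crd c has_derivative (\<lambda>h. h *\<^sub>R ?v)) (at t within ?S)"
    using has_vector_derivative_within_subset[OF curve_deriv[OF t c], of ?S] I(1)
    unfolding has_vector_derivative_def by blast
  have "((\<lambda>s. trans_deriv c d (crd c s) (X s c)) has_derivative
    (\<lambda>h. trans_deriv2 c d ?x (X t c) (h *\<^sub>R ?v) + trans_deriv c d ?x (h *\<^sub>R (Y c - Gam c ?x ?v (X t c))))) (at t within ?S)"
  proof (rule has_derivative_linear_apply[where D = "\<lambda>h a. trans_deriv2 c d ?x a (h *\<^sub>R ?v)", OF _ tS])
    show "linear (trans_deriv c d (crd c s))" if "s \<in> ?S" for s by (rule trans_deriv_linear[OF cA dA S(3)[OF that]])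
    show "linear (\<lambda>a. trans_deriv2 c d ?x a (h *\<^sub>R ?v))" for h by (rule trans_deriv2_linear(2)[OF cA dA o])
    show "((\<lambda>s. trans_deriv c d (crd c s) u) has_derivative (\<lambda>h. trans_deriv2 c d ?x u (h *\<^sub>R ?v))) (at t within ?S)" for u
      by (rule has_derivative_compose[OF crdD trans_deriv_has_derivative[OF cA dA o]])
    show "((\<lambda>s. X s c) has_derivative (\<lambda>h. h *\<^sub>R (Y c - Gam c ?x ?v (X t c)))) (at t within ?S)"
      using D unfolding cov_deriv_at_def has_vector_derivative_def at .
  qed
  moreover have "trans_deriv2 c d ?x (X t c) (h *\<^sub>R ?v) + trans_deriv c d ?x (h *\<^sub>R (Y c - Gam c ?x ?v (X t c)))
     = h *\<^sub>R (Y d - Gam d (crd d t) (vel t d) (X t d))" for h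
  proof -
    note lin = trans_deriv_linear[OF cA dA o]
    have "trans_deriv2 c d ?x (X t c) ?v = trans_deriv c d ?x (Gam c ?x ?v (X t c)) - Gam d (crd d t) (vel t d) (X t d)"
      using Gam_transform[OF cA dA o, of ?v "X t c"] trans_deriv2_sym[OF cA dA o, of "X t c" ?v]
        tangent_transform[OF c d vel_tangent[OF t]] tangent_transform[OF c d X[OF I(2)]] by (simp add: eqt)
    then show ?thesis
      using linear_scale[OF trans_deriv2_linear(1)[OF cA dA o]] Y
      by (simp add: linear_scale[OF lin] linear_diff[OF lin] scaleR_diff_right)
  qed
  ultimately have "((\<lambda>s. trans_deriv c d (crd c s) (X s c)) has_vector_derivative (Y d - Gam d (crd d t) (vel t d) (X t d))) (at t within ?S)"
    unfolding has_vector_derivative_def by (simp only:)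
  then have "((\<lambda>s. X s d) has_vector_derivative (Y d - Gam d (crd d t) (vel t d) (X t d))) (at t within ?S)"
    by (rule has_vector_derivative_transform[OF tS, rotated])
      (use tangent_transform S X in blast)
  then show ?thesis unfolding cov_deriv_at_def at .
qed

lemma metric_product_rule:
  assumes t: "t \<in> {a..b}" and X: "\<And>s. s \<in> {a..b} \<Longrightarrow> X s \<in> tangent_space A (\<gamma> s)" "\<And>s. s \<in> {a..b} \<Longrightarrow> Y s \<in> tangent_space A (\<gamma> s)"
    and X': "X' \<in> tangent_space A (\<gamma> t)" "Y' \<in> tangent_space A (\<gamma> t)"
    and D: "c \<in> charts_at A (\<gamma> t)" "cov_deriv_at {a..b} X X' c t" "cov_deriv_at {a..b} Y Y' c t"
  shows "((\<lambda>s. g (\<gamma> s) (X s) (Y s)) has_real_derivative g (\<gamma> t) X' (Y t) + g (\<gamma> t) (X t) Y') (at t within {a..b})"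
proof -
  note c = D(1) and cA = charts_atD(1)[OF D(1)] and xt = charts_atD(3)[OF D(1)]
  obtain W where W: "open W" "t \<in> W" "{a..b} \<inter> W = {s \<in> {a..b}. \<gamma> s \<in> fst c}"
    using stays_in_open[OF order_refl t, of "fst c"] chart(1) cA charts_atD(2)[OF c] by blast
  let ?S = "{a..b} \<inter> W"
  have at: "at t within ?S = at t within {a..b}" by (rule at_within_nhd[OF W(2,1)]) auto
  have tS: "t \<in> ?S" using t W by blast
  have S: "c \<in> charts_at A (\<gamma> s)" "s \<in> {a..b}" if "s \<in> ?S" for s
    using that W(3) cA by (auto simp: charts_at_def)
  let ?v = "vel t c" and ?x = "crd c t"
  note sx = sym_formD[OF metr_sym_form[OF cA xt]]
  have crdD: "(crd c has_derivative (\<lambda>h. h *\<^sub>R ?v)) (at t within ?S)"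
    using curve_deriv[OF t c] unfolding has_vector_derivative_def at .
  have lin: "linear (metr c (crd c s) u)" "linear (\<lambda>u. metr c (crd c s) u w)" if "s \<in> ?S" for s u w
    using sym_formD(1)[OF metr_sym_form[OF cA charts_atD(3)[OF S(1)[OF that]]]] by (simp_all add: bilinear_def)
  have dlin: "linear (metr_deriv c ?x h u)" "linear (\<lambda>u. metr_deriv c ?x h u w)" for h u w
    using sym_formD(1)[OF metr_deriv_bilinear(1)[OF cA xt]] by (simp_all add: bilinear_def)
  let ?X = "X' c - Gam c ?x ?v (X t c)" and ?Y = "Y' c - Gam c ?x ?v (Y t c)"
  have 1: "((\<lambda>s. metr c (crd c s) (X s c) w) has_derivative
    (\<lambda>h. metr_deriv c ?x (h *\<^sub>R ?v) (X t c) w + metr c ?x (h *\<^sub>R ?X) w)) (at t within ?S)" for w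
  proof (rule has_derivative_linear_apply[where f = "\<lambda>s u. metr c (crd c s) u w" and D = "\<lambda>h u. metr_deriv c ?x (h *\<^sub>R ?v) u w", OF _ tS])
    show "((\<lambda>s. metr c (crd c s) u w) has_derivative (\<lambda>h. metr_deriv c ?x (h *\<^sub>R ?v) u w)) (at t within ?S)" for u
      by (rule has_derivative_compose[OF crdD metr_has_derivative[OF cA xt]])
    show "((\<lambda>s. X s c) has_derivative (\<lambda>h. h *\<^sub>R ?X)) (at t within ?S)"
      using D(2) unfolding cov_deriv_at_def has_vector_derivative_def at .
  qed (use lin dlin in auto)
  have "((\<lambda>s. metr c (crd c s) (X s c) (Y s c)) has_derivative
    (\<lambda>h. (metr_deriv c ?x (h *\<^sub>R ?v) (X t c) (Y t c) + metr c ?x (h *\<^sub>R ?X) (Y t c)) + metr c ?x (X t c) (h *\<^sub>R ?Y))) (at t within ?S)"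
  proof (rule has_derivative_linear_apply[where f = "\<lambda>s u. metr c (crd c s) (X s c) u"
        and D = "\<lambda>h w. metr_deriv c ?x (h *\<^sub>R ?v) (X t c) w + metr c ?x (h *\<^sub>R ?X) w", OF _ tS])
    show "((\<lambda>s. Y s c) has_derivative (\<lambda>h. h *\<^sub>R ?Y)) (at t within ?S)"
      using D(3) unfolding cov_deriv_at_def has_vector_derivative_def at .
    show "linear (\<lambda>w. metr_deriv c ?x (h *\<^sub>R ?v) (X t c) w + metr c ?x (h *\<^sub>R ?X) w)" for h
      by (intro linear_compose_add dlin lin tS)
  qed (use lin 1 in auto)
  moreover have "(metr_deriv c ?x (h *\<^sub>R ?v) (X t c) (Y t c) + metr c ?x (h *\<^sub>R ?X) (Y t c)) + metr c ?x (X t c) (h *\<^sub>R ?Y)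
     = h * (metr c ?x (X' c) (Y t c) + metr c ?x (X t c) (Y' c))" for h
  proof -
    have "metr_deriv c ?x (h *\<^sub>R ?v) (X t c) (Y t c) = h * metr_deriv c ?x ?v (X t c) (Y t c)"
      using linear_scale[OF metr_deriv_bilinear(2)[OF cA xt], of h ?v] by simp
    then show ?thesis unfolding metr_compatible[OF cA xt] by (simp add: sx(5,6,9,10) algebra_simps)
  qed
  ultimately have "((\<lambda>s. metr c (crd c s) (X s c) (Y s c)) has_derivative
    (\<lambda>h. h * (metr c ?x (X' c) (Y t c) + metr c ?x (X t c) (Y' c)))) (at t within ?S)" by (simp only:)
  then have "((\<lambda>s. g (\<gamma> s) (X s) (Y s)) has_derivative
    (\<lambda>h. h * (metr c ?x (X' c) (Y t c) + metr c ?x (X t c) (Y' c)))) (at t within ?S)"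
  proof (rule has_derivative_transform[OF tS, rotated])
    show "g (\<gamma> s) (X s) (Y s) = metr c (crd c s) (X s c) (Y s c)" if "s \<in> ?S" for s
      by (rule metric_value[OF S(1)[OF that] X(1)[OF S(2)[OF that]] X(2)[OF S(2)[OF that]]])
  qed
  moreover have "metr c ?x (X' c) (Y t c) + metr c ?x (X t c) (Y' c) = g (\<gamma> t) X' (Y t) + g (\<gamma> t) (X t) Y'"
    using metric_value[OF c X'(1) X(2)[OF t]] metric_value[OF c X(1)[OF t] X'(2)] by simp
  moreover have "(\<lambda>h. h * k) = (*) k" for k :: real by auto
  ultimately show ?thesis unfolding at has_field_derivative_def by simp
qed

text \<open>A Jacobi field together with its covariant derivative, which makes the equation a first order system.\<close>
definition jacobi_pair :: "real \<Rightarrow> real \<Rightarrow> (real \<Rightarrow> ('m, 'e) tvec) \<Rightarrow> (real \<Rightarrow> ('m, 'e) tvec) \<Rightarrow> bool" where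
  "jacobi_pair p q J Z \<longleftrightarrow> (\<forall>t\<in>{p..q}. J t \<in> tangent_space A (\<gamma> t) \<and> Z t \<in> tangent_space A (\<gamma> t) \<and>
    (\<forall>c\<in>charts_at A (\<gamma> t). cov_deriv_at {p..q} J (Z t) c t \<and>
       cov_deriv_at {p..q} Z (curvature A g (\<gamma> t) (vel t) (J t) (vel t)) c t))"

lemma curvature_tangent:
  assumes "u \<in> tangent_space A p" "v \<in> tangent_space A p" "w \<in> tangent_space A p"
  shows "curvature A g p u v w \<in> tangent_space A p"
proof -
  obtain c where c: "c \<in> charts_at A p" using ex_chart by blast
  show ?thesis
  proof (rule tangentI[OF c])
    fix d assume d: "d \<in> charts_at A p"
    have "transition c d (snd c p) = snd d p" using charts_atD(4)[OF c] by (simp add: transition_def)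
    then show "curvature A g p u v w d = trans_deriv c d (snd c p) (curvature A g p u v w c)"
      using Riem_transform[OF charts_atD(1)[OF c] charts_atD(1)[OF d] overlapI[OF charts_atD(1)[OF c] charts_atD(1)[OF d] c d], of "u c" "v c" "w c"]
        tangent_transform[OF c d assms(1)] tangent_transform[OF c d assms(2)] tangent_transform[OF c d assms(3)]
      by (simp add: curvature_chart[OF c] curvature_chart[OF d])
  qed (simp add: curvature_def)
qed

lemma jacobi_pairD:
  assumes "jacobi_pair p q J Z" "t \<in> {p..q}"
  shows "J t \<in> tangent_space A (\<gamma> t)" "Z t \<in> tangent_space A (\<gamma> t)"
    "c \<in> charts_at A (\<gamma> t) \<Longrightarrow> cov_deriv_at {p..q} J (Z t) c t"
    "c \<in> charts_at A (\<gamma> t) \<Longrightarrow> cov_deriv_at {p..q} Z (curvature A g (\<gamma> t) (vel t) (J t) (vel t)) c t"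
  using assms unfolding jacobi_pair_def by blast+

lemma jacobi_pairI:
  assumes pq: "{p..q} \<subseteq> {a..b}" and JZ: "\<And>t. t \<in> {p..q} \<Longrightarrow> J t \<in> tangent_space A (\<gamma> t)" "\<And>t. t \<in> {p..q} \<Longrightarrow> Z t \<in> tangent_space A (\<gamma> t)"
    and D: "\<And>t. t \<in> {p..q} \<Longrightarrow> \<exists>c\<in>charts_at A (\<gamma> t). ((\<lambda>s. (J s c, Z s c)) has_vector_derivative
      jacobi_coeff c (crd c t) (vel t c) (J t c, Z t c)) (at t within {p..q})"
  shows "jacobi_pair p q J Z"
  unfolding jacobi_pair_def
proof (intro ballI conjI)
  fix t assume t: "t \<in> {p..q}"
  show "J t \<in> tangent_space A (\<gamma> t)" "Z t \<in> tangent_space A (\<gamma> t)" using JZ t by blast+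
  obtain c where c: "c \<in> charts_at A (\<gamma> t)" and Dc: "((\<lambda>s. (J s c, Z s c)) has_vector_derivative
      jacobi_coeff c (crd c t) (vel t c) (J t c, Z t c)) (at t within {p..q})" using D[OF t] by blast
  fix d assume d: "d \<in> charts_at A (\<gamma> t)"
  have vt: "vel t \<in> tangent_space A (\<gamma> t)" using vel_tangent t pq by blast
  have "cov_deriv_at {p..q} J (Z t) c t"
    using bounded_linear.has_vector_derivative[OF bounded_linear_fst Dc] by (simp add: cov_deriv_at_def jacobi_coeff_def)
  then show "cov_deriv_at {p..q} J (Z t) d t"
    by (rule cov_deriv_at_transform[OF pq t _ c d, where X = J and Y = "Z t", rotated])
      (rule tangent_transform[OF c d JZ(2)[OF t]], rule JZ(1))
  have "cov_deriv_at {p..q} Z (curvature A g (\<gamma> t) (vel t) (J t) (vel t)) c t"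
    using bounded_linear.has_vector_derivative[OF bounded_linear_snd Dc]
    by (simp add: cov_deriv_at_def jacobi_coeff_def curvature_chart[OF c])
  then show "cov_deriv_at {p..q} Z (curvature A g (\<gamma> t) (vel t) (J t) (vel t)) d t"
    by (rule cov_deriv_at_transform[OF pq t _ c d, where X = Z, rotated])
      (rule tangent_transform[OF c d curvature_tangent[OF vt JZ(1)[OF t] vt]], rule JZ(2))
qed

lemma jacobi_pair_system:
  assumes "jacobi_pair p q J Z" "t \<in> {p..q}" and c: "c \<in> charts_at A (\<gamma> t)"
  shows "((\<lambda>s. (J s c, Z s c)) has_vector_derivative jacobi_coeff c (crd c t) (vel t c) (J t c, Z t c)) (at t within {p..q})"
  using has_vector_derivative_Pair jacobi_pairD(3,4)[OF assms] unfolding cov_deriv_at_def jacobi_coeff_def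
  by (simp add: curvature_chart[OF c])

lemma jacobi_pair_subset:
  assumes "jacobi_pair p q J Z" "{p'..q'} \<subseteq> {p..q}" shows "jacobi_pair p' q' J Z"
  using assms has_vector_derivative_within_subset[OF _ assms(2)]
  unfolding jacobi_pair_def cov_deriv_at_def by blast

lemma jacobi_pair_glue:
  assumes 1: "jacobi_pair p q J Z" and 2: "jacobi_pair q r J' Z'" and pqr: "p \<le> q" "q \<le> r"
    and sub: "{p..r} \<subseteq> {a..b}" and eq: "J q = J' q" "Z q = Z' q"
  shows "jacobi_pair p r (\<lambda>t. if t \<le> q then J t else J' t) (\<lambda>t. if t \<le> q then Z t else Z' t)"
proof (rule jacobi_pairI[OF sub])
  fix t assume t: "t \<in> {p..r}"
  show "(if t \<le> q then J t else J' t) \<in> tangent_space A (\<gamma> t)" "(if t \<le> q then Z t else Z' t) \<in> tangent_space A (\<gamma> t)"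
    using jacobi_pairD(1,2)[OF 1] jacobi_pairD(1,2)[OF 2] t by auto
  obtain c where c: "c \<in> charts_at A (\<gamma> t)" using ex_chart by blast
  let ?D = "jacobi_coeff c (crd c t) (vel t c) ((if t \<le> q then J t else J' t) c, (if t \<le> q then Z t else Z' t) c)"
  have "((\<lambda>s. if s \<le> q then (J s c, Z s c) else (J' s c, Z' s c)) has_vector_derivative ?D) (at t within {p..r})"
  proof (rule glue_has_vector_derivative[OF pqr t])
    show "((\<lambda>s. (J s c, Z s c)) has_vector_derivative ?D) (at t within {p..q})" if "t \<le> q"
      using jacobi_pair_system[OF 1 _ c] t that by simp
    have "((\<lambda>s. (J' s c, Z' s c)) has_vector_derivative jacobi_coeff c (crd c t) (vel t c) (J' t c, Z' t c)) (at t within {q..r})" if "q \<le> t"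
      using jacobi_pair_system[OF 2 _ c] t that by simp
    then show "((\<lambda>s. (J' s c, Z' s c)) has_vector_derivative ?D) (at t within {q..r})" if "q \<le> t"
      using that eq by (cases "t = q") auto
  qed (use eq in simp)
  moreover have "(\<lambda>s. if s \<le> q then (J s c, Z s c) else (J' s c, Z' s c)) =
    (\<lambda>s. ((if s \<le> q then J s else J' s) c, (if s \<le> q then Z s else Z' s) c))" by auto
  ultimately show "\<exists>c\<in>charts_at A (\<gamma> t). ((\<lambda>s. ((if s \<le> q then J s else J' s) c, (if s \<le> q then Z s else Z' s) c)) has_vector_derivative
     jacobi_coeff c (crd c t) (vel t c) ((if t \<le> q then J t else J' t) c, (if t \<le> q then Z t else Z' t) c)) (at t within {p..r})"
    using c by (intro bexI[of _ c]) simp_all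
qed

lemma jacobi_pair_linear:
  assumes 1: "jacobi_pair p q J Z" and 2: "jacobi_pair p q J' Z'" and pq: "{p..q} \<subseteq> {a..b}"
  shows "jacobi_pair p q (\<lambda>t. J t + r *\<^sub>R J' t) (\<lambda>t. Z t + r *\<^sub>R Z' t)"
proof (rule jacobi_pairI[OF pq])
  fix t assume t: "t \<in> {p..q}"
  show "J t + r *\<^sub>R J' t \<in> tangent_space A (\<gamma> t)" "Z t + r *\<^sub>R Z' t \<in> tangent_space A (\<gamma> t)"
    by (intro subspace_add subspace_scale subspace_tangent jacobi_pairD(1,2)[OF 1 t] jacobi_pairD(1,2)[OF 2 t])+
  obtain c where c: "c \<in> charts_at A (\<gamma> t)" using ex_chart by blast
  note lin = jacobi_coeff_linear_at[OF c, of "vel t c"]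
  have "((\<lambda>s. (J s c, Z s c) + r *\<^sub>R (J' s c, Z' s c)) has_vector_derivative
    (jacobi_coeff c (crd c t) (vel t c) (J t c, Z t c) + r *\<^sub>R jacobi_coeff c (crd c t) (vel t c) (J' t c, Z' t c))) (at t within {p..q})"
    using has_vector_derivative_add[OF jacobi_pair_system[OF 1 t c]
      bounded_linear.has_vector_derivative[OF bounded_linear_scaleR_right jacobi_pair_system[OF 2 t c]]] .
  then have "((\<lambda>s. ((J s + r *\<^sub>R J' s) c, (Z s + r *\<^sub>R Z' s) c)) has_vector_derivative
    jacobi_coeff c (crd c t) (vel t c) ((J t + r *\<^sub>R J' t) c, (Z t + r *\<^sub>R Z' t) c)) (at t within {p..q})"
    unfolding linear_scale[OF lin, symmetric] linear_add[OF lin, symmetric] by (simp add: scaleR_fun_def)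
  then show "\<exists>c\<in>charts_at A (\<gamma> t). ((\<lambda>s. ((J s + r *\<^sub>R J' s) c, (Z s + r *\<^sub>R Z' s) c)) has_vector_derivative
    jacobi_coeff c (crd c t) (vel t c) ((J t + r *\<^sub>R J' t) c, (Z t + r *\<^sub>R Z' t) c)) (at t within {p..q})"
    using c by blast
qed

lemma chart_neighbourhood:
  assumes x: "x \<in> {a..b}" and c: "c \<in> charts_at A (\<gamma> x)"
  obtains \<delta> where "\<delta> > 0" "\<And>t. t \<in> {a..b} \<Longrightarrow> \<bar>t - x\<bar> \<le> \<delta> \<Longrightarrow> c \<in> charts_at A (\<gamma> t)"
proof -
  obtain W where W: "open W" "x \<in> W" "{a..b} \<inter> W = {s \<in> {a..b}. \<gamma> s \<in> fst c}"
    using stays_in_open[OF order_refl x, of "fst c"] chart(1) charts_atD[OF c] by blast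
  then obtain \<delta> where \<delta>: "\<delta> > 0" "cball x \<delta> \<subseteq> W" using open_contains_cball by blast
  show thesis
  proof (rule that[OF \<delta>(1)])
    fix t assume t: "t \<in> {a..b}" "\<bar>t - x\<bar> \<le> \<delta>"
    have "t \<in> cball x \<delta>" using t(2) by (simp add: dist_real_def abs_minus_commute)
    then have "t \<in> {a..b} \<inter> W" using t(1) \<delta>(2) by blast
    then have "\<gamma> t \<in> fst c" using W(3) by blast
    then show "c \<in> charts_at A (\<gamma> t)" by (simp add: charts_at_def charts_atD(1)[OF c])
  qed
qed

lemma crd_tendsto:
  assumes "t \<in> {a..b}" "c \<in> charts_at A (\<gamma> t)"
  shows "(crd c \<longlongrightarrow> crd c t) (at t within {a..b})" "((\<lambda>s. vel s c) \<longlongrightarrow> vel t c) (at t within {a..b})"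
  using has_vector_derivative_continuous[OF curve_deriv[OF assms]]
    has_vector_derivative_continuous[OF vel_parallel[OF assms, unfolded cov_deriv_at_def]]
  by (simp_all add: continuous_within)

lemma jacobi_coeff_neighbourhood:
  assumes x: "x \<in> {a..b}" and c: "c \<in> charts_at A (\<gamma> x)"
  obtains \<delta> K where "\<delta> > 0" "K > 0" "\<And>t. t \<in> {a..b} \<Longrightarrow> \<bar>t - x\<bar> \<le> \<delta> \<Longrightarrow> c \<in> charts_at A (\<gamma> t)"
    "\<And>t y. t \<in> {a..b} \<Longrightarrow> \<bar>t - x\<bar> \<le> \<delta> \<Longrightarrow> norm (jacobi_coeff c (crd c t) (vel t c) y) \<le> K * norm y"
    "\<And>y. continuous_on ({a..b} \<inter> {x-\<delta>..x+\<delta>}) (\<lambda>t. jacobi_coeff c (crd c t) (vel t c) y)"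
proof -
  obtain \<delta> where \<delta>: "\<delta> > 0" "\<And>t. t \<in> {a..b} \<Longrightarrow> \<bar>t - x\<bar> \<le> \<delta> \<Longrightarrow> c \<in> charts_at A (\<gamma> t)"
    using chart_neighbourhood[OF assms] by blast
  let ?S = "{a..b} \<inter> {x-\<delta>..x+\<delta>}"
  have S: "t \<in> {a..b}" "\<bar>t - x\<bar> \<le> \<delta>" if "t \<in> ?S" for t using that by auto
  have lin: "linear (jacobi_coeff c (crd c t) (vel t c))" if "t \<in> ?S" for t
    by (rule jacobi_coeff_linear_at[OF \<delta>(2)[OF S[OF that]]])
  have cont: "continuous_on ?S (\<lambda>t. jacobi_coeff c (crd c t) (vel t c) y)" for y
    unfolding continuous_on_def
  proof
    fix t assume t: "t \<in> ?S"
    note ct = \<delta>(2)[OF S[OF t]]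
    have sub: "?S \<subseteq> {a..b}" by blast
    show "((\<lambda>t. jacobi_coeff c (crd c t) (vel t c) y) \<longlongrightarrow> jacobi_coeff c (crd c t) (vel t c) y) (at t within ?S)"
      by (rule jacobi_coeff_tendsto[OF charts_atD(1)[OF ct] tendsto_within_subset[OF crd_tendsto(1)[OF S(1)[OF t] ct] sub]
            charts_atD(3)[OF ct] tendsto_within_subset[OF crd_tendsto(2)[OF S(1)[OF t] ct] sub] tendsto_const])
  qed
  have "compact ?S" by (simp add: compact_Int_closed)
  then obtain K where K: "K > 0" "\<And>t y. t \<in> ?S \<Longrightarrow> norm (jacobi_coeff c (crd c t) (vel t c) y) \<le> K * norm y"
    using linear_family_bounded[where S = ?S and A = "\<lambda>t. jacobi_coeff c (crd c t) (vel t c)", OF _ lin cont] by blast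
  show thesis
  proof (rule that[OF \<delta>(1) K(1) \<delta>(2)])
    fix t y assume "t \<in> {a..b}" "\<bar>t - x\<bar> \<le> \<delta>"
    then have "t \<in> ?S" by auto
    then show "norm (jacobi_coeff c (crd c t) (vel t c) y) \<le> K * norm y" by (rule K(2))
  qed (assumption | rule cont)+
qed

text \<open>In a single chart this is a linear differential equation on a short interval; the local solutions are glued
  by bisection.\<close>
lemma jacobi_pair_exists:
  assumes "J0 \<in> tangent_space A (\<gamma> a)" "Z0 \<in> tangent_space A (\<gamma> a)"
  shows "\<exists>J Z. jacobi_pair a b J Z \<and> J a = J0 \<and> Z a = Z0"
proof -
  define P where "P p q \<longleftrightarrow> (a \<le> p \<longrightarrow> p \<le> q \<longrightarrow> q \<le> b \<longrightarrow> (\<forall>J0\<in>tangent_space A (\<gamma> p). \<forall>Z0\<in>tangent_space A (\<gamma> p).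
    \<exists>J Z. jacobi_pair p q J Z \<and> J p = J0 \<and> Z p = Z0))" for p q
  have "P a b"
  proof (rule Bolzano)
    show "a \<le> b" using ab by simp
    fix p q r assume *: "P p q" "P q r" "p \<le> q" "q \<le> r"
    show "P p r"
      unfolding P_def
    proof (intro impI ballI)
      assume "a \<le> p" "p \<le> r" "r \<le> b"
      then have sub: "{p..r} \<subseteq> {a..b}" and le: "a \<le> q" "q \<le> b" using * by auto
      fix J0 Z0 assume 0: "J0 \<in> tangent_space A (\<gamma> p)" "Z0 \<in> tangent_space A (\<gamma> p)"
      obtain J Z where JZ: "jacobi_pair p q J Z" "J p = J0" "Z p = Z0"
        using *(1,3) 0 \<open>a \<le> p\<close> le unfolding P_def by blast
      obtain J' Z' where JZ': "jacobi_pair q r J' Z'" "J' q = J q" "Z' q = Z q"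
        using *(2)[unfolded P_def, THEN mp, OF le(1), THEN mp, OF *(4), THEN mp, OF \<open>r \<le> b\<close>]
          jacobi_pairD(1,2)[OF JZ(1), of q] *(3) by (meson atLeastAtMost_iff order_refl)
      from jacobi_pair_glue[OF JZ(1) JZ'(1) *(3,4) sub JZ'(2,3)[symmetric]] JZ *(3)
      show "\<exists>J Z. jacobi_pair p r J Z \<and> J p = J0 \<and> Z p = Z0"
        by (intro exI[of _ "\<lambda>t. if t \<le> q then J t else J' t"] exI[of _ "\<lambda>t. if t \<le> q then Z t else Z' t"]) auto
    qed
  next
    fix x assume "a \<le> x" "x \<le> b"
    then have x: "x \<in> {a..b}" by simp
    obtain c where c: "c \<in> charts_at A (\<gamma> x)" using ex_chart by blast
    obtain \<delta> K where \<delta>: "\<delta> > 0" "K > 0" "\<And>t. t \<in> {a..b} \<Longrightarrow> \<bar>t - x\<bar> \<le> \<delta> \<Longrightarrow> c \<in> charts_at A (\<gamma> t)"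
      and bound: "\<And>t y. t \<in> {a..b} \<Longrightarrow> \<bar>t - x\<bar> \<le> \<delta> \<Longrightarrow> norm (jacobi_coeff c (crd c t) (vel t c) y) \<le> K * norm y"
      and cont: "\<And>y. continuous_on ({a..b} \<inter> {x-\<delta>..x+\<delta>}) (\<lambda>t. jacobi_coeff c (crd c t) (vel t c) y)"
      using jacobi_coeff_neighbourhood[OF x c] by blast
    define \<epsilon> where "\<epsilon> = min \<delta> (1 / (2 * K))"
    have \<epsilon>: "\<epsilon> > 0" using \<delta> by (simp add: \<epsilon>_def)
    have "P p q" if pq: "p \<le> x" "x \<le> q" "q - p < \<epsilon>" for p q
      unfolding P_def
    proof (intro impI ballI)
      assume apqb: "a \<le> p" "p \<le> q" "q \<le> b"
      then have sub: "{p..q} \<subseteq> {a..b}" "{p..q} \<subseteq> {a..b} \<inter> {x-\<delta>..x+\<delta>}" using pq by (auto simp: \<epsilon>_def)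
      have near: "t \<in> {a..b}" "\<bar>t - x\<bar> \<le> \<delta>" if "t \<in> {p..q}" for t using that sub by auto
      have ct: "c \<in> charts_at A (\<gamma> t)" if "t \<in> {p..q}" for t by (rule \<delta>(3)[OF near[OF that]])
      fix J0 Z0 assume 0: "J0 \<in> tangent_space A (\<gamma> p)" "Z0 \<in> tangent_space A (\<gamma> p)"
      have "K * (q - p) \<le> K * (1 / (2 * K))" using pq \<delta>(2) by (intro mult_left_mono) (auto simp: \<epsilon>_def)
      then have K: "K * (q - p) \<le> 1 / 2" using \<delta>(2) by simp
      obtain y where y: "y p = (J0 c, Z0 c)" "\<And>t. t \<in> {p..q} \<Longrightarrow>
          (y has_vector_derivative jacobi_coeff c (crd c t) (vel t c) (y t)) (at t within {p..q})"
      proof (rule linear_ode_exists[where A = "\<lambda>t. jacobi_coeff c (crd c t) (vel t c)" and ?y0.0 = "(J0 c, Z0 c)" and c = p and d = q and K = K])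
        show "linear (jacobi_coeff c (crd c t) (vel t c))" if "t \<in> {p..q}" for t
          by (rule jacobi_coeff_linear_at[OF ct[OF that]])
        show "continuous_on {p..q} (\<lambda>t. jacobi_coeff c (crd c t) (vel t c) z)" for z
          by (rule continuous_on_subset[OF cont sub(2)])
      qed (use apqb bound near K \<delta>(2) in auto)
      define J where "J t = coord_vector A c (fst (y t)) (\<gamma> t)" for t
      define Z where "Z t = coord_vector A c (snd (y t)) (\<gamma> t)" for t
      have JZc: "J t c = fst (y t)" "Z t c = snd (y t)" if "t \<in> {p..q}" for t
        using coord_vector_self[OF A ct[OF that]] by (simp_all add: J_def Z_def)
      have "jacobi_pair p q J Z"
      proof (rule jacobi_pairI[OF sub(1)])
        fix t assume t: "t \<in> {p..q}"
        show "J t \<in> tangent_space A (\<gamma> t)" "Z t \<in> tangent_space A (\<gamma> t)"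
          using coord_vector_tangent[OF A ct[OF t]] by (simp_all add: J_def Z_def)
        have "((\<lambda>s. (J s c, Z s c)) has_vector_derivative jacobi_coeff c (crd c t) (vel t c) (y t)) (at t within {p..q})"
        proof (rule has_vector_derivative_transform)
          show "t \<in> {p..q}" by (rule t)
          show "(J s c, Z s c) = y s" if "s \<in> {p..q}" for s by (simp add: JZc[OF that])
          show "(y has_vector_derivative jacobi_coeff c (crd c t) (vel t c) (y t)) (at t within {p..q})" by (rule y(2)[OF t])
        qed
        then show "\<exists>c\<in>charts_at A (\<gamma> t). ((\<lambda>s. (J s c, Z s c)) has_vector_derivative
            jacobi_coeff c (crd c t) (vel t c) (J t c, Z t c)) (at t within {p..q})"
          using ct[OF t] JZc[OF t] by (intro bexI[of _ c]) simp_all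
      qed
      moreover have "J p = J0" "Z p = Z0"
        using coord_vector_of_tangent[OF A ct[of p] 0(1)] coord_vector_of_tangent[OF A ct[of p] 0(2)] y(1) apqb
        by (simp_all add: J_def Z_def)
      ultimately show "\<exists>J Z. jacobi_pair p q J Z \<and> J p = J0 \<and> Z p = Z0" by blast
    qed
    then show "\<exists>d>0. \<forall>p q. p \<le> x \<and> x \<le> q \<and> q - p < d \<longrightarrow> P p q" using \<epsilon> by blast
  qed
  then show ?thesis using assms ab unfolding P_def by auto
qed

text \<open>Uniqueness in a single chart spreads along the interval by bisection.\<close>
lemma jacobi_pair_zero:
  assumes JZ: "jacobi_pair a b J Z" and s: "s \<in> {a..b}" "J s = 0" "Z s = 0" and t: "t \<in> {a..b}"
  shows "J t = 0" "Z t = 0"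
proof -
  define P where "P p q \<longleftrightarrow> (a \<le> p \<longrightarrow> q \<le> b \<longrightarrow> (\<exists>s\<in>{p..q}. J s = 0 \<and> Z s = 0) \<longrightarrow> (\<forall>t\<in>{p..q}. J t = 0 \<and> Z t = 0))" for p q
  have "P a b"
  proof (rule Bolzano)
    show "a \<le> b" using ab by simp
    fix p q r assume *: "P p q" "P q r" "p \<le> q" "q \<le> r"
    show "P p r"
      unfolding P_def
    proof (intro impI)
      assume pr: "a \<le> p" "r \<le> b" and "\<exists>s\<in>{p..r}. J s = 0 \<and> Z s = 0"
      then obtain s where s: "s \<in> {p..r}" "J s = 0" "Z s = 0" by blast
      have q: "q \<le> b" "a \<le> q" using pr * by auto
      note 1 = *(1)[unfolded P_def, THEN mp, OF pr(1), THEN mp, OF q(1), THEN mp]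
      note 2 = *(2)[unfolded P_def, THEN mp, OF q(2), THEN mp, OF pr(2), THEN mp]
      have "J q = 0 \<and> Z q = 0"
      proof (cases "s \<le> q")
        case True
        then have "s \<in> {p..q}" using s(1) by simp
        then have "\<forall>t\<in>{p..q}. J t = 0 \<and> Z t = 0" using s(2,3) by (intro 1) blast
        then show ?thesis using *(3) by simp
      next
        case False
        then have "s \<in> {q..r}" using s(1) by simp
        then have "\<forall>t\<in>{q..r}. J t = 0 \<and> Z t = 0" using s(2,3) by (intro 2) blast
        then show ?thesis using *(4) by simp
      qed
      moreover have "q \<in> {p..q}" "q \<in> {q..r}" using *(3,4) by auto
      ultimately have "\<forall>t\<in>{p..q}. J t = 0 \<and> Z t = 0" "\<forall>t\<in>{q..r}. J t = 0 \<and> Z t = 0"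
        by (intro 1 2; blast)+
      then show "\<forall>t\<in>{p..r}. J t = 0 \<and> Z t = 0" by (metis atLeastAtMost_iff linear)
    qed
  next
    fix x assume "a \<le> x" "x \<le> b"
    then have x: "x \<in> {a..b}" by simp
    obtain c where c: "c \<in> charts_at A (\<gamma> x)" using ex_chart by blast
    obtain \<delta> K where \<delta>: "\<delta> > 0" "K > 0" "\<And>t. t \<in> {a..b} \<Longrightarrow> \<bar>t - x\<bar> \<le> \<delta> \<Longrightarrow> c \<in> charts_at A (\<gamma> t)"
      and bound: "\<And>t y. t \<in> {a..b} \<Longrightarrow> \<bar>t - x\<bar> \<le> \<delta> \<Longrightarrow> norm (jacobi_coeff c (crd c t) (vel t c) y) \<le> K * norm y"
      and "\<And>y. continuous_on ({a..b} \<inter> {x-\<delta>..x+\<delta>}) (\<lambda>t. jacobi_coeff c (crd c t) (vel t c) y)"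
      using jacobi_coeff_neighbourhood[OF x c] by blast
    have "P p q" if pq: "p \<le> x" "x \<le> q" "q - p < \<delta>" for p q
      unfolding P_def
    proof (intro impI ballI)
      assume apqb: "a \<le> p" "q \<le> b" and "\<exists>s\<in>{p..q}. J s = 0 \<and> Z s = 0"
      then obtain s where s: "s \<in> {p..q}" "J s = 0" "Z s = 0" by blast
      have sub: "{p..q} \<subseteq> {a..b}" using apqb by auto
      have near: "t \<in> {a..b}" "\<bar>t - x\<bar> \<le> \<delta>" if "t \<in> {p..q}" for t using that sub pq by auto
      fix t assume t: "t \<in> {p..q}"
      have "(\<lambda>s. (J s c, Z s c)) t = 0"
      proof (rule linear_growth_zero[where L = K and s = s])
        show "((\<lambda>s. (J s c, Z s c)) has_vector_derivative jacobi_coeff c (crd c r) (vel r c) (J r c, Z r c)) (at r within {p..q})"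
          if "r \<in> {p..q}" for r
          using jacobi_pair_system[OF jacobi_pair_subset[OF JZ sub] that \<delta>(3)[OF near[OF that]]] .
        show "norm (jacobi_coeff c (crd c r) (vel r c) (J r c, Z r c)) \<le> K * norm (J r c, Z r c)" if "r \<in> {p..q}" for r
          by (rule bound[OF near[OF that]])
        show "(J s c, Z s c) = 0" using s by (simp add: zero_prod_def)
      qed (use \<delta>(2) s(1) t in simp_all)
      then have "J t c = 0" "Z t c = 0" by (simp_all add: zero_prod_def)
      note ct = \<delta>(3)[OF near[OF t]]
      note eq0 = tangent_eqI[OF ct _ subspace_0[OF subspace_tangent]]
      have "J t = 0" by (rule eq0[OF jacobi_pairD(1)[OF JZ near(1)[OF t]]]) (simp add: \<open>J t c = 0\<close>)
      moreover have "Z t = 0" by (rule eq0[OF jacobi_pairD(2)[OF JZ near(1)[OF t]]]) (simp add: \<open>Z t c = 0\<close>)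
      ultimately show "J t = 0 \<and> Z t = 0" by blast
    qed
    then show "\<exists>d>0. \<forall>p q. p \<le> x \<and> x \<le> q \<and> q - p < d \<longrightarrow> P p q" using \<delta>(1) by blast
  qed
  then show "J t = 0" "Z t = 0" using s t unfolding P_def by blast+
qed

lemma jacobi_pair_cong:
  assumes JZ: "jacobi_pair a b J Z" and eq: "\<And>t. t \<in> {a..b} \<Longrightarrow> J' t = J t"
  shows "jacobi_pair a b J' Z"
  unfolding jacobi_pair_def
proof (intro ballI conjI)
  fix t assume t: "t \<in> {a..b}"
  show "J' t \<in> tangent_space A (\<gamma> t)" "Z t \<in> tangent_space A (\<gamma> t)" using jacobi_pairD(1,2)[OF JZ t] eq[OF t] by auto
  fix c assume c: "c \<in> charts_at A (\<gamma> t)"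
  show "cov_deriv_at {a..b} J' (Z t) c t"
    unfolding cov_deriv_at_def eq[OF t]
    by (rule has_vector_derivative_transform[OF t _ jacobi_pairD(3)[OF JZ t c, unfolded cov_deriv_at_def]]) (simp add: eq)
  show "cov_deriv_at {a..b} Z (curvature A g (\<gamma> t) (vel t) (J' t) (vel t)) c t"
    using jacobi_pairD(4)[OF JZ t c] eq[OF t] by simp
qed

lemma jacobi_pair_unique:
  assumes 1: "jacobi_pair a b J Z" and 2: "jacobi_pair a b J' Z'" and s: "s \<in> {a..b}" "J s = J' s" "Z s = Z' s" and t: "t \<in> {a..b}"
  shows "J t = J' t" "Z t = Z' t"
proof -
  have p: "jacobi_pair a b (\<lambda>t. J t + (-1) *\<^sub>R J' t) (\<lambda>t. Z t + (-1) *\<^sub>R Z' t)"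
    by (rule jacobi_pair_linear[OF 1 2 order_refl])
  show "J t = J' t" using jacobi_pair_zero(1)[OF p s(1) _ _ t] s(2,3) by simp
  show "Z t = Z' t" using jacobi_pair_zero(2)[OF p s(1) _ _ t] s(2,3) by simp
qed

text \<open>A Jacobi field determines its covariant derivative.\<close>
lemma jacobi_pair_zero_field:
  assumes JZ: "jacobi_pair a b J Z" and zero: "\<And>t. t \<in> {a..b} \<Longrightarrow> J t = 0" and t: "t \<in> {a..b}"
  shows "Z t = 0"
proof -
  obtain c where c: "c \<in> charts_at A (\<gamma> t)" using ex_chart by blast
  have 1: "((\<lambda>s. J s c) has_vector_derivative (Z t c - Gam c (crd c t) (vel t c) (J t c))) (at t within {a..b})"
    using jacobi_pairD(3)[OF JZ t c] by (simp add: cov_deriv_at_def)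
  have 2: "((\<lambda>s. J s c) has_vector_derivative 0) (at t within {a..b})"
    by (rule has_vector_derivative_transform[OF t _ has_vector_derivative_const[of 0]]) (simp add: zero)
  have "Z t c = Gam c (crd c t) (vel t c) (J t c)"
    using vector_derivative_within_closed_interval[OF ab t 1] vector_derivative_within_closed_interval[OF ab t 2] by simp
  also have "\<dots> = 0" using bilinear_rzero[OF Gam_bilinear[OF charts_atD(1)[OF c] charts_atD(3)[OF c]]] zero[OF t] by simp
  finally show ?thesis
    using tangent_eqI[OF c jacobi_pairD(2)[OF JZ t] subspace_0[OF subspace_tangent]] by simp
qed

text \<open>The variation through reparametrised geodesics.\<close>
lemma tangential_jacobi_pair: "jacobi_pair a b (\<lambda>t. (r * t + s) *\<^sub>R vel t) (\<lambda>t. r *\<^sub>R vel t)"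
proof (rule jacobi_pairI[OF order_refl])
  fix t assume t: "t \<in> {a..b}"
  show "(r * t + s) *\<^sub>R vel t \<in> tangent_space A (\<gamma> t)" "r *\<^sub>R vel t \<in> tangent_space A (\<gamma> t)"
    using vel_tangent[OF t] subspace_tangent by (auto intro: subspace_scale)
  obtain c where c: "c \<in> charts_at A (\<gamma> t)" using ex_chart by blast
  note cA = charts_atD(1)[OF c] and x = charts_atD(3)[OF c]
  let ?v = "vel t c"
  have Dv: "((\<lambda>s. vel s c) has_vector_derivative - Gam c (crd c t) ?v ?v) (at t within {a..b})"
    using vel_parallel[OF t c] by (simp add: cov_deriv_at_def)
  have Ds: "((\<lambda>t. r * t + s) has_vector_derivative r) (at t within {a..b})"
    by (auto intro!: derivative_eq_intros simp: has_real_derivative_iff_has_vector_derivative[symmetric])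
  have 1: "((\<lambda>t. (r * t + s) *\<^sub>R vel t c) has_vector_derivative ((r * t + s) *\<^sub>R (- Gam c (crd c t) ?v ?v) + r *\<^sub>R ?v)) (at t within {a..b})"
    using bounded_bilinear.has_vector_derivative[OF bounded_bilinear_scaleR Ds Dv] .
  have 2: "((\<lambda>t. r *\<^sub>R vel t c) has_vector_derivative r *\<^sub>R (- Gam c (crd c t) ?v ?v)) (at t within {a..b})"
    using bounded_linear.has_vector_derivative[OF bounded_linear_scaleR_right Dv] .
  have R: "Riem c (crd c t) ?v ?v ?v = 0" by (simp add: Riem_def)
  have "jacobi_coeff c (crd c t) ?v ((r * t + s) *\<^sub>R ?v, r *\<^sub>R ?v)
    = ((r * t + s) *\<^sub>R (- Gam c (crd c t) ?v ?v) + r *\<^sub>R ?v, r *\<^sub>R (- Gam c (crd c t) ?v ?v))"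
    using bilinear_rmul[OF Gam_bilinear[OF cA x]] linear_scale[OF Riem_linear[OF cA x]] R
    by (simp add: jacobi_coeff_def)
  then show "\<exists>c\<in>charts_at A (\<gamma> t). ((\<lambda>t'. (((r * t' + s) *\<^sub>R vel t') c, (r *\<^sub>R vel t') c)) has_vector_derivative
     jacobi_coeff c (crd c t) (vel t c) (((r * t + s) *\<^sub>R vel t) c, (r *\<^sub>R vel t) c)) (at t within {a..b})"
    using has_vector_derivative_Pair[OF 1 2] c by (intro bexI[of _ c]) (simp_all add: scaleR_fun_def)
qed

text \<open>The velocity is itself a Jacobi field with covariant derivative zero, so it vanishes everywhere if it vanishes
  once, and then the geodesic is locally constant.\<close>
lemma vel_nonzero:
  assumes nc: "\<not> \<gamma> constant_on {a..b}" and t: "t \<in> {a..b}" shows "vel t \<noteq> 0"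
proof
  assume "vel t = 0"
  then have zero: "vel s = 0" if "s \<in> {a..b}" for s
    using jacobi_pair_zero(1)[OF tangential_jacobi_pair[of 0 1] t _ _ that] by simp
  define P where "P p q \<longleftrightarrow> (a \<le> p \<longrightarrow> q \<le> b \<longrightarrow> p \<le> q \<longrightarrow> \<gamma> p = \<gamma> q)" for p q
  have "P a u" if u: "u \<in> {a..b}" for u
  proof (rule Bolzano)
    show "a \<le> u" using u by simp
    show "P p r" if "P p q" "P q r" "p \<le> q" "q \<le> r" for p q r using that unfolding P_def by simp
    fix x assume "a \<le> x" "x \<le> u"
    then have x: "x \<in> {a..b}" using u by simp
    obtain c where c: "c \<in> charts_at A (\<gamma> x)" using ex_chart by blast
    obtain \<delta> where \<delta>: "\<delta> > 0" "\<And>t. t \<in> {a..b} \<Longrightarrow> \<bar>t - x\<bar> \<le> \<delta> \<Longrightarrow> c \<in> charts_at A (\<gamma> t)"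
      using chart_neighbourhood[OF x c] by blast
    have "P p q" if pq: "p \<le> x" "x \<le> q" "q - p < \<delta>" for p q
      unfolding P_def
    proof (intro impI)
      assume apqb: "a \<le> p" "q \<le> b" "p \<le> q"
      then have sub: "{p..q} \<subseteq> {a..b}" by auto
      have ct: "c \<in> charts_at A (\<gamma> s)" if "s \<in> {p..q}" for s using \<delta>(2)[of s] that pq sub by auto
      have "(crd c has_derivative (\<lambda>h. 0)) (at s within {p..q})" if s: "s \<in> {p..q}" for s
        using has_vector_derivative_within_subset[OF curve_deriv[OF _ ct[OF s]] sub] zero[of s] s sub
        by (auto simp: has_vector_derivative_def)
      then obtain k where "\<forall>s\<in>{p..q}. crd c s = k" using has_derivative_zero_constant[of "{p..q}" "crd c"] by auto
      then have "crd c p = crd c q" using apqb by simp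
      then show "\<gamma> p = \<gamma> q" using charts_atD(4)[OF ct[of p]] charts_atD(4)[OF ct[of q]] apqb by (metis atLeastAtMost_iff order_refl)
    qed
    then show "\<exists>d>0. \<forall>p q. p \<le> x \<and> x \<le> q \<and> q - p < d \<longrightarrow> P p q" using \<delta>(1) by blast
  qed
  then have "\<forall>u\<in>{a..b}. \<gamma> u = \<gamma> a" unfolding P_def by auto
  then show False using nc unfolding constant_on_def by blast
qed

end

section \<open>Composition of smooth maps\<close>

lemma Ck_on_cong:
  assumes "open U" "\<And>x. x \<in> U \<Longrightarrow> f x = h x" shows "Ck_on k U f \<Longrightarrow> Ck_on k U h"
  using assms(2)
proof (induction k arbitrary: f h)
  case 0
  then show ?case using continuous_on_cong[of U U f h] by simp
next
  case (Suc k)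
  have der: "(h has_derivative frechet_derivative f (at x)) (at x)" if "x \<in> U" for x
  proof (rule has_derivative_transform_within_open[OF _ assms(1) that])
    show "(f has_derivative frechet_derivative f (at x)) (at x)"
      using Suc.prems(1) that frechet_derivative_works by auto
  qed (use Suc.prems in auto)
  have "frechet_derivative f (at x) v = frechet_derivative h (at x) v" if "x \<in> U" for x v
    using frechet_derivative_at[OF der[OF that]] by simp
  then have "Ck_on k U (\<lambda>x. frechet_derivative h (at x) v)" for v
    using Suc.IH[of "\<lambda>x. frechet_derivative f (at x) v" "\<lambda>x. frechet_derivative h (at x) v"] Suc.prems(1) by auto
  moreover have "h differentiable (at x)" if "x \<in> U" for x using der[OF that] differentiableI by blast
  ultimately show ?case by simp
qed

lemma Ck_on_SucI:
  assumes "open U" "\<And>x. x \<in> U \<Longrightarrow> (f has_derivative f' x) (at x)" "\<And>v. Ck_on k U (\<lambda>x. f' x v)"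
  shows "Ck_on (Suc k) U f"
proof -
  have "Ck_on k U (\<lambda>x. frechet_derivative f (at x) v)" for v
  proof -
    have "f' x v = frechet_derivative f (at x) v" if "x \<in> U" for x
      using fun_cong[OF frechet_derivative_at[OF assms(2)[OF that]], of v] .
    then show ?thesis using Ck_on_cong[OF assms(1) _ assms(3)[of v], of "\<lambda>x. frechet_derivative f (at x) v"] by blast
  qed
  moreover have "f differentiable (at x)" if "x \<in> U" for x using assms(2)[OF that] by (rule differentiableI)
  ultimately show ?thesis by simp
qed

lemma Ck_on_derivative: "Ck_on (Suc k) U f \<Longrightarrow> x \<in> U \<Longrightarrow> (f has_derivative frechet_derivative f (at x)) (at x)"
  using frechet_derivative_works by auto

lemma Ck_on_Suc: "Ck_on (Suc k) U f \<Longrightarrow> Ck_on k U f"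
proof (induction k arbitrary: f)
  case 0
  then show ?case using differentiable_imp_continuous_within
    by (auto intro!: continuous_at_imp_continuous_on)
next
  case (Suc k)
  have "Ck_on (Suc k) U (\<lambda>x. frechet_derivative f (at x) v)" for v
    using Suc.prems unfolding Ck_on.simps(2)[of "Suc k"] by blast
  then have "Ck_on k U (\<lambda>x. frechet_derivative f (at x) v)" for v by (rule Suc.IH)
  then show ?case using Suc.prems by simp
qed

lemma Ck_on_sum:
  assumes "open U" "finite I" shows "(\<And>i. i \<in> I \<Longrightarrow> Ck_on k U (f i)) \<Longrightarrow> Ck_on k U (\<lambda>x. \<Sum>i\<in>I. f i x)"
proof (induction k arbitrary: f)
  case 0
  then show ?case by (auto intro!: continuous_on_sum)
next
  case (Suc k)
  show ?case
  proof (rule Ck_on_SucI[OF assms(1)])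
    show "((\<lambda>x. \<Sum>i\<in>I. f i x) has_derivative (\<lambda>v. \<Sum>i\<in>I. frechet_derivative (f i) (at x) v)) (at x)" if "x \<in> U" for x
      by (intro has_derivative_sum Ck_on_derivative[OF Suc.prems that])
    show "Ck_on k U (\<lambda>x. \<Sum>i\<in>I. frechet_derivative (f i) (at x) v)" for v
      by (rule Suc.IH) (use Suc.prems in auto)
  qed
qed

lemma Ck_on_add:
  assumes "open U" "Ck_on k U f" "Ck_on k U h" shows "Ck_on k U (\<lambda>x. f x + h x)"
  using Ck_on_sum[of U "{True, False}" k "\<lambda>i. if i then f else h"] assms by simp

lemma Ck_on_inner:
  assumes "open U" shows "Ck_on k U f \<Longrightarrow> Ck_on k U (\<lambda>x. f x \<bullet> b)"
proof (induction k arbitrary: f)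
  case 0
  then show ?case by (auto intro: continuous_intros)
next
  case (Suc k)
  show ?case
  proof (rule Ck_on_SucI[OF assms(1)])
    show "((\<lambda>x. f x \<bullet> b) has_derivative (\<lambda>v. frechet_derivative f (at x) v \<bullet> b)) (at x)" if "x \<in> U" for x
      by (intro has_derivative_inner_left Ck_on_derivative[OF Suc.prems that])
    show "Ck_on k U (\<lambda>x. frechet_derivative f (at x) v \<bullet> b)" for v
      by (rule Suc.IH) (use Suc.prems in auto)
  qed
qed

lemma Ck_on_scaleR:
  assumes "open U" shows "Ck_on k U f \<Longrightarrow> Ck_on k U h \<Longrightarrow> Ck_on k U (\<lambda>x. f x *\<^sub>R h x)"
proof (induction k arbitrary: f h)
  case 0
  then show ?case by (auto intro: continuous_intros)
next
  case (Suc k)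
  show ?case
  proof (rule Ck_on_SucI[OF assms(1)])
    show "((\<lambda>x. f x *\<^sub>R h x) has_derivative (\<lambda>v. f x *\<^sub>R frechet_derivative h (at x) v + frechet_derivative f (at x) v *\<^sub>R h x)) (at x)"
      if "x \<in> U" for x
      by (intro has_derivative_scaleR Ck_on_derivative[OF Suc.prems(1) that] Ck_on_derivative[OF Suc.prems(2) that])
    show "Ck_on k U (\<lambda>x. f x *\<^sub>R frechet_derivative h (at x) v + frechet_derivative f (at x) v *\<^sub>R h x)" for v
    proof (rule Ck_on_add[OF assms])
      show "Ck_on k U (\<lambda>x. f x *\<^sub>R frechet_derivative h (at x) v)"
        by (rule Suc.IH[OF Ck_on_Suc[OF Suc.prems(1)]]) (use Suc.prems(2) in auto)
      show "Ck_on k U (\<lambda>x. frechet_derivative f (at x) v *\<^sub>R h x)"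
        by (rule Suc.IH[OF _ Ck_on_Suc[OF Suc.prems(2)]]) (use Suc.prems(1) in auto)
    qed
  qed
qed

text \<open>The chain rule expresses the derivative of the composition through the partial derivatives of \<open>f\<close> at \<open>h x\<close>, so that
  the induction hypothesis applies to them.\<close>
lemma Ck_on_compose:
  fixes f :: "'b::euclidean_space \<Rightarrow> 'c::real_normed_vector" and h :: "'a::euclidean_space \<Rightarrow> 'b"
  assumes U: "open U" "open V" "h ` U \<subseteq> V"
  shows "Ck_on k V f \<Longrightarrow> Ck_on k U h \<Longrightarrow> Ck_on k U (\<lambda>x. f (h x))"
proof (induction k arbitrary: f)
  case 0
  then show ?case using continuous_on_compose2[of V f U h] U by simp
next
  case (Suc k)
  show ?case
  proof (rule Ck_on_SucI[OF U(1)])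
    fix x assume x: "x \<in> U"
    then have hx: "h x \<in> V" using U by blast
    have lin: "linear (frechet_derivative f (at (h x)))"
      using Ck_on_derivative[OF Suc.prems(1) hx] has_derivative_linear by blast
    have "((\<lambda>x. f (h x)) has_derivative (\<lambda>v. frechet_derivative f (at (h x)) (frechet_derivative h (at x) v))) (at x)"
      by (rule has_derivative_compose[OF Ck_on_derivative[OF Suc.prems(2) x] Ck_on_derivative[OF Suc.prems(1) hx]])
    then show "((\<lambda>x. f (h x)) has_derivative
      (\<lambda>v. \<Sum>b\<in>Basis. (frechet_derivative h (at x) v \<bullet> b) *\<^sub>R frechet_derivative f (at (h x)) b)) (at x)"
      by (simp only: linear_basis_sum[OF lin, symmetric])
  next
    fix v
    have "Ck_on k U (\<lambda>x. (frechet_derivative h (at x) v \<bullet> b) *\<^sub>R frechet_derivative f (at (h x)) b)" for b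
    proof (rule Ck_on_scaleR[OF U(1) Ck_on_inner[OF U(1)]])
      show "Ck_on k U (\<lambda>x. frechet_derivative h (at x) v)" using Suc.prems(2) by simp
      show "Ck_on k U (\<lambda>x. frechet_derivative f (at (h x)) b)"
        using Suc.IH[of "\<lambda>y. frechet_derivative f (at y) b", OF _ Ck_on_Suc[OF Suc.prems(2)]] Suc.prems(1) by simp
    qed
    then show "Ck_on k U (\<lambda>x. \<Sum>b\<in>Basis. (frechet_derivative h (at x) v \<bullet> b) *\<^sub>R frechet_derivative f (at (h x)) b)"
      by (intro Ck_on_sum[OF U(1)]) auto
  qed
qed

lemma smooth_on_compose:
  fixes f :: "'b::euclidean_space \<Rightarrow> 'c::real_normed_vector" and h :: "'a::euclidean_space \<Rightarrow> 'b"
  assumes "open U" "open V" "h ` U \<subseteq> V" "smooth_on V f" "smooth_on U h"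
  shows "smooth_on U (\<lambda>x. f (h x))"
  using Ck_on_compose[OF assms(1-3)] assms(4,5) unfolding smooth_on_def by blast

lemma smooth_on_cong:
  assumes "open U" "\<And>x. x \<in> U \<Longrightarrow> f x = h x" "smooth_on U f" shows "smooth_on U h"
  using Ck_on_cong[where f = f and h = h, OF assms(1,2)] assms(3) unfolding smooth_on_def by blast


section \<open>Submanifolds and their second fundamental form\<close>

text \<open>A subspace is closed, so it contains the directional derivatives of the maps with values in it.\<close>
lemma directional_derivative_in_subspace:
  fixes f :: "'a::euclidean_space \<Rightarrow> 'b::euclidean_space"
  assumes f: "(f has_derivative f') (at x)" and W: "subspace W"
    and U: "open U" "x \<in> U" and fW: "\<And>s. x + s *\<^sub>R v \<in> U \<Longrightarrow> f (x + s *\<^sub>R v) \<in> W"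
  shows "f' v \<in> W"
proof -
  have "((\<lambda>s. x + s *\<^sub>R v) has_derivative (\<lambda>s. s *\<^sub>R v)) (at 0)" by (auto intro!: derivative_eq_intros)
  from has_derivative_compose[OF this, of f f'] f
  have "((\<lambda>s. f (x + s *\<^sub>R v)) has_derivative (\<lambda>s. f' (s *\<^sub>R v))) (at 0)" by simp
  moreover have "f' (s *\<^sub>R v) = s *\<^sub>R f' v" for s using linear_scale[OF has_derivative_linear[OF f]] .
  ultimately have "((\<lambda>s. f (x + s *\<^sub>R v)) has_vector_derivative f' v) (at 0)" by (simp add: has_vector_derivative_def)
  then have lim: "((\<lambda>s. (1 / s) *\<^sub>R (f (x + s *\<^sub>R v) - f x)) \<longlongrightarrow> f' v) (at 0)"
    unfolding has_vector_derivative_def has_derivative_iff_norm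
  proof -
    assume "bounded_linear (\<lambda>s. s *\<^sub>R f' v) \<and>
      ((\<lambda>y. norm (f (x + y *\<^sub>R v) - f (x + 0 *\<^sub>R v) - (y - 0) *\<^sub>R f' v) / norm (y - 0)) \<longlongrightarrow> 0) (at 0)"
    then have 1: "((\<lambda>y. norm (f (x + y *\<^sub>R v) - f x - y *\<^sub>R f' v) / \<bar>y\<bar>) \<longlongrightarrow> 0) (at 0)" by simp
    have "((\<lambda>s. (1 / s) *\<^sub>R (f (x + s *\<^sub>R v) - f x) - f' v) \<longlongrightarrow> 0) (at 0)"
    proof (rule Lim_null_comparison[OF _ 1])
      show "\<forall>\<^sub>F s in at 0. norm ((1 / s) *\<^sub>R (f (x + s *\<^sub>R v) - f x) - f' v) \<le> norm (f (x + s *\<^sub>R v) - f x - s *\<^sub>R f' v) / \<bar>s\<bar>"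
      proof (rule eventually_mono[OF eventually_neq_at_within[of 0]])
        fix s :: real assume "s \<noteq> 0"
        then have "(1 / s) *\<^sub>R (f (x + s *\<^sub>R v) - f x) - f' v = (1 / s) *\<^sub>R (f (x + s *\<^sub>R v) - f x - s *\<^sub>R f' v)"
          by (simp add: scaleR_diff_right)
        then show "norm ((1 / s) *\<^sub>R (f (x + s *\<^sub>R v) - f x) - f' v) \<le> norm (f (x + s *\<^sub>R v) - f x - s *\<^sub>R f' v) / \<bar>s\<bar>"
          by simp
      qed
    qed
    then show ?thesis by (simp add: LIM_zero_iff)
  qed
  have "((\<lambda>s. x + s *\<^sub>R v) \<longlongrightarrow> x + 0 *\<^sub>R v) (at (0::real))" by (intro tendsto_intros)
  then have "\<forall>\<^sub>F s in at (0::real). x + s *\<^sub>R v \<in> U" using topological_tendstoD[OF _ U(1)] U(2) by simp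
  then have "\<forall>\<^sub>F s in at (0::real). (1 / s) *\<^sub>R (f (x + s *\<^sub>R v) - f x) \<in> W"
  proof eventually_elim
    case (elim s)
    have "f x \<in> W" using fW[of 0] U(2) by simp
    then show ?case using fW[OF elim] W by (simp add: subspace_scale subspace_diff)
  qed
  then show ?thesis by (rule Lim_in_closed_set[OF closed_subspace[OF W] _ _ lim]) simp
qed

context semi_riemannian
begin

lemma slice_chartD:
  assumes "slice_chart A P c W" shows "c \<in> A" "subspace W" "snd c ` (fst c \<inter> P) = chart_image c \<inter> W"
  using assms by (auto simp: slice_chart_def)

lemma slice_chart_mem:
  assumes s: "slice_chart A P c W" and y: "y \<in> chart_image c"
  shows "chart_inv c y \<in> P \<longleftrightarrow> y \<in> W"
proof
  assume "chart_inv c y \<in> P"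
  moreover have "chart_inv c y \<in> fst c" and eq: "snd c (chart_inv c y) = y" using chart(4,5)[OF slice_chartD(1)[OF s] y] by auto
  ultimately have "snd c (chart_inv c y) \<in> snd c ` (fst c \<inter> P)" by blast
  then show "y \<in> W" unfolding slice_chartD(3)[OF s] eq by blast
next
  assume "y \<in> W"
  then have "y \<in> snd c ` (fst c \<inter> P)" unfolding slice_chartD(3)[OF s] using y by blast
  then obtain q where "y = snd c q" "q \<in> fst c" "q \<in> P" by blast
  then show "chart_inv c y \<in> P" using chart(3)[OF slice_chartD(1)[OF s]] by simp
qed

text \<open>The points with coordinates \<open>snd d p + s w\<close> lie in \<open>P\<close>, so the transition map sends this line to \<open>W\<close>.\<close>
lemma slice_chart_transform:
  assumes c: "slice_chart A P c W" "c \<in> charts_at A p" and d: "slice_chart A P d W'" "d \<in> charts_at A p"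
    and p: "p \<in> P" and w: "w \<in> W'"
  shows "trans_deriv d c (snd d p) w \<in> W"
proof (rule directional_derivative_in_subspace[where f = "transition d c" and f' = "trans_deriv d c (snd d p)" and v = w])
  let ?U = "overlap d c"
  note cA = charts_atD(1)[OF c(2)] and dA = charts_atD(1)[OF d(2)]
  show "(transition d c has_derivative trans_deriv d c (snd d p)) (at (snd d p))"
    by (rule transition_has_derivative[OF dA cA overlapI[OF dA cA d(2) c(2)]])
  show "subspace W" by (rule slice_chartD(2)[OF c(1)])
  show "open ?U" by (rule open_overlap'[OF dA cA])
  show "snd d p \<in> ?U" by (rule overlapI[OF dA cA d(2) c(2)])
  fix s assume s: "snd d p + s *\<^sub>R w \<in> ?U"
  note o = overlapD[OF dA cA s]
  have "snd d p \<in> W'" using slice_chart_mem[OF d(1) charts_atD(3)[OF d(2)]] charts_atD(4)[OF d(2)] p by simp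
  then have "snd d p + s *\<^sub>R w \<in> W'" using w slice_chartD(2)[OF d(1)] by (simp add: subspace_add subspace_scale)
  then have "chart_inv d (snd d p + s *\<^sub>R w) \<in> P" using slice_chart_mem[OF d(1) o(1)] by simp
  then show "transition d c (snd d p + s *\<^sub>R w) \<in> W" using slice_chart_mem[OF c(1) o(2)] o(3) by simp
qed

lemma sub_tangent_slice:
  assumes c: "slice_chart A P c W" "p \<in> fst c" and p: "p \<in> P"
  shows "v \<in> sub_tangent A P p \<longleftrightarrow> v \<in> tangent_space A p \<and> v c \<in> W"
proof
  assume "v \<in> sub_tangent A P p"
  then obtain d W' where v: "v \<in> tangent_space A p" and d: "p \<in> fst d" "slice_chart A P d W'" "v d \<in> W'"
    unfolding sub_tangent_def by blast
  have ca: "c \<in> charts_at A p" "d \<in> charts_at A p" using c d slice_chartD(1) by (auto simp: charts_at_def)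
  show "v \<in> tangent_space A p \<and> v c \<in> W"
    using slice_chart_transform[OF c(1) ca(1) d(2) ca(2) p d(3)] tangent_transform[OF ca(2,1) v] v by simp
next
  assume "v \<in> tangent_space A p \<and> v c \<in> W"
  then show "v \<in> sub_tangent A P p" unfolding sub_tangent_def using c by blast
qed

lemma subspace_sub_tangent:
  assumes c: "slice_chart A P c W" "p \<in> fst c" and p: "p \<in> P"
  shows "subspace (sub_tangent A P p)"
proof -
  have "sub_tangent A P p = {v \<in> tangent_space A p. v c \<in> W}" using sub_tangent_slice[OF assms] by blast
  then show ?thesis using slice_chartD(2)[OF c(1)] subspace_tangent[of p]
    by (auto simp: subspace_def scaleR_fun_def)
qed

lemma nabla_tangent:
  assumes U: "open U" "p \<in> U" and Y: "smooth_vector_field_on A U Y" and v: "v \<in> tangent_space A p"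
  shows "nabla A g p v Y \<in> tangent_space A p"
proof -
  obtain c where c: "c \<in> charts_at A p" using ex_chart by blast
  define F where "F c x = Y (chart_inv c x) c" for c x
  have Fs: "smooth_on (snd c ` (fst c \<inter> U)) (F c)" if "c \<in> A" for c
    using Y that unfolding smooth_vector_field_on_def F_def by blast
  have Yt: "Y q \<in> tangent_space A q" if "q \<in> U" for q using Y that unfolding smooth_vector_field_on_def by blast
  have nab: "nabla A g p v Y c = frechet_derivative (F c) (at (snd c p)) (v c) + Gam c (snd c p) (v c) (F c (snd c p))"
    if "c \<in> charts_at A p" for c
    using that charts_atD(4)[OF that] by (simp add: nabla_def F_def[abs_def] Gam_def)
  have FD: "(F c has_derivative frechet_derivative (F c) (at (snd c p))) (at (snd c p))" if "c \<in> charts_at A p" for c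
    by (rule smooth_on_has_derivative[OF Fs]) (use that U charts_atD in \<open>auto\<close>)
  show ?thesis
  proof (rule tangentI[OF c])
    fix d assume d: "d \<in> charts_at A p"
    note cA = charts_atD(1)[OF c] and dA = charts_atD(1)[OF d] 
    let ?x = "snd c p"
    have x: "?x \<in> overlap c d" by (rule overlapI[OF cA dA c d])
    have eqx: "transition c d ?x = snd d p" using charts_atD(4)[OF c] by (simp add: transition_def)
    define V where "V = snd c ` (fst c \<inter> (fst d \<inter> U))"
    have V: "open V" "?x \<in> V"
      using open_overlap[OF A cA open_Int[OF chart(1)[OF dA] U(1)]] charts_atD(2)[OF c] charts_atD(2)[OF d] U(2) by (auto simp: V_def)
    have 1: "((\<lambda>y. F d (transition c d y)) has_derivative (\<lambda>h. frechet_derivative (F d) (at (snd d p)) (trans_deriv c d ?x h))) (at ?x)"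
      by (rule has_derivative_compose[OF transition_has_derivative[OF cA dA x]]) (unfold eqx, rule FD[OF d])
    have 2: "((\<lambda>y. trans_deriv c d y (F c y)) has_derivative
      (\<lambda>h. trans_deriv2 c d ?x (F c ?x) h + trans_deriv c d ?x (frechet_derivative (F c) (at ?x) h))) (at ?x)"
    proof (rule has_derivative_linear_apply_at[OF open_overlap'[OF cA dA] x, where D = "\<lambda>h a. trans_deriv2 c d ?x a h"])
      show "linear (\<lambda>a. trans_deriv2 c d ?x a h)" for h by (rule trans_deriv2_linear(2)[OF cA dA x])
    qed (rule trans_deriv_linear[OF cA dA] trans_deriv_has_derivative[OF cA dA x] FD[OF c] | assumption)+
    have eqF: "F d (transition c d y) = trans_deriv c d y (F c y)" if y: "y \<in> V" for y
    proof -
      obtain q where q: "y = snd c q" "q \<in> fst c" "q \<in> fst d" "q \<in> U" using y by (auto simp: V_def)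
      have ca: "c \<in> charts_at A q" "d \<in> charts_at A q" using q cA dA by (auto simp: charts_at_def)
      show ?thesis using tangent_transform[OF ca Yt[OF q(4)]] charts_atD(4)[OF ca(1)] charts_atD(4)[OF ca(2)] q(1)
        by (simp add: F_def transition_def)
    qed
    have "((\<lambda>y. F d (transition c d y)) has_derivative
      (\<lambda>h. trans_deriv2 c d ?x (F c ?x) h + trans_deriv c d ?x (frechet_derivative (F c) (at ?x) h))) (at ?x)"
      by (rule has_derivative_transform_within_open[OF 2 V]) (rule eqF[symmetric])
    from fun_cong[OF has_derivative_unique[OF 1 this], of "v c"]
    have D: "frechet_derivative (F d) (at (snd d p)) (v d) = trans_deriv2 c d ?x (F c ?x) (v c)
      + trans_deriv c d ?x (frechet_derivative (F c) (at ?x) (v c))"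
      using tangent_transform[OF c d v] by simp
    have "Gam d (snd d p) (v d) (F d (snd d p)) = trans_deriv c d ?x (Gam c ?x (v c) (F c ?x)) - trans_deriv2 c d ?x (F c ?x) (v c)"
      using Gam_transform[OF cA dA x, of "v c" "F c ?x"] tangent_transform[OF c d v] eqF[OF V(2)] eqx
        trans_deriv2_sym[OF cA dA x, of "v c" "F c ?x"] by simp
    then show "nabla A g p v Y d = trans_deriv c d ?x (nabla A g p v Y c)"
      unfolding nab[OF c] nab[OF d] D linear_add[OF trans_deriv_linear[OF cA dA x]] by simp
  qed (simp add: nabla_def)
qed

lemma coord_vector_smooth:
  assumes c: "c \<in> A" shows "smooth_vector_field_on A (fst c) (coord_vector A c u)"
  unfolding smooth_vector_field_on_def
proof (intro conjI ballI)
  show "coord_vector A c u p \<in> tangent_space A p" if "p \<in> fst c" for p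
    using coord_vector_tangent[OF A] that c by (simp add: charts_at_def)
  fix d assume d: "d \<in> A"
  have "smooth_on (overlap d c) (\<lambda>x. trans_deriv c d (transition d c x) u)"
  proof (rule smooth_on_compose[OF open_overlap'[OF d c] open_overlap'[OF c d] _ trans_deriv_smooth[OF c d] transition_smooth[OF d c]])
    show "transition d c ` overlap d c \<subseteq> overlap c d"
      using chart(3)[OF d] by (auto simp: overlap_def transition_def)
  qed
  then have "smooth_on (overlap d c) (\<lambda>x. coord_vector A c u (chart_inv d x) d)"
    by (rule smooth_on_cong[OF open_overlap'[OF d c], rotated])
      (use overlapD[OF d c] chart(3)[OF d] in \<open>auto simp: coord_vector_def trans_deriv_def transition_def\<close>)
  then show "smooth_on (snd d ` (fst d \<inter> fst c)) (\<lambda>x. coord_vector A c u (chart_inv d x) d)"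
    by (simp add: overlap_def)
qed

text \<open>In a slice chart the components of a field tangent to \<open>P\<close> lie in \<open>W\<close> along \<open>P\<close>, hence so do their derivatives
  in the directions of \<open>P\<close>. These are orthogonal to \<open>n\<close>, and only the Christoffel term remains, which depends on the
  field only through its value at \<open>p\<close>. The coordinate field shows that an extension exists.\<close>
lemma second_fundamental_form_slice:
  assumes c: "slice_chart A P c W" "p \<in> fst c" and p: "p \<in> P"
    and v: "v1 \<in> sub_tangent A P p" "v2 \<in> sub_tangent A P p"
    and n: "n \<in> orth_complement A g p (sub_tangent A P p)"
  shows "second_fundamental_form A g P p n v1 v2 = metr c (snd c p) (Gam c (snd c p) (v1 c) (v2 c)) (n c)"
proof -
  note cA = slice_chartD(1)[OF c(1)] and W = slice_chartD(2)[OF c(1)]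
  have ca: "c \<in> charts_at A p" using c(2) cA by (simp add: charts_at_def)
  let ?x = "snd c p"
  note x = charts_atD(3)[OF ca]
  have vt: "v1 \<in> tangent_space A p" "v1 c \<in> W" "v2 \<in> tangent_space A p" "v2 c \<in> W"
    using v sub_tangent_slice[OF c p] by auto
  have nt: "n \<in> tangent_space A p" "\<And>v. v \<in> sub_tangent A P p \<Longrightarrow> g p n v = 0" using n by (auto simp: orth_complement_def)
  define V0 where "V0 = coord_vector A c (v2 c)"
  let ?s = "metr c ?x (Gam c ?x (v1 c) (v2 c)) (n c)"
  have V0: "open (fst c) \<and> p \<in> fst c \<and> smooth_vector_field_on A (fst c) V0 \<and>
     (\<forall>q\<in>fst c \<inter> P. V0 q \<in> sub_tangent A P q) \<and> V0 p = v2"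
  proof (intro conjI ballI)
    show "V0 p = v2" unfolding V0_def by (rule coord_vector_of_tangent[OF A ca vt(3)])
    fix q assume q: "q \<in> fst c \<inter> P"
    then have cq: "c \<in> charts_at A q" using cA by (simp add: charts_at_def)
    show "V0 q \<in> sub_tangent A P q"
      using sub_tangent_slice[OF c(1), of q] q coord_vector_tangent[OF A cq] coord_vector_self[OF A cq] vt(4) by (simp add: V0_def)
  qed (use chart(1)[OF cA] c(2) coord_vector_smooth[OF cA] V0_def in auto)
  have key: "g p (nabla A g p v1 V) n = ?s"
    if V: "open U" "p \<in> U" "smooth_vector_field_on A U V" "\<And>q. q \<in> U \<inter> P \<Longrightarrow> V q \<in> sub_tangent A P q" "V p = v2" for U V
  proof -
    define F where "F x = V (chart_inv c x) c" for x
    define w where "w = frechet_derivative F (at ?x) (v1 c)"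
    have Fs: "smooth_on (snd c ` (fst c \<inter> U)) F" using V(3) cA unfolding smooth_vector_field_on_def F_def by blast
    have xU: "?x \<in> snd c ` (fst c \<inter> U)" using c(2) V(2) by blast
    have "w \<in> W"
      unfolding w_def
    proof (rule directional_derivative_in_subspace[OF smooth_on_has_derivative[OF Fs xU] W open_overlap[OF A cA V(1)] xU])
      fix s assume "?x + s *\<^sub>R v1 c \<in> snd c ` (fst c \<inter> U)"
      then obtain q where q: "?x + s *\<^sub>R v1 c = snd c q" "q \<in> fst c" "q \<in> U" by blast
      have "?x \<in> W" using slice_chart_mem[OF c(1) x] charts_atD(4)[OF ca] p by simp
      then have "snd c q \<in> W" unfolding q(1)[symmetric] using vt(2) W by (simp add: subspace_add subspace_scale)
      moreover have "chart_inv c (snd c q) = q" using chart(3)[OF cA q(2)] .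
      moreover have "snd c q \<in> chart_image c" using q(2) by (simp add: chart_image_def)
      ultimately have "q \<in> P" using slice_chart_mem[OF c(1)] by metis
      then have "V q \<in> sub_tangent A P q" using V(4) q(3) by blast
      then have "V q c \<in> W" using sub_tangent_slice[OF c(1) q(2) \<open>q \<in> P\<close>] by blast
      then show "F (?x + s *\<^sub>R v1 c) \<in> W" unfolding q(1) F_def using \<open>chart_inv c (snd c q) = q\<close> by simp
    qed
    then have "coord_vector A c w p \<in> sub_tangent A P p"
      using sub_tangent_slice[OF c p] coord_vector_tangent[OF A ca] coord_vector_self[OF A ca] by simp
    then have "g p n (coord_vector A c w p) = 0" by (rule nt(2))
    then have w0: "metr c ?x (n c) w = 0"
      using metric_value[OF ca nt(1) coord_vector_tangent[OF A ca, of w]] coord_vector_self[OF A ca, of w] by simp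
    have "nabla A g p v1 V c = w + Gam c ?x (v1 c) (v2 c)"
      using ca V(5) charts_atD(4)[OF ca] by (simp add: nabla_def w_def F_def[abs_def] Gam_def)
    then have "g p (nabla A g p v1 V) n = metr c ?x (w + Gam c ?x (v1 c) (v2 c)) (n c)"
      using metric_value[OF ca nabla_tangent[OF V(1-3) vt(1)] nt(1)] by simp
    then show ?thesis using w0 sym_formD(2,3)[OF metr_sym_form[OF cA x]] by simp
  qed
  show ?thesis
    unfolding second_fundamental_form_def
  proof (rule the_equality)
    show "\<forall>U V. open U \<and> p \<in> U \<and> smooth_vector_field_on A U V \<and> (\<forall>q\<in>U \<inter> P. V q \<in> sub_tangent A P q) \<and> V p = v2 \<longrightarrow>
      ?s = g p (nabla A g p v1 V) n" using key by metis
    fix s assume "\<forall>U V. open U \<and> p \<in> U \<and> smooth_vector_field_on A U V \<and> (\<forall>q\<in>U \<inter> P. V q \<in> sub_tangent A P q) \<and> V p = v2 \<longrightarrow>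
      s = g p (nabla A g p v1 V) n"
    then have "s = g p (nabla A g p v1 V0) n" using V0 by blast
    also have "\<dots> = ?s" by (rule key) (use V0 in auto)
    finally show "s = ?s" .
  qed
qed

text \<open>The map from \<open>s\<close> to the functional \<open>B s\<close> on \<open>W\<close> is injective, hence surjective for reasons of dimension.\<close>
lemma riesz_on_subspace:
  fixes B :: "'e \<Rightarrow> 'e \<Rightarrow> real"
  assumes B: "sym_form B" and W: "subspace W" and nondeg: "\<And>u. u \<in> W \<Longrightarrow> (\<And>w. w \<in> W \<Longrightarrow> B u w = 0) \<Longrightarrow> u = 0"
    and f: "linear f"
  shows "\<exists>s\<in>W. \<forall>w\<in>W. f w = B s w"
proof -
  obtain E where E: "E \<subseteq> W" "pairwise orthogonal E" "\<And>x. x \<in> E \<Longrightarrow> norm x = 1" "independent E" "card E = dim W" "span E = W"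
    using orthonormal_basis_subspace[OF W] by metis
  have fin: "finite E" using E(4) by (rule independent_imp_finite)
  define h where "h s = (\<Sum>b\<in>E. B s b *\<^sub>R b)" for s
  have h: "linear h"
    unfolding h_def by (intro linearI) (simp_all add: sym_formD[OF B] scaleR_add_left sum.distrib scaleR_sum_right)
  have sp: "u = 0" if "\<And>b. b \<in> E \<Longrightarrow> B u b = 0" "u \<in> W" for u
  proof (rule nondeg[OF that(2)])
    have "subspace {w. B u w = 0}" by (auto simp: subspace_def sym_formD[OF B])
    then have "span E \<subseteq> {w. B u w = 0}" using that(1) by (intro span_minimal) auto
    then show "B u w = 0" if "w \<in> W" for w using that E(6) by blast
  qed
  have on: "b \<bullet> b' = (if b = b' then 1 else 0)" if "b \<in> E" "b' \<in> E" for b b'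
    using E(2,3) that by (auto simp: pairwise_def orthogonal_def norm_eq_1)
  have hin: "h s \<bullet> b = B s b" if "b \<in> E" for s b
  proof -
    have "h s \<bullet> b = (\<Sum>b'\<in>E. if b' = b then B s b' else 0)"
      unfolding h_def inner_sum_left by (intro sum.cong refl) (simp add: on that)
    then show ?thesis using that fin by simp
  qed
  have inj: "inj_on h W"
    unfolding linear_injective_on_subspace_0[OF h W]
  proof (intro ballI impI)
    fix u assume "u \<in> W" "h u = 0"
    then show "u = 0" using sp[of u] hin by (metis inner_zero_left)
  qed
  have sub: "h ` W \<subseteq> W" using E(1) W by (auto simp: h_def intro!: subspace_sum subspace_scale)
  have "dim (h ` W) = dim W" by (rule dim_image_eq[OF h]) (use inj W in \<open>simp add: span_eq_iff[THEN iffD2]\<close>)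
  then have "h ` W = W" using subspace_dim_equal[OF linear_subspace_image[OF h W] W sub] by simp
  moreover have "(\<Sum>b\<in>E. f b *\<^sub>R b) \<in> W" using E(1) W by (auto intro!: subspace_sum subspace_scale)
  ultimately obtain s where s: "s \<in> W" "h s = (\<Sum>b\<in>E. f b *\<^sub>R b)" by (metis imageE)
  have "f b = B s b" if "b \<in> E" for b
  proof -
    have "B s b = (\<Sum>b'\<in>E. f b' *\<^sub>R b') \<bullet> b" using hin[OF that, of s] s(2) by simp
    also have "\<dots> = (\<Sum>b'\<in>E. if b' = b then f b' else 0)"
      unfolding inner_sum_left by (intro sum.cong refl) (simp add: on that)
    finally show ?thesis using that fin by simp
  qed
  moreover have "subspace {w. f w = B s w}"
    by (auto simp: subspace_def sym_formD[OF B] linear_0[OF f] linear_add[OF f] linear_scale[OF f])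
  ultimately have "span E \<subseteq> {w. f w = B s w}" by (intro span_minimal) auto
  then show ?thesis using s(1) E(6) by blast
qed

text \<open>The definite description in the shape operator is well-defined when the tangent space is nondegenerate.\<close>
lemma shape_operator_char:
  assumes c: "slice_chart A P c W" "p \<in> fst c" and p: "p \<in> P" and v: "v \<in> sub_tangent A P p"
    and n: "n \<in> orth_complement A g p (sub_tangent A P p)"
    and nondeg: "\<And>u. u \<in> sub_tangent A P p \<Longrightarrow> (\<And>w. w \<in> sub_tangent A P p \<Longrightarrow> g p u w = 0) \<Longrightarrow> u = 0"
  shows "shape_operator A g P p n v \<in> sub_tangent A P p"
    "w \<in> sub_tangent A P p \<Longrightarrow> second_fundamental_form A g P p n v w = g p (shape_operator A g P p n v) w"
proof -
  note cA = slice_chartD(1)[OF c(1)] and W = slice_chartD(2)[OF c(1)]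
  have ca: "c \<in> charts_at A p" using c(2) cA by (simp add: charts_at_def)
  let ?x = "snd c p" let ?T = "sub_tangent A P p"
  note x = charts_atD(3)[OF ca] and slice = sub_tangent_slice[OF c p]
  note sx = sym_formD[OF metr_sym_form[OF cA x]]
  have cv: "coord_vector A c w p \<in> ?T" if "w \<in> W" for w
    using slice coord_vector_tangent[OF A ca] coord_vector_self[OF A ca] that by simp
  have val: "g p u w = metr c ?x (u c) (w c)" if "u \<in> ?T" "w \<in> ?T" for u w
    using metric_value[OF ca] that slice by blast
  have nd: "u = 0" if u: "u \<in> W" "\<And>w. w \<in> W \<Longrightarrow> metr c ?x u w = 0" for u
  proof -
    have "coord_vector A c u p = 0"
    proof (rule nondeg[OF cv[OF u(1)]])
      show "g p (coord_vector A c u p) w = 0" if "w \<in> ?T" for w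
        using val[OF cv[OF u(1)] that] u(2)[of "w c"] that slice coord_vector_self[OF A ca] by simp
    qed
    then show ?thesis using coord_vector_self[OF A ca, of u] by simp
  qed
  define f where "f w = metr c ?x (Gam c ?x (v c) w) (n c)" for w
  have f: "linear f"
    using bilinear_radd[OF Gam_bilinear[OF cA x]] bilinear_rmul[OF Gam_bilinear[OF cA x]]
    by (intro linearI) (simp_all add: f_def sx(3,5))
  obtain s where s: "s \<in> W" "\<And>w. w \<in> W \<Longrightarrow> f w = metr c ?x s w"
    using riesz_on_subspace[OF metr_sym_form[OF cA x] W nd f] by blast
  have S: "second_fundamental_form A g P p n v w = g p (coord_vector A c s p) w" if "w \<in> ?T" for w
  proof -
    have "second_fundamental_form A g P p n v w = f (w c)"
      unfolding f_def by (rule second_fundamental_form_slice[OF c p v that n])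
    also have "\<dots> = g p (coord_vector A c s p) w"
      using s(2)[of "w c"] val[OF cv[OF s(1)] that] that slice coord_vector_self[OF A ca] by simp
    finally show ?thesis .
  qed
  have "shape_operator A g P p n v = coord_vector A c s p"
    unfolding shape_operator_def
  proof (rule the_equality)
    show "coord_vector A c s p \<in> ?T \<and> (\<forall>w\<in>?T. second_fundamental_form A g P p n v w = g p (coord_vector A c s p) w)"
      using S cv[OF s(1)] by blast
    fix s' assume s': "s' \<in> ?T \<and> (\<forall>w\<in>?T. second_fundamental_form A g P p n v w = g p s' w)"
    have "s' c - s = 0"
    proof (rule nd)
      show "s' c - s \<in> W" using s' slice s(1) W by (auto intro: subspace_diff)
      fix w assume w: "w \<in> W"
      have "metr c ?x (s' c) w = metr c ?x s w"
        using s' S[OF cv[OF w]] val[OF _ cv[OF w], of s'] val[OF cv[OF s(1)] cv[OF w]] cv[OF w] coord_vector_self[OF A ca] by simp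
      then show "metr c ?x (s' c - s) w = 0" by (simp add: sx(9))
    qed
    then show "s' = coord_vector A c s p"
      using coord_vector_of_tangent[OF A ca, of s'] s' slice by simp
  qed
  then show "shape_operator A g P p n v \<in> ?T"
    "w \<in> ?T \<Longrightarrow> second_fundamental_form A g P p n v w = g p (shape_operator A g P p n v) w"
    using S cv[OF s(1)] by simp_all
qed

end

section \<open>Causal vectors\<close>

text \<open>In this lemma and the next \<open>B\<close> is a nondegenerate form without two orthogonal timelike vectors. An isotropic
  vector \<open>u\<close> orthogonal to the timelike vector \<open>v\<close> pairs nontrivially with some vector orthogonal to \<open>v\<close>, and adding a
  multiple of \<open>u\<close> makes that vector timelike.\<close>
lemma orthogonal_to_timelike:
  assumes B: "sym_form B" and nondeg: "\<And>u. (\<And>w. B u w = 0) \<Longrightarrow> u = 0"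
    and idx: "\<And>u v. B u u < 0 \<Longrightarrow> B v v < 0 \<Longrightarrow> B u v \<noteq> 0"
    and v: "B v v < 0" and u: "B u v = 0" "B u u \<le> 0"
  shows "u = 0"
proof (rule ccontr)
  note s = sym_formD[OF B]
  assume u0: "u \<noteq> 0"
  have uu: "B u u = 0" using idx[of u v] u v by force
  obtain z where z: "B u z \<noteq> 0" using nondeg u0 by blast
  define z' where "z' = z - (B z v / B v v) *\<^sub>R v"
  have z': "B z' v = 0" "B u z' \<noteq> 0" using v z u(1) by (simp_all add: z'_def s(5,6,9,10))
  \<comment> \<open>chosen to make the value at \<open>z' + \<tau> u\<close> equal to \<open>-1\<close>\<close>
  define \<tau> where "\<tau> = - (B z' z' + 1) / (2 * B u z')"
  have "B (z' + \<tau> *\<^sub>R u) (z' + \<tau> *\<^sub>R u) = B z' z' + 2 * (\<tau> * B u z')"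
    unfolding sym_form_square[OF B] using s(2)[of z' u] by (simp add: s(5,6) uu)
  also have "2 * (\<tau> * B u z') = - (B z' z' + 1)" using z'(2) by (simp add: \<tau>_def field_simps)
  finally have "B (z' + \<tau> *\<^sub>R u) (z' + \<tau> *\<^sub>R u) < 0" by simp
  moreover have "B (z' + \<tau> *\<^sub>R u) v = 0" using z'(1) u(1) by (simp add: s(3,5))
  ultimately show False using idx[of "z' + \<tau> *\<^sub>R u" v] v by blast
qed

lemma orthogonal_to_causal:
  assumes B: "sym_form B" and nondeg: "\<And>u. (\<And>w. B u w = 0) \<Longrightarrow> u = 0"
    and idx: "\<And>u v. B u u < 0 \<Longrightarrow> B v v < 0 \<Longrightarrow> B u v \<noteq> 0" and e: "B e e < 0"
    and v: "v \<noteq> 0" "B v v \<le> 0" and u: "B u v = 0"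
  shows "B u u \<ge> 0" "B u u = 0 \<Longrightarrow> \<exists>r. u = r *\<^sub>R v"
proof -
  note s = sym_formD[OF B]
  have ort: "u = 0" if "B v v < 0" "B u v = 0" "B u u \<le> 0" for u v
    by (rule orthogonal_to_timelike[OF B nondeg idx that])
  show "B u u \<ge> 0"
  proof (rule ccontr)
    assume "\<not> B u u \<ge> 0"
    then have "v = 0" using ort[of u v] v(2) u s(2) by simp
    then show False using v by blast
  qed
  assume uu: "B u u = 0"
  show "\<exists>r. u = r *\<^sub>R v"
  proof (cases "B v v < 0")
    case True
    then have "u = 0" using ort[of v u] u uu by simp
    then show ?thesis by (intro exI[of _ 0]) simp
  next
    case False
    then have vv: "B v v = 0" using v by simp
    have ve: "B v e \<noteq> 0" using ort[OF e, of v] v by force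
    \<comment> \<open>an isotropic combination orthogonal to the timelike vector \<open>e\<close>\<close>
    define w where "w = B v e *\<^sub>R u - B u e *\<^sub>R v"
    have "B w e = 0" by (simp add: w_def s(5,9))
    moreover have "B w w = 0" using u s(2)[of v u] by (simp add: w_def s(5,6,9,10) uu vv)
    ultimately have "w = 0" using ort[OF e, of w] by simp
    then have "B v e *\<^sub>R u = B u e *\<^sub>R v" by (simp add: w_def)
    then have "u = (B u e / B v e) *\<^sub>R v" using ve by (metis divide_inverse_commute scaleR_scaleR scaleR_one left_inverse)
    then show ?thesis by blast
  qed
qed

context semi_riemannian
begin

lemma tangent_coords:
  assumes c: "c \<in> charts_at A p"
  shows "linear (\<lambda>u. coord_vector A c u p)" "inj (\<lambda>u. coord_vector A c u p)"
  using coord_vector_lin[OF A c] coord_vector_self[OF A c] by (auto intro!: linearI injI) metis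

lemma dim_tangent_subspace:
  assumes c: "c \<in> charts_at A p" and W: "W \<subseteq> tangent_space A p"
  shows "dim W = dim ((\<lambda>v. v c) ` W)" "dim W \<le> DIM('e)"
proof -
  have "W = (\<lambda>u. coord_vector A c u p) ` (\<lambda>v. v c) ` W"
    using coord_vector_of_tangent[OF A c] W by force
  then have "dim W = dim ((\<lambda>u. coord_vector A c u p) ` (\<lambda>v. v c) ` W)" by simp
  also have "\<dots> = dim ((\<lambda>v. v c) ` W)"
    by (rule dim_image_eq[OF tangent_coords(1)[OF c]]) (rule inj_on_subset[OF tangent_coords(2)[OF c] subset_UNIV])
  finally show "dim W = dim ((\<lambda>v. v c) ` W)" .
  then show "dim W \<le> DIM('e)" by (simp add: dim_subset_UNIV)
qed

text \<open>Two orthogonal timelike vectors would span a negative definite plane, so the index would be at least \<open>2\<close>.\<close>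
lemma lorentzian_form:
  assumes L: "lorentzian A g" and c: "c \<in> charts_at A p"
  shows "\<exists>e. metr c (snd c p) e e < 0"
    "metr c (snd c p) u u < 0 \<Longrightarrow> metr c (snd c p) v v < 0 \<Longrightarrow> metr c (snd c p) u v \<noteq> 0"
proof -
  let ?B = "metr c (snd c p)"
  note s = sym_formD[OF metr_sym_form[OF charts_atD(1)[OF c] charts_atD(3)[OF c]]]
  let ?S = "{dim W | W. subspace W \<and> W \<subseteq> tangent_space A p \<and> (\<forall>v\<in>W. v \<noteq> 0 \<longrightarrow> g p v v < 0)}"
  let ?cv = "\<lambda>u. coord_vector A c u p"
  have gv: "g p (?cv u) (?cv v) = ?B u v" for u v
    using metric_value[OF c coord_vector_tangent[OF A c] coord_vector_tangent[OF A c]] coord_vector_self[OF A c] by simp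
  have M: "Max ?S = 1" using L unfolding lorentzian_def metric_index_def by blast
  have "\<forall>n\<in>?S. n \<le> DIM('e)"
  proof
    fix n assume "n \<in> ?S"
    then obtain W where "n = dim W" "W \<subseteq> tangent_space A p" by (elim CollectE exE conjE)
    then show "n \<le> DIM('e)" using dim_tangent_subspace(2)[OF c] by simp
  qed
  then have fin: "finite ?S" using finite_nat_set_iff_bounded_le by blast
  have "dim {0 :: ('m, 'e) tvec} = 0"
    using dim_tangent_subspace(1)[OF c, of "{0}"] subspace_0[OF subspace_tangent[of p]] by simp
  then have "0 \<in> ?S" using subspace_0[OF subspace_tangent[of p]] by (intro CollectI exI[of _ "{0}"]) simp
  then have "Max ?S \<in> ?S" using Max_in[OF fin] by blast
  then obtain W where W: "dim W = 1" "W \<subseteq> tangent_space A p" "\<And>v. v \<in> W \<Longrightarrow> v \<noteq> 0 \<Longrightarrow> g p v v < 0" unfolding M by auto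
  have "\<exists>y\<in>W. y \<noteq> 0"
  proof (rule ccontr)
    assume "\<not> (\<exists>y\<in>W. y \<noteq> 0)"
    then have "(\<lambda>v. v c) ` W \<subseteq> {0}" by auto
    then show False using W(1) dim_tangent_subspace(1)[OF c W(2)] by (metis dim_eq_0 zero_neq_one)
  qed
  then obtain y where y: "y \<in> W" "y \<noteq> 0" by blast
  then have "y \<in> tangent_space A p" "g p y y < 0" using W(2,3) by blast+
  then have "?B (y c) (y c) < 0" using metric_value[OF c, of y y] by simp
  then show "\<exists>e. ?B e e < 0" by blast
  assume u: "?B u u < 0" and v: "?B v v < 0"
  show "?B u v \<noteq> 0"
  proof
    assume uv: "?B u v = 0"
    let ?V = "span {u, v}"
    have neg: "?B z z < 0" if z: "z \<in> ?V" "z \<noteq> 0" for z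
    proof -
      obtain r q where zz: "z = r *\<^sub>R u + q *\<^sub>R v"
        using z(1) by (auto simp: span_insert span_singleton)
          (metis add.commute diff_add_cancel)
      have "?B z z = r\<^sup>2 * ?B u u + q\<^sup>2 * ?B v v"
        unfolding zz sym_form_square(1)[OF metr_sym_form[OF charts_atD(1)[OF c] charts_atD(3)[OF c]]]
        using uv by (simp add: s(5,6) power2_eq_square)
      moreover have "r \<noteq> 0 \<or> q \<noteq> 0" using zz z(2) by auto
      then have "r\<^sup>2 * ?B u u + q\<^sup>2 * ?B v v < 0"
        using u v by (cases "r = 0"; cases "q = 0") (auto simp: mult_less_0_iff intro: add_neg_neg)
      ultimately show ?thesis by simp
    qed
    have "u \<noteq> 0" "v \<noteq> 0" using u v s(7)[of 0] by auto
    have "u \<notin> span {v}"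
    proof
      assume "u \<in> span {v}"
      then obtain r where r: "u = r *\<^sub>R v" by (auto simp: span_singleton)
      then have "r = 0" using uv v by (simp add: s(5))
      then show False using r \<open>u \<noteq> 0\<close> by simp
    qed
    then have ind: "independent {u, v}" using \<open>v \<noteq> 0\<close> \<open>u \<noteq> 0\<close> by (simp add: independent_insert)
    have "u \<noteq> v" using uv v by auto
    then have "dim ?V = 2" using ind by (simp add: dim_eq_card_independent)
    moreover have "dim (?cv ` ?V) = dim ?V"
      by (rule dim_image_eq[OF tangent_coords(1)[OF c]]) (rule inj_on_subset[OF tangent_coords(2)[OF c] subset_UNIV])
    moreover have "dim (?cv ` ?V) \<in> ?S"
    proof (intro CollectI exI conjI ballI impI)
      show "subspace (?cv ` ?V)" by (rule linear_subspace_image[OF tangent_coords(1)[OF c] subspace_span])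
      show "?cv ` ?V \<subseteq> tangent_space A p" using coord_vector_tangent[OF A c] by blast
      fix w assume "w \<in> ?cv ` ?V" "w \<noteq> 0"
      then obtain z where z: "z \<in> ?V" "w = ?cv z" by blast
      then have "z \<noteq> 0" using \<open>w \<noteq> 0\<close> linear_0[OF tangent_coords(1)[OF c]] by auto
      then show "g p w w < 0" using neg[OF z(1)] z(2) gv by simp
    qed simp
    ultimately have "2 \<le> Max ?S" using Max_ge[OF fin] by fastforce
    then show False unfolding M by simp
  qed
qed

lemma causal_orthogonal:
  assumes L: "lorentzian A g" and v: "v \<in> tangent_space A p" "v \<noteq> 0" "g p v v \<le> 0"
    and u: "u \<in> tangent_space A p" "g p u v = 0"
  shows "g p u u \<ge> 0" "g p u u = 0 \<Longrightarrow> \<exists>r. u = r *\<^sub>R v"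
proof -
  obtain c where c: "c \<in> charts_at A p" using ex_chart by blast
  let ?B = "metr c (snd c p)"
  note x = charts_atD(1)[OF c] charts_atD(3)[OF c]
  obtain e where e: "?B e e < 0" using lorentzian_form(1)[OF L c] by blast
  have v0: "v c \<noteq> 0" using tangent_eqI[OF c v(1) subspace_0[OF subspace_tangent]] v(2) by auto
  note val = metric_value[OF c]
  have vals: "?B (v c) (v c) \<le> 0" "?B (u c) (v c) = 0" "g p u u = ?B (u c) (u c)"
    using v u val[OF v(1) v(1)] val[OF u(1) v(1)] val[OF u(1) u(1)] by auto
  have nd: "w = 0" if "\<And>z. ?B w z = 0" for w by (rule metr_nondegenerate[OF x that])
  have idx: "?B y z \<noteq> 0" if "?B y y < 0" "?B z z < 0" for y z by (rule lorentzian_form(2)[OF L c that])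
  have "?B (u c) (u c) \<ge> 0"
    by (rule orthogonal_to_causal(1)[OF metr_sym_form[OF x] nd idx e v0 vals(1,2)])
  then show "g p u u \<ge> 0" using vals(3) by simp
  assume "g p u u = 0"
  then have uu: "?B (u c) (u c) = 0" using vals(3) by simp
  have "\<exists>r. u c = r *\<^sub>R v c"
    by (rule orthogonal_to_causal(2)[OF metr_sym_form[OF x] nd idx e v0 vals(1,2) uu])
  then obtain r where r: "u c = r *\<^sub>R v c" by blast
  have "u = r *\<^sub>R v"
    by (rule tangent_eqI[OF c u(1) subspace_scale[OF subspace_tangent v(1)]]) (simp add: r scaleR_fun_def)
  then show "\<exists>r. u = r *\<^sub>R v" by blast
qed

lemma metric_lin:
  assumes "u \<in> tangent_space A p" "v \<in> tangent_space A p" "w \<in> tangent_space A p"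
  shows "g p (u + v) w = g p u w + g p v w" "g p (r *\<^sub>R u) w = r * g p u w" "g p u w = g p w u"
    "g p w (u + v) = g p w u + g p w v" "g p w (r *\<^sub>R u) = r * g p w u"
proof -
  note * = conjunct1[OF g[unfolded semi_riemannian_metric_def], rule_format]
  show 1: "g p (u + v) w = g p u w + g p v w" using *[OF assms] by blast
  show 2: "g p (r *\<^sub>R u) w = r * g p u w" using *[OF assms(1,3,3)] by blast
  show 3: "g p u w = g p w u" using *[OF assms(1,3,3)] by blast
  have 4: "g p v w = g p w v" using *[OF assms(2,3,3)] by blast
  have 5: "g p (u + v) w = g p w (u + v)" using *[OF subspace_add[OF subspace_tangent assms(1,2)] assms(3,3)] by blast
  have 6: "g p (r *\<^sub>R u) w = g p w (r *\<^sub>R u)" using *[OF subspace_scale[OF subspace_tangent assms(1)] assms(3,3)] by blast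
  show "g p w (u + v) = g p w u + g p w v" "g p w (r *\<^sub>R u) = r * g p w u" using 1 2 3 4 5 6 by simp_all
qed

lemma metric_bilinear:
  fixes X Y :: "'x::real_vector \<Rightarrow> ('m, 'e) tvec"
  assumes X: "\<And>x. X x \<in> tangent_space A p" "\<And>x y r. X (x + r *\<^sub>R y) = X x + r *\<^sub>R X y"
    and Y: "\<And>x. Y x \<in> tangent_space A p" "\<And>x y r. Y (x + r *\<^sub>R y) = Y x + r *\<^sub>R Y y"
  shows "bilinear (\<lambda>x y. g p (X x) (Y y))"
proof -
  have "linear X" "linear Y" by (rule linear_fromI, rule X(2) Y(2))+
  note l = linear_add[OF this(1)] linear_scale[OF this(1)] linear_add[OF this(2)] linear_scale[OF this(2)]
  show ?thesis
    unfolding bilinear_def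
    by (intro conjI allI linearI) (simp_all add: l metric_lin[OF X(1) X(1) Y(1)] metric_lin(4,5)[OF Y(1) Y(1) X(1)])
qed

end


section \<open>Jacobi fields and the symplectic structure\<close>

lemma constant_if_zero_derivative:
  fixes h :: "real \<Rightarrow> real"
  assumes "\<And>t. t \<in> {a..b} \<Longrightarrow> (h has_real_derivative 0) (at t within {a..b})" "s \<in> {a..b}" "t \<in> {a..b}"
  shows "h s = h t"
proof -
  have "\<exists>k. \<forall>t\<in>{a..b}. h t = k"
    by (rule has_derivative_zero_constant) (use assms(1) in \<open>auto simp: has_field_derivative_def lambda_zero\<close>)
  then show ?thesis using assms(2,3) by metis
qed

context geodesic_segment
begin

lemma curvature_pair_sym:
  assumes "u \<in> tangent_space A p" "v \<in> tangent_space A p" "w \<in> tangent_space A p"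
  shows "g p (curvature A g p u v u) w = g p v (curvature A g p u w u)"
    "g p (curvature A g p u v u) u = 0"
proof -
  obtain c where c: "c \<in> charts_at A p" using ex_chart by blast
  note x = charts_atD(1)[OF c] charts_atD(3)[OF c] and cur = curvature_chart[OF c] curvature_tangent
  note s = sym_formD[OF metr_sym_form[OF x]]
  have 2: "g p v (curvature A g p u w u) = g p (curvature A g p u w u) v"
    by (rule metric_lin(3)[OF assms(2) assms(2) curvature_tangent[OF assms(1,3,1)]])
  show "g p (curvature A g p u v u) w = g p v (curvature A g p u w u)"
    unfolding 2 using metric_value[OF c curvature_tangent[OF assms(1,2,1)] assms(3)] curvature_chart[OF c]
      metric_value[OF c curvature_tangent[OF assms(1,3,1)] assms(2)] Riem_pair_sym[OF x, of "u c" "v c" "u c" "w c"] by simp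
  show "g p (curvature A g p u v u) u = 0"
  proof -
    let ?R = "Riem c (snd c p) (u c) (v c) (u c)"
    have "metr c (snd c p) ?R (u c) = - metr c (snd c p) (u c) ?R" by (rule Riem_antisym[OF x])
    also have "metr c (snd c p) (u c) ?R = metr c (snd c p) ?R (u c)" by (rule s(2))
    finally have "metr c (snd c p) ?R (u c) = 0" by simp
    then show ?thesis unfolding metric_value[OF c curvature_tangent[OF assms(1,2,1)] assms(1)] curvature_chart[OF c] .
  qed
qed

lemma pair_products:
  assumes 1: "jacobi_pair a b J Z" and 2: "jacobi_pair a b J' Z'" and t: "t \<in> {a..b}"
  defines "R \<equiv> \<lambda>w. curvature A g (\<gamma> t) (vel t) w (vel t)"
  shows "((\<lambda>s. g (\<gamma> s) (J s) (J' s)) has_real_derivative g (\<gamma> t) (Z t) (J' t) + g (\<gamma> t) (J t) (Z' t)) (at t within {a..b})"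
    "((\<lambda>s. g (\<gamma> s) (J s) (Z' s)) has_real_derivative g (\<gamma> t) (Z t) (Z' t) + g (\<gamma> t) (J t) (R (J' t))) (at t within {a..b})"
    "((\<lambda>s. g (\<gamma> s) (Z s) (J' s)) has_real_derivative g (\<gamma> t) (R (J t)) (J' t) + g (\<gamma> t) (Z t) (Z' t)) (at t within {a..b})"
    "((\<lambda>s. g (\<gamma> s) (J s) (vel s)) has_real_derivative g (\<gamma> t) (Z t) (vel t)) (at t within {a..b})"
    "((\<lambda>s. g (\<gamma> s) (Z s) (vel s)) has_real_derivative 0) (at t within {a..b})"
proof -
  obtain c where c: "c \<in> charts_at A (\<gamma> t)" using ex_chart by blast
  note J = jacobi_pairD[OF 1] and J' = jacobi_pairD[OF 2] and v = vel_tangent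
  have R: "R (J t) \<in> tangent_space A (\<gamma> t)" "R (J' t) \<in> tangent_space A (\<gamma> t)"
    unfolding R_def by (intro curvature_tangent v t J(1) J'(1))+
  have D: "cov_deriv_at {a..b} J (Z t) c t" "cov_deriv_at {a..b} Z (R (J t)) c t"
    "cov_deriv_at {a..b} J' (Z' t) c t" "cov_deriv_at {a..b} Z' (R (J' t)) c t"
    unfolding R_def by (rule J(3)[OF t c] J(4)[OF t c] J'(3)[OF t c] J'(4)[OF t c])+
  note z = subspace_0[OF subspace_tangent] and p0 = vel_parallel[OF t c]
  show "((\<lambda>s. g (\<gamma> s) (J s) (J' s)) has_real_derivative g (\<gamma> t) (Z t) (J' t) + g (\<gamma> t) (J t) (Z' t)) (at t within {a..b})"
    by (rule metric_product_rule[OF t J(1) J'(1) J(2)[OF t] J'(2)[OF t] c D(1,3)])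
  show "((\<lambda>s. g (\<gamma> s) (J s) (Z' s)) has_real_derivative g (\<gamma> t) (Z t) (Z' t) + g (\<gamma> t) (J t) (R (J' t))) (at t within {a..b})"
    by (rule metric_product_rule[OF t J(1) J'(2) J(2)[OF t] R(2) c D(1,4)])
  show "((\<lambda>s. g (\<gamma> s) (Z s) (J' s)) has_real_derivative g (\<gamma> t) (R (J t)) (J' t) + g (\<gamma> t) (Z t) (Z' t)) (at t within {a..b})"
    by (rule metric_product_rule[OF t J(2) J'(1) R(1) J'(2)[OF t] c D(2,3)])
  have g0: "g (\<gamma> t) w 0 = 0" if "w \<in> tangent_space A (\<gamma> t)" for w
    using metric_lin(5)[OF that that that, of 0] by simp
  have "((\<lambda>s. g (\<gamma> s) (J s) (vel s)) has_real_derivative g (\<gamma> t) (Z t) (vel t) + g (\<gamma> t) (J t) 0) (at t within {a..b})"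
    by (rule metric_product_rule[OF t J(1) v J(2)[OF t] z c D(1) p0])
  then show "((\<lambda>s. g (\<gamma> s) (J s) (vel s)) has_real_derivative g (\<gamma> t) (Z t) (vel t)) (at t within {a..b})"
    using g0[OF J(1)[OF t]] by simp
  have "((\<lambda>s. g (\<gamma> s) (Z s) (vel s)) has_real_derivative g (\<gamma> t) (R (J t)) (vel t) + g (\<gamma> t) (Z t) 0) (at t within {a..b})"
    by (rule metric_product_rule[OF t J(2) v R(1) z c D(2) p0])
  then show "((\<lambda>s. g (\<gamma> s) (Z s) (vel s)) has_real_derivative 0) (at t within {a..b})"
    using g0[OF J(2)[OF t]] curvature_pair_sym(2)[OF v[OF t] J(1)[OF t] J(1)[OF t]] by (simp add: R_def)
qed

text \<open>The symplectic form of the space of Jacobi fields is conserved, since the curvature terms cancel.\<close>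
lemma lagrange_identity:
  assumes 1: "jacobi_pair a b J Z" and 2: "jacobi_pair a b J' Z'" and t: "t \<in> {a..b}"
  shows "g (\<gamma> t) (J t) (Z' t) - g (\<gamma> t) (Z t) (J' t) = g (\<gamma> a) (J a) (Z' a) - g (\<gamma> a) (Z a) (J' a)"
proof (rule constant_if_zero_derivative[where h = "\<lambda>t. g (\<gamma> t) (J t) (Z' t) - g (\<gamma> t) (Z t) (J' t)"])
  show "((\<lambda>t. g (\<gamma> t) (J t) (Z' t) - g (\<gamma> t) (Z t) (J' t)) has_real_derivative 0) (at t within {a..b})" if t: "t \<in> {a..b}" for t
    using DERIV_diff[OF pair_products(2)[OF 1 2 t] pair_products(3)[OF 1 2 t]]
      curvature_pair_sym(1)[OF vel_tangent[OF t] jacobi_pairD(1)[OF 1 t] jacobi_pairD(1)[OF 2 t]] by simp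
qed (use t ab in auto)

text \<open>The function \<open>g (J s) (vel s)\<close> is affine in \<open>s\<close> and vanishes at \<open>a\<close> and at \<open>t\<close>.\<close>
lemma jacobi_orthogonal_velocity:
  assumes 1: "jacobi_pair a b J Z" and 0: "g (\<gamma> a) (J a) (vel a) = 0" and t: "a < t" "t \<le> b" "J t = 0"
  shows "g (\<gamma> t) (Z t) (vel t) = 0"
proof -
  have tI: "t \<in> {a..b}" and aI: "a \<in> {a..b}" using t ab by auto
  let ?k = "g (\<gamma> t) (Z t) (vel t)"
  have k: "g (\<gamma> s) (Z s) (vel s) = ?k" if "s \<in> {a..b}" for s
    by (rule constant_if_zero_derivative[OF pair_products(5)[OF 1 1] that tI])
  have "g (\<gamma> t) (J t) (vel t) - ?k * t = g (\<gamma> a) (J a) (vel a) - ?k * a"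
  proof (rule constant_if_zero_derivative[where h = "\<lambda>s. g (\<gamma> s) (J s) (vel s) - ?k * s", OF _ tI aI])
    fix s assume s: "s \<in> {a..b}"
    have "((\<lambda>s. ?k * s) has_real_derivative ?k) (at s within {a..b})" by (auto intro!: derivative_eq_intros)
    from DERIV_diff[OF pair_products(4)[OF 1 1 s] this]
    show "((\<lambda>s. g (\<gamma> s) (J s) (vel s) - ?k * s) has_real_derivative 0) (at s within {a..b})"
      using k[OF s] by simp
  qed
  moreover have "g (\<gamma> t) (J t) (vel t) = 0"
    using metric_lin(2)[OF vel_tangent[OF tI] vel_tangent[OF tI] vel_tangent[OF tI], of 0] t(3) by simp
  ultimately have "?k * (t - a) = 0" using 0 by (simp add: algebra_simps)
  then show ?thesis using t(1) by simp
qed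

lemma jacobi_pair_covariant_deriv:
  assumes "jacobi_pair a b J Z" "t \<in> {a..b}" shows "covariant_deriv A g a b \<gamma> J t = Z t"
proof
  fix c
  show "covariant_deriv A g a b \<gamma> J t c = Z t c"
  proof (cases "c \<in> charts_at A (\<gamma> t)")
    case True
    then show ?thesis using jacobi_pairD(3)[OF assms] cov_deriv_at_iff[OF assms(2) True] by blast
  qed (use tangent_zero[OF jacobi_pairD(2)[OF assms]] in \<open>simp add: covariant_deriv_def\<close>)
qed

lemma jacobi_fields_iff:
  "J \<in> jacobi_fields A g P a b \<gamma> \<longleftrightarrow> (\<forall>t. t \<notin> {a..b} \<longrightarrow> J t = 0) \<and> (\<exists>Z. jacobi_pair a b J Z \<and>
     J a \<in> sub_tangent A P (\<gamma> a) \<and>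
     Z a + shape_operator A g P (\<gamma> a) (vel a) (J a) \<in> orth_complement A g (\<gamma> a) (sub_tangent A P (\<gamma> a)))"
proof
  assume J: "J \<in> jacobi_fields A g P a b \<gamma>"
  let ?Z = "covariant_deriv A g a b \<gamma> J"
  have f: "field_along A a b \<gamma> J" "field_along A a b \<gamma> ?Z"
    and eq: "\<And>t. t \<in> {a..b} \<Longrightarrow> covariant_deriv A g a b \<gamma> ?Z t = curvature A g (\<gamma> t) (vel t) (J t) (vel t)"
    using J unfolding jacobi_fields_def by blast+
  have "jacobi_pair a b J ?Z"
    unfolding jacobi_pair_def
  proof (intro ballI conjI)
    fix t assume t: "t \<in> {a..b}"
    show "J t \<in> tangent_space A (\<gamma> t)" "?Z t \<in> tangent_space A (\<gamma> t)" using f t unfolding field_along_def by blast+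
    fix c assume c: "c \<in> charts_at A (\<gamma> t)"
    show "cov_deriv_at {a..b} J (?Z t) c t" "cov_deriv_at {a..b} ?Z (curvature A g (\<gamma> t) (vel t) (J t) (vel t)) c t"
      using f t c eq[OF t] unfolding cov_deriv_at_iff[OF t c] field_along_def by simp_all
  qed
  then show "(\<forall>t. t \<notin> {a..b} \<longrightarrow> J t = 0) \<and> (\<exists>Z. jacobi_pair a b J Z \<and> J a \<in> sub_tangent A P (\<gamma> a) \<and>
     Z a + shape_operator A g P (\<gamma> a) (vel a) (J a) \<in> orth_complement A g (\<gamma> a) (sub_tangent A P (\<gamma> a)))"
    using J unfolding jacobi_fields_def by blast
next
  assume "(\<forall>t. t \<notin> {a..b} \<longrightarrow> J t = 0) \<and> (\<exists>Z. jacobi_pair a b J Z \<and> J a \<in> sub_tangent A P (\<gamma> a) \<and>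
     Z a + shape_operator A g P (\<gamma> a) (vel a) (J a) \<in> orth_complement A g (\<gamma> a) (sub_tangent A P (\<gamma> a)))"
  then obtain Z where zero: "\<forall>t. t \<notin> {a..b} \<longrightarrow> J t = 0" and JZ: "jacobi_pair a b J Z" and ini: "J a \<in> sub_tangent A P (\<gamma> a)"
     "Z a + shape_operator A g P (\<gamma> a) (vel a) (J a) \<in> orth_complement A g (\<gamma> a) (sub_tangent A P (\<gamma> a))" by blast
  let ?Z = "covariant_deriv A g a b \<gamma> J"
  note ZZ = jacobi_pair_covariant_deriv[OF JZ] and D = jacobi_pairD[OF JZ]
  have DZ: "cov_deriv_at {a..b} ?Z (curvature A g (\<gamma> t) (vel t) (J t) (vel t)) c t"
    if t: "t \<in> {a..b}" and c: "c \<in> charts_at A (\<gamma> t)" for t c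
    unfolding cov_deriv_at_def ZZ[OF t]
    by (rule has_vector_derivative_transform[OF t _ D(4)[OF t c, unfolded cov_deriv_at_def]]) (simp add: ZZ)
  have 1: "field_along A a b \<gamma> J"
    unfolding field_along_def using D(1,3) cov_deriv_at_iff by blast
  have 2: "field_along A a b \<gamma> ?Z"
    unfolding field_along_def
  proof (intro ballI conjI)
    show "?Z t \<in> tangent_space A (\<gamma> t)" if "t \<in> {a..b}" for t using D(2)[OF that] ZZ[OF that] by simp
    show "(\<lambda>s. ?Z s c) differentiable at t within {a..b}" if "t \<in> {a..b}" "c \<in> charts_at A (\<gamma> t)" for t c
      using DZ[OF that] cov_deriv_at_iff[OF that] by blast
  qed
  have 3: "covariant_deriv A g a b \<gamma> ?Z t = curvature A g (\<gamma> t) (vel t) (J t) (vel t)" if t: "t \<in> {a..b}" for t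
  proof
    fix c
    show "covariant_deriv A g a b \<gamma> ?Z t c = curvature A g (\<gamma> t) (vel t) (J t) (vel t) c"
    proof (cases "c \<in> charts_at A (\<gamma> t)")
      case True
      then show ?thesis using DZ[OF t True] cov_deriv_at_iff[OF t True] by blast
    qed (simp add: covariant_deriv_def curvature_def)
  qed
  have "a \<in> {a..b}" using ab by simp
  then show "J \<in> jacobi_fields A g P a b \<gamma>"
    using zero 1 2 3 ini ZZ unfolding jacobi_fields_def by simp
qed

end

locale orthogonal_geodesic = geodesic_segment A g a b \<gamma>
  for A :: "('m::t2_space, 'e::euclidean_space) chart set" and g a b \<gamma> +
  fixes P :: "'m set" and k :: nat
  assumes causal: "riemannian A g \<or> lorentzian A g"
    and submanifold: "submanifold A k P" and start: "\<gamma> a \<in> P"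
    and non_constant: "\<not> \<gamma> constant_on {a..b}"
    and orthogonal: "vel a \<in> orth_complement A g (\<gamma> a) (sub_tangent A P (\<gamma> a))"
    and non_spacelike: "lorentzian A g \<Longrightarrow> t \<in> {a..b} \<Longrightarrow> g (\<gamma> t) (vel t) (vel t) \<le> 0"
    and transversal: "lorentzian A g \<Longrightarrow> vel a \<notin> sub_tangent A P (\<gamma> a)"
begin

abbreviation "TP \<equiv> sub_tangent A P (\<gamma> a)"
abbreviation "sff \<equiv> second_fundamental_form A g P (\<gamma> a) (vel a)"

lemma aI: "a \<in> {a..b}" using ab by simp

lemma slice_exists:
  obtains c W where "slice_chart A P c W" "\<gamma> a \<in> fst c" "dim W = k"
  using submanifold start unfolding submanifold_def by blast

lemma TP_subspace: "subspace TP"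
  using slice_exists subspace_sub_tangent start by metis

lemma TP_tangent: "v \<in> TP \<Longrightarrow> v \<in> tangent_space A (\<gamma> a)"
  by (simp add: sub_tangent_def)

lemma TP_orthogonal: "v \<in> TP \<Longrightarrow> g (\<gamma> a) v (vel a) = 0"
  using orthogonal metric_lin(3)[OF vel_tangent[OF aI] vel_tangent[OF aI] TP_tangent]
  by (simp add: orth_complement_def)

text \<open>In the Lorentzian case the tangent space is orthogonal to the causal vector \<open>vel a\<close>, so its isotropic vectors are
  multiples of \<open>vel a\<close>, which transversality excludes.\<close>
lemma TP_nondegenerate:
  assumes u: "u \<in> TP" "\<And>w. w \<in> TP \<Longrightarrow> g (\<gamma> a) u w = 0" shows "u = 0"
proof (rule ccontr)
  assume u0: "u \<noteq> 0"
  have uu: "g (\<gamma> a) u u = 0" using u by blast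
  show False
  proof (cases "riemannian A g")
    case True
    then show ?thesis using uu u0 TP_tangent[OF u(1)] unfolding riemannian_def by force
  next
    case False
    then have L: "lorentzian A g" using causal by blast
    obtain r where r: "u = r *\<^sub>R vel a"
      using causal_orthogonal(2)[OF L vel_tangent[OF aI] vel_nonzero[OF non_constant aI] non_spacelike[OF L aI]
        TP_tangent[OF u(1)] TP_orthogonal[OF u(1)] uu] by blast
    then have "r \<noteq> 0" using u0 by auto
    then have "vel a = (1 / r) *\<^sub>R u" using r by simp
    then show ?thesis using transversal[OF L] subspace_scale[OF TP_subspace u(1), of "1 / r"] by simp
  qed
qed

lemma sff_linear:
  assumes "u \<in> TP" "v \<in> TP" "w \<in> TP"
  shows "sff (u + v) w = sff u w + sff v w" "sff (r *\<^sub>R u) w = r * sff u w" "sff u w = sff w u"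
proof -
  obtain c W where c: "slice_chart A P c W" "\<gamma> a \<in> fst c" using slice_exists by metis
  note cA = slice_chartD(1)[OF c(1)]
  have ca: "c \<in> charts_at A (\<gamma> a)" using c cA by (simp add: charts_at_def)
  note x = charts_atD(3)[OF ca] and S = second_fundamental_form_slice[OF c start _ _ orthogonal]
  note s = sym_formD[OF metr_sym_form[OF cA x]] and G = Gam_bilinear[OF cA x]
  show "sff (u + v) w = sff u w + sff v w"
    unfolding S[OF assms(1,3)] S[OF assms(2,3)] S[OF subspace_add[OF TP_subspace assms(1,2)] assms(3)]
    by (simp add: bilinear_ladd[OF G] s(3))
  show "sff (r *\<^sub>R u) w = r * sff u w"
    unfolding S[OF assms(1,3)] S[OF subspace_scale[OF TP_subspace assms(1)] assms(3)]
    by (simp add: bilinear_lmul[OF G] s(5) scaleR_fun_def)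
  show "sff u w = sff w u"
    unfolding S[OF assms(1,3)] S[OF assms(3,1)] using Gam_sym[OF cA x] by metis
qed

text \<open>The initial condition of a \<open>P\<close>-Jacobi field, tested against the tangent vectors of \<open>P\<close>. It is linear in the
  data and involves the second fundamental form directly, which is what converges.\<close>
definition admissible :: "('m, 'e) tvec \<Rightarrow> ('m, 'e) tvec \<Rightarrow> bool" where
  "admissible u z \<longleftrightarrow> u \<in> TP \<and> z \<in> tangent_space A (\<gamma> a) \<and> (\<forall>w\<in>TP. g (\<gamma> a) z w + sff u w = 0)"

lemma jacobi_fields_admissible:
  "J \<in> jacobi_fields A g P a b \<gamma> \<longleftrightarrow> (\<forall>t. t \<notin> {a..b} \<longrightarrow> J t = 0) \<and> (\<exists>Z. jacobi_pair a b J Z \<and> admissible (J a) (Z a))"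
proof -
  obtain c W where c: "slice_chart A P c W" "\<gamma> a \<in> fst c" using slice_exists by metis
  have "(u \<in> TP \<and> z + shape_operator A g P (\<gamma> a) (vel a) u \<in> orth_complement A g (\<gamma> a) TP) \<longleftrightarrow> admissible u z"
    if z: "z \<in> tangent_space A (\<gamma> a)" for u z
  proof (cases "u \<in> TP")
    case True
    have sh: "shape_operator A g P (\<gamma> a) (vel a) u \<in> TP"
      "w \<in> TP \<Longrightarrow> sff u w = g (\<gamma> a) (shape_operator A g P (\<gamma> a) (vel a) u) w" for w
      by (rule shape_operator_char[OF c start True orthogonal TP_nondegenerate]; assumption)+
    note st = TP_tangent[OF sh(1)]
    have "g (\<gamma> a) (z + shape_operator A g P (\<gamma> a) (vel a) u) w = g (\<gamma> a) z w + sff u w" if "w \<in> TP" for w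
      using metric_lin(1)[OF z st TP_tangent[OF that]] sh(2)[OF that] by simp
    then show ?thesis using z st subspace_add[OF subspace_tangent z st] True
      by (auto simp: admissible_def orth_complement_def)
  qed (simp add: admissible_def)
  then show ?thesis unfolding jacobi_fields_iff using jacobi_pairD(2)[OF _ aI] by blast
qed

lemma admissible_symmetric:
  assumes "admissible u z" "admissible u' z'" shows "g (\<gamma> a) u z' = g (\<gamma> a) z u'"
proof -
  have "g (\<gamma> a) z u' = - sff u u'" "g (\<gamma> a) z' u = - sff u' u" using assms by (auto simp: admissible_def add_eq_0_iff)
  moreover have "sff u u' = sff u' u" using sff_linear(3)[of u u u'] assms by (simp add: admissible_def)
  moreover have "g (\<gamma> a) u z' = g (\<gamma> a) z' u"
    using metric_lin(3)[of u _ u z'] assms TP_tangent by (simp add: admissible_def)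
  ultimately show ?thesis by simp
qed

text \<open>In the Lorentzian case the derivative of the field is orthogonal to the
  causal vector \<open>vel t\<close>; it is not proportional to it, since otherwise the field would be a multiple of
  \<open>(s - t) * vel s\<close> and its initial value would violate transversality.\<close>
lemma crossing_positive:
  assumes 1: "jacobi_pair a b J Z" "admissible (J a) (Z a)" and t: "a < t" "t \<le> b" "J t = 0" and Z: "Z t \<noteq> 0"
  shows "g (\<gamma> t) (Z t) (Z t) > 0"
proof -
  have tI: "t \<in> {a..b}" using t by simp
  note Zt = jacobi_pairD(2)[OF 1(1) tI]
  show ?thesis
  proof (cases "riemannian A g")
    case True
    then show ?thesis using Zt Z unfolding riemannian_def by blast
  next
    case False
    then have L: "lorentzian A g" using causal by blast
    have Ja: "J a \<in> TP" using 1(2) by (simp add: admissible_def)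
    have ort: "g (\<gamma> t) (Z t) (vel t) = 0"
      by (rule jacobi_orthogonal_velocity[OF 1(1) TP_orthogonal[OF Ja] t])
    note co = causal_orthogonal[OF L vel_tangent[OF tI] vel_nonzero[OF non_constant tI] non_spacelike[OF L tI] Zt ort]
    have "g (\<gamma> t) (Z t) (Z t) \<noteq> 0"
    proof
      assume "g (\<gamma> t) (Z t) (Z t) = 0"
      then obtain r where r: "Z t = r *\<^sub>R vel t" using co(2) by blast
      let ?J = "\<lambda>s. (r * s + - (r * t)) *\<^sub>R vel s" and ?Z = "\<lambda>s. r *\<^sub>R vel s"
      have pair: "jacobi_pair a b (\<lambda>s. J s + (-1) *\<^sub>R ?J s) (\<lambda>s. Z s + (-1) *\<^sub>R ?Z s)"
        by (rule jacobi_pair_linear[OF 1(1) tangential_jacobi_pair order_refl])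
      have "J a + (-1) *\<^sub>R ?J a = 0"
        by (rule jacobi_pair_zero(1)[OF pair tI _ _ aI]) (simp_all add: t(3) r)
      then have "J a = (r * (a - t)) *\<^sub>R vel a" by (simp add: algebra_simps)
      moreover have "r \<noteq> 0" using r Z by auto
      ultimately have "vel a = (1 / (r * (a - t))) *\<^sub>R J a" using t(1) by simp
      then show False using transversal[OF L] subspace_scale[OF TP_subspace Ja, of "1 / (r * (a - t))"] by simp
    qed
    then show ?thesis using co(1) by simp
  qed
qed

end

section \<open>Convergence of geodesics and of Jacobi fields\<close>

text \<open>The neighbourhoods of the pair formed by the limit index and the time \<open>t\<close>. Limits along
  this filter are limits jointly in the index and the time.\<close>
definition joint_nhds :: "'i filter \<Rightarrow> 't::topological_space set \<Rightarrow> 't \<Rightarrow> ('i \<times> 't) filter" where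
  "joint_nhds F S t = F \<times>\<^sub>F inf (nhds t) (principal S)"

lemma eventually_joint_nhds:
  "(\<forall>\<^sub>F x in joint_nhds F S t. Q x) \<longleftrightarrow>
    (\<exists>Pf U. eventually Pf F \<and> open U \<and> t \<in> U \<and> (\<forall>i s. Pf i \<longrightarrow> s \<in> U \<inter> S \<longrightarrow> Q (i, s)))"
proof
  assume "\<forall>\<^sub>F x in joint_nhds F S t. Q x"
  then obtain Pf Pg where P: "eventually Pf F" "eventually Pg (inf (nhds t) (principal S))" "\<And>i s. Pf i \<Longrightarrow> Pg s \<Longrightarrow> Q (i, s)"
    unfolding joint_nhds_def eventually_prod_filter by blast
  then obtain U where "open U" "t \<in> U" "\<forall>s\<in>U. s \<in> S \<longrightarrow> Pg s"
    unfolding eventually_inf_principal eventually_nhds by blast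
  then show "\<exists>Pf U. eventually Pf F \<and> open U \<and> t \<in> U \<and> (\<forall>i s. Pf i \<longrightarrow> s \<in> U \<inter> S \<longrightarrow> Q (i, s))"
    using P by (intro exI[of _ Pf] exI[of _ U]) blast
next
  assume "\<exists>Pf U. eventually Pf F \<and> open U \<and> t \<in> U \<and> (\<forall>i s. Pf i \<longrightarrow> s \<in> U \<inter> S \<longrightarrow> Q (i, s))"
  then obtain Pf U where P: "eventually Pf F" "open U" "t \<in> U" "\<And>i s. Pf i \<Longrightarrow> s \<in> U \<inter> S \<Longrightarrow> Q (i, s)" by blast
  have "eventually (\<lambda>s. s \<in> U \<inter> S) (inf (nhds t) (principal S))"
    unfolding eventually_inf_principal eventually_nhds using P(2,3) by blast
  then show "\<forall>\<^sub>F x in joint_nhds F S t. Q x"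
    unfolding joint_nhds_def eventually_prod_filter using P(1,4) by blast
qed

lemma eventually_joint_realE:
  fixes t :: real
  assumes "\<forall>\<^sub>F x in joint_nhds F S t. Q x"
  obtains Pf d where "eventually Pf F" "d > 0" "\<And>i s. Pf i \<Longrightarrow> s \<in> S \<Longrightarrow> \<bar>s - t\<bar> < d \<Longrightarrow> Q (i, s)"
proof -
  obtain Pf U where P: "eventually Pf F" "open U" "t \<in> U" "\<And>i s. Pf i \<Longrightarrow> s \<in> U \<inter> S \<Longrightarrow> Q (i, s)"
    using assms unfolding eventually_joint_nhds by blast
  obtain d where d: "d > 0" "ball t d \<subseteq> U" using P(2,3) openE by blast
  show thesis
  proof (rule that[OF P(1) d(1)])
    fix i s assume *: "Pf i" "s \<in> S" "\<bar>s - t\<bar> < d"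
    then have "s \<in> ball t d" by (simp add: dist_real_def abs_minus_commute)
    then show "Q (i, s)" using P(4)[OF *(1)] d(2) *(2) by blast
  qed
qed

lemma eventually_jointI:
  fixes t :: real
  assumes "eventually Pf F" "d > 0" "\<And>i s. Pf i \<Longrightarrow> s \<in> S \<Longrightarrow> \<bar>s - t\<bar> < d \<Longrightarrow> Q (i, s)"
  shows "\<forall>\<^sub>F x in joint_nhds F S t. Q x"
  unfolding eventually_joint_nhds
proof (intro exI conjI allI impI)
  show "eventually Pf F" by (rule assms(1))
  show "open (ball t d)" "t \<in> ball t d" using assms(2) by auto
  show "Q (i, s)" if "Pf i" "s \<in> ball t d \<inter> S" for i s
    by (rule assms(3)[OF that(1)]) (use that(2) in \<open>auto simp: dist_real_def\<close>)
qed

text \<open>This is the tube lemma: finitely many of the local statements cover the compact set.\<close>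
lemma compact_eventually:
  assumes K: "compact K" "K \<subseteq> S" and Q: "\<And>t. t \<in> K \<Longrightarrow> \<forall>\<^sub>F x in joint_nhds F S t. Q (fst x) (snd x)"
  shows "\<forall>\<^sub>F i in F. \<forall>s\<in>K. Q i s"
proof -
  have "\<forall>t\<in>K. \<exists>Pf U. eventually Pf F \<and> open U \<and> t \<in> U \<and> (\<forall>i s. Pf i \<longrightarrow> s \<in> U \<inter> S \<longrightarrow> Q i s)"
    using Q unfolding eventually_joint_nhds by simp
  then obtain Pf U where P: "\<And>t. t \<in> K \<Longrightarrow> eventually (Pf t) F \<and> open (U t) \<and> t \<in> U t \<and> (\<forall>i s. Pf t i \<longrightarrow> s \<in> U t \<inter> S \<longrightarrow> Q i s)"
    by metis
  then obtain C where C: "C \<subseteq> K" "finite C" "K \<subseteq> (\<Union>t\<in>C. U t)"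
    using compactE_image[OF K(1), of K U] by (metis UN_iff subsetI)
  have "\<forall>\<^sub>F i in F. \<forall>t\<in>C. Pf t i" using C P by (intro eventually_ball_finite) auto
  then show ?thesis
  proof eventually_elim
    case (elim i)
    show ?case
    proof
      fix s assume s: "s \<in> K"
      then obtain t where t: "t \<in> C" "s \<in> U t" using C(3) by blast
      then show "Q i s" using P[of t] elim C(1) s K(2) by blast
    qed
  qed
qed

lemma tendsto_joint_fst:
  assumes "\<forall>\<^sub>F i in F. Q i" shows "\<forall>\<^sub>F x in joint_nhds F S t. Q (fst x)"
  unfolding eventually_joint_nhds using assms by (intro exI[of _ Q] exI[of _ UNIV]) auto

lemma filterlim_joint_snd:
  assumes "(f \<longlongrightarrow> f t) (at t within S)"
  shows "((\<lambda>x. f (snd x)) \<longlongrightarrow> f t) (joint_nhds F S t)"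
proof (rule topological_tendstoI)
  fix V assume V: "open V" "f t \<in> V"
  obtain U where U: "open U" "t \<in> U" "\<And>s. s \<in> U \<Longrightarrow> s \<noteq> t \<Longrightarrow> s \<in> S \<Longrightarrow> f s \<in> V"
    using topological_tendstoD[OF assms V] unfolding eventually_at_topological by blast
  show "\<forall>\<^sub>F x in joint_nhds F S t. f (snd x) \<in> V"
    unfolding eventually_joint_nhds
  proof (intro exI conjI allI impI)
    show "f (snd (i, s)) \<in> V" if "True" "s \<in> U \<inter> S" for i s using U(3)[of s] V(2) that by (cases "s = t") auto
  qed (use U in auto)
qed

lemma joint_tendsto_at:
  assumes "(f \<longlongrightarrow> l) (joint_nhds F S t)" "t \<in> S"
  shows "((\<lambda>i. f (i, t)) \<longlongrightarrow> l) F"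
proof (rule topological_tendstoI)
  fix V assume V: "open V" "l \<in> V"
  obtain Pf U where "eventually Pf F" "t \<in> U" "\<And>i s. Pf i \<Longrightarrow> s \<in> U \<inter> S \<Longrightarrow> f (i, s) \<in> V"
    using topological_tendstoD[OF assms(1) V] unfolding eventually_joint_nhds by blast
  then show "\<forall>\<^sub>F i in F. f (i, t) \<in> V" using assms(2) by (auto elim: eventually_mono)
qed

text \<open>How local estimates on short intervals give convergence on the whole interval. The quantities
  \<open>y t0 i t\<close> are the coordinates in a chart around the limit point at time \<open>t0\<close>, and \<open>R t0 i t\<close>
  says that this chart can be used.\<close>
lemma propagate_convergence:
  fixes y :: "real \<Rightarrow> 'i \<Rightarrow> real \<Rightarrow> 'x::metric_space"
  assumes ab: "a \<le> b" and start: "C a"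
    and local: "\<And>t0. t0 \<in> {a..b} \<Longrightarrow> \<exists>\<delta>>0. \<forall>s\<in>{a..b}. \<bar>s - t0\<bar> \<le> \<delta> \<longrightarrow> C s \<longrightarrow>
      (\<forall>\<epsilon>>0. \<forall>\<^sub>F i in F. \<forall>t\<in>{s..b}. \<bar>t - t0\<bar> \<le> \<delta> \<longrightarrow> R t0 i t \<and> dist (y t0 i t) (y t0 l t) < \<epsilon>)"
    and conv: "\<And>t0. t0 \<in> {a..b} \<Longrightarrow> \<exists>\<delta>>0. \<forall>t\<in>{a..b}. \<bar>t - t0\<bar> \<le> \<delta> \<longrightarrow> (\<forall>\<^sub>F i in F. R t0 i t) \<longrightarrow>
      ((\<lambda>i. y t0 i t) \<longlongrightarrow> y t0 l t) F \<longrightarrow> C t"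
    and cont: "\<And>t0. t0 \<in> {a..b} \<Longrightarrow> (y t0 l \<longlongrightarrow> y t0 l t0) (at t0 within {a..b})"
    and t: "t \<in> {a..b}"
  shows "C t" "((\<lambda>x. y t (fst x) (snd x)) \<longlongrightarrow> y t l t) (joint_nhds F {a..b} t)"
    "\<forall>\<^sub>F x in joint_nhds F {a..b} t. R t (fst x) (snd x)"
proof -
  have C: "C u" if u: "u \<in> {a..b}" for u
  proof -
    have "a \<le> a \<longrightarrow> u \<le> b \<longrightarrow> a \<le> u \<longrightarrow> C a \<longrightarrow> C u"
    proof (rule Bolzano[where P = "\<lambda>p q. a \<le> p \<longrightarrow> q \<le> b \<longrightarrow> p \<le> q \<longrightarrow> C p \<longrightarrow> C q"])
      show "a \<le> u" using u by simp
      fix x assume x: "a \<le> x" "x \<le> u"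
      then have xI: "x \<in> {a..b}" using u by simp
      obtain \<delta> where \<delta>: "\<delta> > 0" "\<And>s. s \<in> {a..b} \<Longrightarrow> \<bar>s - x\<bar> \<le> \<delta> \<Longrightarrow> C s \<Longrightarrow>
        (\<forall>\<epsilon>>0. \<forall>\<^sub>F i in F. \<forall>t\<in>{s..b}. \<bar>t - x\<bar> \<le> \<delta> \<longrightarrow> R x i t \<and> dist (y x i t) (y x l t) < \<epsilon>)"
        using local[OF xI] by blast
      obtain \<delta>' where \<delta>': "\<delta>' > 0" "\<And>t. t \<in> {a..b} \<Longrightarrow> \<bar>t - x\<bar> \<le> \<delta>' \<Longrightarrow> (\<forall>\<^sub>F i in F. R x i t) \<Longrightarrow>
        ((\<lambda>i. y x i t) \<longlongrightarrow> y x l t) F \<Longrightarrow> C t"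
        using conv[OF xI] by blast
      show "\<exists>d>0. \<forall>p q. p \<le> x \<and> x \<le> q \<and> q - p < d \<longrightarrow> (a \<le> p \<longrightarrow> q \<le> b \<longrightarrow> p \<le> q \<longrightarrow> C p \<longrightarrow> C q)"
      proof (intro exI conjI allI impI)
        show "min \<delta> \<delta>' > 0" using \<delta> \<delta>' by simp
        fix p q assume pq: "p \<le> x \<and> x \<le> q \<and> q - p < min \<delta> \<delta>'" "a \<le> p" "q \<le> b" "p \<le> q" "C p"
        have ev: "\<forall>\<^sub>F i in F. R x i q \<and> dist (y x i q) (y x l q) < \<epsilon>" if "\<epsilon> > 0" for \<epsilon>
        proof -
          have "\<forall>\<^sub>F i in F. \<forall>t\<in>{p..b}. \<bar>t - x\<bar> \<le> \<delta> \<longrightarrow> R x i t \<and> dist (y x i t) (y x l t) < \<epsilon>"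
            using \<delta>(2)[of p] pq that by auto
          then show ?thesis by eventually_elim (use pq in auto)
        qed
        show "C q"
        proof (rule \<delta>'(2))
          show "\<forall>\<^sub>F i in F. R x i q" using ev[of 1] by (auto elim: eventually_mono)
          show "((\<lambda>i. y x i q) \<longlongrightarrow> y x l q) F"
          proof (rule tendstoI)
            fix e :: real assume "0 < e"
            from ev[OF this] show "\<forall>\<^sub>F i in F. dist (y x i q) (y x l q) < e" by eventually_elim blast
          qed
        qed (use pq in auto)
      qed
    qed auto
    then show ?thesis using u start by simp
  qed
  show "C t" by (rule C[OF t])
  obtain \<delta> where \<delta>: "\<delta> > 0" "\<And>s. s \<in> {a..b} \<Longrightarrow> \<bar>s - t\<bar> \<le> \<delta> \<Longrightarrow> C s \<Longrightarrow>
    (\<forall>\<epsilon>>0. \<forall>\<^sub>F i in F. \<forall>u\<in>{s..b}. \<bar>u - t\<bar> \<le> \<delta> \<longrightarrow> R t i u \<and> dist (y t i u) (y t l u) < \<epsilon>)"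
    using local[OF t] by blast
  define s where "s = max a (t - \<delta>)"
  have s: "s \<in> {a..b}" "\<bar>s - t\<bar> \<le> \<delta>" using t \<delta>(1) by (auto simp: s_def)
  have ev: "\<forall>\<^sub>F x in joint_nhds F {a..b} t. R t (fst x) (snd x) \<and> dist (y t (fst x) (snd x)) (y t l (snd x)) < \<epsilon>" if "\<epsilon> > 0" for \<epsilon>
  proof (rule eventually_jointI[OF _ \<delta>(1)])
    show "\<forall>\<^sub>F i in F. \<forall>u\<in>{s..b}. \<bar>u - t\<bar> \<le> \<delta> \<longrightarrow> R t i u \<and> dist (y t i u) (y t l u) < \<epsilon>"
      using \<delta>(2)[OF s C[OF s(1)]] that by blast
  qed (auto simp: s_def)
  show "\<forall>\<^sub>F x in joint_nhds F {a..b} t. R t (fst x) (snd x)" using ev[of 1] by (auto elim: eventually_mono)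
  show "((\<lambda>x. y t (fst x) (snd x)) \<longlongrightarrow> y t l t) (joint_nhds F {a..b} t)"
  proof (rule tendstoI)
    fix \<epsilon> :: real assume e: "\<epsilon> > 0"
    have "\<forall>\<^sub>F x in joint_nhds F {a..b} t. dist (y t l (snd x)) (y t l t) < \<epsilon> / 2"
      by (rule tendstoD[OF filterlim_joint_snd[OF cont[OF t]]]) (use e in simp)
    moreover have "\<forall>\<^sub>F x in joint_nhds F {a..b} t. R t (fst x) (snd x) \<and> dist (y t (fst x) (snd x)) (y t l (snd x)) < \<epsilon> / 2"
      by (rule ev) (use e in simp)
    ultimately show "\<forall>\<^sub>F x in joint_nhds F {a..b} t. dist (y t (fst x) (snd x)) (y t l t) < \<epsilon>"
    proof eventually_elim
      case (elim x)
      have "dist (y t (fst x) (snd x)) (y t l t) \<le> dist (y t (fst x) (snd x)) (y t l (snd x)) + dist (y t l (snd x)) (y t l t)"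
        by (rule dist_triangle)
      then show ?case using elim by linarith
    qed
  qed
qed

text \<open>Continuous induction on an interval, by bisection.\<close>
lemma continuation:
  fixes s e :: real
  assumes se: "s \<le> e" and start: "Q s"
    and closed: "\<And>t. s < t \<Longrightarrow> t \<le> e \<Longrightarrow> (\<And>u. s \<le> u \<Longrightarrow> u < t \<Longrightarrow> Q u) \<Longrightarrow> Q t"
    and "open": "\<And>t. s \<le> t \<Longrightarrow> t \<le> e \<Longrightarrow> Q t \<Longrightarrow> \<exists>d>0. \<forall>u. t \<le> u \<longrightarrow> u < t + d \<longrightarrow> u \<le> e \<longrightarrow> Q u"
    and t: "t \<in> {s..e}"
  shows "Q t"
proof -
  have "s \<le> s \<longrightarrow> e \<le> e \<longrightarrow> (\<forall>u\<in>{s..s}. Q u) \<longrightarrow> (\<forall>u\<in>{s..e}. Q u)"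
  proof (rule Bolzano[OF se, where P = "\<lambda>p q. s \<le> p \<longrightarrow> q \<le> e \<longrightarrow> (\<forall>u\<in>{s..p}. Q u) \<longrightarrow> (\<forall>u\<in>{s..q}. Q u)"])
    fix p q r :: real
    assume 1: "s \<le> p \<longrightarrow> q \<le> e \<longrightarrow> (\<forall>u\<in>{s..p}. Q u) \<longrightarrow> (\<forall>u\<in>{s..q}. Q u)"
      and 2: "s \<le> q \<longrightarrow> r \<le> e \<longrightarrow> (\<forall>u\<in>{s..q}. Q u) \<longrightarrow> (\<forall>u\<in>{s..r}. Q u)" and le: "p \<le> q" "q \<le> r"
    show "s \<le> p \<longrightarrow> r \<le> e \<longrightarrow> (\<forall>u\<in>{s..p}. Q u) \<longrightarrow> (\<forall>u\<in>{s..r}. Q u)"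
    proof (rule impI, rule impI, rule impI)
      assume *: "s \<le> p" "r \<le> e" "\<forall>u\<in>{s..p}. Q u"
      have "s \<le> q" "q \<le> e" using * le by linarith+
      then show "\<forall>u\<in>{s..r}. Q u" using 1 2 * by blast
    qed
  next
    fix x assume x: "s \<le> x" "x \<le> e"
    show "\<exists>d>0. \<forall>p q. p \<le> x \<and> x \<le> q \<and> q - p < d \<longrightarrow> (s \<le> p \<longrightarrow> q \<le> e \<longrightarrow> (\<forall>u\<in>{s..p}. Q u) \<longrightarrow> (\<forall>u\<in>{s..q}. Q u))"
    proof (cases "\<forall>u. s \<le> u \<longrightarrow> u < x \<longrightarrow> Q u")
      case True
      have "Q x" using closed[of x] True start x by (cases "s = x") auto
      then obtain d where d: "d > 0" "\<And>u. x \<le> u \<Longrightarrow> u < x + d \<Longrightarrow> u \<le> e \<Longrightarrow> Q u" using "open" x by blast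
      show ?thesis
      proof (intro exI[of _ d] conjI allI impI ballI)
        fix p q u assume *: "p \<le> x \<and> x \<le> q \<and> q - p < d" "s \<le> p" "q \<le> e" "u \<in> {s..q}"
        show "Q u" using True d(2)[of u] * by (cases "u < x") auto
      qed (rule d(1))
    next
      case False
      then obtain u where u: "s \<le> u" "u < x" "\<not> Q u" by blast
      show ?thesis
      proof (intro exI[of _ "x - u"] conjI allI impI ballI)
        fix p q v assume *: "p \<le> x \<and> x \<le> q \<and> q - p < x - u" "\<forall>u\<in>{s..p}. Q u"
        then have "u \<in> {s..p}" using u by auto
        then show "Q v" using *(2) u(3) by blast
      qed (use u in simp)
    qed
  qed
  then have "\<forall>u\<in>{s..e}. Q u" using start by simp
  then show ?thesis using t by blast
qed

context manifold
begin

definition tvec_lim :: "('j \<Rightarrow> 'm) \<Rightarrow> ('j \<Rightarrow> ('m, 'e) tvec) \<Rightarrow> 'm \<Rightarrow> ('m, 'e) tvec \<Rightarrow> 'j filter \<Rightarrow> bool" where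
  "tvec_lim p v p0 v0 H \<longleftrightarrow> (p \<longlongrightarrow> p0) H \<and> (\<forall>c\<in>charts_at A p0. ((\<lambda>i. v i c) \<longlongrightarrow> v0 c) H)"

lemma chart_eventually:
  assumes "(p \<longlongrightarrow> p0) H" "c \<in> charts_at A p0" shows "\<forall>\<^sub>F i in H. c \<in> charts_at A (p i)"
proof -
  have "\<forall>\<^sub>F i in H. p i \<in> fst c"
    by (rule topological_tendstoD[OF assms(1) chart(1)[OF charts_atD(1)[OF assms(2)]] charts_atD(2)[OF assms(2)]])
  then show ?thesis using charts_atD(1)[OF assms(2)] by (auto simp: charts_at_def elim: eventually_mono)
qed

lemma coord_tendsto:
  assumes "(p \<longlongrightarrow> p0) H" "c \<in> charts_at A p0" shows "((\<lambda>i. snd c (p i)) \<longlongrightarrow> snd c p0) H"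
proof (rule continuous_on_tendsto_compose[OF chart(6)[OF charts_atD(1)[OF assms(2)]] assms(1) charts_atD(2)[OF assms(2)]])
  show "\<forall>\<^sub>F i in H. p i \<in> fst c" using chart_eventually[OF assms] by eventually_elim (rule charts_atD(2))
qed

lemma point_tendsto:
  assumes c: "c \<in> charts_at A p0" and ev: "\<forall>\<^sub>F i in H. c \<in> charts_at A (p i)"
    and lim: "((\<lambda>i. snd c (p i)) \<longlongrightarrow> snd c p0) H"
  shows "(p \<longlongrightarrow> p0) H"
proof -
  have "((\<lambda>i. chart_inv c (snd c (p i))) \<longlongrightarrow> chart_inv c (snd c p0)) H"
    by (rule continuous_on_tendsto_compose[OF chart(7)[OF charts_atD(1)[OF c]] lim charts_atD(3)[OF c]])
      (use ev in \<open>auto elim: eventually_mono intro: charts_atD(3)\<close>)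
  then have "((\<lambda>i. chart_inv c (snd c (p i))) \<longlongrightarrow> p0) H" by (simp add: charts_atD(4)[OF c])
  then show ?thesis
    by (rule Lim_transform_eventually) (use ev in \<open>auto elim: eventually_mono intro: charts_atD(4)\<close>)
qed

text \<open>One chart suffices, since the components in the other charts are images under differentials of transition maps.\<close>
lemma tvec_limI:
  assumes p: "(p \<longlongrightarrow> p0) H" and c: "c \<in> charts_at A p0" and lim: "((\<lambda>i. v i c) \<longlongrightarrow> v0 c) H"
    and v: "\<forall>\<^sub>F i in H. v i \<in> tangent_space A (p i)" "v0 \<in> tangent_space A p0"
  shows "tvec_lim p v p0 v0 H"
  unfolding tvec_lim_def
proof (intro conjI ballI)
  fix d assume d: "d \<in> charts_at A p0"
  note cA = charts_atD(1)[OF c] and dA = charts_atD(1)[OF d]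
  have ev: "\<forall>\<^sub>F i in H. snd c (p i) \<in> overlap c d"
    using chart_eventually[OF p c] chart_eventually[OF p d] by eventually_elim (rule overlapI[OF cA dA])
  have o: "snd c p0 \<in> overlap c d" by (rule overlapI[OF cA dA c d])
  have "((\<lambda>i. trans_deriv c d (snd c (p i)) (v i c)) \<longlongrightarrow> trans_deriv c d (snd c p0) (v0 c)) H"
  proof (rule linear_apply_tendsto[OF _ _ _ lim])
    show "\<forall>\<^sub>F i in H. linear (trans_deriv c d (snd c (p i)))"
      using ev by eventually_elim (rule trans_deriv_linear[OF cA dA])
    show "linear (trans_deriv c d (snd c p0))" by (rule trans_deriv_linear[OF cA dA o])
    show "((\<lambda>i. trans_deriv c d (snd c (p i)) b) \<longlongrightarrow> trans_deriv c d (snd c p0) b) H" for b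
      by (rule continuous_on_tendsto_compose[OF smooth_on_continuous[OF trans_deriv_smooth[OF cA dA]] coord_tendsto[OF p c] o ev])
  qed
  moreover have "\<forall>\<^sub>F i in H. trans_deriv c d (snd c (p i)) (v i c) = v i d"
    using chart_eventually[OF p c] chart_eventually[OF p d] v(1)
    by eventually_elim (rule tangent_transform[symmetric])
  ultimately have "((\<lambda>i. v i d) \<longlongrightarrow> trans_deriv c d (snd c p0) (v0 c)) H" by (rule Lim_transform_eventually)
  then show "((\<lambda>i. v i d) \<longlongrightarrow> v0 d) H" using tangent_transform[OF c d v(2)] by simp
qed (rule p)

lemma tvec_limD:
  assumes "tvec_lim p v p0 v0 H"
  shows "(p \<longlongrightarrow> p0) H" "c \<in> charts_at A p0 \<Longrightarrow> ((\<lambda>i. v i c) \<longlongrightarrow> v0 c) H"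
  using assms by (auto simp: tvec_lim_def)

end

context semi_riemannian
begin

lemma metric_tendsto:
  assumes u: "tvec_lim p u p0 u0 H" and v: "tvec_lim p v p0 v0 H"
    and T: "\<forall>\<^sub>F i in H. u i \<in> tangent_space A (p i)" "u0 \<in> tangent_space A p0"
      "\<forall>\<^sub>F i in H. v i \<in> tangent_space A (p i)" "v0 \<in> tangent_space A p0"
  shows "((\<lambda>i. g (p i) (u i) (v i)) \<longlongrightarrow> g p0 u0 v0) H"
proof -
  obtain c where c: "c \<in> charts_at A p0" using ex_chart by blast
  note p = tvec_limD(1)[OF u]
  have "((\<lambda>i. metr c (snd c (p i)) (u i c) (v i c)) \<longlongrightarrow> metr c (snd c p0) (u0 c) (v0 c)) H"
    by (rule metr_tendsto[OF charts_atD(1)[OF c] coord_tendsto[OF p c] charts_atD(3)[OF c] tvec_limD(2)[OF u c] tvec_limD(2)[OF v c]])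
  moreover have "\<forall>\<^sub>F i in H. metr c (snd c (p i)) (u i c) (v i c) = g (p i) (u i) (v i)"
    using chart_eventually[OF p c] T(1,3) by eventually_elim (rule metric_value[symmetric])
  ultimately show ?thesis unfolding metric_value[OF c T(2,4)] by (rule Lim_transform_eventually)
qed

text \<open>The geodesic equation as a first order system.\<close>
definition geodesic_field :: "('m, 'e) chart \<Rightarrow> 'e \<times> 'e \<Rightarrow> 'e \<times> 'e" where
  "geodesic_field c y = (snd y, - Gam c (fst y) (snd y) (snd y))"

lemma geodesic_field_lipschitz:
  assumes c: "c \<in> A" and sub: "cball y0 r \<subseteq> chart_image c \<times> UNIV"
  obtains L where "L \<ge> 0" "\<And>y z. y \<in> cball y0 r \<Longrightarrow> z \<in> cball y0 r \<Longrightarrow>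
    norm (geodesic_field c y - geodesic_field c z) \<le> L * norm (y - z)"
proof -
  define D where "D y h = (snd h, - (dGam c (fst y) (fst h) (snd y) (snd y) + Gam c (fst y) (snd h) (snd y) + Gam c (fst y) (snd y) (snd h)))"
    for y h :: "'e \<times> 'e"
  let ?U = "chart_image c \<times> (UNIV :: 'e set)"
  have U: "open ?U" using open_image[OF c] by (simp add: open_Times)
  have der: "(geodesic_field c has_derivative D y) (at y)" if y: "y \<in> ?U" for y
  proof -
    have x: "fst y \<in> chart_image c" using y by auto
    have f: "(fst has_derivative fst) (at y)" and s: "(snd has_derivative snd) (at y)"
      by (auto intro: derivative_eq_intros)
    have "((\<lambda>y. Gam c (fst y) (snd y) (snd y)) has_derivative
      (\<lambda>h. dGam c (fst y) (fst h) (snd y) (snd y) + Gam c (fst y) (snd h) (snd y) + Gam c (fst y) (snd y) (snd h))) (at y)"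
    proof (rule has_derivative_bilinear_apply_at[OF U y, where f = "\<lambda>y. Gam c (fst y)" and D = "\<lambda>h. dGam c (fst y) (fst h)"
          and b = snd and b' = snd and c = snd and c' = snd])
      show "((\<lambda>y. Gam c (fst y) u v) has_derivative (\<lambda>h. dGam c (fst y) (fst h) u v)) (at y)" for u v
        by (rule has_derivative_compose[OF f Gam_has_derivative[OF c x]])
    qed (use s Gam_bilinear[OF c] dGam_bilinear(1)[OF c x] in auto)
    then show ?thesis unfolding geodesic_field_def[abs_def] D_def[abs_def]
      by (intro has_derivative_Pair has_derivative_minus s)
  qed
  have lin: "linear (D y)" if "y \<in> cball y0 r" for y
    using der[of y] that sub has_derivative_linear by blast
  have cont: "continuous_on (cball y0 r) (\<lambda>y. D y h)" for h
    unfolding continuous_on_def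
  proof
    fix y assume "y \<in> cball y0 r"
    then have x: "fst y \<in> chart_image c" using sub by auto
    show "((\<lambda>y. D y h) \<longlongrightarrow> D y h) (at y within cball y0 r)"
      unfolding D_def by (intro tendsto_intros dGam_tendsto[OF c _ x] Gam_tendsto[OF c _ x])
  qed
  obtain L where L: "L > 0" "\<And>y h. y \<in> cball y0 r \<Longrightarrow> norm (D y h) \<le> L * norm h"
    using linear_family_bounded[where S = "cball y0 r" and A = D, OF compact_cball lin cont] by blast
  show thesis
  proof (rule that[of L])
    fix y z assume yz: "y \<in> cball y0 r" "z \<in> cball y0 r"
    show "norm (geodesic_field c y - geodesic_field c z) \<le> L * norm (y - z)"
    proof (rule differentiable_bound[OF convex_cball])
      show "(geodesic_field c has_derivative D x) (at x within cball y0 r)" if "x \<in> cball y0 r" for x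
        using der[of x] that sub has_derivative_at_withinI by blast
      show "onorm (D x) \<le> L" if "x \<in> cball y0 r" for x by (rule onorm_le[OF L(2)[OF that]])
    qed (use yz in auto)
  qed (use L in simp)
qed

end

locale geodesic_family = semi_riemannian A g
  for A :: "('m::t2_space, 'e::euclidean_space) chart set" and g +
  fixes a b :: real and \<gamma> :: "'i \<Rightarrow> real \<Rightarrow> 'm" and F :: "'i filter" and l :: 'i
  assumes ab: "a < b" and geo: "\<And>i. geodesic A g a b (\<gamma> i)"
begin

sublocale seg: geodesic_segment A g a b "\<gamma> i" for i
  by unfold_locales (rule ab, rule geo)

abbreviation "V i \<equiv> velocity A a b (\<gamma> i)"

definition velocity_conv :: "real \<Rightarrow> bool" where
  "velocity_conv t \<longleftrightarrow> tvec_lim (\<lambda>i. \<gamma> i t) (\<lambda>i. V i t) (\<gamma> l t) (V l t) F"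

definition phase :: "('m, 'e) chart \<Rightarrow> 'i \<Rightarrow> real \<Rightarrow> 'e \<times> 'e" where
  "phase c i t = (snd c (\<gamma> i t), V i t c)"

lemma phase_deriv:
  assumes t: "t \<in> {a..b}" and c: "c \<in> charts_at A (\<gamma> i t)"
  shows "(phase c i has_vector_derivative geodesic_field c (phase c i t)) (at t within {a..b})"
  using has_vector_derivative_Pair[OF seg.curve_deriv[OF t c] seg.vel_parallel[OF t c, unfolded seg.cov_deriv_at_def]]
  by (simp add: phase_def[abs_def] geodesic_field_def)

lemma phase_continuous:
  assumes "t \<in> {a..b}" "c \<in> charts_at A (\<gamma> i t)" shows "(phase c i \<longlongrightarrow> phase c i t) (at t within {a..b})"
  using has_vector_derivative_continuous[OF phase_deriv[OF assms]] by (simp add: continuous_within)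

lemma phase_near:
  assumes t: "t \<in> {a..b}" and c: "c \<in> charts_at A (\<gamma> i t)" and e: "e > 0"
  obtains d where "d > 0" "\<And>s. s \<in> {a..b} \<Longrightarrow> \<bar>s - t\<bar> \<le> d \<Longrightarrow> c \<in> charts_at A (\<gamma> i s) \<and> dist (phase c i s) (phase c i t) < e"
proof -
  obtain d1 where d1: "d1 > 0" "\<And>s. s \<in> {a..b} \<Longrightarrow> \<bar>s - t\<bar> \<le> d1 \<Longrightarrow> c \<in> charts_at A (\<gamma> i s)"
    using seg.chart_neighbourhood[OF t c] by blast
  obtain d2 where d2: "d2 > 0" "\<And>s. s \<in> {a..b} \<Longrightarrow> s \<noteq> t \<Longrightarrow> \<bar>s - t\<bar> < d2 \<Longrightarrow> dist (phase c i s) (phase c i t) < e"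
    using tendstoD[OF phase_continuous[OF t c] e] by (rule eventually_at_within_ballE) blast
  show thesis
  proof (rule that[of "min d1 (d2 / 2)"])
    show "min d1 (d2 / 2) > 0" using d1 d2 by simp
    fix s assume s: "s \<in> {a..b}" "\<bar>s - t\<bar> \<le> min d1 (d2 / 2)"
    then have "\<bar>s - t\<bar> < d2" using d2(1) by linarith
    then show "c \<in> charts_at A (\<gamma> i s) \<and> dist (phase c i s) (phase c i t) < e"
      using d1(2)[of s] d2(2)[of s] s e by (cases "s = t") auto
  qed
qed

text \<open>A geodesic which starts close to the limit geodesic stays close to it by Gronwall's estimate. That it stays in
  the chart as long as its coordinates stay in a compact set uses that the manifold is Hausdorff.\<close>
lemma geodesic_local:
  assumes t0: "t0 \<in> {a..b}" and c: "c \<in> charts_at A (\<gamma> l t0)"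
  shows "\<exists>\<delta>>0. \<forall>s\<in>{a..b}. \<bar>s - t0\<bar> \<le> \<delta> \<longrightarrow> velocity_conv s \<longrightarrow>
    (\<forall>\<epsilon>>0. \<forall>\<^sub>F i in F. \<forall>t\<in>{s..b}. \<bar>t - t0\<bar> \<le> \<delta> \<longrightarrow> c \<in> charts_at A (\<gamma> i t) \<and> dist (phase c i t) (phase c l t) < \<epsilon>)"
proof -
  note cA = charts_atD(1)[OF c]
  let ?y0 = "phase c l t0"
  have "?y0 \<in> chart_image c \<times> UNIV" using charts_atD(3)[OF c] by (simp add: phase_def)
  moreover have "open (chart_image c \<times> (UNIV :: 'e set))" using open_image[OF cA] by (simp add: open_Times)
  ultimately have "\<exists>r>0. cball ?y0 r \<subseteq> chart_image c \<times> UNIV" unfolding open_contains_cball by (rule bspec[rotated])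
  then obtain r where r: "r > 0" "cball ?y0 r \<subseteq> chart_image c \<times> UNIV" by (elim exE conjE)
  obtain L where L: "L \<ge> 0" "\<And>y z. y \<in> cball ?y0 r \<Longrightarrow> z \<in> cball ?y0 r \<Longrightarrow>
    norm (geodesic_field c y - geodesic_field c z) \<le> L * norm (y - z)"
    using geodesic_field_lipschitz[OF cA r(2)] by blast
  obtain \<delta> where \<delta>: "\<delta> > 0" "\<And>t. t \<in> {a..b} \<Longrightarrow> \<bar>t - t0\<bar> \<le> \<delta> \<Longrightarrow> c \<in> charts_at A (\<gamma> l t) \<and> dist (phase c l t) ?y0 < r / 2"
    using phase_near[OF t0 c, of "r / 2"] r(1) by auto
  show ?thesis
  proof (intro exI[of _ \<delta>] conjI ballI impI allI \<delta>(1))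
    fix s \<epsilon> :: real assume s: "s \<in> {a..b}" "\<bar>s - t0\<bar> \<le> \<delta>" and conv: "velocity_conv s" and \<epsilon>: "\<epsilon> > 0"
    \<comment> \<open>the factor in Gronwall's estimate; the initial distance \<open>\<eta>\<close> grows to at most \<open>m\<close>\<close>
    define M where "M = exp ((2 * L + 1) * (2 * \<delta>))"
    define m where "m = min \<epsilon> (r / 2)"
    define \<eta> where "\<eta> = m / sqrt M"
    have M: "M \<ge> 1" using L(1) \<delta>(1) by (simp add: M_def)
    have m: "m > 0" "m \<le> \<epsilon>" "m \<le> r / 2" using \<epsilon> r by (auto simp: m_def)
    have sM: "sqrt M \<ge> 1" using M by simp
    have \<eta>: "\<eta> > 0" "M * \<eta>\<^sup>2 = m\<^sup>2" using M m by (simp_all add: \<eta>_def power_divide)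
    have "m / sqrt M \<le> m / 1" using sM m(1) by (intro divide_left_mono) auto
    then have \<eta>m: "\<eta> \<le> m" by (simp add: \<eta>_def)
    have cs: "c \<in> charts_at A (\<gamma> l s)" using \<delta>(2) s by blast
    note tv = conv[unfolded velocity_conv_def]
    have "((\<lambda>i. phase c i s) \<longlongrightarrow> phase c l s) F"
      unfolding phase_def using coord_tendsto[OF tvec_limD(1)[OF tv] cs] tvec_limD(2)[OF tv cs] by (rule tendsto_Pair)
    from tendstoD[OF this \<eta>(1)] chart_eventually[OF tvec_limD(1)[OF tv] cs]
    show "\<forall>\<^sub>F i in F. \<forall>t\<in>{s..b}. \<bar>t - t0\<bar> \<le> \<delta> \<longrightarrow> c \<in> charts_at A (\<gamma> i t) \<and> dist (phase c i t) (phase c l t) < \<epsilon>"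
    proof eventually_elim
      case (elim i)
      define e where "e = min b (t0 + \<delta>)"
      define Q where "Q t \<longleftrightarrow> c \<in> charts_at A (\<gamma> i t) \<and> dist (phase c i t) ?y0 < r" for t
      have se: "s \<le> e" using s by (auto simp: e_def)
      have sub: "t \<in> {a..b}" "\<bar>t - t0\<bar> \<le> \<delta>" if "s \<le> t" "t \<le> e" for t using that s by (auto simp: e_def)
      have grow: "dist (phase c i u) (phase c l u) < m"
        if u: "s \<le> u" "u \<le> e" and Qu: "\<And>x. s \<le> x \<Longrightarrow> x \<le> u \<Longrightarrow> c \<in> charts_at A (\<gamma> i x) \<and> phase c i x \<in> cball ?y0 r" for u
      proof -
        let ?w = "\<lambda>t. phase c i t - phase c l t"
        have I: "x \<in> {a..b}" "\<bar>x - t0\<bar> \<le> \<delta>" if "x \<in> {s..u}" for x using that u sub[of x] by auto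
        have sub': "{s..u} \<subseteq> {a..b}" using I by blast
        have ux: "u \<in> {s..u}" using u by simp
        have "(norm (?w u))\<^sup>2 + 0\<^sup>2 \<le> exp ((2 * L + 1) * (u - s)) * ((norm (?w s))\<^sup>2 + 0\<^sup>2)"
        proof (rule gronwall[where u' = "\<lambda>t. geodesic_field c (phase c i t) - geodesic_field c (phase c l t)", OF _ _ L(1) ux])
          fix x assume x: "x \<in> {s..u}"
          have ci: "c \<in> charts_at A (\<gamma> i x)" "phase c i x \<in> cball ?y0 r" using Qu[of x] x by auto
          have cl: "c \<in> charts_at A (\<gamma> l x)" "dist (phase c l x) ?y0 < r / 2" using \<delta>(2)[OF I[OF x]] by auto
          show "(?w has_vector_derivative geodesic_field c (phase c i x) - geodesic_field c (phase c l x)) (at x within {s..u})"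
            by (intro has_vector_derivative_diff has_vector_derivative_within_subset[OF phase_deriv[OF I(1)[OF x] ci(1)] sub']
                has_vector_derivative_within_subset[OF phase_deriv[OF I(1)[OF x] cl(1)] sub'])
          have "phase c l x \<in> cball ?y0 r" using cl(2) r(1) by (simp add: dist_commute)
          then show "norm (geodesic_field c (phase c i x) - geodesic_field c (phase c l x)) \<le> L * norm (?w x) + 0"
            using L(2)[OF ci(2)] by simp
        qed
        also have "\<dots> \<le> M * ((norm (?w s))\<^sup>2 + 0\<^sup>2)"
        proof (rule mult_right_mono)
          have "u - s \<le> 2 * \<delta>" using sub(2)[of s] sub(2)[OF u] se by auto
          then show "exp ((2 * L + 1) * (u - s)) \<le> M" using L(1) by (simp add: M_def mult_left_mono)
        qed simp
        also have "\<dots> < M * \<eta>\<^sup>2"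
          using elim(1) M by (intro mult_strict_left_mono) (auto simp: dist_norm intro!: power_strict_mono)
        finally have "(norm (?w u))\<^sup>2 < m\<^sup>2" using \<eta>(2) by simp
        then show ?thesis using m(1) by (simp add: dist_norm power2_less_imp_less)
      qed
      have near: "dist (phase c i u) ?y0 < r" if "dist (phase c i u) (phase c l u) < m" "s \<le> u" "u \<le> e" for u
      proof -
        have "dist (phase c i u) ?y0 \<le> dist (phase c i u) (phase c l u) + dist (phase c l u) ?y0" by (rule dist_triangle)
        then show ?thesis using that(1) \<delta>(2)[OF sub[OF that(2,3)]] m(3) by linarith
      qed
      have Q: "Q t" if t: "t \<in> {s..e}" for t
      proof (rule continuation[OF se _ _ _ t])
        show "Q s" unfolding Q_def using elim near[of s] \<eta>m se by simp
        fix t assume t: "s < t" "t \<le> e" and Qt: "\<And>u. s \<le> u \<Longrightarrow> u < t \<Longrightarrow> Q u"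
        have tI: "t \<in> {a..b}" using sub[of t] t by simp
        \<comment> \<open>a compact subset of a Hausdorff space is closed, so the geodesic cannot leave the domain of the chart at time \<open>t\<close>\<close>
        define K where "K = chart_inv c ` fst ` cball ?y0 r"
        have "fst ` cball ?y0 r \<subseteq> chart_image c" using r(2) by auto
        then have "continuous_on (fst ` cball ?y0 r) (chart_inv c)" using continuous_on_subset[OF chart(7)[OF cA]] by blast
        moreover have "compact (fst ` cball ?y0 r)"
          by (rule compact_continuous_image[OF continuous_on_fst[OF continuous_on_id] compact_cball])
        ultimately have "compact K" unfolding K_def by (rule compact_continuous_image)
        then have K: "closed K" by (rule compact_imp_closed)
        have left: "at t within {s..t} = at_left t" by (rule at_within_Icc_at_left[OF t(1)])
        have sub': "{s..t} \<subseteq> {a..b}" using sub t by auto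
        have evl: "\<forall>\<^sub>F u in at_left t. s \<le> u \<and> u < t" using eventually_at_left_real[OF t(1)] by eventually_elim auto
        have "(\<gamma> i \<longlongrightarrow> \<gamma> i t) (at t within {a..b})" using seg.curve_continuous tI by (simp add: continuous_on_def)
        then have lim: "(\<gamma> i \<longlongrightarrow> \<gamma> i t) (at_left t)" unfolding left[symmetric] by (rule tendsto_within_subset[OF _ sub'])
        have "\<forall>\<^sub>F u in at_left t. \<gamma> i u \<in> K"
          using evl
        proof eventually_elim
          case (elim u)
          then have qu: "c \<in> charts_at A (\<gamma> i u)" "dist (phase c i u) ?y0 < r" using Qt unfolding Q_def by auto
          have "phase c i u \<in> cball ?y0 r" using qu(2) by (simp add: dist_commute)
          then have "chart_inv c (fst (phase c i u)) \<in> K" unfolding K_def by blast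
          then show ?case using charts_atD(4)[OF qu(1)] by (simp add: phase_def)
        qed
        then have "\<gamma> i t \<in> K" by (rule Lim_in_closed_set[OF K _ trivial_limit_at_left_real lim])
        then obtain y where y: "y \<in> cball ?y0 r" "\<gamma> i t = chart_inv c (fst y)" unfolding K_def by blast
        have ct: "c \<in> charts_at A (\<gamma> i t)" unfolding y(2) by (rule charts_at_inv[OF cA]) (use y(1) r(2) in auto)
        have "(phase c i \<longlongrightarrow> phase c i t) (at_left t)"
          unfolding left[symmetric] by (rule tendsto_within_subset[OF phase_continuous[OF tI ct] sub'])
        moreover have "\<forall>\<^sub>F u in at_left t. phase c i u \<in> cball ?y0 r"
          using evl by eventually_elim (use Qt in \<open>force simp: Q_def dist_commute\<close>)
        ultimately have yt: "phase c i t \<in> cball ?y0 r"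
          using Lim_in_closed_set[OF closed_cball _ trivial_limit_at_left_real] by blast
        have "c \<in> charts_at A (\<gamma> i x) \<and> phase c i x \<in> cball ?y0 r" if "s \<le> x" "x \<le> t" for x
        proof (cases "x = t")
          case False
          then have "Q x" using Qt that by simp
          then show ?thesis by (simp add: Q_def dist_commute)
        qed (use ct yt in simp)
        from near[OF grow[OF _ t(2) this]] show "Q t" using ct t by (simp add: Q_def)
      next
        fix t assume t: "s \<le> t" "t \<le> e" "Q t"
        then have ct: "c \<in> charts_at A (\<gamma> i t)" and gap: "r - dist (phase c i t) ?y0 > 0" by (auto simp: Q_def)
        obtain d where d: "d > 0" "\<And>u. u \<in> {a..b} \<Longrightarrow> \<bar>u - t\<bar> \<le> d \<Longrightarrow> c \<in> charts_at A (\<gamma> i u) \<and>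
            dist (phase c i u) (phase c i t) < r - dist (phase c i t) ?y0"
          using phase_near[OF sub(1)[OF t(1,2)] ct gap] by blast
        show "\<exists>d>0. \<forall>u. t \<le> u \<longrightarrow> u < t + d \<longrightarrow> u \<le> e \<longrightarrow> Q u"
        proof (intro exI[of _ d] conjI allI impI d(1))
          fix u assume u: "t \<le> u" "u < t + d" "u \<le> e"
          have "u \<in> {a..b}" using sub[of u] u t by simp
          then have "c \<in> charts_at A (\<gamma> i u)" "dist (phase c i u) (phase c i t) < r - dist (phase c i t) ?y0"
            using d(2)[of u] u by auto
          moreover have "dist (phase c i u) ?y0 \<le> dist (phase c i u) (phase c i t) + dist (phase c i t) ?y0" by (rule dist_triangle)
          ultimately show "Q u" by (simp add: Q_def)
        qed
      qed
      show ?case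
      proof (intro ballI impI)
        fix t assume "t \<in> {s..b}" "\<bar>t - t0\<bar> \<le> \<delta>"
        then have t: "s \<le> t" "t \<le> e" by (auto simp: e_def)
        have "dist (phase c i t) (phase c l t) < m"
          by (rule grow[OF t]) (use Q t in \<open>auto simp: Q_def dist_commute less_imp_le\<close>)
        then show "c \<in> charts_at A (\<gamma> i t) \<and> dist (phase c i t) (phase c l t) < \<epsilon>"
          using Q[of t] t m(2) by (auto simp: Q_def)
      qed
    qed
  qed
qed

text \<open>Convergence in the tangent bundle, jointly in the index and the time.\<close>
definition joint_conv :: "('i \<Rightarrow> real \<Rightarrow> ('m, 'e) tvec) \<Rightarrow> real \<Rightarrow> bool" where
  "joint_conv X t \<longleftrightarrow> tvec_lim (\<lambda>x. \<gamma> (fst x) (snd x)) (\<lambda>x. X (fst x) (snd x)) (\<gamma> l t) (X l t) (joint_nhds F {a..b} t)"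

lemma eventually_joint_time: "\<forall>\<^sub>F x in joint_nhds F {a..b} t. snd x \<in> {a..b}"
  unfolding eventually_joint_nhds by (intro exI[of _ "\<lambda>_. True"] exI[of _ UNIV]) auto

lemma velocity_joint_conv:
  assumes start: "velocity_conv a" and t: "t \<in> {a..b}"
  shows "joint_conv V t" "velocity_conv t"
proof -
  define ch where "ch t = (SOME c. c \<in> charts_at A (\<gamma> l t))" for t
  have ch: "ch t \<in> charts_at A (\<gamma> l t)" for t unfolding ch_def using ex_chart by (rule someI_ex)
  have conv: "\<exists>\<delta>>0. \<forall>t\<in>{a..b}. \<bar>t - t0\<bar> \<le> \<delta> \<longrightarrow> (\<forall>\<^sub>F i in F. ch t0 \<in> charts_at A (\<gamma> i t)) \<longrightarrow>
      ((\<lambda>i. phase (ch t0) i t) \<longlongrightarrow> phase (ch t0) l t) F \<longrightarrow> velocity_conv t" if t0: "t0 \<in> {a..b}" for t0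
  proof -
    obtain \<delta> where \<delta>: "\<delta> > 0" "\<And>t. t \<in> {a..b} \<Longrightarrow> \<bar>t - t0\<bar> \<le> \<delta> \<Longrightarrow> ch t0 \<in> charts_at A (\<gamma> l t)"
      using seg.chart_neighbourhood[OF t0 ch] by blast
    show ?thesis
    proof (intro exI[of _ \<delta>] conjI ballI impI \<delta>(1))
      fix t assume t: "t \<in> {a..b}" "\<bar>t - t0\<bar> \<le> \<delta>" and ev: "\<forall>\<^sub>F i in F. ch t0 \<in> charts_at A (\<gamma> i t)"
        and lim: "((\<lambda>i. phase (ch t0) i t) \<longlongrightarrow> phase (ch t0) l t) F"
      note c = \<delta>(2)[OF t]
      have "((\<lambda>i. \<gamma> i t) \<longlongrightarrow> \<gamma> l t) F"
        using point_tendsto[OF c ev] tendsto_fst[OF lim] by (simp add: phase_def)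
      then show "velocity_conv t"
        unfolding velocity_conv_def
        by (rule tvec_limI[OF _ c]) (use tendsto_snd[OF lim] seg.vel_tangent[OF t(1)] in \<open>simp_all add: phase_def\<close>)
    qed
  qed
  note * = propagate_convergence[where C = velocity_conv and R = "\<lambda>t0 i t. ch t0 \<in> charts_at A (\<gamma> i t)" and y = "\<lambda>t0. phase (ch t0)",
      OF less_imp_le[OF ab] start geodesic_local[OF _ ch] conv phase_continuous[OF _ ch] t]
  show "velocity_conv t" by (rule *(1))
  have lim: "((\<lambda>x. phase (ch t) (fst x) (snd x)) \<longlongrightarrow> phase (ch t) l t) (joint_nhds F {a..b} t)" by (rule *(2))
  have ev: "\<forall>\<^sub>F x in joint_nhds F {a..b} t. ch t \<in> charts_at A (\<gamma> (fst x) (snd x))" by (rule *(3))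
  have "((\<lambda>x. \<gamma> (fst x) (snd x)) \<longlongrightarrow> \<gamma> l t) (joint_nhds F {a..b} t)"
    using point_tendsto[OF ch ev] tendsto_fst[OF lim] by (simp add: phase_def)
  then show "joint_conv V t"
    unfolding joint_conv_def
  proof (rule tvec_limI[OF _ ch])
    show "((\<lambda>x. V (fst x) (snd x) (ch t)) \<longlongrightarrow> V l t (ch t)) (joint_nhds F {a..b} t)"
      using tendsto_snd[OF lim] by (simp add: phase_def)
    show "\<forall>\<^sub>F x in joint_nhds F {a..b} t. V (fst x) (snd x) \<in> tangent_space A (\<gamma> (fst x) (snd x))"
      using eventually_joint_time by eventually_elim (rule seg.vel_tangent)
  qed (rule seg.vel_tangent[OF t])
qed

definition field_conv :: "('i \<Rightarrow> real \<Rightarrow> ('m, 'e) tvec) \<Rightarrow> real \<Rightarrow> bool" where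
  "field_conv X t \<longleftrightarrow> tvec_lim (\<lambda>i. \<gamma> i t) (\<lambda>i. X i t) (\<gamma> l t) (X l t) F"

context
  fixes J Z :: "'i \<Rightarrow> real \<Rightarrow> ('m, 'e) tvec"
  assumes vconv: "velocity_conv a" and JZ: "\<And>i. seg.jacobi_pair i a b (J i) (Z i)"
begin

text \<open>The coefficients of the two linear systems are uniformly close on a short interval, by compactness. Their
  difference is the inhomogeneous term in Gronwall's estimate.\<close>
lemma jacobi_local:
  assumes t0: "t0 \<in> {a..b}" and c: "c \<in> charts_at A (\<gamma> l t0)"
  shows "\<exists>\<delta>>0. \<forall>s\<in>{a..b}. \<bar>s - t0\<bar> \<le> \<delta> \<longrightarrow> field_conv J s \<and> field_conv Z s \<longrightarrow>
    (\<forall>\<epsilon>>0. \<forall>\<^sub>F i in F. \<forall>t\<in>{s..b}. \<bar>t - t0\<bar> \<le> \<delta> \<longrightarrow> c \<in> charts_at A (\<gamma> i t) \<and>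
      dist (J i t c, Z i t c) (J l t c, Z l t c) < \<epsilon>)"
proof -
  note cA = charts_atD(1)[OF c]
  obtain \<delta> K where \<delta>: "\<delta> > 0" "K > 0" "\<And>t. t \<in> {a..b} \<Longrightarrow> \<bar>t - t0\<bar> \<le> \<delta> \<Longrightarrow> c \<in> charts_at A (\<gamma> l t)"
    and bound: "\<And>t y. t \<in> {a..b} \<Longrightarrow> \<bar>t - t0\<bar> \<le> \<delta> \<Longrightarrow> norm (jacobi_coeff c (snd c (\<gamma> l t)) (V l t c) y) \<le> K * norm y"
    and "\<And>y. continuous_on ({a..b} \<inter> {t0-\<delta>..t0+\<delta>}) (\<lambda>t. jacobi_coeff c (snd c (\<gamma> l t)) (V l t c) y)"
    using seg.jacobi_coeff_neighbourhood[OF t0 c] by blast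
  let ?S = "{a..b} \<inter> {t0-\<delta>..t0+\<delta>}"
  define Y where "Y i t = (J i t c, Z i t c)" for i t
  define \<A> where "\<A> i t = jacobi_coeff c (snd c (\<gamma> i t)) (V i t c)" for i t
  have S: "t \<in> {a..b}" "\<bar>t - t0\<bar> \<le> \<delta>" if "t \<in> ?S" for t using that by auto
  have Yd: "(Y i has_vector_derivative \<A> i t (Y i t)) (at t within {a..b})" if "t \<in> {a..b}" "c \<in> charts_at A (\<gamma> i t)" for i t
    using seg.jacobi_pair_system[OF JZ that] by (simp add: Y_def[abs_def] \<A>_def)
  have lin: "linear (\<A> i t)" if "c \<in> charts_at A (\<gamma> i t)" for i t
    unfolding \<A>_def by (rule jacobi_coeff_linear_at[OF that])
  have "continuous_on ?S (Y l)"
    unfolding continuous_on_def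
  proof
    fix t assume t: "t \<in> ?S"
    have "(Y l \<longlongrightarrow> Y l t) (at t within {a..b})"
      using has_vector_derivative_continuous[OF Yd[OF S(1)[OF t] \<delta>(3)[OF S[OF t]]]] by (simp add: continuous_within)
    then show "(Y l \<longlongrightarrow> Y l t) (at t within ?S)" by (rule tendsto_within_subset) auto
  qed
  moreover have cS: "compact ?S" by (simp add: compact_Int_closed)
  ultimately have "bounded (Y l ` ?S)" using compact_continuous_image compact_imp_bounded by blast
  then obtain N where N: "N > 0" "\<forall>y\<in>Y l ` ?S. norm y \<le> N" unfolding bounded_pos by blast
  show ?thesis
  proof (intro exI[of _ \<delta>] conjI ballI impI allI \<delta>(1))
    fix s \<epsilon> :: real assume s: "s \<in> {a..b}" "\<bar>s - t0\<bar> \<le> \<delta>" and conv: "field_conv J s \<and> field_conv Z s" and \<epsilon>: "\<epsilon> > 0"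
    define M where "M = exp ((2 * (K + 1) + 1) * (2 * \<delta>))"
    have M: "M \<ge> 1" using \<delta> by (simp add: M_def)
    \<comment> \<open>bounds both the initial distance and the inhomogeneous term; each contributes \<open>\<epsilon>\<^sup>2 / 4\<close> to the square of the final distance\<close>
    define \<eta> where "\<eta> = \<epsilon> / sqrt (4 * M)"
    have \<eta>: "\<eta> > 0" "M * \<eta>\<^sup>2 = \<epsilon>\<^sup>2 / 4" using M \<epsilon> by (simp_all add: \<eta>_def power_divide)
    define \<zeta> where "\<zeta> = min 1 (\<eta> / N)"
    have \<zeta>: "\<zeta> > 0" "\<zeta> \<le> 1" "\<zeta> * N \<le> \<eta>" using \<eta> N by (auto simp: \<zeta>_def min_def field_simps)
    have cs: "c \<in> charts_at A (\<gamma> l s)" using \<delta>(3) s by blast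
    have J: "tvec_lim (\<lambda>i. \<gamma> i s) (\<lambda>i. J i s) (\<gamma> l s) (J l s) F" and Z: "tvec_lim (\<lambda>i. \<gamma> i s) (\<lambda>i. Z i s) (\<gamma> l s) (Z l s) F"
      using conv by (auto simp: field_conv_def)
    have "((\<lambda>i. Y i s) \<longlongrightarrow> Y l s) F"
      unfolding Y_def using tvec_limD(2)[OF J cs] tvec_limD(2)[OF Z cs] by (rule tendsto_Pair)
    note ev1 = tendstoD[OF this \<eta>(1)]
    have ev2: "\<forall>\<^sub>F i in F. \<forall>t\<in>?S. c \<in> charts_at A (\<gamma> i t) \<and> (\<forall>y. norm (\<A> i t y - \<A> l t y) \<le> \<zeta> * norm y)"
    proof (rule compact_eventually[OF cS, of "{a..b}"])
      fix t assume t: "t \<in> ?S"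
      note ct = \<delta>(3)[OF S[OF t]] and tI = S(1)[OF t]
      let ?N = "joint_nhds F {a..b} t"
      note V = velocity_joint_conv(1)[OF vconv tI, unfolded joint_conv_def]
      have c1: "\<forall>\<^sub>F x in ?N. c \<in> charts_at A (\<gamma> (fst x) (snd x))" by (rule chart_eventually[OF tvec_limD(1)[OF V] ct])
      have liml: "(\<gamma> l \<longlongrightarrow> \<gamma> l t) (at t within {a..b})" using seg.curve_continuous tI by (simp add: continuous_on_def)
      have c2: "\<forall>\<^sub>F x in ?N. c \<in> charts_at A (\<gamma> l (snd x))" by (rule chart_eventually[OF filterlim_joint_snd[OF liml] ct])
      have l1: "((\<lambda>x. \<A> (fst x) (snd x) y) \<longlongrightarrow> \<A> l t y) ?N" for y
        unfolding \<A>_def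
        by (rule jacobi_coeff_tendsto[OF cA coord_tendsto[OF tvec_limD(1)[OF V] ct] charts_atD(3)[OF ct] tvec_limD(2)[OF V ct] tendsto_const])
      have l2: "((\<lambda>x. \<A> l (snd x) y) \<longlongrightarrow> \<A> l t y) ?N" for y
        unfolding \<A>_def
        by (rule jacobi_coeff_tendsto[OF cA filterlim_joint_snd[OF seg.crd_tendsto(1)[OF tI ct]] charts_atD(3)[OF ct]
              filterlim_joint_snd[OF seg.crd_tendsto(2)[OF tI ct]] tendsto_const])
      have "\<forall>\<^sub>F x in ?N. \<forall>y. norm (\<A> (fst x) (snd x) y - \<A> l t y) \<le> \<zeta> / 2 * norm y"
        by (rule linear_tendsto_uniform[OF _ lin[OF ct] l1]) (use c1 lin \<zeta>(1) in \<open>auto elim: eventually_mono\<close>)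
      moreover have "\<forall>\<^sub>F x in ?N. \<forall>y. norm (\<A> l (snd x) y - \<A> l t y) \<le> \<zeta> / 2 * norm y"
        by (rule linear_tendsto_uniform[OF _ lin[OF ct] l2]) (use c2 lin \<zeta>(1) in \<open>auto elim: eventually_mono\<close>)
      ultimately show "\<forall>\<^sub>F x in ?N. c \<in> charts_at A (\<gamma> (fst x) (snd x)) \<and>
          (\<forall>y. norm (\<A> (fst x) (snd x) y - \<A> l (snd x) y) \<le> \<zeta> * norm y)"
        using c1
      proof eventually_elim
        case (elim x)
        have "norm (\<A> (fst x) (snd x) y - \<A> l (snd x) y) \<le> \<zeta> * norm y" for y
        proof -
          have "norm (\<A> (fst x) (snd x) y - \<A> l (snd x) y) \<le> norm (\<A> (fst x) (snd x) y - \<A> l t y) + norm (\<A> l (snd x) y - \<A> l t y)"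
            by norm
          then show ?thesis using elim(1)[rule_format, of y] elim(2)[rule_format, of y] by linarith
        qed
        then show ?case using elim(3) by blast
      qed
    qed auto
    from ev1 ev2 show "\<forall>\<^sub>F i in F. \<forall>t\<in>{s..b}. \<bar>t - t0\<bar> \<le> \<delta> \<longrightarrow> c \<in> charts_at A (\<gamma> i t) \<and>
      dist (J i t c, Z i t c) (J l t c, Z l t c) < \<epsilon>"
    proof eventually_elim
      case (elim i)
      show ?case
      proof (intro ballI impI)
        fix t assume t: "t \<in> {s..b}" "\<bar>t - t0\<bar> \<le> \<delta>"
        have sub: "{s..t} \<subseteq> ?S" using s t by auto
        let ?w = "\<lambda>t. Y i t - Y l t"
        have ts: "t \<in> {s..t}" using t by simp
        have "(norm (?w t))\<^sup>2 + \<eta>\<^sup>2 \<le> exp ((2 * (K + 1) + 1) * (t - s)) * ((norm (?w s))\<^sup>2 + \<eta>\<^sup>2)"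
        proof (rule gronwall[where u' = "\<lambda>t. \<A> i t (Y i t) - \<A> l t (Y l t)", OF _ _ _ ts])
          fix x assume "x \<in> {s..t}"
          then have x: "x \<in> ?S" using sub by blast
          then have ci: "c \<in> charts_at A (\<gamma> i x)" "\<And>y. norm (\<A> i x y - \<A> l x y) \<le> \<zeta> * norm y" using elim(2) by auto
          note cl = \<delta>(3)[OF S[OF x]]
          have sub': "{s..t} \<subseteq> {a..b}" using sub by auto
          show "(?w has_vector_derivative \<A> i x (Y i x) - \<A> l x (Y l x)) (at x within {s..t})"
            by (intro has_vector_derivative_diff has_vector_derivative_within_subset[OF Yd[OF S(1)[OF x] ci(1)] sub']
                has_vector_derivative_within_subset[OF Yd[OF S(1)[OF x] cl] sub'])
          \<comment> \<open>the last of the three parts does not involve the difference of the solutions and gives the inhomogeneous term\<close>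
          have "\<A> i x (Y i x) - \<A> l x (Y l x) = (\<A> i x (?w x) - \<A> l x (?w x)) + \<A> l x (?w x) + (\<A> i x (Y l x) - \<A> l x (Y l x))"
            using linear_diff[OF lin[OF ci(1)], of "Y i x" "Y l x"] by simp
          then have "norm (\<A> i x (Y i x) - \<A> l x (Y l x)) \<le>
            norm (\<A> i x (?w x) - \<A> l x (?w x)) + norm (\<A> l x (?w x)) + norm (\<A> i x (Y l x) - \<A> l x (Y l x))"
            by (metis add_mono norm_triangle_ineq norm_triangle_le order_refl)
          also have "\<dots> \<le> \<zeta> * norm (?w x) + K * norm (?w x) + \<zeta> * norm (Y l x)"
            using ci(2) bound[OF S[OF x]] by (intro add_mono) (auto simp: \<A>_def)
          also have "\<dots> \<le> 1 * norm (?w x) + K * norm (?w x) + \<eta>"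
          proof (intro add_mono mult_right_mono order_refl)
            have "\<zeta> * norm (Y l x) \<le> \<zeta> * N" using N(2) x \<zeta>(1) by (intro mult_left_mono) auto
            then show "\<zeta> * norm (Y l x) \<le> \<eta>" using \<zeta>(3) by simp
          qed (use \<zeta>(2) in auto)
          finally show "norm (\<A> i x (Y i x) - \<A> l x (Y l x)) \<le> (K + 1) * norm (?w x) + \<eta>" by (simp add: algebra_simps)
        qed (use \<delta>(2) in simp)
        also have "\<dots> \<le> M * ((norm (?w s))\<^sup>2 + \<eta>\<^sup>2)"
        proof (rule mult_right_mono)
          have "t - s \<le> 2 * \<delta>" using s t by linarith
          then have "(2 * (K + 1) + 1) * (t - s) \<le> (2 * (K + 1) + 1) * (2 * \<delta>)" using \<delta>(2) by (intro mult_left_mono) auto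
          then show "exp ((2 * (K + 1) + 1) * (t - s)) \<le> M" by (simp add: M_def)
        qed simp
        also have "\<dots> \<le> M * (\<eta>\<^sup>2 + \<eta>\<^sup>2)"
          using elim(1) M by (intro mult_left_mono add_right_mono) (auto simp: dist_norm intro!: power_mono)
        also have "\<dots> = \<epsilon>\<^sup>2 / 2" using \<eta>(2) by (simp add: algebra_simps)
        also have "\<dots> < \<epsilon>\<^sup>2" using \<epsilon> by simp
        finally have "(norm (?w t))\<^sup>2 < \<epsilon>\<^sup>2" using zero_le_power2[of \<eta>] by linarith
        then have "norm (?w t) < \<epsilon>" using \<epsilon> by (simp add: power2_less_imp_less)
        moreover have "t \<in> ?S" using sub ts by blast
        ultimately show "c \<in> charts_at A (\<gamma> i t) \<and> dist (J i t c, Z i t c) (J l t c, Z l t c) < \<epsilon>"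
          using elim(2) by (auto simp: Y_def dist_norm)
      qed
    qed
  qed
qed

lemma jacobi_joint_conv:
  assumes start: "field_conv J a" "field_conv Z a" and t: "t \<in> {a..b}"
  shows "joint_conv J t" "joint_conv Z t"
proof -
  define ch where "ch t = (SOME c. c \<in> charts_at A (\<gamma> l t))" for t
  have ch: "ch t \<in> charts_at A (\<gamma> l t)" for t unfolding ch_def using ex_chart by (rule someI_ex)
  define Y where "Y c i t = (J i t c, Z i t c)" for c i t
  note JZt = seg.jacobi_pairD(1,2)[OF JZ]
  have conv: "\<exists>\<delta>>0. \<forall>t\<in>{a..b}. \<bar>t - t0\<bar> \<le> \<delta> \<longrightarrow> (\<forall>\<^sub>F i in F. ch t0 \<in> charts_at A (\<gamma> i t)) \<longrightarrow>
      ((\<lambda>i. Y (ch t0) i t) \<longlongrightarrow> Y (ch t0) l t) F \<longrightarrow> field_conv J t \<and> field_conv Z t" if t0: "t0 \<in> {a..b}" for t0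
  proof -
    obtain \<delta> where \<delta>: "\<delta> > 0" "\<And>t. t \<in> {a..b} \<Longrightarrow> \<bar>t - t0\<bar> \<le> \<delta> \<Longrightarrow> ch t0 \<in> charts_at A (\<gamma> l t)"
      using seg.chart_neighbourhood[OF t0 ch] by blast
    show ?thesis
    proof (intro exI[of _ \<delta>] ballI impI conjI \<delta>(1))
      fix t assume t: "t \<in> {a..b}" "\<bar>t - t0\<bar> \<le> \<delta>" and lim: "((\<lambda>i. Y (ch t0) i t) \<longlongrightarrow> Y (ch t0) l t) F"
      note c = \<delta>(2)[OF t] and V = velocity_joint_conv(2)[OF vconv t(1), unfolded velocity_conv_def]
      show "field_conv J t" "field_conv Z t"
        unfolding field_conv_def
        by (rule tvec_limI[OF tvec_limD(1)[OF V] c];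
            use tendsto_fst[OF lim] tendsto_snd[OF lim] JZt[OF t(1)] in \<open>simp add: Y_def\<close>)+
    qed
  qed
  have cont: "(Y (ch t0) l \<longlongrightarrow> Y (ch t0) l t0) (at t0 within {a..b})" if t0: "t0 \<in> {a..b}" for t0
    using has_vector_derivative_continuous[OF seg.jacobi_pair_system[OF JZ t0 ch]] by (simp add: continuous_within Y_def[abs_def])
  have local: "\<exists>\<delta>>0. \<forall>s\<in>{a..b}. \<bar>s - t0\<bar> \<le> \<delta> \<longrightarrow> field_conv J s \<and> field_conv Z s \<longrightarrow>
    (\<forall>\<epsilon>>0. \<forall>\<^sub>F i in F. \<forall>t\<in>{s..b}. \<bar>t - t0\<bar> \<le> \<delta> \<longrightarrow> ch t0 \<in> charts_at A (\<gamma> i t) \<and>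
      dist (Y (ch t0) i t) (Y (ch t0) l t) < \<epsilon>)" if t0: "t0 \<in> {a..b}" for t0
    unfolding Y_def by (rule jacobi_local[OF t0 ch])
  have lim: "((\<lambda>x. Y (ch t) (fst x) (snd x)) \<longlongrightarrow> Y (ch t) l t) (joint_nhds F {a..b} t)"
    by (rule propagate_convergence(2)[where C = "\<lambda>t. field_conv J t \<and> field_conv Z t"
      and R = "\<lambda>t0 i t. ch t0 \<in> charts_at A (\<gamma> i t)" and y = "\<lambda>t0. Y (ch t0)", OF less_imp_le[OF ab] conjI[OF start] local conv cont t])
  note V = velocity_joint_conv(1)[OF vconv t, unfolded joint_conv_def]
  have ev: "\<forall>\<^sub>F x in joint_nhds F {a..b} t. J (fst x) (snd x) \<in> tangent_space A (\<gamma> (fst x) (snd x))"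
    "\<forall>\<^sub>F x in joint_nhds F {a..b} t. Z (fst x) (snd x) \<in> tangent_space A (\<gamma> (fst x) (snd x))"
    by (rule eventually_mono[OF eventually_joint_time], erule JZt)+
  show "joint_conv J t" "joint_conv Z t"
    unfolding joint_conv_def
    by (rule tvec_limI[OF tvec_limD(1)[OF V] ch]; use tendsto_fst[OF lim] tendsto_snd[OF lim] JZt[OF t] ev in \<open>simp add: Y_def\<close>)+
qed

end

end

section \<open>Stability of a count of crossings\<close>

lemma finite_positive_lower_bound:
  fixes T :: "real set"
  assumes "finite T" "\<And>x. x \<in> T \<Longrightarrow> x > 0" shows "\<exists>e>0. \<forall>x\<in>T. e < x"
proof (cases "T = {}")
  case False
  then have "Min T > 0" "\<forall>x\<in>T. Min T / 2 < x"
    using assms by (auto simp: Min_gr_iff) (smt (verit) Min_le assms(2) Min_in field_sum_of_halves)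
  then show ?thesis by (intro exI[of _ "Min T / 2"]) auto
qed (use zero_less_one in blast)

lemma eventually_joint_realD:
  fixes t :: real
  assumes "\<forall>\<^sub>F x in joint_nhds F S t. Q x"
  shows "\<exists>Pf d. eventually Pf F \<and> d > 0 \<and> (\<forall>i s. Pf i \<longrightarrow> s \<in> S \<longrightarrow> \<bar>s - t\<bar> < d \<longrightarrow> Q (i, s))"
  using eventually_joint_realE[OF assms] by metis

text \<open>\<open>\<kappa> i t\<close> is the multiplicity of the time \<open>t\<close> for the index \<open>i\<close>. The times of positive multiplicity of the
  limit are finitely many. Outside small intervals around them the multiplicities vanish for large indices, by
  compactness, and on these intervals the counts agree.\<close>
lemma stable_count:
  fixes \<kappa> :: "'i \<Rightarrow> real \<Rightarrow> nat" and a b :: real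
  defines "cnt \<equiv> \<lambda>i I. \<Sum>s | s \<in> I \<and> \<kappa> i s \<noteq> 0. \<kappa> i s"
  assumes ab: "a < b" and lF: "\<And>Q. eventually Q F \<Longrightarrow> Q l"
    and ini: "\<forall>\<^sub>F x in joint_nhds F {a..b} a. a < snd x \<longrightarrow> \<kappa> (fst x) (snd x) = 0"
    and reg: "\<And>t. t \<in> {a<..b} \<Longrightarrow> \<kappa> l t = 0 \<Longrightarrow> \<forall>\<^sub>F x in joint_nhds F {a..b} t. \<kappa> (fst x) (snd x) = 0"
    and cross: "\<And>t. t \<in> {a<..b} \<Longrightarrow> \<exists>\<eta>>0. \<forall>p q. a < p \<longrightarrow> p \<le> q \<longrightarrow> q \<le> b \<longrightarrow> \<bar>p - t\<bar> < \<eta> \<longrightarrow> \<bar>q - t\<bar> < \<eta> \<longrightarrow>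
      (\<forall>\<^sub>F i in F. finite {s \<in> {p..<q}. \<kappa> i s \<noteq> 0}) \<and>
      (\<kappa> l p = 0 \<longrightarrow> \<kappa> l q = 0 \<longrightarrow> (\<forall>\<^sub>F i in F. cnt i {p..<q} = cnt l {p..<q}))"
    and "end": "\<kappa> l b = 0"
  shows "\<forall>\<^sub>F i in F. \<kappa> i b = 0 \<and> finite {s \<in> {a<..b}. \<kappa> i s \<noteq> 0} \<and> cnt i {a<..b} = cnt l {a<..b}"
proof -
  define S where "S = {s \<in> {a<..b}. \<kappa> l s \<noteq> 0}"
  have Sab: "a < t" "t < b" if t: "t \<in> S" for t
  proof -
    have "t \<noteq> b" using t "end" by (cases "t = b") (simp_all add: S_def)
    then show "a < t" "t < b" using t by (simp_all add: S_def)
  qed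
  have free: "\<exists>d>0. \<forall>s\<in>{a..b}. \<bar>s - t\<bar> < d \<longrightarrow> s \<notin> S" if t: "t \<in> {a..b}" "t \<notin> S" for t
  proof -
    have "\<forall>\<^sub>F x in joint_nhds F {a..b} t. a < snd x \<longrightarrow> \<kappa> (fst x) (snd x) = 0"
    proof (cases "t = a")
      case False
      then have "\<forall>\<^sub>F x in joint_nhds F {a..b} t. \<kappa> (fst x) (snd x) = 0" using reg[of t] t by (simp add: S_def)
      then show ?thesis by (auto elim: eventually_mono)
    qed (use ini in simp)
    from eventually_joint_realD[OF this] obtain Pf d where d: "eventually Pf F" "d > 0"
      "\<forall>i s. Pf i \<longrightarrow> s \<in> {a..b} \<longrightarrow> \<bar>s - t\<bar> < d \<longrightarrow> a < snd (i, s) \<longrightarrow> \<kappa> (fst (i, s)) (snd (i, s)) = 0"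
      by (elim exE conjE) (rule that)
    have "s \<notin> S" if "s \<in> {a..b}" "\<bar>s - t\<bar> < d" for s
      using d(3)[rule_format, OF lF[OF d(1)] that] by (simp add: S_def)
    then show ?thesis using d(2) by blast
  qed
  have "\<exists>U. open U \<and> t \<in> U \<and> finite (U \<inter> S)" if t: "t \<in> {a..b}" for t
  proof (cases "t \<in> S")
    case False
    then obtain d where d: "d > 0" "\<And>s. s \<in> {a..b} \<Longrightarrow> \<bar>s - t\<bar> < d \<Longrightarrow> s \<notin> S" using free[OF t] by blast
    have "s \<notin> S" if "s \<in> ball t d" for s
    proof
      assume s: "s \<in> S"
      then have "s \<in> {a..b}" by (simp add: S_def)
      moreover have "\<bar>s - t\<bar> < d" using that by (simp add: dist_real_def abs_minus_commute)
      ultimately show False using d(2) s by blast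
    qed
    then have "ball t d \<inter> S = {}" by blast
    then show ?thesis using d(1) by (intro exI[of _ "ball t d"]) auto
  next
    case True
    note tab = Sab[OF True]
    from tab have "t \<in> {a<..b}" by simp
    from cross[OF this] obtain \<eta> where \<eta>0: "\<eta> > 0" and all: "\<forall>p q. a < p \<longrightarrow> p \<le> q \<longrightarrow> q \<le> b \<longrightarrow> \<bar>p - t\<bar> < \<eta> \<longrightarrow> \<bar>q - t\<bar> < \<eta> \<longrightarrow>
      (\<forall>\<^sub>F i in F. finite {s \<in> {p..<q}. \<kappa> i s \<noteq> 0}) \<and>
      (\<kappa> l p = 0 \<longrightarrow> \<kappa> l q = 0 \<longrightarrow> (\<forall>\<^sub>F i in F. cnt i {p..<q} = cnt l {p..<q}))"
      by (elim exE conjE) (rule that)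
    note \<eta> = \<eta>0 conjunct1[OF all[rule_format]]
    define p where "p = max ((a + t) / 2) (t - \<eta> / 2)"
    define q where "q = min b (t + \<eta> / 2)"
    have pq: "a < p" "p < t" "t < q" "q \<le> b" "\<bar>p - t\<bar> < \<eta>" "\<bar>q - t\<bar> < \<eta>"
      using tab \<eta>(1) by (simp_all add: p_def q_def abs_if less_max_iff_disj max_less_iff_conj min_less_iff_disj)
    have "finite {s \<in> {p..<q}. \<kappa> l s \<noteq> 0}" by (rule lF[OF \<eta>(2)]) (use pq in auto)
    moreover have "{p<..<q} \<inter> S \<subseteq> {s \<in> {p..<q}. \<kappa> l s \<noteq> 0}" by (auto simp: S_def)
    ultimately have "finite ({p<..<q} \<inter> S)" by (rule finite_subset[rotated])
    then show ?thesis using pq by (intro exI[of _ "{p<..<q}"]) auto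
  qed
  then obtain U where U: "\<And>t. t \<in> {a..b} \<Longrightarrow> open (U t) \<and> t \<in> U t \<and> finite (U t \<inter> S)" by metis
  obtain C where C: "C \<subseteq> {a..b}" "finite C" "{a..b} \<subseteq> (\<Union>t\<in>C. U t)"
  proof (rule compactE_image[of "{a..b}" "{a..b}" U])
    show "{a..b} \<subseteq> (\<Union>t\<in>{a..b}. U t)" using U by blast
  qed (use U in auto)
  have "S \<subseteq> (\<Union>t\<in>C. U t \<inter> S)" using C(3) by (auto simp: S_def)
  moreover have "finite (\<Union>t\<in>C. U t \<inter> S)" using C U by blast
  ultimately have finS: "finite S" by (rule finite_subset)
  have "\<forall>t\<in>S. \<exists>\<eta>>0. \<forall>p q. a < p \<longrightarrow> p \<le> q \<longrightarrow> q \<le> b \<longrightarrow> \<bar>p - t\<bar> < \<eta> \<longrightarrow> \<bar>q - t\<bar> < \<eta> \<longrightarrow>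
      (\<forall>\<^sub>F i in F. finite {s \<in> {p..<q}. \<kappa> i s \<noteq> 0}) \<and>
      (\<kappa> l p = 0 \<longrightarrow> \<kappa> l q = 0 \<longrightarrow> (\<forall>\<^sub>F i in F. cnt i {p..<q} = cnt l {p..<q}))"
  proof
    fix t assume "t \<in> S"
    then have "t \<in> {a<..b}" by (simp add: S_def)
    from cross[OF this] show "\<exists>\<eta>>0. \<forall>p q. a < p \<longrightarrow> p \<le> q \<longrightarrow> q \<le> b \<longrightarrow> \<bar>p - t\<bar> < \<eta> \<longrightarrow> \<bar>q - t\<bar> < \<eta> \<longrightarrow>
      (\<forall>\<^sub>F i in F. finite {s \<in> {p..<q}. \<kappa> i s \<noteq> 0}) \<and>
      (\<kappa> l p = 0 \<longrightarrow> \<kappa> l q = 0 \<longrightarrow> (\<forall>\<^sub>F i in F. cnt i {p..<q} = cnt l {p..<q}))" .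
  qed
  from bchoice[OF this] obtain \<eta> where \<eta>: "\<forall>t\<in>S. \<eta> t > 0 \<and> (\<forall>p q. a < p \<longrightarrow> p \<le> q \<longrightarrow> q \<le> b \<longrightarrow> \<bar>p - t\<bar> < \<eta> t \<longrightarrow> \<bar>q - t\<bar> < \<eta> t \<longrightarrow>
      (\<forall>\<^sub>F i in F. finite {s \<in> {p..<q}. \<kappa> i s \<noteq> 0}) \<and>
      (\<kappa> l p = 0 \<longrightarrow> \<kappa> l q = 0 \<longrightarrow> (\<forall>\<^sub>F i in F. cnt i {p..<q} = cnt l {p..<q})))"
    by (elim exE) (rule that)
  \<comment> \<open>a number below all elements of \<open>T\<close> is a radius for disjoint intervals inside \<open>{a<..<b}\<close> where \<open>cross\<close> applies\<close>
  define T where "T = \<eta> ` S \<union> (\<lambda>t. t - a) ` S \<union> (\<lambda>t. b - t) ` S \<union> (\<lambda>(t, t'). \<bar>t - t'\<bar> / 2) ` {z \<in> S \<times> S. fst z \<noteq> snd z}"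
  have finT: "finite T" unfolding T_def using finS by (intro finite_UnI finite_imageI) (auto intro: finite_subset[of _ "S \<times> S"])
  have posT: "x > 0" if "x \<in> T" for x using that \<eta> Sab by (auto simp: T_def)
  have "\<exists>e>0. \<forall>x\<in>T. e < x" by (rule finite_positive_lower_bound[OF finT posT])
  then obtain e where e0: "e > 0" and eT: "\<forall>x\<in>T. e < x" by (elim exE conjE) (rule that)
  note e = e0 bspec[OF eT]
  have e\<eta>: "e < \<eta> t" "a < t - e" "t + e < b" if "t \<in> S" for t
    using e(2)[of "\<eta> t"] e(2)[of "t - a"] e(2)[of "b - t"] that by (auto simp: T_def)
  have apart: "2 * e < \<bar>t - t'\<bar>" if "t \<in> S" "t' \<in> S" "t \<noteq> t'" for t t'
  proof -
    have "\<bar>t - t'\<bar> / 2 \<in> T" unfolding T_def using that by (intro UnI2 image_eqI[of _ _ "(t, t')"]) auto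
    then show ?thesis using e(2) by fastforce
  qed
  define K where "K = {a..b} - (\<Union>t\<in>S. {t - e<..<t + e})"
  have "compact K" unfolding K_def by (intro compact_diff compact_Icc open_UN ballI open_greaterThanLessThan)
  have evK: "\<forall>\<^sub>F i in F. \<forall>s\<in>K. a < s \<longrightarrow> \<kappa> i s = 0"
  proof (rule compact_eventually[OF \<open>compact K\<close>, of "{a..b}"])
    fix t assume t: "t \<in> K"
    have "t \<notin> S"
    proof
      assume "t \<in> S"
      then have "t \<in> (\<Union>t\<in>S. {t - e<..<t + e})" using e(1) by force
      then show False using t by (simp add: K_def)
    qed
    show "\<forall>\<^sub>F x in joint_nhds F {a..b} t. a < snd x \<longrightarrow> \<kappa> (fst x) (snd x) = 0"
    proof (cases "t = a")
      case False
      then have "\<forall>\<^sub>F x in joint_nhds F {a..b} t. \<kappa> (fst x) (snd x) = 0"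
        using reg[of t] t \<open>t \<notin> S\<close> by (simp add: S_def K_def)
      then show ?thesis by (auto elim: eventually_mono)
    qed (use ini in simp)
  qed (auto simp: K_def)
  have endK: "t - e \<in> K" "t + e \<in> K" if t: "t \<in> S" for t
  proof -
    have out: "x \<notin> (\<Union>t'\<in>S. {t' - e<..<t' + e})" if x: "x = t - e \<or> x = t + e" for x
    proof
      assume "x \<in> (\<Union>t'\<in>S. {t' - e<..<t' + e})"
      then obtain t' where t': "t' \<in> S" "x \<in> {t' - e<..<t' + e}" by (rule UN_E)
      show False using apart[OF t t'(1)] t'(2) x e(1) by (cases "t = t'") (auto simp: abs_if split: if_splits)
    qed
    show "t - e \<in> K" "t + e \<in> K" using e\<eta>[OF t] e(1) out by (auto simp only: K_def Diff_iff atLeastAtMost_iff)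
  qed
  have evS: "\<forall>\<^sub>F i in F. \<forall>t\<in>S. finite {s \<in> {t - e..<t + e}. \<kappa> i s \<noteq> 0} \<and> cnt i {t - e..<t + e} = cnt l {t - e..<t + e}"
  proof (rule eventually_ball_finite[OF finS], rule ballI)
    fix t assume t: "t \<in> S"
    have "\<kappa> l (t - e) = 0" "\<kappa> l (t + e) = 0" using lF[OF evK] endK[OF t] e\<eta>[OF t] e(1) Sab[OF t] by auto
    moreover have "a < t - e" "t - e \<le> t + e" "t + e \<le> b" "\<bar>t - e - t\<bar> < \<eta> t" "\<bar>t + e - t\<bar> < \<eta> t"
      using e\<eta>[OF t] e(1) by auto
    ultimately have "\<forall>\<^sub>F i in F. finite {s \<in> {t - e..<t + e}. \<kappa> i s \<noteq> 0}"
      "\<forall>\<^sub>F i in F. cnt i {t - e..<t + e} = cnt l {t - e..<t + e}"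
      using conjunct2[OF bspec[OF \<eta> t], rule_format, of "t - e" "t + e"] by simp_all
    then show "\<forall>\<^sub>F i in F. finite {s \<in> {t - e..<t + e}. \<kappa> i s \<noteq> 0} \<and> cnt i {t - e..<t + e} = cnt l {t - e..<t + e}"
      by eventually_elim blast
  qed
  have total: "finite {s \<in> {a<..b}. \<kappa> i s \<noteq> 0} \<and> cnt i {a<..b} = (\<Sum>t\<in>S. cnt i {t - e..<t + e})"
    if K: "\<forall>s\<in>K. a < s \<longrightarrow> \<kappa> i s = 0" and f: "\<forall>t\<in>S. finite {s \<in> {t - e..<t + e}. \<kappa> i s \<noteq> 0}" for i
  proof -
    have eq: "{s \<in> {a<..b}. \<kappa> i s \<noteq> 0} = (\<Union>t\<in>S. {s \<in> {t - e..<t + e}. \<kappa> i s \<noteq> 0})"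
    proof (intro equalityI subsetI)
      fix s assume s: "s \<in> {s \<in> {a<..b}. \<kappa> i s \<noteq> 0}"
      then have "s \<notin> K" using K by auto
      then obtain t where "t \<in> S" "s \<in> {t - e<..<t + e}" using s by (auto simp: K_def)
      then show "s \<in> (\<Union>t\<in>S. {s \<in> {t - e..<t + e}. \<kappa> i s \<noteq> 0})" using s by (intro UN_I[of t]) auto
    next
      fix s assume "s \<in> (\<Union>t\<in>S. {s \<in> {t - e..<t + e}. \<kappa> i s \<noteq> 0})"
      then obtain t where "t \<in> S" "s \<in> {t - e..<t + e}" "\<kappa> i s \<noteq> 0" by blast
      then show "s \<in> {s \<in> {a<..b}. \<kappa> i s \<noteq> 0}" using e\<eta>[of t] by auto
    qed
    have "{s \<in> {t - e..<t + e}. \<kappa> i s \<noteq> 0} \<inter> {s \<in> {t' - e..<t' + e}. \<kappa> i s \<noteq> 0} = {}" if "t \<in> S" "t' \<in> S" "t \<noteq> t'" for t t'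
      using apart[OF that] by auto
    then have "cnt i {a<..b} = (\<Sum>t\<in>S. cnt i {t - e..<t + e})"
      unfolding cnt_def eq using finS f by (intro sum.UNION_disjoint) auto
    moreover have "finite {s \<in> {a<..b}. \<kappa> i s \<noteq> 0}" unfolding eq using finS f by blast
    ultimately show ?thesis by blast
  qed
  have bK: "b \<in> K" using ab e\<eta>(3) by (force simp: K_def)
  from evK evS show ?thesis
  proof eventually_elim
    case (elim i)
    have fin: "finite {s \<in> {a<..b}. \<kappa> i s \<noteq> 0}" using total[OF elim(1)] elim(2) by auto
    have "cnt i {a<..b} = (\<Sum>t\<in>S. cnt i {t - e..<t + e})" using total[OF elim(1)] elim(2) by auto
    also have "\<dots> = (\<Sum>t\<in>S. cnt l {t - e..<t + e})" using elim(2) by (intro sum.cong) auto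
    also have "\<dots> = cnt l {a<..b}" using total[OF lF[OF evK]] lF[OF evS] by auto
    finally show ?case using elim(1) bK ab fin by simp
  qed
qed

lemma orthogonal_projection_exists:
  fixes W :: "'e::euclidean_space set"
  assumes W: "subspace W"
  shows "\<exists>P. linear P \<and> (\<forall>x. P x \<in> W) \<and> (\<forall>x\<in>W. P x = x) \<and> (\<forall>x y. P x \<bullet> y = x \<bullet> P y)"
proof -
  obtain E where E: "E \<subseteq> W" "pairwise orthogonal E" "\<And>x. x \<in> E \<Longrightarrow> norm x = 1" "independent E" "card E = dim W" "span E = W"
    using orthonormal_basis_subspace[OF W] by metis
  have fin: "finite E" using E(4) by (rule independent_imp_finite)
  have on: "b \<bullet> b' = (if b = b' then 1 else 0)" if "b \<in> E" "b' \<in> E" for b b'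
    using E(2,3) that by (auto simp: pairwise_def orthogonal_def norm_eq_1)
  define P where "P x = (\<Sum>b\<in>E. (x \<bullet> b) *\<^sub>R b)" for x
  have lin: "linear P"
    unfolding P_def by (intro linearI) (simp_all add: inner_add_left scaleR_add_left sum.distrib scaleR_sum_right)
  have "P b = b" if "b \<in> E" for b
  proof -
    have "P b = (\<Sum>b'\<in>E. if b' = b then b' else 0)" unfolding P_def by (intro sum.cong refl) (simp add: on that)
    then show ?thesis using fin that by simp
  qed
  moreover have "subspace {x. P x = x}" by (auto simp: subspace_def linear_0[OF lin] linear_add[OF lin] linear_scale[OF lin])
  ultimately have "span E \<subseteq> {x. P x = x}" by (intro span_minimal) auto
  moreover have "P x \<in> W" for x unfolding P_def using E(1) W by (auto intro!: subspace_sum subspace_scale)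
  moreover have "P x \<bullet> y = x \<bullet> P y" for x y
    by (simp add: P_def inner_sum_left inner_sum_right inner_commute mult.commute)
  ultimately show ?thesis using lin E(6) by blast
qed


section \<open>Initial data of the Jacobi fields along a converging family\<close>

text \<open>The vectors \<open>e i n\<close> form the bases in the definition of convergence of subspaces with forms. The limit index
  belongs to every set that contains eventually all indices, so a property that holds eventually holds for it.\<close>
locale orthogonal_family = geodesic_family A g a b \<gamma> F l
  for A :: "('m::t2_space, 'e::euclidean_space) chart set" and g a b
    and \<gamma> :: "'i \<Rightarrow> real \<Rightarrow> 'm" and F :: "'i filter" and l :: 'i +
  fixes P :: "'i \<Rightarrow> 'm set" and k :: nat and c :: "('m, 'e) chart" and e :: "'i \<Rightarrow> nat \<Rightarrow> ('m, 'e) tvec"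
  assumes orth: "\<And>i. orthogonal_geodesic A g a b (\<gamma> i) (P i) k"
    and lF: "\<And>Q. eventually Q F \<Longrightarrow> Q l"
    and vconv: "velocity_conv a"
    and c: "c \<in> charts_at A (\<gamma> l a)"
    and basis: "\<forall>\<^sub>F i in F. is_basis k (e i) (sub_tangent A (P i) (\<gamma> i a))"
    and basis_lim: "\<And>n. n < k \<Longrightarrow> ((\<lambda>i. e i n c) \<longlongrightarrow> e l n c) F"
    and sff_lim: "\<And>m n. m < k \<Longrightarrow> n < k \<Longrightarrow>
      ((\<lambda>i. second_fundamental_form A g (P i) (\<gamma> i a) (V i a) (e i m) (e i n)) \<longlongrightarrow>
        second_fundamental_form A g (P l) (\<gamma> l a) (V l a) (e l m) (e l n)) F"
begin

sublocale og: orthogonal_geodesic A g a b "\<gamma> i" "P i" k for i by (rule orth)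

lemma aI: "a \<in> {a..b}" using ab by simp

abbreviation "cv i u \<equiv> coord_vector A c u (\<gamma> i a)"

text \<open>The coordinates with respect to the basis \<open>e l\<close>, extended linearly from \<open>W\<close> to the model space.\<close>
definition dual :: "nat \<Rightarrow> 'e \<Rightarrow> real" where
  "dual n = (SOME f. linear f \<and> (\<forall>m<k. f (e l m c) = (if m = n then 1 else 0)))"

text \<open>The tangent space of the limit submanifold in the chart \<open>c\<close>.\<close>
definition W :: "'e set" where "W = span ((\<lambda>n. e l n c) ` {..<k})"

definition proj :: "'e \<Rightarrow> 'e" where
  "proj = (SOME P. linear P \<and> (\<forall>x. P x \<in> W) \<and> (\<forall>x\<in>W. P x = x) \<and> (\<forall>x y. P x \<bullet> y = x \<bullet> P y))"

text \<open>A linear map close to the identity which maps the tangent space of the limit submanifold, in coordinates,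
  to the tangent space of the submanifold with index \<open>i\<close>.\<close>
definition frame_map :: "'i \<Rightarrow> 'e \<Rightarrow> 'e" where
  "frame_map i q = q + (\<Sum>n<k. dual n q *\<^sub>R (e i n c - e l n c))"

text \<open>The second fundamental form of the submanifold with index \<open>i\<close>, pulled back by \<open>frame_map i\<close>.\<close>
definition frame_sff :: "'i \<Rightarrow> 'e \<Rightarrow> 'e \<Rightarrow> real" where
  "frame_sff i p q = (\<Sum>m<k. \<Sum>n<k. dual m p * dual n q * og.sff i (e i m) (e i n))"

text \<open>The inner product of this vector with \<open>q\<close> is the metric pairing of \<open>w\<close> with \<open>frame_map i q\<close>.\<close>
definition frame_pairing :: "'i \<Rightarrow> 'e \<Rightarrow> 'e" where
  "frame_pairing i w = (\<Sum>b\<in>Basis. metr c (snd c (\<gamma> i a)) w (frame_map i b) *\<^sub>R b)"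

text \<open>The inner product of this vector with \<open>q\<close> is the value prescribed for the pairing with \<open>frame_map i q\<close>: minus the
  second fundamental form for \<open>q \<in> W\<close>, and a free parameter for \<open>q\<close> orthogonal to \<open>W\<close>.\<close>
definition pairing_rhs :: "'i \<Rightarrow> 'e \<Rightarrow> 'e" where
  "pairing_rhs i x = (x - proj x) - (\<Sum>b\<in>Basis. frame_sff i (proj x) (proj b) *\<^sub>R b)"

definition good :: "'i \<Rightarrow> bool" where
  "good i \<longleftrightarrow> c \<in> charts_at A (\<gamma> i a) \<and> is_basis k (e i) (og.TP i) \<and> inj (frame_pairing i)"

text \<open>The pair of \<open>initJ i x\<close> and \<open>initZ i x\<close> runs over the admissible initial data when \<open>x\<close> runs over the
  model space: \<open>proj x\<close> gives the initial value, and the derivative is determined by its pairings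
  with the vectors \<open>frame_map i q\<close>, which are prescribed by the second fundamental form for \<open>q \<in> W\<close> and free on the
  orthogonal complement of \<open>W\<close>.\<close>
definition initJ :: "'i \<Rightarrow> 'e \<Rightarrow> 'e" where "initJ i x = frame_map i (proj x)"

definition initZ :: "'i \<Rightarrow> 'e \<Rightarrow> 'e" where "initZ i x = inv (frame_pairing i) (pairing_rhs i x)"

lemma basis_l: "is_basis k (e l) (og.TP l)" by (rule lF[OF basis])

lemma basisD:
  assumes "is_basis k (e i) (og.TP i)" "n < k"
  shows "e i n \<in> og.TP i" "e i n \<in> tangent_space A (\<gamma> i a)"
proof -
  show "e i n \<in> og.TP i" using assms span_base[of "e i n" "e i ` {..<k}"] by (auto simp: is_basis_def)
  then show "e i n \<in> tangent_space A (\<gamma> i a)" by (rule og.TP_tangent)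
qed

lemma cv_e: "c \<in> charts_at A (\<gamma> i a) \<Longrightarrow> is_basis k (e i) (og.TP i) \<Longrightarrow> n < k \<Longrightarrow> cv i (e i n c) = e i n"
  by (rule coord_vector_of_tangent[OF A _ basisD(2)])

lemma dual: "linear (dual n)" "m < k \<Longrightarrow> dual n (e l m c) = (if m = n then 1 else 0)"
proof -
  let ?f = "\<lambda>n. e l n c" and ?ev = "\<lambda>v :: ('m, 'e) tvec. v c"
  have lin: "linear ?ev" by (intro linearI) (simp_all add: scaleR_fun_def)
  have B: "inj_on (e l) {..<k}" "independent (e l ` {..<k})" "span (e l ` {..<k}) = og.TP l"
    using basis_l by (auto simp: is_basis_def)
  have inj: "inj_on ?ev (span (e l ` {..<k}))"
    unfolding B(3) using tangent_eqI[OF c] og.TP_tangent by (intro inj_onI) blast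
  have ind: "independent (?ev ` e l ` {..<k})" by (rule linear_independent_injective_image[OF lin B(2) inj])
  have injf: "inj_on ?f {..<k}"
  proof (rule inj_onI)
    fix m n assume mn: "m \<in> {..<k}" "n \<in> {..<k}" "?f m = ?f n"
    then have "e l m = e l n" using inj_onD[OF inj, of "e l m" "e l n"] by (auto intro: span_base)
    then show "m = n" using inj_onD[OF B(1)] mn by blast
  qed
  obtain f where f: "linear f" "\<forall>x\<in>?ev ` e l ` {..<k}. f x = (if x = ?f n \<and> n < k then 1 else (0::real))"
    using linear_independent_extend[OF ind, of "\<lambda>x. if x = ?f n \<and> n < k then 1 else (0::real)"] by blast
  have "f (e l m c) = (if m = n then 1 else 0)" if "m < k" for m
    using f(2) that inj_onD[OF injf, of m n] by auto
  then have "\<exists>f. linear f \<and> (\<forall>m<k. f (e l m c) = (if m = n then 1 else (0::real)))" using f(1) by blast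
  from someI_ex[OF this] show "linear (dual n)" "m < k \<Longrightarrow> dual n (e l m c) = (if m = n then 1 else 0)"
    unfolding dual_def[symmetric] by blast+
qed

lemma proj: "linear proj" "proj x \<in> W" "x \<in> W \<Longrightarrow> proj x = x" "proj x \<bullet> y = x \<bullet> proj y"
proof -
  have "subspace W" by (simp add: W_def)
  from someI_ex[OF orthogonal_projection_exists[OF this]]
  show "linear proj" "proj x \<in> W" "x \<in> W \<Longrightarrow> proj x = x" "proj x \<bullet> y = x \<bullet> proj y"
    unfolding proj_def[symmetric] by blast+
qed

lemma W_expand:
  assumes "w \<in> W" shows "w = (\<Sum>n<k. dual n w *\<^sub>R e l n c)"
proof -
  let ?h = "\<lambda>w. (\<Sum>n<k. dual n w *\<^sub>R e l n c)"
  have lin: "linear ?h" by (intro linear_compose_sum ballI linear_compose[OF dual(1) linear_scaleR_left, unfolded comp_def])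
  have "?h (e l m c) = e l m c" if "m < k" for m
  proof -
    have "?h (e l m c) = (\<Sum>n<k. if n = m then e l n c else 0)" by (intro sum.cong refl) (simp add: dual(2)[OF that])
    then show ?thesis using that by simp
  qed
  moreover have "subspace {w. w = ?h w}"
    using linear_0[OF lin] linear_add[OF lin] linear_scale[OF lin] by (auto simp: subspace_def)
  ultimately have "W \<subseteq> {w. w = ?h w}" unfolding W_def by (intro span_minimal) auto
  then show ?thesis using assms by blast
qed

lemma frame_map_linear: "linear (frame_map i)"
  unfolding frame_map_def
  by (intro linear_compose_add linear_compose_sum ballI linear_compose[OF dual(1) linear_scaleR_left, unfolded comp_def])
    (simp add: linear_id[unfolded id_def])

lemma frame_map_l: "frame_map l q = q" by (simp add: frame_map_def)

lemma frame_map_W: "w \<in> W \<Longrightarrow> frame_map i w = (\<Sum>n<k. dual n w *\<^sub>R e i n c)"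
  unfolding frame_map_def using W_expand[of w] by (simp add: scaleR_diff_right sum_subtractf)

lemma frame_map_tendsto: "((\<lambda>i. frame_map i q) \<longlongrightarrow> frame_map l q) F"
  unfolding frame_map_def by (intro tendsto_intros basis_lim) auto

lemma frame_sff_tendsto: "((\<lambda>i. frame_sff i p q) \<longlongrightarrow> frame_sff l p q) F"
  unfolding frame_sff_def by (intro tendsto_intros sff_lim) auto

lemma frame_sff_linear: "linear (\<lambda>p. frame_sff i p q)" "linear (frame_sff i p)"
  by (intro linearI; simp add: frame_sff_def linear_add[OF dual(1)] linear_scale[OF dual(1)] algebra_simps sum.distrib sum_distrib_left)+

lemma sff_sum:
  assumes "finite I" "\<And>n. n \<in> I \<Longrightarrow> u n \<in> og.TP i" "v \<in> og.TP i"
  shows "og.sff i (\<Sum>n\<in>I. r n *\<^sub>R u n) v = (\<Sum>n\<in>I. r n * og.sff i (u n) v)"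
  using assms
proof (induction I rule: finite_induct)
  case empty
  then show ?case using og.sff_linear(2)[of v i v v 0] by (simp add: zero_fun_def)
next
  case (insert x I)
  have "(\<Sum>n\<in>I. r n *\<^sub>R u n) \<in> og.TP i" "r x *\<^sub>R u x \<in> og.TP i"
    using og.TP_subspace insert by (auto intro!: subspace_sum subspace_scale)
  then show ?case using insert og.sff_linear(1)[of "r x *\<^sub>R u x" i "\<Sum>n\<in>I. r n *\<^sub>R u n" v] og.sff_linear(2)[of "u x" i v v "r x"] by (simp add: plus_fun_def)
qed

context
  fixes i assumes ci: "c \<in> charts_at A (\<gamma> i a)" and bi: "is_basis k (e i) (og.TP i)"
begin

lemma cv_linear: "linear (\<lambda>u. cv i u)" by (rule tangent_coords(1)[OF ci])

lemma cv_at: "cv i u c = u" by (rule coord_vector_self[OF A ci])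

lemma cv_frame_map: "w \<in> W \<Longrightarrow> cv i (frame_map i w) = (\<Sum>n<k. dual n w *\<^sub>R e i n)"
  unfolding frame_map_W linear_sum[OF cv_linear] linear_scale[OF cv_linear] by (intro sum.cong refl) (simp add: cv_e[OF ci bi])

lemma cv_frame_map_TP: "w \<in> W \<Longrightarrow> cv i (frame_map i w) \<in> og.TP i"
  unfolding cv_frame_map using og.TP_subspace basisD(1)[OF bi] by (auto intro!: subspace_sum subspace_scale)

lemma TP_frame_map:
  assumes "u \<in> og.TP i" shows "\<exists>w\<in>W. u = cv i (frame_map i w)"
proof -
  have lin: "linear (\<lambda>w. cv i (frame_map i w))" using linear_compose[OF frame_map_linear cv_linear] by (simp add: comp_def)
  have sub: "subspace ((\<lambda>w. cv i (frame_map i w)) ` W)" by (rule linear_subspace_image[OF lin]) (simp add: W_def)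
  have "e i n \<in> (\<lambda>w. cv i (frame_map i w)) ` W" if n: "n < k" for n
  proof (rule image_eqI)
    show w: "e l n c \<in> W" using n by (auto simp: W_def intro: span_base)
    have "cv i (frame_map i (e l n c)) = (\<Sum>m<k. if m = n then e i m else 0)"
      unfolding cv_frame_map[OF w] by (intro sum.cong refl) (simp add: dual(2)[OF n])
    then show "e i n = cv i (frame_map i (e l n c))" using n by simp
  qed
  then have "span (e i ` {..<k}) \<subseteq> (\<lambda>w. cv i (frame_map i w)) ` W" by (intro span_minimal sub) auto
  then show ?thesis using assms bi by (auto simp: is_basis_def)
qed

lemma sff_frame_sff:
  assumes "p \<in> W" "q \<in> W" shows "og.sff i (cv i (frame_map i p)) (cv i (frame_map i q)) = frame_sff i p q"
proof -
  have e: "e i n \<in> og.TP i" if "n \<in> {..<k}" for n using basisD(1)[OF bi] that by simp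
  have 1: "og.sff i (e i m) (\<Sum>n<k. dual n q *\<^sub>R e i n) = (\<Sum>n<k. dual n q * og.sff i (e i m) (e i n))" if m: "m \<in> {..<k}" for m
  proof -
    have "og.sff i (e i m) (\<Sum>n<k. dual n q *\<^sub>R e i n) = og.sff i (\<Sum>n<k. dual n q *\<^sub>R e i n) (e i m)"
      using cv_frame_map_TP[OF assms(2)] unfolding cv_frame_map[OF assms(2)] by (intro og.sff_linear(3)[OF e[OF m] e[OF m]])
    also have "\<dots> = (\<Sum>n<k. dual n q * og.sff i (e i n) (e i m))" by (rule sff_sum[OF finite_lessThan e e[OF m]])
    also have "\<dots> = (\<Sum>n<k. dual n q * og.sff i (e i m) (e i n))"
      using og.sff_linear(3)[OF e e[OF m]] e e[OF m] by (intro sum.cong refl) (metis og.sff_linear(3))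
    finally show ?thesis .
  qed
  have 2: "og.sff i (\<Sum>m<k. dual m p *\<^sub>R e i m) (cv i (frame_map i q)) = (\<Sum>m<k. dual m p * og.sff i (e i m) (cv i (frame_map i q)))"
    by (rule sff_sum[OF finite_lessThan e cv_frame_map_TP[OF assms(2)]])
  show ?thesis
    unfolding cv_frame_map[OF assms(1)] 2 unfolding cv_frame_map[OF assms(2)] frame_sff_def
    by (intro sum.cong refl) (simp add: 1 sum_distrib_left mult.assoc)
qed

lemma frame_pairing_linear: "linear (frame_pairing i)"
  by (intro linearI) (simp_all add: frame_pairing_def scaleR_add_left sum.distrib scaleR_sum_right
    sym_formD(3,5)[OF metr_sym_form[OF charts_atD(1)[OF ci] charts_atD(3)[OF ci]]])

lemma frame_pairing_inner: "frame_pairing i w \<bullet> q = metr c (snd c (\<gamma> i a)) w (frame_map i q)"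
proof -
  have "linear (metr c (snd c (\<gamma> i a)) w)"
    using metr_sym_form[OF charts_atD(1)[OF ci] charts_atD(3)[OF ci]] by (simp add: sym_form_def bilinear_def)
  from linear_basis_sum[OF linear_compose[OF frame_map_linear[of i] this], of q] show ?thesis
    by (simp add: frame_pairing_def inner_sum_left inner_commute[of q] mult.commute comp_def)
qed

end

lemma frame_pairing_tendsto: "((\<lambda>i. frame_pairing i w) \<longlongrightarrow> frame_pairing l w) F"
  unfolding frame_pairing_def
  by (intro tendsto_intros metr_tendsto[OF charts_atD(1)[OF c] coord_tendsto[OF tvec_limD(1)[OF vconv[unfolded velocity_conv_def]] c]
    charts_atD(3)[OF c] tendsto_const frame_map_tendsto])

lemma good_eventually: "\<forall>\<^sub>F i in F. good i"
proof -
  have ev: "\<forall>\<^sub>F i in F. c \<in> charts_at A (\<gamma> i a)"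
    by (rule chart_eventually[OF tvec_limD(1)[OF vconv[unfolded velocity_conv_def]] c])
  have "\<exists>m>0. \<forall>\<^sub>F i in F. \<forall>x. m * norm x \<le> norm (frame_pairing i x)"
  proof (rule linear_injective_eventually)
    show "\<forall>\<^sub>F i in F. linear (frame_pairing i)" using ev basis by eventually_elim (rule frame_pairing_linear)
    show "linear (frame_pairing l)" by (rule frame_pairing_linear[OF c basis_l])
    show "((\<lambda>i. frame_pairing i w) \<longlongrightarrow> frame_pairing l w) F" for w by (rule frame_pairing_tendsto)
    show "x = 0" if "frame_pairing l x = 0" for x
      using metr_nondegenerate[OF charts_atD(1)[OF c] charts_atD(3)[OF c], of x] frame_pairing_inner[OF c basis_l, of x] that by (simp add: frame_map_l)
  qed
  then obtain m where "m > 0" "\<forall>\<^sub>F i in F. \<forall>x. m * norm x \<le> norm (frame_pairing i x)" by blast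
  from this(2) ev basis show ?thesis
  proof eventually_elim
    case (elim i)
    have "x = 0" if "frame_pairing i x = 0" for x using elim(1)[rule_format, of x] that \<open>m > 0\<close> by (simp add: mult_le_0_iff)
    then have "inj (frame_pairing i)" using linear_injective_0[OF frame_pairing_linear[OF elim(2,3)]] by blast
    then show ?case using elim by (simp add: good_def)
  qed
qed

lemma good_l: "good l" by (rule lF[OF good_eventually])

lemma goodD: "good i \<Longrightarrow> c \<in> charts_at A (\<gamma> i a)" "good i \<Longrightarrow> is_basis k (e i) (og.TP i)" "good i \<Longrightarrow> inj (frame_pairing i)"
  by (simp_all add: good_def)

lemma proj_inner: "(x - proj x) \<bullet> q = x \<bullet> (q - proj q)"
  using proj(4)[of x q] by (simp add: inner_diff_left inner_diff_right)

lemma proj_compl: "proj (x - proj x) = 0"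
  using proj(2)[of x] by (simp add: linear_diff[OF proj(1)] proj(3))

lemma pairing_rhs_linear: "linear (pairing_rhs i)"
  by (intro linearI) (simp_all add: pairing_rhs_def linear_add[OF proj(1)] linear_scale[OF proj(1)] linear_add[OF frame_sff_linear(1)]
    linear_scale[OF frame_sff_linear(1)] scaleR_add_left sum.distrib scaleR_sum_right scaleR_diff_right)

lemma pairing_rhs_inner: "pairing_rhs i x \<bullet> q = (x - proj x) \<bullet> q - frame_sff i (proj x) (proj q)"
proof -
  have "linear (\<lambda>q. frame_sff i (proj x) (proj q))" using linear_compose[OF proj(1) frame_sff_linear(2)] by (simp add: comp_def)
  from linear_basis_sum[OF this, of q] show ?thesis
    by (simp add: pairing_rhs_def inner_diff_left inner_sum_left inner_commute[of q] mult.commute)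
qed

context
  fixes i assumes gi: "good i"
begin

lemma frame_pairing_surj: "surj (frame_pairing i)"
  using linear_injective_imp_surjective[OF frame_pairing_linear[OF goodD(1,2)[OF gi]] goodD(3)[OF gi]] by simp

lemma frame_pairing_initZ: "frame_pairing i (initZ i x) = pairing_rhs i x"
  unfolding initZ_def by (rule surj_f_inv_f[OF frame_pairing_surj])

lemma initZ_metric: "metr c (snd c (\<gamma> i a)) (initZ i x) (frame_map i q) = (x - proj x) \<bullet> q - frame_sff i (proj x) (proj q)"
  using frame_pairing_inner[OF goodD(1,2)[OF gi], of "initZ i x" q] frame_pairing_initZ pairing_rhs_inner by simp

lemma init_linear: "initJ i (x + r *\<^sub>R y) = initJ i x + r *\<^sub>R initJ i y" "initZ i (x + r *\<^sub>R y) = initZ i x + r *\<^sub>R initZ i y"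
proof -
  note G = frame_pairing_linear[OF goodD(1,2)[OF gi]]
  show "initJ i (x + r *\<^sub>R y) = initJ i x + r *\<^sub>R initJ i y"
    by (simp add: initJ_def linear_add[OF proj(1)] linear_scale[OF proj(1)] linear_add[OF frame_map_linear] linear_scale[OF frame_map_linear])
  have "frame_pairing i (initZ i (x + r *\<^sub>R y)) = frame_pairing i (initZ i x + r *\<^sub>R initZ i y)"
    by (simp add: frame_pairing_initZ linear_add[OF G] linear_scale[OF G] linear_add[OF pairing_rhs_linear] linear_scale[OF pairing_rhs_linear])
  then show "initZ i (x + r *\<^sub>R y) = initZ i x + r *\<^sub>R initZ i y" using goodD(3)[OF gi] by (simp add: inj_eq)
qed

lemma metric_cv: "g (\<gamma> i a) (cv i u) (cv i v) = metr c (snd c (\<gamma> i a)) u v"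
  using metric_value[OF goodD(1)[OF gi] coord_vector_tangent[OF A goodD(1)[OF gi]] coord_vector_tangent[OF A goodD(1)[OF gi]]]
    cv_at[OF goodD(1,2)[OF gi]] by simp

lemma init_admissible: "og.admissible i (cv i (initJ i x)) (cv i (initZ i x))"
  unfolding og.admissible_def
proof (intro conjI ballI)
  note ci = goodD(1,2)[OF gi]
  show "cv i (initJ i x) \<in> og.TP i" unfolding initJ_def by (rule cv_frame_map_TP[OF ci proj(2)])
  show "cv i (initZ i x) \<in> tangent_space A (\<gamma> i a)" by (rule coord_vector_tangent[OF A ci(1)])
  fix w assume "w \<in> og.TP i"
  then obtain q where q: "q \<in> W" "w = cv i (frame_map i q)" using TP_frame_map[OF ci] by blast
  have "g (\<gamma> i a) (cv i (initZ i x)) w = - frame_sff i (proj x) q"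
    unfolding q(2) metric_cv initZ_metric proj_inner using proj(3)[OF q(1)] by simp
  moreover have "og.sff i (cv i (initJ i x)) w = frame_sff i (proj x) q"
    unfolding q(2) initJ_def by (rule sff_frame_sff[OF ci proj(2) q(1)])
  ultimately show "g (\<gamma> i a) (cv i (initZ i x)) w + og.sff i (cv i (initJ i x)) w = 0" by simp
qed

text \<open>What the second fundamental form does not prescribe of the pairings with a derivative \<open>z\<close> is a functional that
  vanishes on \<open>W\<close>. The vector \<open>r\<close> orthogonal to \<open>W\<close> that represents it is the second part of the parameter.\<close>
lemma admissible_init:
  assumes "og.admissible i u z" shows "\<exists>x. u = cv i (initJ i x) \<and> z = cv i (initZ i x)"
proof -
  note ci = goodD(1,2)[OF gi]
  let ?m = "metr c (snd c (\<gamma> i a))"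
  have u: "u \<in> og.TP i" and z: "z \<in> tangent_space A (\<gamma> i a)" and uz: "\<And>w. w \<in> og.TP i \<Longrightarrow> g (\<gamma> i a) z w + og.sff i u w = 0"
    using assms by (auto simp: og.admissible_def)
  obtain p where p: "p \<in> W" "u = cv i (frame_map i p)" using TP_frame_map[OF ci u] by blast
  have zc: "cv i (z c) = z" by (rule coord_vector_of_tangent[OF A ci(1) z])
  define f where "f q = ?m (z c) (frame_map i q) + frame_sff i p (proj q)" for q
  have lf: "linear f"
  proof -
    have "linear (?m (z c))" using metr_sym_form[OF charts_atD(1)[OF ci(1)] charts_atD(3)[OF ci(1)]] by (simp add: sym_form_def bilinear_def)
    then show ?thesis
      unfolding f_def using linear_compose_add[OF linear_compose[OF frame_map_linear] linear_compose[OF proj(1) frame_sff_linear(2)], of "?m (z c)" i i p]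
      by (simp add: comp_def)
  qed
  have f0: "f q = 0" if q: "q \<in> W" for q
    using uz[OF cv_frame_map_TP[OF ci q]] sff_frame_sff[OF ci p(1) q] metric_cv[of "z c" "frame_map i q"] zc p(2) proj(3)[OF q] by (simp add: f_def)
  define r where "r = (\<Sum>b\<in>Basis. f b *\<^sub>R b)"
  have r: "r \<bullet> q = f q" for q
    using linear_basis_sum[OF lf, of q] by (simp add: r_def inner_sum_left inner_commute[of q] mult.commute)
  have "proj r \<bullet> proj r = f (proj (proj r))" using proj(4)[of r "proj r"] r by simp
  also have "\<dots> = 0" using f0 proj(2) by blast
  finally have pr: "proj r = 0" by simp
  have px: "proj (p + r) = p" by (simp add: linear_add[OF proj(1)] proj(3)[OF p(1)] pr)
  have "frame_pairing i (z c) = pairing_rhs i (p + r)"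
  proof (rule vector_eq_ldot[THEN iffD1], rule allI)
    fix q
    have "frame_pairing i (z c) \<bullet> q = f q - frame_sff i p (proj q)" unfolding frame_pairing_inner[OF ci] by (simp add: f_def)
    also have "\<dots> = pairing_rhs i (p + r) \<bullet> q" unfolding pairing_rhs_inner px using r by simp
    finally show "q \<bullet> frame_pairing i (z c) = q \<bullet> pairing_rhs i (p + r)" by (simp add: inner_commute)
  qed
  then have "frame_pairing i (z c) = frame_pairing i (initZ i (p + r))" by (simp add: frame_pairing_initZ)
  then have "z c = initZ i (p + r)" using goodD(3)[OF gi] by (simp add: inj_eq)
  then have "u = cv i (initJ i (p + r)) \<and> z = cv i (initZ i (p + r))" using zc p(2) px by (simp add: initJ_def)
  then show ?thesis by blast
qed

lemma init_injective:
  assumes "initJ i x = 0" "initZ i x = 0" shows "x = 0"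
proof -
  note ci = goodD(1,2)[OF gi]
  have frame_map_inj: "q = 0" if "frame_map i q = 0" for q
  proof -
    obtain w where "q = frame_pairing i w" using frame_pairing_surj by (metis surjD)
    then have "q \<bullet> q = metr c (snd c (\<gamma> i a)) w (frame_map i q)" using frame_pairing_inner[OF ci, of w q] by simp
    then show ?thesis using that sym_formD(8)[OF metr_sym_form[OF charts_atD(1)[OF ci(1)] charts_atD(3)[OF ci(1)]]] by simp
  qed
  have "proj x = 0" using frame_map_inj assms(1) by (simp add: initJ_def)
  moreover have "pairing_rhs i x = 0" using frame_pairing_initZ[of x] assms(2) linear_0[OF frame_pairing_linear[OF ci]] by simp
  ultimately show ?thesis
    using pairing_rhs_inner[of i x x] linear_0[OF frame_sff_linear(1)] by simp
qed

end

lemma init_tendsto: "((\<lambda>i. initJ i x) \<longlongrightarrow> initJ l x) F" "((\<lambda>i. initZ i x) \<longlongrightarrow> initZ l x) F"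
proof -
  show "((\<lambda>i. initJ i x) \<longlongrightarrow> initJ l x) F" unfolding initJ_def by (rule frame_map_tendsto)
  note gl = goodD[OF good_l]
  have "((\<lambda>i. pairing_rhs i x) \<longlongrightarrow> pairing_rhs l x) F" unfolding pairing_rhs_def by (intro tendsto_intros frame_sff_tendsto)
  then have "((\<lambda>i. pairing_rhs i x) \<longlongrightarrow> frame_pairing l (initZ l x)) F" by (simp add: frame_pairing_initZ[OF good_l])
  then have R: "((\<lambda>i. frame_pairing i (initZ i x)) \<longlongrightarrow> frame_pairing l (initZ l x)) F"
    by (rule Lim_transform_eventually) (use good_eventually frame_pairing_initZ in \<open>auto elim: eventually_mono\<close>)
  show "((\<lambda>i. initZ i x) \<longlongrightarrow> initZ l x) F"
  proof (rule linear_solution_tendsto[OF _ frame_pairing_linear[OF gl(1,2)] frame_pairing_tendsto _ R])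
    show "\<forall>\<^sub>F i in F. linear (frame_pairing i)"
      using good_eventually by eventually_elim (rule frame_pairing_linear[OF goodD(1,2)])
    show "x = 0" if "frame_pairing l x = 0" for x using that gl(3) linear_injective_0[OF frame_pairing_linear[OF gl(1,2)]] by blast
  qed
qed


section \<open>The Jacobi fields with given initial data\<close>

definition jf :: "'i \<Rightarrow> 'e \<Rightarrow> (real \<Rightarrow> ('m, 'e) tvec) \<times> (real \<Rightarrow> ('m, 'e) tvec)" where
  "jf i x = (SOME JZ. seg.jacobi_pair i a b (fst JZ) (snd JZ) \<and>
    (good i \<longrightarrow> fst JZ a = cv i (initJ i x) \<and> snd JZ a = cv i (initZ i x)))"

definition Jf :: "'i \<Rightarrow> 'e \<Rightarrow> real \<Rightarrow> ('m, 'e) tvec" where "Jf i x = fst (jf i x)"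
definition Zf :: "'i \<Rightarrow> 'e \<Rightarrow> real \<Rightarrow> ('m, 'e) tvec" where "Zf i x = snd (jf i x)"

lemma jf: "seg.jacobi_pair i a b (Jf i x) (Zf i x)"
  "good i \<Longrightarrow> Jf i x a = cv i (initJ i x)" "good i \<Longrightarrow> Zf i x a = cv i (initZ i x)"
proof -
  have "\<exists>JZ. seg.jacobi_pair i a b (fst JZ) (snd JZ) \<and>
    (good i \<longrightarrow> fst JZ a = cv i (initJ i x) \<and> snd JZ a = cv i (initZ i x))"
  proof (cases "good i")
    case True
    note t = coord_vector_tangent[OF A goodD(1)[OF True]]
    show ?thesis using seg.jacobi_pair_exists[OF t t, of "initJ i x" "initZ i x"] by force
  next
    case False
    have "0 \<in> tangent_space A (\<gamma> i a)" by (rule subspace_0[OF subspace_tangent])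
    from seg.jacobi_pair_exists[OF this this] False show ?thesis by force
  qed
  from someI_ex[OF this] show "seg.jacobi_pair i a b (Jf i x) (Zf i x)"
    "good i \<Longrightarrow> Jf i x a = cv i (initJ i x)" "good i \<Longrightarrow> Zf i x a = cv i (initZ i x)"
    unfolding Jf_def Zf_def jf_def by blast+
qed

lemmas jf_tangent = seg.jacobi_pairD(1,2)[OF jf(1)]

lemma jf_coord_a:
  assumes "good i" shows "Jf i x a c = initJ i x" "Zf i x a c = initZ i x"
  using jf(2,3)[OF assms] cv_at[OF goodD(1,2)[OF assms]] by simp_all

lemma jf_admissible: "good i \<Longrightarrow> og.admissible i (Jf i x a) (Zf i x a)"
  using init_admissible jf(2,3) by simp

lemma jf_linear:
  assumes gi: "good i" and t: "t \<in> {a..b}"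
  shows "Jf i (x + r *\<^sub>R y) t = Jf i x t + r *\<^sub>R Jf i y t" "Zf i (x + r *\<^sub>R y) t = Zf i x t + r *\<^sub>R Zf i y t"
proof -
  note p = seg.jacobi_pair_linear[OF jf(1)[of i x] jf(1)[of i y] order_refl, of r]
  note cl = linear_add[OF cv_linear[OF goodD(1,2)[OF gi]]] linear_scale[OF cv_linear[OF goodD(1,2)[OF gi]]]
  have 1: "Jf i (x + r *\<^sub>R y) a = Jf i x a + r *\<^sub>R Jf i y a" "Zf i (x + r *\<^sub>R y) a = Zf i x a + r *\<^sub>R Zf i y a"
    unfolding jf(2,3)[OF gi] init_linear[OF gi] cl by simp_all
  show "Jf i (x + r *\<^sub>R y) t = Jf i x t + r *\<^sub>R Jf i y t" "Zf i (x + r *\<^sub>R y) t = Zf i x t + r *\<^sub>R Zf i y t"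
    using seg.jacobi_pair_unique[OF jf(1) p aI 1 t] .
qed

lemma jf_coord_linear:
  assumes "good i" "t \<in> {a..b}" shows "linear (\<lambda>x. Jf i x t d)" "linear (\<lambda>x. Zf i x t d)"
  by (rule linear_fromI; simp add: jf_linear[OF assms] scaleR_fun_def)+

lemma jf_joint:
  assumes t: "t \<in> {a..b}" shows "joint_conv (\<lambda>i. Jf i x) t" "joint_conv (\<lambda>i. Zf i x) t"
proof -
  note V = vconv[unfolded velocity_conv_def]
  have "field_conv (\<lambda>i. Jf i x) a" "field_conv (\<lambda>i. Zf i x) a"
    unfolding field_conv_def
  proof -
    show "tvec_lim (\<lambda>i. \<gamma> i a) (\<lambda>i. Jf i x a) (\<gamma> l a) (Jf l x a) F"
    proof (rule tvec_limI[OF tvec_limD(1)[OF V] c])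
      show "((\<lambda>i. Jf i x a c) \<longlongrightarrow> Jf l x a c) F"
        unfolding jf_coord_a[OF good_l]
        by (rule Lim_transform_eventually[OF init_tendsto(1)]) (use good_eventually jf_coord_a in \<open>auto elim: eventually_mono\<close>)
    qed (use jf_tangent aI in auto)
    show "tvec_lim (\<lambda>i. \<gamma> i a) (\<lambda>i. Zf i x a) (\<gamma> l a) (Zf l x a) F"
    proof (rule tvec_limI[OF tvec_limD(1)[OF V] c])
      show "((\<lambda>i. Zf i x a c) \<longlongrightarrow> Zf l x a c) F"
        unfolding jf_coord_a[OF good_l]
        by (rule Lim_transform_eventually[OF init_tendsto(2)]) (use good_eventually jf_coord_a in \<open>auto elim: eventually_mono\<close>)
    qed (use jf_tangent aI in auto)
  qed
  from jacobi_joint_conv[OF vconv jf(1) this t] show "joint_conv (\<lambda>i. Jf i x) t" "joint_conv (\<lambda>i. Zf i x) t" .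
qed

lemma jf_coord_joint:
  assumes t: "t \<in> {a..b}" and d: "d \<in> charts_at A (\<gamma> l t)"
  shows "((\<lambda>z. Jf (fst z) x (snd z) d) \<longlongrightarrow> Jf l x t d) (joint_nhds F {a..b} t)"
    "((\<lambda>z. Zf (fst z) x (snd z) d) \<longlongrightarrow> Zf l x t d) (joint_nhds F {a..b} t)"
    "\<forall>\<^sub>F z in joint_nhds F {a..b} t. d \<in> charts_at A (\<gamma> (fst z) (snd z)) \<and> good (fst z) \<and> snd z \<in> {a..b}"
proof -
  note J = jf_joint(1)[OF t, unfolded joint_conv_def] and Z = jf_joint(2)[OF t, unfolded joint_conv_def]
  show "((\<lambda>z. Jf (fst z) x (snd z) d) \<longlongrightarrow> Jf l x t d) (joint_nhds F {a..b} t)" by (rule tvec_limD(2)[OF J d])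
  show "((\<lambda>z. Zf (fst z) x (snd z) d) \<longlongrightarrow> Zf l x t d) (joint_nhds F {a..b} t)" by (rule tvec_limD(2)[OF Z d])
  show "\<forall>\<^sub>F z in joint_nhds F {a..b} t. d \<in> charts_at A (\<gamma> (fst z) (snd z)) \<and> good (fst z) \<and> snd z \<in> {a..b}"
    using chart_eventually[OF tvec_limD(1)[OF J] d] tendsto_joint_fst[OF good_eventually] eventually_joint_time
    by eventually_elim blast
qed

text \<open>The form whose crossings are the focal points. The term with \<open>r\<close> vanishes where the field does; it is there to
  make the radical equal to the space of the parameters whose field vanishes.\<close>
definition form :: "real \<Rightarrow> 'i \<Rightarrow> real \<Rightarrow> 'e \<Rightarrow> 'e \<Rightarrow> real" where
  "form r i t x y = g (\<gamma> i t) (Jf i x t) (Zf i y t) + r * g (\<gamma> i t) (Jf i x t) (Jf i y t)"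

definition Ker :: "'i \<Rightarrow> real \<Rightarrow> 'e set" where "Ker i t = {x. Jf i x t = 0}"

lemma pairing_symmetric:
  assumes gi: "good i" and t: "t \<in> {a..b}"
  shows "g (\<gamma> i t) (Jf i x t) (Zf i y t) = g (\<gamma> i t) (Jf i y t) (Zf i x t)"
proof -
  have "g (\<gamma> i t) (Jf i x t) (Zf i y t) = g (\<gamma> i t) (Zf i x t) (Jf i y t)"
    using seg.lagrange_identity[OF jf(1)[of i x] jf(1)[of i y] t] og.admissible_symmetric[OF jf_admissible[OF gi] jf_admissible[OF gi]]
    by simp
  also have "\<dots> = g (\<gamma> i t) (Jf i y t) (Zf i x t)" by (rule metric_lin(3)[OF jf_tangent(2)[OF t] jf_tangent(2)[OF t] jf_tangent(1)[OF t]])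
  finally show ?thesis .
qed

lemma form_sym:
  assumes gi: "good i" and t: "t \<in> {a..b}" shows "sym_form (form r i t)"
proof -
  note tan = jf_tangent[OF t] and lin = jf_linear[OF gi t]
  have "sym_form (\<lambda>x y. g (\<gamma> i t) (Jf i x t) (Zf i y t))"
    unfolding sym_form_def using metric_bilinear[of "\<lambda>x. Jf i x t" "\<gamma> i t" "\<lambda>y. Zf i y t", OF tan(1) lin(1) tan(2) lin(2)] pairing_symmetric[OF assms] by blast
  moreover have "sym_form (\<lambda>x y. g (\<gamma> i t) (Jf i x t) (Jf i y t))"
    unfolding sym_form_def using metric_bilinear[of "\<lambda>x. Jf i x t" "\<gamma> i t" "\<lambda>y. Jf i y t", OF tan(1) lin(1) tan(1) lin(1)] metric_lin(3)[OF tan(1) tan(1) tan(1)] by blast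
  ultimately show ?thesis using sym_form_combine[of _ _ 1 r] unfolding form_def[abs_def] by simp
qed

lemma form_tendsto:
  assumes t: "t \<in> {a..b}" shows "((\<lambda>i. form r i t x y) \<longlongrightarrow> form r l t x y) F"
proof -
  note J = jf_joint(1)[OF t, unfolded joint_conv_def] and Z = jf_joint(2)[OF t, unfolded joint_conv_def]
  have T: "\<forall>\<^sub>F z in joint_nhds F {a..b} t. Jf (fst z) x (snd z) \<in> tangent_space A (\<gamma> (fst z) (snd z))"
    "\<forall>\<^sub>F z in joint_nhds F {a..b} t. Zf (fst z) x (snd z) \<in> tangent_space A (\<gamma> (fst z) (snd z))" for x
    by (rule eventually_mono[OF eventually_joint_time], erule jf_tangent)+
  note T' = jf_tangent[OF t]
  have "((\<lambda>z. form r (fst z) (snd z) x y) \<longlongrightarrow> form r l t x y) (joint_nhds F {a..b} t)"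
    unfolding form_def
    by (intro tendsto_intros metric_tendsto[OF J Z T(1) T'(1) T(2) T'(2)] metric_tendsto[OF J J T(1) T'(1) T(1) T'(1)])
  from joint_tendsto_at[OF this t] show ?thesis by simp
qed

lemma Zf_nonzero:
  assumes gi: "good i" and t: "t \<in> {a..b}" and x: "Jf i x t = 0" "x \<noteq> 0" shows "Zf i x t \<noteq> 0"
proof
  assume "Zf i x t = 0"
  then have "Jf i x a = 0" "Zf i x a = 0" using seg.jacobi_pair_zero[OF jf(1) t x(1) _ aI] by auto
  then have "initJ i x = 0" "initZ i x = 0" using jf_coord_a[OF gi, of x] by auto
  then show False using init_injective[OF gi] x(2) by blast
qed

lemma crossing_positive:
  assumes gi: "good i" and t: "t \<in> {a<..b}" and x: "Jf i x t = 0" "x \<noteq> 0"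
  shows "g (\<gamma> i t) (Zf i x t) (Zf i x t) > 0"
  by (rule og.crossing_positive[OF jf(1) jf_admissible[OF gi]]) (use t x Zf_nonzero[OF gi _ x] in auto)

lemma subspace_Ker: "good i \<Longrightarrow> t \<in> {a..b} \<Longrightarrow> subspace (Ker i t)"
proof -
  assume gi: "good i" and t: "t \<in> {a..b}"
  have "linear (\<lambda>x. Jf i x t)" by (rule linear_fromI) (rule jf_linear[OF gi t])
  then show ?thesis unfolding Ker_def by (rule linear_subspace_kernel)
qed

lemma Ker_coord:
  assumes "t \<in> {a..b}" "d \<in> charts_at A (\<gamma> i t)" shows "x \<in> Ker i t \<longleftrightarrow> Jf i x t d = 0"
  using tangent_eqI[OF assms(2) jf_tangent(1)[OF assms(1)] subspace_0[OF subspace_tangent]] by (auto simp: Ker_def)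

text \<open>For suitable \<open>r\<close> the map \<open>Z + r J\<close> is injective for the limit at the time \<open>t\<close>, hence bijective for all nearby indices
  and times, and then \<open>x\<close> is in the radical exactly if \<open>J x\<close> is orthogonal to
  everything, hence zero.\<close>
lemma shift_exists:
  assumes t: "t \<in> {a<..b}"
  shows "\<exists>r. \<forall>\<^sub>F z in joint_nhds F {a..b} t. good (fst z) \<and> form_radical (form r (fst z) (snd z)) = Ker (fst z) (snd z)"
proof -
  have tI: "t \<in> {a..b}" using t by simp
  obtain d where d: "d \<in> charts_at A (\<gamma> l t)" using ex_chart by blast
  let ?m = "metr d (snd d (\<gamma> l t))"
  note val = metric_value[OF d]
  have "\<exists>r. \<forall>x. Zf l x t d + r *\<^sub>R Jf l x t d = 0 \<longrightarrow> x = 0"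
  proof (rule exists_shift_injective[OF jf_coord_linear(1)[OF good_l tI] jf_coord_linear(2)[OF good_l tI]
        metr_sym_form[OF charts_atD(1)[OF d] charts_atD(3)[OF d]]])
    show "?m (Jf l x t d) (Zf l y t d) = ?m (Jf l y t d) (Zf l x t d)" for x y
      using pairing_symmetric[OF good_l tI, of x y] val[OF jf_tangent(1)[OF tI] jf_tangent(2)[OF tI]] by simp
    show "?m (Zf l x t d) (Zf l x t d) > 0" if "Jf l x t d = 0" "x \<noteq> 0" for x
      using crossing_positive[OF good_l t _ that(2)] that(1) Ker_coord[OF tI d, of x] val[OF jf_tangent(2)[OF tI] jf_tangent(2)[OF tI]]
      by (simp add: Ker_def)
  qed
  then obtain r where r: "\<And>x. Zf l x t d + r *\<^sub>R Jf l x t d = 0 \<Longrightarrow> x = 0" by blast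
  note cj = jf_coord_joint[OF tI d]
  let ?G = "\<lambda>z x. Zf (fst z) x (snd z) d + r *\<^sub>R Jf (fst z) x (snd z) d"
  have lin: "linear (\<lambda>x. Zf i x s d + r *\<^sub>R Jf i x s d)" if "good i" "s \<in> {a..b}" for i s
    by (intro linear_compose_add linear_compose_scale_right jf_coord_linear that)
  have "\<exists>m>0. \<forall>\<^sub>F z in joint_nhds F {a..b} t. \<forall>x. m * norm x \<le> norm (?G z x)"
  proof (rule linear_injective_eventually)
    show "\<forall>\<^sub>F z in joint_nhds F {a..b} t. linear (?G z)" using cj(3) by eventually_elim (intro lin; blast)
    show "linear (\<lambda>x. Zf l x t d + r *\<^sub>R Jf l x t d)" by (rule lin[OF good_l tI])
    show "((\<lambda>z. ?G z x) \<longlongrightarrow> Zf l x t d + r *\<^sub>R Jf l x t d) (joint_nhds F {a..b} t)" for x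
      by (intro tendsto_intros cj(1,2))
  qed (rule r)
  then obtain m where m: "m > 0" "\<forall>\<^sub>F z in joint_nhds F {a..b} t. \<forall>x. m * norm x \<le> norm (?G z x)" by blast
  from m(2) cj(3) have "\<forall>\<^sub>F z in joint_nhds F {a..b} t. good (fst z) \<and> form_radical (form r (fst z) (snd z)) = Ker (fst z) (snd z)"
  proof eventually_elim
    case (elim z)
    obtain i s where z: "z = (i, s)" by (cases z)
    have gi: "good i" and s: "s \<in> {a..b}" and ds: "d \<in> charts_at A (\<gamma> i s)" using elim(2) by (auto simp: z)
    note lz = lin[OF gi s] and tan = jf_tangent[OF s]
    have "x = 0" if "Zf i x s d + r *\<^sub>R Jf i x s d = 0" for x
      using elim(1)[rule_format, of x] that m(1) by (simp add: z mult_le_0_iff)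
    then have "inj (\<lambda>x. Zf i x s d + r *\<^sub>R Jf i x s d)" using linear_injective_0[OF lz] by blast
    then have surj: "surj (\<lambda>x. Zf i x s d + r *\<^sub>R Jf i x s d)" using linear_injective_imp_surjective[OF lz] by blast
    let ?m = "metr d (snd d (\<gamma> i s))"
    note sm = sym_formD[OF metr_sym_form[OF charts_atD(1)[OF ds] charts_atD(3)[OF ds]]]
    have form: "form r i s x y = ?m (Jf i x s d) (Zf i y s d + r *\<^sub>R Jf i y s d)" for x y
      using metric_value[OF ds tan(1) tan(2)] metric_value[OF ds tan(1) tan(1)] by (simp add: form_def sm(4,6))
    have "x \<in> form_radical (form r i s) \<longleftrightarrow> Jf i x s d = 0" for x
    proof
      assume "x \<in> form_radical (form r i s)"
      then have "?m (Jf i x s d) w = 0" for w using surjD[OF surj, of w] form unfolding form_radical_def by auto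
      then show "Jf i x s d = 0" by (rule metr_nondegenerate[OF charts_atD(1)[OF ds] charts_atD(3)[OF ds]])
    qed (simp add: form_radical_def form sm(7))
    then show ?case using gi Ker_coord[OF s ds] by (auto simp: z)
  qed
  then show ?thesis by blast
qed

lemma kernel_regular:
  assumes t: "t \<in> {a..b}" and K: "dim (Ker l t) = 0"
  shows "\<forall>\<^sub>F z in joint_nhds F {a..b} t. dim (Ker (fst z) (snd z)) = 0"
proof -
  obtain d where d: "d \<in> charts_at A (\<gamma> l t)" using ex_chart by blast
  note cj = jf_coord_joint[OF t d]
  have "\<exists>m>0. \<forall>\<^sub>F z in joint_nhds F {a..b} t. \<forall>x. m * norm x \<le> norm (Jf (fst z) x (snd z) d)"
  proof (rule linear_injective_eventually[OF _ jf_coord_linear(1)[OF good_l t] cj(1)])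
    show "\<forall>\<^sub>F z in joint_nhds F {a..b} t. linear (\<lambda>x. Jf (fst z) x (snd z) d)"
      using cj(3) by eventually_elim (intro jf_coord_linear; blast)
    show "x = 0" if "Jf l x t d = 0" for x using that K Ker_coord[OF t d] by auto
  qed
  then obtain m where m: "m > 0" "\<forall>\<^sub>F z in joint_nhds F {a..b} t. \<forall>x. m * norm x \<le> norm (Jf (fst z) x (snd z) d)" by blast
  from m(2) cj(3) show ?thesis
  proof eventually_elim
    case (elim z)
    have "x = 0" if "x \<in> Ker (fst z) (snd z)" for x
      using elim(1)[rule_format, of x] that m(1) by (simp add: Ker_def mult_le_0_iff)
    then show ?case by auto
  qed
qed


section \<open>Counting the focal points near a given time\<close>

lemma form_deriv:
  assumes s: "s \<in> {p..q}" and pq: "{p..q} \<subseteq> {a..b}"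
  shows "((\<lambda>s. form r i s x y) has_real_derivative
      (g (\<gamma> i s) (Zf i x s) (Zf i y s) + g (\<gamma> i s) (Jf i x s) (curvature A g (\<gamma> i s) (V i s) (Jf i y s) (V i s))) +
      r * (g (\<gamma> i s) (Zf i x s) (Jf i y s) + g (\<gamma> i s) (Jf i x s) (Zf i y s))) (at s within {p..q})"
proof -
  have t: "s \<in> {a..b}" using assms by blast
  note pp = seg.pair_products(1,2)[OF jf(1)[of i x] jf(1)[of i y] t]
  show ?thesis
    unfolding form_def by (rule DERIV_subset[OF DERIV_add[OF pp(2) DERIV_cmult[OF pp(1)]] pq])
qed

text \<open>On the radical the derivative of the form is \<open>g (Z x) (Z x)\<close>, since the other terms contain the vanishing field,
  so all crossings are positive.\<close>
lemma form_count:
  assumes gi: "good i" and pq: "a < p" "p \<le> q" "q \<le> b"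
    and rad: "\<And>s. s \<in> {p..q} \<Longrightarrow> form_radical (form r i s) = Ker i s"
  shows "finite {s \<in> {p..<q}. dim (Ker i s) \<noteq> 0}"
    "(\<Sum>s | s \<in> {p..<q} \<and> dim (Ker i s) \<noteq> 0. dim (Ker i s)) + nsd_dim (form r i q) = nsd_dim (form r i p)"
proof -
  have sub: "{p..q} \<subseteq> {a..b}" using pq by auto
  have B: "sym_form (form r i s)" if "s \<in> {p..q}" for s by (rule form_sym[OF gi]) (use that sub in blast)
  have pos: "(g (\<gamma> i s) (Zf i x s) (Zf i x s) + g (\<gamma> i s) (Jf i x s) (curvature A g (\<gamma> i s) (V i s) (Jf i x s) (V i s))) +
      r * (g (\<gamma> i s) (Zf i x s) (Jf i x s) + g (\<gamma> i s) (Jf i x s) (Zf i x s)) > 0"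
    if s: "s \<in> {p..q}" and x: "x \<in> form_radical (form r i s)" "x \<noteq> 0" for s x
  proof -
    have sI: "s \<in> {a..b}" and sl: "s \<in> {a<..b}" using s pq by auto
    have J0: "Jf i x s = 0" using x(1) rad[OF s] by (simp add: Ker_def)
    note tan = jf_tangent[OF sI]
    have z: "g (\<gamma> i s) 0 w = 0" "g (\<gamma> i s) w 0 = 0" if "w \<in> tangent_space A (\<gamma> i s)" for w
      using metric_lin(2)[OF that that that, of 0] metric_lin(5)[OF that that that, of 0] by simp_all
    have "curvature A g (\<gamma> i s) (V i s) (Jf i x s) (V i s) \<in> tangent_space A (\<gamma> i s)"
      by (rule seg.curvature_tangent[OF seg.vel_tangent[OF sI] tan(1) seg.vel_tangent[OF sI]])
    then show ?thesis using crossing_positive[OF gi sl J0 x(2)] z(1) z[OF tan(2)] unfolding J0 by simp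
  qed
  have eq: "form_radical (form r i s) \<noteq> {0} \<longleftrightarrow> dim (Ker i s) \<noteq> 0" if s: "s \<in> {p..q}" for s
  proof -
    have "0 \<in> Ker i s" using subspace_0[OF subspace_Ker[OF gi]] s sub by blast
    then show ?thesis unfolding rad[OF s] dim_eq_0 by blast
  qed
  have set: "{s \<in> {p..<q}. form_radical (form r i s) \<noteq> {0}} = {s \<in> {p..<q}. dim (Ker i s) \<noteq> 0}"
    by (rule Collect_cong, rule conj_cong[OF refl eq]) simp
  note cc = crossing_count[OF pq(2) B form_deriv[OF _ sub] pos]
  show "finite {s \<in> {p..<q}. dim (Ker i s) \<noteq> 0}" unfolding set[symmetric] by (rule cc(1))
  have "(\<Sum>s | s \<in> {p..<q} \<and> form_radical (form r i s) \<noteq> {0}. dim (form_radical (form r i s))) + nsd_dim (form r i q) =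
      nsd_dim (form r i p)" by (rule cc(2))
  moreover have "(\<Sum>s | s \<in> {p..<q} \<and> dim (Ker i s) \<noteq> 0. dim (Ker i s)) =
      (\<Sum>s | s \<in> {p..<q} \<and> form_radical (form r i s) \<noteq> {0}. dim (form_radical (form r i s)))"
    unfolding set by (intro sum.cong refl) (simp add: rad)
  ultimately show "(\<Sum>s | s \<in> {p..<q} \<and> dim (Ker i s) \<noteq> 0. dim (Ker i s)) + nsd_dim (form r i q) = nsd_dim (form r i p)"
    by (simp only:)
qed

text \<open>The count is a difference of two values of \<open>nsd_dim\<close>, each of which is stable where the limit form is
  nondegenerate.\<close>
lemma local_count:
  assumes t: "t \<in> {a<..b}"
  shows "\<exists>\<eta>>0. \<forall>p q. a < p \<longrightarrow> p \<le> q \<longrightarrow> q \<le> b \<longrightarrow> \<bar>p - t\<bar> < \<eta> \<longrightarrow> \<bar>q - t\<bar> < \<eta> \<longrightarrow>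
      (\<forall>\<^sub>F i in F. finite {s \<in> {p..<q}. dim (Ker i s) \<noteq> 0}) \<and>
      (dim (Ker l p) = 0 \<longrightarrow> dim (Ker l q) = 0 \<longrightarrow>
        (\<forall>\<^sub>F i in F. (\<Sum>s | s \<in> {p..<q} \<and> dim (Ker i s) \<noteq> 0. dim (Ker i s)) =
          (\<Sum>s | s \<in> {p..<q} \<and> dim (Ker l s) \<noteq> 0. dim (Ker l s))))"
proof -
  obtain r where r: "\<forall>\<^sub>F z in joint_nhds F {a..b} t. good (fst z) \<and> form_radical (form r (fst z) (snd z)) = Ker (fst z) (snd z)"
    using shift_exists[OF t] by (elim exE) (rule that)
  from eventually_joint_realD[OF r] obtain Pf \<eta> where Pf: "eventually Pf F" and \<eta>: "\<eta> > 0"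
    and all: "\<forall>i s. Pf i \<longrightarrow> s \<in> {a..b} \<longrightarrow> \<bar>s - t\<bar> < \<eta> \<longrightarrow>
      good (fst (i, s)) \<and> form_radical (form r (fst (i, s)) (snd (i, s))) = Ker (fst (i, s)) (snd (i, s))"
    by (elim exE conjE) (rule that)
  have rad: "form_radical (form r i s) = Ker i s" if "Pf i" "s \<in> {a..b}" "\<bar>s - t\<bar> < \<eta>" for i s
    using all[rule_format, OF that] by simp
  have tI: "t \<in> {a..b}" using t by simp
  have gd: "good i" if "Pf i" for i using all[rule_format, OF that tI] \<eta> by simp
  have "(\<forall>\<^sub>F i in F. finite {s \<in> {p..<q}. dim (Ker i s) \<noteq> 0}) \<and>
      (dim (Ker l p) = 0 \<longrightarrow> dim (Ker l q) = 0 \<longrightarrow>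
        (\<forall>\<^sub>F i in F. (\<Sum>s | s \<in> {p..<q} \<and> dim (Ker i s) \<noteq> 0. dim (Ker i s)) =
          (\<Sum>s | s \<in> {p..<q} \<and> dim (Ker l s) \<noteq> 0. dim (Ker l s))))"
    if pq: "a < p" "p \<le> q" "q \<le> b" and near: "\<bar>p - t\<bar> < \<eta>" "\<bar>q - t\<bar> < \<eta>" for p q
  proof -
    have rad': "form_radical (form r i s) = Ker i s" if "Pf i" "s \<in> {p..q}" for i s
      by (rule rad[OF that(1)]) (use that(2) pq near in \<open>auto simp: abs_if split: if_splits\<close>)
    have fc: "finite {s \<in> {p..<q}. dim (Ker i s) \<noteq> 0}"
      "(\<Sum>s | s \<in> {p..<q} \<and> dim (Ker i s) \<noteq> 0. dim (Ker i s)) + nsd_dim (form r i q) = nsd_dim (form r i p)"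
      if i: "Pf i" for i
      by (rule form_count[OF gd[OF i] pq rad'[OF i]], assumption)+
    have fin: "\<forall>\<^sub>F i in F. finite {s \<in> {p..<q}. dim (Ker i s) \<noteq> 0}" using Pf by eventually_elim (rule fc(1))
    have "\<forall>\<^sub>F i in F. (\<Sum>s | s \<in> {p..<q} \<and> dim (Ker i s) \<noteq> 0. dim (Ker i s)) =
          (\<Sum>s | s \<in> {p..<q} \<and> dim (Ker l s) \<noteq> 0. dim (Ker l s))"
      if K: "dim (Ker l p) = 0" "dim (Ker l q) = 0"
    proof -
      have stable: "\<forall>\<^sub>F i in F. form_radical (form r i u) = {0} \<and> nsd_dim (form r i u) = nsd_dim (form r l u)"
        if u: "u \<in> {p..q}" and Ku: "dim (Ker l u) = 0" for u
      proof (rule nondegenerate_form_stable)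
        have uI: "u \<in> {a..b}" using u pq by auto
        show "\<forall>\<^sub>F i in F. sym_form (form r i u)" using good_eventually by eventually_elim (rule form_sym[OF _ uI])
        show "sym_form (form r l u)" by (rule form_sym[OF good_l uI])
        show "((\<lambda>i. form r i u x y) \<longlongrightarrow> form r l u x y) F" for x y by (rule form_tendsto[OF uI])
        have "0 \<in> Ker l u" by (rule subspace_0[OF subspace_Ker[OF good_l uI]])
        then show "form_radical (form r l u) = {0}" using Ku unfolding rad'[OF lF[OF Pf] u] dim_eq_0 by blast
      qed
      have "p \<in> {p..q}" "q \<in> {p..q}" using pq(2) by auto
      from stable[OF this(1) K(1)] stable[OF this(2) K(2)] Pf show ?thesis
      proof eventually_elim
        case (elim i)
        show ?case using fc(2)[OF elim(3)] fc(2)[OF lF[OF Pf]] elim(1,2) by linarith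
      qed
    qed
    then show ?thesis using fin by blast
  qed
  then show ?thesis using \<eta> by blast
qed

end

section \<open>There are no focal points near the initial submanifold\<close>

text \<open>By the mean value inequality the quotient is close to the derivatives at nearby times, which converge jointly.\<close>
lemma difference_quotient_joint_tendsto:
  fixes f :: "'i \<Rightarrow> real \<Rightarrow> 'x::real_normed_vector"
  assumes D: "\<forall>\<^sub>F z in joint_nhds F {a..b} a. (f (fst z) has_vector_derivative D (fst z) (snd z)) (at (snd z) within {a..b})"
    and lim: "((\<lambda>z. D (fst z) (snd z)) \<longlongrightarrow> D0) (joint_nhds F {a..b} a)" and ab: "a < b"
  shows "((\<lambda>z. (1 / (snd z - a)) *\<^sub>R (f (fst z) (snd z) - f (fst z) a)) \<longlongrightarrow> D0)
    (inf (joint_nhds F {a..b} a) (principal {z. a < snd z}))"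
proof (rule tendstoI)
  fix \<epsilon> :: real assume \<epsilon>: "\<epsilon> > 0"
  have "\<forall>\<^sub>F z in joint_nhds F {a..b} a. (f (fst z) has_vector_derivative D (fst z) (snd z)) (at (snd z) within {a..b}) \<and>
      dist (D (fst z) (snd z)) D0 < \<epsilon> / 4"
    using D tendstoD[OF lim, of "\<epsilon> / 4"] \<epsilon> by (simp add: eventually_conj)
  from eventually_joint_realD[OF this] obtain Pf d where Pf: "eventually Pf F" and d: "d > 0"
    and all: "\<forall>i s. Pf i \<longrightarrow> s \<in> {a..b} \<longrightarrow> \<bar>s - a\<bar> < d \<longrightarrow>
      (f (fst (i, s)) has_vector_derivative D (fst (i, s)) (snd (i, s))) (at (snd (i, s)) within {a..b}) \<and>
      dist (D (fst (i, s)) (snd (i, s))) D0 < \<epsilon> / 4"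
    by (elim exE conjE) (rule that)
  show "\<forall>\<^sub>F z in inf (joint_nhds F {a..b} a) (principal {z. a < snd z}).
      dist ((1 / (snd z - a)) *\<^sub>R (f (fst z) (snd z) - f (fst z) a)) D0 < \<epsilon>"
    unfolding eventually_inf_principal
  proof (rule eventually_jointI[OF Pf d], rule impI)
    fix i s assume i: "Pf i" and s: "s \<in> {a..b}" "\<bar>s - a\<bar> < d" and "(i, s) \<in> {z. a < snd z}"
    then have as: "a < s" by simp
    have D': "(f i has_vector_derivative D i u) (at u within {a..s})" "norm (D i u - D0) < \<epsilon> / 4" if u: "u \<in> {a..s}" for u
    proof -
      have "u \<in> {a..b}" "\<bar>u - a\<bar> < d" using u s as by auto
      note * = all[rule_format, OF i this]
      show "norm (D i u - D0) < \<epsilon> / 4" using * by (simp add: dist_norm)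
      show "(f i has_vector_derivative D i u) (at u within {a..s})"
        by (rule has_vector_derivative_within_subset[of _ _ _ "{a..b}"]) (use * s in auto)
    qed
    have aI: "a \<in> {a..s}" using as by simp
    have "norm (f i s - f i a - (s - a) *\<^sub>R D i a) \<le> norm (s - a) * (\<epsilon> / 2)"
    proof (rule vector_differentiable_bound_linearization[OF D'(1) _ _ aI])
      show "closed_segment a s \<subseteq> {a..s}" using as by (simp add: closed_segment_eq_real_ivl)
      fix u assume "u \<in> {a..s}"
      then show "norm (D i u - D i a) \<le> \<epsilon> / 2"
        using D'(2)[of u] D'(2)[OF aI] norm_triangle_ineq4[of "D i u - D0" "D i a - D0"] by simp
    qed
    moreover have "norm ((1 / (s - a)) *\<^sub>R X) \<le> \<epsilon> / 2" if "norm X \<le> norm (s - a) * (\<epsilon> / 2)" for X :: 'x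
      using as that by (simp add: field_simps)
    ultimately have "norm ((1 / (s - a)) *\<^sub>R (f i s - f i a - (s - a) *\<^sub>R D i a)) \<le> \<epsilon> / 2" by blast
    moreover have "(1 / (s - a)) *\<^sub>R (f i s - f i a - (s - a) *\<^sub>R D i a) = (1 / (s - a)) *\<^sub>R (f i s - f i a) - D i a"
      using as by (simp add: scaleR_diff_right)
    ultimately have "norm ((1 / (s - a)) *\<^sub>R (f i s - f i a) - D i a) \<le> \<epsilon> / 2" by simp
    then have "norm ((1 / (s - a)) *\<^sub>R (f i s - f i a) - D0) < \<epsilon>"
      using D'(2)[OF aI] norm_triangle_ineq[of "(1 / (s - a)) *\<^sub>R (f i s - f i a) - D i a" "D i a - D0"] \<epsilon> by simp
    then show "dist ((1 / (snd (i, s) - a)) *\<^sub>R (f (fst (i, s)) (snd (i, s)) - f (fst (i, s)) a)) D0 < \<epsilon>"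
      by (simp add: dist_norm)
  qed
qed

context orthogonal_family
begin

lemma quotient_tendsto:
  "((\<lambda>z. (1 / (snd z - a)) *\<^sub>R (Jf (fst z) x (snd z) c - Jf (fst z) x a c)) \<longlongrightarrow>
      initZ l x - Gam c (snd c (\<gamma> l a)) (V l a c) (initJ l x))
    (inf (joint_nhds F {a..b} a) (principal {z. a < snd z}))"
proof (rule difference_quotient_joint_tendsto[OF _ _ ab])
  let ?D = "\<lambda>i s. Zf i x s c - Gam c (snd c (\<gamma> i s)) (V i s c) (Jf i x s c)"
  note cj = jf_coord_joint[OF aI c]
  note vj = velocity_joint_conv(1)[OF vconv aI, unfolded joint_conv_def]
  show "\<forall>\<^sub>F z in joint_nhds F {a..b} a. ((\<lambda>s. Jf (fst z) x s c) has_vector_derivative ?D (fst z) (snd z)) (at (snd z) within {a..b})"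
    using cj(3)
  proof eventually_elim
    case (elim z)
    then have "c \<in> charts_at A (\<gamma> (fst z) (snd z))" "snd z \<in> {a..b}" by blast+
    from seg.jacobi_pairD(3)[OF jf(1) this(2,1)] show ?case by (simp add: seg.cov_deriv_at_def)
  qed
  show "((\<lambda>z. ?D (fst z) (snd z)) \<longlongrightarrow> initZ l x - Gam c (snd c (\<gamma> l a)) (V l a c) (initJ l x)) (joint_nhds F {a..b} a)"
    by (intro tendsto_diff cj(2)[unfolded jf_coord_a[OF good_l]]
      Gam_tendsto[OF charts_atD(1)[OF c] coord_tendsto[OF tvec_limD(1)[OF vj] c] charts_atD(3)[OF c] tvec_limD(2)[OF vj c]
        cj(1)[unfolded jf_coord_a[OF good_l]]])
qed

lemma initZ_linear: "good i \<Longrightarrow> linear (initZ i)"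
  by (rule linear_fromI) (rule init_linear(2))

text \<open>The derivative with the data \<open>x - proj x\<close> is orthogonal to \<open>W\<close>, because its initial value is zero. It cancels
  \<open>proj x\<close> only if \<open>proj x\<close> is orthogonal to \<open>W\<close>, hence zero.\<close>
lemma proj_initZ_injective:
  assumes x: "proj x + initZ l (x - proj x) = 0" shows "x = 0"
proof -
  note cl = goodD(1,2)[OF good_l]
  define n where "n = x - proj x"
  have pn: "proj n = 0" unfolding n_def by (rule proj_compl)
  have nn: "n - proj n = n" by (simp add: pn)
  have m: "metr c (snd c (\<gamma> l a)) (initZ l n) q = n \<bullet> q" for q
    using initZ_metric[OF good_l, of n q] unfolding nn pn frame_map_l by (simp add: linear_0[OF frame_sff_linear(1)])
  have Z: "initZ l n = - proj x" using x by (simp add: n_def add_eq_0_iff)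
  note sm = sym_formD[OF metr_sym_form[OF charts_atD(1)[OF c] charts_atD(3)[OF c]]]
  have "cv l (proj x) = 0"
  proof (rule og.TP_nondegenerate)
    show "cv l (proj x) \<in> og.TP l" using cv_frame_map_TP[OF cl proj(2)[of x]] by (simp add: frame_map_l)
    fix w assume "w \<in> og.TP l"
    then obtain q where q: "q \<in> W" "w = cv l (frame_map l q)" using TP_frame_map[OF cl] by blast
    have "metr c (snd c (\<gamma> l a)) (- proj x) q = n \<bullet> proj q" using m[of q] proj(3)[OF q(1)] unfolding Z by simp
    also have "\<dots> = 0" using proj(4)[of n q] pn by simp
    finally have "metr c (snd c (\<gamma> l a)) (proj x) q = 0" using sm(5)[of "-1" "proj x" q] by simp
    then show "g (\<gamma> l a) (cv l (proj x)) w = 0" unfolding q(2) metric_cv[OF good_l] by (simp add: frame_map_l)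
  qed
  then have px: "proj x = 0" using cv_at[OF cl, of "proj x"] by simp
  then have "n \<bullet> n = 0" using m[of n] unfolding Z by (simp add: sm(7))
  then show ?thesis using px by (simp add: n_def)
qed

text \<open>To first order in \<open>s - a\<close> the value at time \<open>s\<close> is the sum of the initial value, which depends on \<open>proj x\<close>, and of
  \<open>s - a\<close> times the initial derivative. After the value is divided by \<open>s - a\<close> and \<open>proj x\<close> is replaced by its quotient by
  \<open>s - a\<close>, it depends on the data through a map \<open>N\<close> with an injective limit.\<close>
lemma kernel_initial:
  "\<forall>\<^sub>F z in joint_nhds F {a..b} a. a < snd z \<longrightarrow> dim (Ker (fst z) (snd z)) = 0"
proof -
  let ?H = "inf (joint_nhds F {a..b} a) (principal {z. a < snd z})"
  define Y where "Y z x = (1 / (snd z - a)) *\<^sub>R (Jf (fst z) x (snd z) c - Jf (fst z) x a c)" for z x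
  define N where "N z x = frame_map (fst z) (proj x) + (snd z - a) *\<^sub>R Y z (proj x) + Y z (x - proj x)" for z x
  have evH: "\<forall>\<^sub>F z in ?H. Q z" if "\<forall>\<^sub>F z in joint_nhds F {a..b} a. Q z" for Q
    using that unfolding eventually_inf_principal by (rule eventually_mono) simp
  have pos: "\<forall>\<^sub>F z in ?H. a < snd z" unfolding eventually_inf_principal by simp
  have cj: "\<forall>\<^sub>F z in ?H. c \<in> charts_at A (\<gamma> (fst z) (snd z)) \<and> good (fst z) \<and> snd z \<in> {a..b}"
    by (rule evH[OF jf_coord_joint(3)[OF aI c]])
  have linY: "linear (Y z)" if z: "good (fst z)" "snd z \<in> {a..b}" for z
    unfolding Y_def by (intro linear_compose_scale_right linear_compose_sub jf_coord_linear z aI)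
  have linq: "linear (\<lambda>x. x - proj x)" by (intro linear_compose_sub proj(1)) (simp add: linear_id[unfolded id_def])
  have linN: "linear (N z)" if z: "good (fst z)" "snd z \<in> {a..b}" for z
    unfolding N_def
    by (intro linear_compose_add linear_compose_scale_right
      linear_compose[OF proj(1) frame_map_linear, unfolded comp_def] linear_compose[OF proj(1) linY[OF z], unfolded comp_def]
      linear_compose[OF linq linY[OF z], unfolded comp_def])
  have "\<exists>m>0. \<forall>\<^sub>F z in ?H. \<forall>x. m * norm x \<le> norm (N z x)"
  proof (rule linear_injective_eventually)
    show "\<forall>\<^sub>F z in ?H. linear (N z)" using cj by eventually_elim (intro linN; blast)
    show "linear (\<lambda>x. proj x + initZ l (x - proj x))"
      by (intro linear_compose_add proj(1) linear_compose[OF linq initZ_linear[OF good_l], unfolded comp_def])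
    fix x
    let ?D = "\<lambda>x. initZ l x - Gam c (snd c (\<gamma> l a)) (V l a c) (initJ l x)"
    have lim: "((\<lambda>z. Y z y) \<longlongrightarrow> ?D y) ?H" for y unfolding Y_def by (rule quotient_tendsto)
    have s0: "((\<lambda>z. snd z - a) \<longlongrightarrow> 0) ?H"
    proof (rule tendstoI)
      fix \<epsilon> :: real assume "\<epsilon> > 0"
      then show "\<forall>\<^sub>F z in ?H. dist (snd z - a) 0 < \<epsilon>"
        by (intro evH eventually_jointI[of "\<lambda>_. True" _ \<epsilon>]) (simp_all add: dist_real_def)
    qed
    have L: "((\<lambda>z. frame_map (fst z) (proj x)) \<longlongrightarrow> proj x) ?H"
    proof (rule topological_tendstoI)
      fix S assume "open S" "proj x \<in> S"
      then have "\<forall>\<^sub>F i in F. frame_map i (proj x) \<in> S" using topological_tendstoD[OF frame_map_tendsto[of "proj x"], of S] by (simp add: frame_map_l)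
      then show "\<forall>\<^sub>F z in ?H. frame_map (fst z) (proj x) \<in> S" by (intro evH tendsto_joint_fst)
    qed
    have "initJ l (x - proj x) = 0" by (simp add: initJ_def proj_compl frame_map_l)
    then have D: "?D (x - proj x) = initZ l (x - proj x)"
      using bilinear_rzero[OF Gam_bilinear[OF charts_atD(1)[OF c] charts_atD(3)[OF c]]] by simp
    show "((\<lambda>z. N z x) \<longlongrightarrow> proj x + initZ l (x - proj x)) ?H"
      using tendsto_add[OF tendsto_add[OF L tendsto_scaleR[OF s0 lim[of "proj x"]]] lim[of "x - proj x"]]
      unfolding D N_def by simp
  qed (rule proj_initZ_injective)
  then obtain m where m: "m > 0" "\<forall>\<^sub>F z in ?H. \<forall>x. m * norm x \<le> norm (N z x)" by (elim exE conjE) (rule that)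
  from m(2) cj pos have "\<forall>\<^sub>F z in ?H. dim (Ker (fst z) (snd z)) = 0"
  proof eventually_elim
    case (elim z)
    obtain i s where z: "z = (i, s)" by (cases z)
    have gi: "good i" and s: "s \<in> {a..b}" "a < s" using elim(2,3) by (simp_all add: z)
    have N0: "y = 0" if "N z y = 0" for y
      using elim(1)[rule_format, of y] that m(1) by (simp add: mult_le_0_iff)
    have "x = 0" if x: "x \<in> Ker i s" for x
    proof -
      define n where "n = x - proj x"
      \<comment> \<open>the rescaled data, for which \<open>N\<close> gives the value at time \<open>s\<close> divided by \<open>s - a\<close>\<close>
      define y where "y = (1 / (s - a)) *\<^sub>R proj x + n"
      have pn: "proj n = 0" unfolding n_def by (rule proj_compl)
      have py: "proj y = (1 / (s - a)) *\<^sub>R proj x"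
        by (simp add: y_def linear_add[OF proj(1)] linear_scale[OF proj(1)] pn proj(3)[OF proj(2)])
      have yn: "y - (1 / (s - a)) *\<^sub>R proj x = n" by (simp add: y_def)
      have lY: "linear (Y z)" by (rule linY) (use gi s in \<open>simp_all add: z\<close>)
      have J0: "Jf i (proj x) a c = frame_map i (proj x)" "Jf i n a c = 0"
        unfolding jf_coord_a[OF gi] initJ_def pn proj(3)[OF proj(2)] by (simp_all add: linear_0[OF frame_map_linear])
      have "Jf i x s c = Jf i (proj x + 1 *\<^sub>R n) s c" by (simp add: n_def)
      also have "\<dots> = Jf i (proj x) s c + Jf i n s c" unfolding jf_linear[OF gi s(1)] by simp
      finally have J: "Jf i (proj x) s c + Jf i n s c = 0" using x by (simp add: Ker_def)
      have "N z y = (1 / (s - a)) *\<^sub>R (frame_map i (proj x)) + Y z (proj x) + Y z n"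
        using s(2) linear_scale[OF lY, of "1 / (s - a)" "proj x", unfolded z] unfolding N_def py yn by (simp add: linear_scale[OF frame_map_linear] z)
      also have "\<dots> = (1 / (s - a)) *\<^sub>R (Jf i (proj x) s c + Jf i n s c)"
        unfolding Y_def by (simp add: z J0 algebra_simps)
      finally have "N z y = 0" using J by simp
      then have "y = 0" by (rule N0)
      then have py0: "proj y = 0" by (simp add: linear_0[OF proj(1)])
      then have px: "proj x = 0" using py py0 s(2) by simp
      then have "n = 0" using yn \<open>y = 0\<close> px by simp
      with px show ?thesis by (simp add: n_def)
    qed
    then show ?case by (auto simp: z)
  qed
  then show ?thesis unfolding eventually_inf_principal by (rule eventually_mono) simp
qed


section \<open>Focal points as zeros of the parametrised Jacobi fields\<close>

definition field :: "'i \<Rightarrow> 'e \<Rightarrow> real \<Rightarrow> ('m, 'e) tvec" where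
  "field i x = (\<lambda>t. if t \<in> {a..b} then Jf i x t else 0)"

lemma field_linear: "good i \<Longrightarrow> linear (field i)"
proof (rule linear_fromI, rule ext)
  fix x y r t assume "good i"
  then show "field i (x + r *\<^sub>R y) t = (field i x + r *\<^sub>R field i y) t"
    by (cases "t \<in> {a..b}") (simp_all add: field_def jf_linear scaleR_fun_def zero_fun_def del: atLeastAtMost_iff)
qed

lemma field_injective:
  assumes gi: "good i" shows "inj (field i)"
  unfolding linear_injective_0[OF field_linear[OF gi]]
proof (intro allI impI)
  fix x assume x: "field i x = 0"
  have J: "Jf i x t = 0" if "t \<in> {a..b}" for t using fun_cong[OF x, of t] that by (simp add: field_def)
  have "Zf i x a = 0" by (rule seg.jacobi_pair_zero_field[OF jf(1) J aI])
  then show "x = 0" using init_injective[OF gi, of x] jf_coord_a[OF gi, of x] J[OF aI] by simp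
qed

lemma jacobi_fields_range:
  assumes gi: "good i" shows "jacobi_fields A g (P i) a b (\<gamma> i) = range (field i)"
proof (intro equalityI subsetI)
  fix J assume "J \<in> jacobi_fields A g (P i) a b (\<gamma> i)"
  then have out: "\<forall>t. t \<notin> {a..b} \<longrightarrow> J t = 0" and "\<exists>Z. seg.jacobi_pair i a b J Z \<and> og.admissible i (J a) (Z a)"
    unfolding og.jacobi_fields_admissible by blast+
  from this(2) obtain Z where Z: "seg.jacobi_pair i a b J Z" "og.admissible i (J a) (Z a)" by (elim exE conjE) (rule that)
  obtain x where x: "J a = cv i (initJ i x)" "Z a = cv i (initZ i x)"
    using admissible_init[OF gi Z(2)] by (elim exE conjE) (rule that)
  have "J t = Jf i x t" if "t \<in> {a..b}" for t
    by (rule seg.jacobi_pair_unique(1)[OF Z(1) jf(1) aI _ _ that]) (simp_all add: x jf(2,3)[OF gi])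
  then have "J = field i x" using out by (auto simp: field_def fun_eq_iff)
  then show "J \<in> range (field i)" by (rule range_eqI)
next
  fix J assume "J \<in> range (field i)"
  then obtain x where J: "J = field i x" by (rule rangeE)
  have eq: "J t = Jf i x t" if "t \<in> {a..b}" for t using that by (simp add: J field_def)
  have "seg.jacobi_pair i a b J (Zf i x)" by (rule seg.jacobi_pair_cong[OF jf(1) eq])
  moreover have "og.admissible i (J a) (Zf i x a)" unfolding eq[OF aI] by (rule jf_admissible[OF gi])
  moreover have "\<forall>t. t \<notin> {a..b} \<longrightarrow> J t = 0" by (simp add: J field_def)
  ultimately show "J \<in> jacobi_fields A g (P i) a b (\<gamma> i)" unfolding og.jacobi_fields_admissible by blast
qed

lemma vanishing_fields:
  assumes gi: "good i" and t: "t \<in> {a..b}"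
  shows "{J \<in> jacobi_fields A g (P i) a b (\<gamma> i). J t = 0} = field i ` Ker i t"
  unfolding jacobi_fields_range[OF gi] using t by (auto simp: Ker_def field_def)

lemma focal_multiplicity_eq:
  assumes gi: "good i" and t: "t \<in> {a..b}"
  shows "focal_multiplicity A g (P i) a b (\<gamma> i) t = dim (Ker i t)"
  unfolding focal_multiplicity_def vanishing_fields[OF assms]
  by (rule dim_image_eq[OF field_linear[OF gi]]) (rule inj_on_subset[OF field_injective[OF gi] subset_UNIV])

lemma focal_iff:
  assumes gi: "good i"
  shows "focal A g (P i) a b (\<gamma> i) t \<longleftrightarrow> t \<in> {a<..b} \<and> dim (Ker i t) \<noteq> 0"
proof (cases "t \<in> {a<..b}")
  case True
  then have t: "t \<in> {a..b}" by simp
  have "(\<exists>J\<in>jacobi_fields A g (P i) a b (\<gamma> i). J \<noteq> 0 \<and> J t = 0) \<longleftrightarrow>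
      (\<exists>J\<in>{J \<in> jacobi_fields A g (P i) a b (\<gamma> i). J t = 0}. J \<noteq> 0)" by auto
  also have "\<dots> \<longleftrightarrow> (\<exists>x\<in>Ker i t. field i x \<noteq> 0)" unfolding vanishing_fields[OF gi t] by simp
  also have "field i x = 0 \<longleftrightarrow> x = 0" for x
    using linear_0[OF field_linear[OF gi]] injD[OF field_injective[OF gi], of x 0] by auto
  then have "(\<exists>x\<in>Ker i t. field i x \<noteq> 0) \<longleftrightarrow> (\<exists>x\<in>Ker i t. x \<noteq> 0)" by simp
  also have "\<dots> \<longleftrightarrow> dim (Ker i t) \<noteq> 0" unfolding dim_eq_0 by blast
  finally show ?thesis unfolding focal_def using True by blast
qed (simp add: focal_def del: greaterThanAtMost_iff)

lemma geometric_index_eq: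
  assumes gi: "good i" and fin: "finite {s \<in> {a<..b}. dim (Ker i s) \<noteq> 0}"
  shows "geometric_index A g (P i) a b (\<gamma> i) = enat (\<Sum>s | s \<in> {a<..b} \<and> dim (Ker i s) \<noteq> 0. dim (Ker i s))"
proof -
  have "(\<Sum>t | t \<in> {a<..b} \<and> dim (Ker i t) \<noteq> 0. focal_multiplicity A g (P i) a b (\<gamma> i) t) =
      (\<Sum>s | s \<in> {a<..b} \<and> dim (Ker i s) \<noteq> 0. dim (Ker i s))"
    by (intro sum.cong refl focal_multiplicity_eq[OF gi]) simp
  then show ?thesis using fin unfolding geometric_index_def focal_iff[OF gi] by simp
qed

lemma geometric_index_stable:
  assumes nf: "\<not> focal A g (P l) a b (\<gamma> l) b"
  shows "\<forall>\<^sub>F i in F. \<not> focal A g (P i) a b (\<gamma> i) b \<and>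
    geometric_index A g (P i) a b (\<gamma> i) = geometric_index A g (P l) a b (\<gamma> l)"
proof -
  have "b \<in> {a<..b}" using ab by simp
  then have b: "dim (Ker l b) = 0" using nf focal_iff[OF good_l] by blast
  have reg: "\<forall>\<^sub>F x in joint_nhds F {a..b} t. dim (Ker (fst x) (snd x)) = 0" if "t \<in> {a<..b}" "dim (Ker l t) = 0" for t
    by (rule kernel_regular[OF _ that(2)]) (use that(1) in simp)
  have st: "\<forall>\<^sub>F i in F. dim (Ker i b) = 0 \<and> finite {s \<in> {a<..b}. dim (Ker i s) \<noteq> 0} \<and>
      (\<Sum>s | s \<in> {a<..b} \<and> dim (Ker i s) \<noteq> 0. dim (Ker i s)) = (\<Sum>s | s \<in> {a<..b} \<and> dim (Ker l s) \<noteq> 0. dim (Ker l s))"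
  proof (rule stable_count[where \<kappa> = "\<lambda>i t. dim (Ker i t)" and F = F and l = l])
    show "a < b" by (rule ab)
    show "Q l" if "eventually Q F" for Q by (rule lF[OF that])
    show "\<forall>\<^sub>F x in joint_nhds F {a..b} a. a < snd x \<longrightarrow> dim (Ker (fst x) (snd x)) = 0" by (rule kernel_initial)
  qed (rule reg local_count b; assumption)+
  from st good_eventually show ?thesis
  proof eventually_elim
    case (elim i)
    have "\<not> focal A g (P i) a b (\<gamma> i) b" using elim focal_iff[OF elim(2)] by blast
    moreover have "geometric_index A g (P i) a b (\<gamma> i) = geometric_index A g (P l) a b (\<gamma> l)"
      using elim(1) lF[OF st] geometric_index_eq[OF elim(2)] geometric_index_eq[OF good_l] by simp
    ultimately show ?case by blast
  qed
qed

end


section \<open>Sequences with a limit as families over the extended naturals\<close>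

text \<open>The sets that contain \<open>\<infinity>\<close> and almost all natural numbers. The limit itself belongs to the family, so its
  finiteness properties come out of the same statements as those of the sequence.\<close>
definition enat_filter :: "enat filter" where
  "enat_filter = sup (filtermap enat sequentially) (principal {\<infinity>})"

lemma eventually_enat_filter:
  "(\<forall>\<^sub>F i in enat_filter. Q i) \<longleftrightarrow> (\<forall>\<^sub>F j in sequentially. Q (enat j)) \<and> Q \<infinity>"
  by (simp add: enat_filter_def eventually_sup eventually_filtermap eventually_principal)

lemma enat_filter_tendsto:
  assumes "(\<lambda>j. f (enat j)) \<longlonglongrightarrow> f \<infinity>" shows "(f \<longlongrightarrow> f \<infinity>) enat_filter"
  by (rule topological_tendstoI) (simp add: eventually_enat_filter topological_tendstoD[OF assms])

theorem corollary5p2p2: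
  fixes A :: "('m::{t2_space, second_countable_topology}, 'e::euclidean_space) chart set"
    and g :: "('m, 'e) metric"
    and k :: nat
    and a b :: real
    and P :: "enat \<Rightarrow> 'm set"
    and \<gamma> :: "enat \<Rightarrow> real \<Rightarrow> 'm"
    and S :: "enat \<Rightarrow> ('m, 'e) tvec \<Rightarrow> ('m, 'e) tvec \<Rightarrow> real"
  assumes manifold: "smooth_structure A"
    and metric: "riemannian A g \<or> lorentzian A g"
    and interval: "a < b"
    and submanifolds: "\<And>j. submanifold A k (P j)"
    and geodesics: "\<And>j. geodesic A g a b (\<gamma> j)"
    and non_constant: "\<And>j. \<not> \<gamma> j constant_on {a..b}"
    and start: "\<And>j. \<gamma> j a \<in> P j"
    and orthogonal: "\<And>j. velocity A a b (\<gamma> j) a \<in> orth_complement A g (\<gamma> j a) (sub_tangent A (P j) (\<gamma> j a))"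
    and non_spacelike: "\<And>j t. lorentzian A g \<Longrightarrow> t \<in> {a..b} \<Longrightarrow>
      g (\<gamma> j t) (velocity A a b (\<gamma> j) t) (velocity A a b (\<gamma> j) t) \<le> 0"
    and transversal: "\<And>j. lorentzian A g \<Longrightarrow> velocity A a b (\<gamma> j) a \<notin> sub_tangent A (P j) (\<gamma> j a)"
    and S_def: "\<And>j. S j = second_fundamental_form A g (P j) (\<gamma> j a) (velocity A a b (\<gamma> j) a)"
    and velocity_tendsto: "tangent_bundle_tendsto A
      (\<lambda>j. \<gamma> (enat j) a) (\<lambda>j. velocity A a b (\<gamma> (enat j)) a)
      (\<gamma> \<infinity> a) (velocity A a b (\<gamma> \<infinity>) a)"
    and sff_tendsto: "GB_tendsto A k
      (\<lambda>j. \<gamma> (enat j) a) (\<lambda>j. sub_tangent A (P (enat j)) (\<gamma> (enat j) a)) (\<lambda>j. S (enat j))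
      (\<gamma> \<infinity> a) (sub_tangent A (P \<infinity>) (\<gamma> \<infinity> a)) (S \<infinity>)"
    and not_focal: "\<not> focal A g (P \<infinity>) a b (\<gamma> \<infinity>) b"
  shows "\<forall>\<^sub>F j in sequentially.
      \<not> focal A g (P (enat j)) a b (\<gamma> (enat j)) b \<and>
      geometric_index A g (P (enat j)) a b (\<gamma> (enat j)) = geometric_index A g (P \<infinity>) a b (\<gamma> \<infinity>)"
proof -
  have g: "semi_riemannian_metric A g" using metric unfolding riemannian_def lorentzian_def by blast
  obtain d where p: "(\<lambda>j. \<gamma> (enat j) a) \<longlonglongrightarrow> \<gamma> \<infinity> a" and d: "d \<in> charts_at A (\<gamma> \<infinity> a)"
    and dv: "(\<lambda>j. velocity A a b (\<gamma> (enat j)) a d) \<longlonglongrightarrow> velocity A a b (\<gamma> \<infinity>) a d"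
    using velocity_tendsto unfolding tangent_bundle_tendsto_def by (elim conjE bexE) (rule that)
  obtain c e e\<^sub>0 where c: "c \<in> charts_at A (\<gamma> \<infinity> a)" and e\<^sub>0: "is_basis k e\<^sub>0 (sub_tangent A (P \<infinity>) (\<gamma> \<infinity> a))"
    and e: "\<forall>\<^sub>F j in sequentially. is_basis k (e j) (sub_tangent A (P (enat j)) (\<gamma> (enat j) a))"
    and elim: "\<forall>n<k. (\<lambda>j. e j n c) \<longlonglongrightarrow> e\<^sub>0 n c"
    and Slim: "\<forall>m<k. \<forall>n<k. (\<lambda>j. S (enat j) (e j m) (e j n)) \<longlonglongrightarrow> S \<infinity> (e\<^sub>0 m) (e\<^sub>0 n)"
    using sff_tendsto unfolding GB_tendsto_def by (elim conjE bexE exE) (rule that)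
  define E where "E i = (case i of enat j \<Rightarrow> e j | \<infinity> \<Rightarrow> e\<^sub>0)" for i
  have E: "E (enat j) = e j" "E \<infinity> = e\<^sub>0" for j by (simp_all add: E_def)
  interpret geodesic_family A g a b \<gamma> enat_filter \<infinity>
    by unfold_locales (rule manifold g interval geodesics)+
  have vconv: "velocity_conv a"
    unfolding velocity_conv_def
  proof (rule tvec_limI[OF _ d])
    show "((\<lambda>i. \<gamma> i a) \<longlongrightarrow> \<gamma> \<infinity> a) enat_filter" by (rule enat_filter_tendsto[OF p])
    show "((\<lambda>i. V i a d) \<longlongrightarrow> V \<infinity> a d) enat_filter" by (rule enat_filter_tendsto[OF dv])
    have "a \<in> {a..b}" using interval by simp
    note t = seg.vel_tangent[OF this]
    show "V \<infinity> a \<in> tangent_space A (\<gamma> \<infinity> a)" by (rule t)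
    show "\<forall>\<^sub>F i in enat_filter. V i a \<in> tangent_space A (\<gamma> i a)" using t by simp
  qed
  interpret orthogonal_family A g a b \<gamma> enat_filter \<infinity> P k c E
  proof (intro orthogonal_family.intro orthogonal_family_axioms.intro)
    show "geodesic_family A g a b \<gamma>" by unfold_locales
    show "orthogonal_geodesic A g a b (\<gamma> i) (P i) k" for i
      by unfold_locales (rule metric, rule submanifolds, rule start, rule non_constant, rule orthogonal, erule (1) non_spacelike, erule transversal)
    show "Q \<infinity>" if "eventually Q enat_filter" for Q using that by (simp add: eventually_enat_filter)
    show "velocity_conv a" by (rule vconv)
    show "c \<in> charts_at A (\<gamma> \<infinity> a)" by (rule c)
    show "\<forall>\<^sub>F i in enat_filter. is_basis k (E i) (sub_tangent A (P i) (\<gamma> i a))"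
      using e e\<^sub>0 by (simp add: eventually_enat_filter E)
    show "((\<lambda>i. E i n c) \<longlongrightarrow> E \<infinity> n c) enat_filter" if "n < k" for n
      by (rule enat_filter_tendsto) (use elim that in \<open>simp add: E\<close>)
    show "((\<lambda>i. second_fundamental_form A g (P i) (\<gamma> i a) (V i a) (E i m) (E i n)) \<longlongrightarrow>
        second_fundamental_form A g (P \<infinity>) (\<gamma> \<infinity> a) (V \<infinity> a) (E \<infinity> m) (E \<infinity> n)) enat_filter" if "m < k" "n < k" for m n
      unfolding S_def[symmetric] by (rule enat_filter_tendsto) (use Slim that in \<open>simp add: E\<close>)
  qed
  show ?thesis using geometric_index_stable[OF not_focal] by (simp add: eventually_enat_filter)
qed

end
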